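(* Let $f$ be a Kobayashi surface of general type associated to the Weierstrass data $$g=\prod_{i=1}^{n-1}\frac{z-b_i}{1-\overline{b_i}z},\qquad \omega=\frac{\mathrm{i}\prod_{i=1}^{n-1}(1-\overline{b_i}z)^2}{\prod_{j=0}^{2n-1}(e^{-\mathrm{i}\alpha_j/2}z-e^{\mathrm{i}\alpha_j/2})}\,dz,$$ where $n\ge2$, $|b_1|,\dots,|b_{n-1}|<1$ and $0=\alpha_0\le\alpha_1\le\cdots\le\alpha_{2n-1}<2\pi$. Put $\alpha_{2n}:=2\pi$. Suppose that $$|\alpha_j-\alpha_{j+1}|<\frac{\pi}{n-1}\qquad(j=0,\dots,2n-1),$$ and also that $\alpha_0,\dots,\alpha_{2n-1}$ are distinct. Let $\tilde f=(\tilde x_0,\tilde x_1,\tilde x_2):\Omega_{\alpha_0,\dots,\alpha_{2n-1}}\to\mathbb{R}^3_1$ denote the analytic extension of $f$. If $b_1,\dots,b_{n-1}$ are sufficiently close to $0$, then the map $$(\tilde x_1,\tilde x_2):\Omega_{\alpha_0,\dots,\alpha_{2n-1}}\to\mathbb{R}^2$$ is a diffeomorphism. In particular, the image of $\tilde f$ gives a zero mean curvature entire graph of mixed type. As a consequence, one gets a $(4n-7)$-parameter family of zero mean curvature entire graphs up to congruence and homothety.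
   Context: $\mathbb{R}^3_1$ is Lorentz–Minkowski 3-space with signature $(-,+,+)$ and coordinates $(t,x,y)=(x_0,x_1,x_2)$; $S^2=\mathbb{C}\cup\{\infty\}$; $\mathrm{i}=\sqrt{-1}$. The maxface (maximal surface with admissible singularities) associated to $(g,\omega)$ is $f=\mathrm{Re}\int(-2g,1+g^2,\mathrm{i}(1-g^2))\omega$, which here is single-valued on $S^2\setminus\{e^{\mathrm{i}\alpha_0},\dots,e^{\mathrm{i}\alpha_{2n-1}}\}$ and satisfies $f(1/\bar z)=f(z)$. A maxface given by the displayed data is called a Kobayashi surface of order $n$; those obtained by setting $b_1=\cdots=b_{n-1}=0$ are said to be of principal type, and a Kobayashi surface which is not of principal type is said to be of general type. Domain of the analytic extension: $$\Omega_{\alpha_0,\dots,\alpha_{2n-1}}=\left\{(u,\theta)\in\mathbb{R}\times\mathbb{R}/2\pi\mathbb{Z}: u>\max_{j}\cos(\theta-\alpha_j)\right\}\cup\{p_\infty\},$$ a real analytic 2-manifold with coordinates $(u,\theta)$ away from $p_\infty$ and, near $p_\infty$, with coordinate $z=re^{\mathrm{i}\theta}$ in a disk about $0$, where $r=u-\sqrt{u^2-1}$ and $p_\infty$ corresponds to $z=0$. Let $\iota(re^{\mathrm{i}\theta})=\left(\frac{r+r^{-1}}2,\theta\right)$ for $0<r\le1$ and $\iota(0)=p_\infty$. The analytic extension $\tilde f$ of $f$ is the real analytic map on $\Omega_{\alpha_0,\dots,\alpha_{2n-1}}$ with $\tilde f\circ\iota=f$ on $\{|z|\le1\}\setminus\{e^{\mathrm{i}\alpha_j}\}$.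 An entire graph is a set $\{(\lambda(x,y),x,y):(x,y)\in\mathbb{R}^2\}$ with $\lambda:\mathbb{R}^2\to\mathbb{R}$ smooth; it has zero mean curvature if $(1-\lambda_y^2)\lambda_{xx}+2\lambda_x\lambda_y\lambda_{xy}+(1-\lambda_x^2)\lambda_{yy}=0$; it is of mixed type if it has both space-like points ($\lambda_x^2+\lambda_y^2<1$) and time-like points ($\lambda_x^2+\lambda_y^2>1$). Congruence means equality up to isometries of $\mathbb{R}^3_1$ (and reparametrization), homothety means scaling of $\mathbb{R}^3_1$. *)

theory Defs
  imports "HOL-Complex_Analysis.Complex_Analysis"
begin

section \<open>Smooth and real analytic maps\<close>

text \<open>\<open>Ck_on k S f\<close> is meant for open \<open>S\<close>.\<close>

primrec Ck_on :: "nat \<Rightarrow> 'a::euclidean_space set \<Rightarrow> ('a \<Rightarrow> 'b::real_normed_vector) \<Rightarrow> bool" where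
  "Ck_on 0 S f \<longleftrightarrow> continuous_on S f"
| "Ck_on (Suc k) S f \<longleftrightarrow>
     (\<forall>x\<in>S. f differentiable (at x)) \<and> (\<forall>v. Ck_on k S (\<lambda>x. frechet_derivative f (at x) v))"

definition smooth_on :: "'a::euclidean_space set \<Rightarrow> ('a \<Rightarrow> 'b::real_normed_vector) \<Rightarrow> bool" where
  "smooth_on S f \<longleftrightarrow> (\<forall>k. Ck_on k S f)"

definition real_analytic_on :: "(real \<times> real) set \<Rightarrow> (real \<times> real \<Rightarrow> 'b::real_normed_vector) \<Rightarrow> bool" where
  "real_analytic_on S F \<longleftrightarrow> (\<forall>(x0, y0)\<in>S. \<exists>r>0. \<exists>a :: nat \<times> nat \<Rightarrow> 'b.
     \<forall>x y. \<bar>x - x0\<bar> < r \<and> \<bar>y - y0\<bar> < r \<longrightarrow>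
       ((\<lambda>(i, j). ((x - x0) ^ i * (y - y0) ^ j) *\<^sub>R a (i, j)) has_sum F (x, y)) UNIV)"


section \<open>Lorentz--Minkowski 3-space\<close>

text \<open>The coordinates \<open>(x\<^sub>0, x\<^sub>1, x\<^sub>2)\<close> of Lorentz--Minkowski space are the components
  \<open>p $ 1, p $ 2, p $ 3\<close>; the first one is the time coordinate.\<close>

definition lorentz :: "real^3 \<Rightarrow> real^3 \<Rightarrow> real" where
  "lorentz p q = - (p $ 1 * q $ 1) + p $ 2 * q $ 2 + p $ 3 * q $ 3"

definition lorentz_isometry :: "(real^3 \<Rightarrow> real^3) \<Rightarrow> bool" where
  "lorentz_isometry T \<longleftrightarrow> (\<exists>A v. linear A \<and> (\<forall>p q. lorentz (A p) (A q) = lorentz p q) \<and>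
     T = (\<lambda>p. A p + v))"

text \<open>Congruence is taken for the image sets, i.e. up to reparametrization.\<close>

definition congruent_up_to_homothety :: "(real^3) set \<Rightarrow> (real^3) set \<Rightarrow> bool" where
  "congruent_up_to_homothety S S' \<longleftrightarrow>
     (\<exists>T c. lorentz_isometry T \<and> c > 0 \<and> S' = (\<lambda>p. c *\<^sub>R T p) ` S)"

definition Dx :: "(real \<times> real \<Rightarrow> real) \<Rightarrow> real \<times> real \<Rightarrow> real" where
  "Dx l = (\<lambda>(x, y). deriv (\<lambda>t. l (t, y)) x)"

definition Dy :: "(real \<times> real \<Rightarrow> real) \<Rightarrow> real \<times> real \<Rightarrow> real" where
  "Dy l = (\<lambda>(x, y). deriv (\<lambda>t. l (x, t)) y)"

definition zero_mean_curvature :: "(real \<times> real \<Rightarrow> real) \<Rightarrow> bool" where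
  "zero_mean_curvature l \<longleftrightarrow> (\<forall>p.
     (1 - (Dy l p)\<^sup>2) * Dx (Dx l) p + 2 * Dx l p * Dy l p * Dy (Dx l) p
       + (1 - (Dx l p)\<^sup>2) * Dy (Dy l) p = 0)"

definition mixed_type :: "(real \<times> real \<Rightarrow> real) \<Rightarrow> bool" where
  "mixed_type l \<longleftrightarrow> (\<exists>p. (Dx l p)\<^sup>2 + (Dy l p)\<^sup>2 < 1) \<and> (\<exists>p. (Dx l p)\<^sup>2 + (Dy l p)\<^sup>2 > 1)"

definition entire_graph_of :: "(real \<times> real \<Rightarrow> real) \<Rightarrow> (real^3) set" where
  "entire_graph_of l = {vector [l (x, y), x, y] | x y. True}"

definition zmc_entire_graph_of_mixed_type :: "(real^3) set \<Rightarrow> bool" where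
  "zmc_entire_graph_of_mixed_type S \<longleftrightarrow>
     (\<exists>l. smooth_on UNIV l \<and> S = entire_graph_of l \<and> zero_mean_curvature l \<and> mixed_type l)"


section \<open>Kobayashi surfaces\<close>

definition kobayashi_g :: "nat \<Rightarrow> (nat \<Rightarrow> complex) \<Rightarrow> complex \<Rightarrow> complex" where
  "kobayashi_g n b z = (\<Prod>i\<in>{1..n-1}. (z - b i) / (1 - cnj (b i) * z))"

text \<open>The coefficient of \<open>dz\<close> in \<open>\<omega>\<close>.\<close>

definition kobayashi_omega :: "nat \<Rightarrow> (nat \<Rightarrow> real) \<Rightarrow> (nat \<Rightarrow> complex) \<Rightarrow> complex \<Rightarrow> complex" where
  "kobayashi_omega n \<alpha> b z =
     \<i> * (\<Prod>i\<in>{1..n-1}. (1 - cnj (b i) * z)\<^sup>2) / (\<Prod>j\<in>{0..2*n-1}. cis (- \<alpha> j / 2) * z - cis (\<alpha> j / 2))"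

definition kobayashi_integrand ::
  "nat \<Rightarrow> (nat \<Rightarrow> real) \<Rightarrow> (nat \<Rightarrow> complex) \<Rightarrow> complex \<Rightarrow> complex^3" where
  "kobayashi_integrand n \<alpha> b z =
     (let g = kobayashi_g n b z; w = kobayashi_omega n \<alpha> b z
      in vector [- 2 * g * w, (1 + g\<^sup>2) * w, \<i> * (1 - g\<^sup>2) * w])"

definition singular_points :: "nat \<Rightarrow> (nat \<Rightarrow> real) \<Rightarrow> complex set" where
  "singular_points n \<alpha> = (\<lambda>j. cis (\<alpha> j)) ` {0..2*n-1}"

definition poles_g :: "nat \<Rightarrow> (nat \<Rightarrow> complex) \<Rightarrow> complex set" where
  "poles_g n b = {z. \<exists>i\<in>{1..n-1}. cnj (b i) * z = 1}"

text \<open>\<open>f\<close> is the (single-valued) maxface \<open>Re \<integral> (-2g, 1+g\<^sup>2, \<i>(1-g\<^sup>2)) \<omega>\<close>, unique up to a translation.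
  The three forms extend holomorphically across the poles of \<open>g\<close> (the zeros of \<open>\<omega>\<close>), where the
  formula above takes a junk value; so paths through these points are left out, and the values of
  \<open>f\<close> there are given by continuity. The value of \<open>f\<close> at \<open>\<infinity>\<close>, also determined by continuity, is
  not represented.\<close>

definition kobayashi_surface ::
  "nat \<Rightarrow> (nat \<Rightarrow> real) \<Rightarrow> (nat \<Rightarrow> complex) \<Rightarrow> (complex \<Rightarrow> real^3) \<Rightarrow> bool" where
  "kobayashi_surface n \<alpha> b f \<longleftrightarrow>
     continuous_on (- singular_points n \<alpha>) f \<and>
     (\<forall>\<gamma> k. valid_path \<gamma> \<and> path_image \<gamma> \<subseteq> - (singular_points n \<alpha> \<union> poles_g n b) \<longrightarrow>
        f (pathfinish \<gamma>) $ k - f (pathstart \<gamma>) $ k =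
          Re (contour_integral \<gamma> (\<lambda>z. kobayashi_integrand n \<alpha> b z $ k)))"

definition kobayashi_data :: "nat \<Rightarrow> (nat \<Rightarrow> real) \<Rightarrow> (nat \<Rightarrow> complex) \<Rightarrow> bool" where
  "kobayashi_data n \<alpha> b \<longleftrightarrow> (\<forall>i\<in>{1..n-1}. cmod (b i) < 1) \<and>
     \<alpha> 0 = 0 \<and> (\<forall>j<2*n-1. \<alpha> j \<le> \<alpha> (Suc j)) \<and> \<alpha> (2*n-1) < 2 * pi"

definition principal_type :: "nat \<Rightarrow> (nat \<Rightarrow> complex) \<Rightarrow> bool" where
  "principal_type n b \<longleftrightarrow> (\<forall>i\<in>{1..n-1}. b i = 0)"

definition small_gaps :: "nat \<Rightarrow> (nat \<Rightarrow> real) \<Rightarrow> bool" where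
  "small_gaps n \<alpha> \<longleftrightarrow> (let a = \<alpha>(2*n := 2*pi)
     in \<forall>j\<in>{0..2*n-1}. \<bar>a j - a (j + 1)\<bar> < pi / (real n - 1))"


section \<open>The domain of the analytic extension\<close>

text \<open>\<open>None\<close> is the point \<open>p\<^sub>\<infinity>\<close>, and the class of \<open>\<theta>\<close> in \<open>\<real>/2\<pi>\<int>\<close> is
  encoded by \<open>cis \<theta>\<close>.\<close>

type_synonym ext_point = "(real \<times> complex) option"

definition polar_domain :: "nat \<Rightarrow> (nat \<Rightarrow> real) \<Rightarrow> (real \<times> real) set" where
  "polar_domain n \<alpha> = {(u, \<theta>). u > Max ((\<lambda>j. cos (\<theta> - \<alpha> j)) ` {0..2*n-1})}"

definition polar_param :: "real \<times> real \<Rightarrow> ext_point" where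
  "polar_param = (\<lambda>(u, \<theta>). Some (u, cis \<theta>))"

definition ext_domain :: "nat \<Rightarrow> (nat \<Rightarrow> real) \<Rightarrow> ext_point set" where
  "ext_domain n \<alpha> = polar_param ` polar_domain n \<alpha> \<union> {None}"

definition ext_iota :: "complex \<Rightarrow> ext_point" where
  "ext_iota z = (if z = 0 then None else Some ((cmod z + inverse (cmod z)) / 2, sgn z))"

text \<open>The manifold structure is given by inverses of charts: \<open>(u,\<theta>)\<close> away from \<open>p\<^sub>\<infinity>\<close> (injective
  only up to \<open>2\<pi>\<close>-translations of \<open>\<theta>\<close>, hence a local inverse of a chart) and the coordinate
  \<open>z = x + \<i>y\<close>, \<open>|z| < 1\<close>, near \<open>p\<^sub>\<infinity>\<close>. On the unit circle \<open>ext_iota\<close> folds, so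
  \<open>|z| = 1\<close> does not belong to the second chart.\<close>

definition ext_params :: "nat \<Rightarrow> (nat \<Rightarrow> real) \<Rightarrow> ((real \<times> real) set \<times> (real \<times> real \<Rightarrow> ext_point)) set" where
  "ext_params n \<alpha> = {(polar_domain n \<alpha>, polar_param), (ball 0 1, \<lambda>(x, y). ext_iota (Complex x y))}"

definition ext_real_analytic :: "nat \<Rightarrow> (nat \<Rightarrow> real) \<Rightarrow> (ext_point \<Rightarrow> 'b::real_normed_vector) \<Rightarrow> bool" where
  "ext_real_analytic n \<alpha> F \<longleftrightarrow> (\<forall>(E, \<psi>)\<in>ext_params n \<alpha>. real_analytic_on E (F \<circ> \<psi>))"

definition analytic_extension ::
  "nat \<Rightarrow> (nat \<Rightarrow> real) \<Rightarrow> (complex \<Rightarrow> real^3) \<Rightarrow> (ext_point \<Rightarrow> real^3) \<Rightarrow> bool" where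
  "analytic_extension n \<alpha> f ft \<longleftrightarrow> ext_real_analytic n \<alpha> ft \<and>
     (\<forall>z. cmod z \<le> 1 \<and> z \<notin> singular_points n \<alpha> \<longrightarrow> ft (ext_iota z) = f z)"

definition ext_smooth_from :: "nat \<Rightarrow> (nat \<Rightarrow> real) \<Rightarrow> (ext_point \<Rightarrow> 'b::real_normed_vector) \<Rightarrow> bool" where
  "ext_smooth_from n \<alpha> F \<longleftrightarrow> (\<forall>(E, \<psi>)\<in>ext_params n \<alpha>. smooth_on E (F \<circ> \<psi>))"

definition ext_smooth_into :: "nat \<Rightarrow> (nat \<Rightarrow> real) \<Rightarrow> ('a::euclidean_space \<Rightarrow> ext_point) \<Rightarrow> bool" where
  "ext_smooth_into n \<alpha> G \<longleftrightarrow> (\<forall>q. \<exists>(E, \<psi>)\<in>ext_params n \<alpha>. \<exists>V h. open V \<and> q \<in> V \<and>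
     smooth_on V h \<and> h ` V \<subseteq> E \<and> (\<forall>p\<in>V. G p = \<psi> (h p)))"

definition ext_diffeomorphism :: "nat \<Rightarrow> (nat \<Rightarrow> real) \<Rightarrow> (ext_point \<Rightarrow> real \<times> real) \<Rightarrow> bool" where
  "ext_diffeomorphism n \<alpha> F \<longleftrightarrow> bij_betw F (ext_domain n \<alpha>) UNIV \<and>
     ext_smooth_from n \<alpha> F \<and> ext_smooth_into n \<alpha> (inv_into (ext_domain n \<alpha>) F)"

end

theory Submission
  imports Defs
begin

text \<open>In the disc model \<open>w = e\<^sup>i\<^sup>\<theta> / u\<close> the extension lives on the open polygon circumscribed about the
  unit circle with points of contact \<open>e\<^sup>i\<^sup>\<alpha>\<^sup>j\<close>, and by partial fractions its components are combinations of the
  logarithms of the sides, \<open>\<Sum>\<^sub>j ln (1 - Re (w e\<^sup>-\<^sup>i\<^sup>\<alpha>\<^sup>j)) R\<^sub>j\<close>. The projection to the plane is proper, because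
  near a vertex the two unbounded logarithms have independent coefficients. Its Jacobian does not vanish:
  inside the circle because \<open>|g| < 1\<close>; outside, it is expressed by the values of \<open>g\<close> at the
  two points of contact of the tangents from \<open>w\<close>, which lie on an arc of length at most \<open>max (\<alpha>\<^sub>j\<^sub>+\<^sub>1 - \<alpha>\<^sub>j)\<close>;
  for small \<open>b\<^sub>i\<close> the argument of \<open>g\<close> varies by less than \<open>\<pi>\<close> on such an arc. A proper local
  homeomorphism to the plane is a homeomorphism.

  A congruence of two images preserves the space-like part and is conformal there, so it is a Moebius
  or anti-Moebius map of the disc, and it permutes the ends \<open>e\<^sup>i\<^sup>\<alpha>\<^sup>j\<close>. With three ends and one zero of \<open>g\<close>
  fixed, \<open>4n - 7\<close> parameters remain; cross ratios of the ends exclude every permutation other than the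
  identity on a small open set of parameters, and then the zeros of \<open>g\<close> are determined as well.\<close>

section \<open>Maps of class \<open>C\<^sup>k\<close>\<close>

text \<open>The coordinate \<open>w\<close> is chosen because \<open>ext_iota\<close> folds along
  the unit circle: z cannot see beyond it, while in \<open>w\<close> every component is a sum of
  logarithms of affine functions, smooth on the whole polygon. For this the residues of the three
  forms must be real, which the half-angle factors of omega achieve, and must sum to zero, so that
  factors common to all sides drop out. The formulas use the two roots z of
  \<open>cnj w * z^2 - 2 * z + w = 0\<close>: inside the circle a point and its mirror image,
  outside the two points of contact. On the circle they coincide, so the Jacobian needs three
  separate arguments. The sum of \<open>(1 + cmod (b i)) / (1 - cmod (b i))\<close> bounds the
  derivative of the argument of g on the circle. That its product with the gap bound \<gamma> stays
  below pi is what small \<open>b i\<close> has to mean; for \<open>b = 0\<close> it is the gap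
  condition of the theorem. The number 4n - 7 counts 2n ends and 2n - 2 real coordinates of zeros,
  less 3 for the automorphisms of the disc and 2 for the Lorentz boosts.\<close>

lemma Ck_on_cong:
  assumes "open S" "\<And>x. x \<in> S \<Longrightarrow> f x = g x" "Ck_on k S f"
  shows "Ck_on k S g"
  using assms(2,3)
proof (induction k arbitrary: f g)
  case 0
  then show ?case using continuous_on_cong[of S S f g] by auto
next
  case (Suc k)
  have d: "(g has_derivative frechet_derivative f (at x)) (at x)" if "x \<in> S" for x
    using that Suc.prems assms(1)
    by (auto simp: frechet_derivative_works intro: has_derivative_transform_within_open)
  have e: "frechet_derivative g (at x) = frechet_derivative f (at x)" if "x \<in> S" for x
    using frechet_derivative_at[OF d[OF that]] by simp
  show ?case
    using d e Suc.prems(2) Suc.IH[of "\<lambda>x. frechet_derivative f (at x) v" "\<lambda>x. frechet_derivative g (at x) v" for v]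
    by (auto simp: differentiable_def)
qed

text \<open>The later derivative rules enter through this form, where any explicit derivative
  serves; uniqueness of the derivative transfers its smoothness to
  \<open>frechet_derivative\<close>.\<close>

lemma Ck_on_SucI:
  assumes "open S" "\<And>x. x \<in> S \<Longrightarrow> (f has_derivative f' x) (at x)" "\<And>v. Ck_on k S (\<lambda>x. f' x v)"
  shows "Ck_on (Suc k) S f"
proof -
  have "Ck_on k S (\<lambda>x. frechet_derivative f (at x) v)" for v
    using frechet_derivative_at[OF assms(2)]
    by (intro Ck_on_cong[OF assms(1) _ assms(3)[of v]]) simp
  then show ?thesis using assms(2) by (auto simp: differentiable_def)
qed

lemma Ck_on_SucD:
  assumes "Ck_on (Suc k) S f" "x \<in> S"
  shows "(f has_derivative frechet_derivative f (at x)) (at x)"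
  using assms by (auto simp: frechet_derivative_works)

lemma Ck_on_SucD2: "Ck_on (Suc k) S f \<Longrightarrow> Ck_on k S (\<lambda>x. frechet_derivative f (at x) v)"
  by simp

lemma Ck_on_Suc_imp:
  assumes "open S" "Ck_on (Suc k) S f" shows "Ck_on k S f"
  using assms(2)
proof (induction k arbitrary: f)
  case 0
  then show ?case
    by (auto intro!: differentiable_imp_continuous_on simp: differentiable_on_def differentiable_at_withinI)
next
  case (Suc k)
  then show ?case by (metis Ck_on.simps(2))
qed

lemma Ck_on_continuous: "open S \<Longrightarrow> Ck_on k S f \<Longrightarrow> continuous_on S f"
proof (induction k)
  case (Suc k) then show ?case using Ck_on_Suc_imp by blast
qed simp

lemma Ck_on_subset: "Ck_on k S f \<Longrightarrow> T \<subseteq> S \<Longrightarrow> Ck_on k T f"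
proof (induction k arbitrary: f)
  case 0 then show ?case by (auto intro: continuous_on_subset)
next
  case (Suc k) then show ?case by auto
qed

lemma Ck_on_const: "Ck_on k S (\<lambda>x. c)"
proof (induction k arbitrary: c)
  case (Suc k)
  have "frechet_derivative (\<lambda>x. c) (at x) = (\<lambda>h. 0)" for x :: 'a
    by (rule frechet_derivative_at[symmetric]) simp
  then show ?case using Suc by simp
qed simp

lemma Ck_on_bounded_linear_compose:
  assumes "open S" "bounded_linear L" "Ck_on k S f"
  shows "Ck_on k S (\<lambda>x. L (f x))"
  using assms(3)
proof (induction k arbitrary: f)
  case 0
  then show ?case using assms(2) by (auto intro: bounded_linear.continuous_on)
next
  case (Suc k)
  show ?case
    by (rule Ck_on_SucI[OF assms(1) bounded_linear.has_derivative[OF assms(2) Ck_on_SucD[OF Suc.prems]]])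
      (use Suc in auto)
qed

lemma Ck_on_bounded_linear:
  assumes "open S" "bounded_linear L" shows "Ck_on k S L"
proof (cases k)
  case 0
  then show ?thesis using assms bounded_linear.continuous_on[OF assms(2) continuous_on_id] by auto
next
  case (Suc m)
  show ?thesis unfolding Suc
    by (rule Ck_on_SucI[OF assms(1) bounded_linear_imp_has_derivative[OF assms(2)] Ck_on_const])
qed

lemma Ck_on_add:
  assumes "open S" "Ck_on k S f" "Ck_on k S g"
  shows "Ck_on k S (\<lambda>x. f x + g x)"
  using assms(2,3)
proof (induction k arbitrary: f g)
  case 0
  then show ?case by (auto intro: continuous_intros)
next
  case (Suc k)
  show ?case
    by (rule Ck_on_SucI[OF assms(1) has_derivative_add[OF Ck_on_SucD[OF Suc.prems(1)] Ck_on_SucD[OF Suc.prems(2)]]])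
      (use Suc in auto)
qed

lemma Ck_on_bilinear:
  assumes "open S" "bounded_bilinear P" "Ck_on k S f" "Ck_on k S g"
  shows "Ck_on k S (\<lambda>x. P (f x) (g x))"
  using assms(3,4)
proof (induction k arbitrary: f g)
  case 0
  then show ?case using bounded_bilinear.continuous_on[OF assms(2)] by auto
next
  case (Suc k)
  have "Ck_on k S f" "Ck_on k S g" using Suc.prems Ck_on_Suc_imp[OF assms(1)] by blast+
  then show ?case
    using Suc.IH Ck_on_SucD2[OF Suc.prems(1)] Ck_on_SucD2[OF Suc.prems(2)]
    by (intro Ck_on_SucI[OF assms(1) bounded_bilinear.FDERIV[OF assms(2) Ck_on_SucD[OF Suc.prems(1)] Ck_on_SucD[OF Suc.prems(2)]]]
       Ck_on_add[OF assms(1)]) auto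
qed

lemma Ck_on_sum:
  assumes "open S" "\<And>i. i \<in> I \<Longrightarrow> Ck_on k S (f i)"
  shows "Ck_on k S (\<lambda>x. \<Sum>i\<in>I. f i x)"
  using assms(2)
proof (induction I rule: infinite_finite_induct)
  case (insert i I)
  then show ?case by (auto intro!: Ck_on_add assms(1))
qed (auto simp: Ck_on_const)

lemma Ck_on_compose:
  fixes f :: "'b::euclidean_space \<Rightarrow> 'c::real_normed_vector"
  assumes "open S" "open T" "Ck_on k S g" "Ck_on k T f" "g ` S \<subseteq> T"
  shows "Ck_on k S (\<lambda>x. f (g x))"
  using assms(3,4)
proof (induction k arbitrary: f)
  case 0
  then show ?case using assms(5) continuous_on_compose2[of T f S g] by auto
next
  case (Suc k)
  let ?f' = "\<lambda>x. frechet_derivative f (at x)" and ?g' = "\<lambda>x. frechet_derivative g (at x)"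
  have g: "Ck_on k S g" using Suc.prems Ck_on_Suc_imp[OF assms(1)] by blast
  \<comment> \<open>The outer derivative is expanded in a basis, so that the chain rule becomes a
    finite sum of products to which the induction hypothesis applies.\<close>
  have d: "((\<lambda>x. f (g x)) has_derivative (\<lambda>v. \<Sum>b\<in>Basis. (?g' x v \<bullet> b) *\<^sub>R ?f' (g x) b)) (at x)"
    if "x \<in> S" for x
  proof -
    have f: "(f has_derivative ?f' (g x)) (at (g x))" using Ck_on_SucD[OF Suc.prems(2)] that assms(5) by blast
    have "(\<lambda>v. ?f' (g x) (?g' x v)) = (\<lambda>v. \<Sum>b\<in>Basis. (?g' x v \<bullet> b) *\<^sub>R ?f' (g x) b)"
    proof
      fix v
      have l: "linear (?f' (g x))" using f by (rule has_derivative_linear)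
      have "?f' (g x) (?g' x v) = ?f' (g x) (\<Sum>b\<in>Basis. (?g' x v \<bullet> b) *\<^sub>R b)"
        by (simp add: euclidean_representation)
      also have "\<dots> = (\<Sum>b\<in>Basis. (?g' x v \<bullet> b) *\<^sub>R ?f' (g x) b)"
        using l by (simp add: linear_sum linear_cmul)
      finally show "?f' (g x) (?g' x v) = (\<Sum>b\<in>Basis. (?g' x v \<bullet> b) *\<^sub>R ?f' (g x) b)" .
    qed
    then show ?thesis using has_derivative_compose[OF Ck_on_SucD[OF Suc.prems(1) that] f] by simp
  qed
  show ?case
  proof (rule Ck_on_SucI[OF assms(1) d])
    show "Ck_on k S (\<lambda>x. \<Sum>b\<in>Basis. (?g' x v \<bullet> b) *\<^sub>R ?f' (g x) b)" for v
    proof (intro Ck_on_sum[OF assms(1)] Ck_on_bilinear[OF assms(1) bounded_bilinear_scaleR])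
      fix b :: 'b assume "b \<in> Basis"
      show "Ck_on k S (\<lambda>x. ?g' x v \<bullet> b)"
        by (rule Ck_on_bounded_linear_compose[OF assms(1) bounded_linear_inner_left Ck_on_SucD2[OF Suc.prems(1)]])
      show "Ck_on k S (\<lambda>x. ?f' (g x) b)"
        by (rule Suc.IH[OF g Ck_on_SucD2[OF Suc.prems(2)]])
    qed
  qed
qed

lemma Ck_on_Pair:
  fixes f :: "'a::euclidean_space \<Rightarrow> 'b::real_normed_vector" and g :: "'a \<Rightarrow> 'c::real_normed_vector"
  assumes "open S" "Ck_on k S f" "Ck_on k S g"
  shows "Ck_on k S (\<lambda>x. (f x, g x))"
proof -
  have "bounded_linear (\<lambda>x::'b. (x, 0::'c))" "bounded_linear (\<lambda>x::'c. (0::'b, x))"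
    by (auto intro!: bounded_linear_Pair bounded_linear_ident bounded_linear_zero)
  from Ck_on_add[OF assms(1) Ck_on_bounded_linear_compose[OF assms(1) this(1) assms(2)]
      Ck_on_bounded_linear_compose[OF assms(1) this(2) assms(3)]]
  show ?thesis by simp
qed

lemma Ck_on_Complex:
  assumes "open S" "Ck_on k S f" "Ck_on k S g"
  shows "Ck_on k S (\<lambda>x. Complex (f x) (g x))"
proof -
  have "Ck_on k S (\<lambda>x. of_real (f x) + \<i> * of_real (g x))"
    by (intro Ck_on_add assms Ck_on_bounded_linear_compose[OF _ bounded_linear_of_real]
       Ck_on_bounded_linear_compose[OF assms(1) bounded_linear_mult_right])
  then show ?thesis by (simp add: Complex_eq)
qed

lemmas Ck_on_mult = Ck_on_bilinear[OF _ bounded_bilinear_mult]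
lemmas Ck_on_scaleR = Ck_on_bilinear[OF _ bounded_bilinear_scaleR]
lemmas Ck_on_Re = Ck_on_bounded_linear_compose[OF _ bounded_linear_Re]
lemmas Ck_on_Im = Ck_on_bounded_linear_compose[OF _ bounded_linear_Im]
lemmas Ck_on_minus = Ck_on_bounded_linear_compose[OF _ bounded_linear_minus[OF bounded_linear_ident]]
lemmas Ck_on_ident = Ck_on_bounded_linear[OF _ bounded_linear_ident]
lemmas Ck_on_fst = Ck_on_bounded_linear[OF _ bounded_linear_fst]
lemmas Ck_on_snd = Ck_on_bounded_linear[OF _ bounded_linear_snd]

lemma Ck_on_diff:
  assumes "open S" "Ck_on k S f" "Ck_on k S g"
  shows "Ck_on k S (\<lambda>x. f x - g x)"
  using Ck_on_add[OF assms(1,2) Ck_on_minus[OF assms(1,3)]] by simp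

lemma Ck_on_real_derivI:
  fixes f :: "real \<Rightarrow> real"
  assumes "open S" "\<And>x. x \<in> S \<Longrightarrow> (f has_real_derivative f' x) (at x)" "Ck_on k S f'"
  shows "Ck_on (Suc k) S f"
  using assms(2)
  by (intro Ck_on_SucI[OF assms(1), of f "\<lambda>x v. f' x * v"] Ck_on_mult assms Ck_on_const)
    (auto simp: has_field_derivative_def)

section \<open>Elementary functions of class C^k\<close>

lemma open_real_nonzero: "open {x::real. x \<noteq> 0}"
  using open_delete[of UNIV "0::real"] by (simp add: Collect_neg_eq Compl_eq_Diff_UNIV)

lemma Ck_on_real_inverse: "Ck_on k {x. x \<noteq> 0} (inverse :: real \<Rightarrow> real)"
proof (induction k)
  case 0 then show ?case by (auto intro!: continuous_intros)
next
  case (Suc k)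
  show ?case
    by (rule Ck_on_real_derivI[OF open_real_nonzero, of _ "\<lambda>x. - (inverse x * inverse x)"])
      (auto intro!: derivative_eq_intros Ck_on_minus open_real_nonzero Ck_on_mult Suc simp: power2_eq_square)
qed

lemma Ck_on_real_ln: "Ck_on k {0<..} (ln :: real \<Rightarrow> real)"
proof (cases k)
  case 0 then show ?thesis by (auto intro!: continuous_intros)
next
  case (Suc m)
  show ?thesis unfolding Suc
    by (rule Ck_on_real_derivI[of _ _ inverse])
      (auto intro!: derivative_eq_intros Ck_on_subset[OF Ck_on_real_inverse] simp: inverse_eq_divide)
qed

lemma Ck_on_real_sqrt: "Ck_on k {0<..} sqrt"
proof (induction k)
  case 0 then show ?case by (auto intro!: continuous_intros)
next
  case (Suc k)
  show ?case
  proof (rule Ck_on_real_derivI)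
    show "(sqrt has_real_derivative inverse (sqrt x) * (1/2)) (at x)" if "x \<in> {0<..}" for x
      using that by (auto intro!: derivative_eq_intros)
    show "Ck_on k {0<..} (\<lambda>x. inverse (sqrt x) * (1/2))"
      by (intro Ck_on_mult Ck_on_const Ck_on_compose[OF _ open_real_nonzero Suc Ck_on_real_inverse]) auto
  qed simp
qed

lemma Ck_on_real_sin_cos: "Ck_on k UNIV (sin :: real \<Rightarrow> real) \<and> Ck_on k UNIV (cos :: real \<Rightarrow> real)"
proof (induction k)
  case 0 then show ?case by (auto intro!: continuous_intros)
next
  case (Suc k)
  then show ?case
    by (auto simp del: Ck_on.simps intro!: Ck_on_real_derivI[of _ sin cos] Ck_on_real_derivI[of _ cos "\<lambda>x. - sin x"]
       Ck_on_minus derivative_eq_intros)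
qed

lemma Ck_on_real_arctan: "Ck_on k UNIV arctan"
proof (cases k)
  case 0 then show ?thesis by (auto intro!: continuous_intros)
next
  case (Suc m)
  have "1 + x * x > 0" for x :: real by (simp add: add_pos_nonneg)
  then have *: "1 + x * x \<noteq> 0" for x :: real by (metis less_irrefl)
  show ?thesis unfolding Suc
    by (rule Ck_on_real_derivI[of _ _ "\<lambda>x. inverse (1 + x * x)"])
     (use * in \<open>auto intro!: derivative_eq_intros Ck_on_compose[OF _ open_real_nonzero _ Ck_on_real_inverse]
       Ck_on_add Ck_on_mult Ck_on_const Ck_on_ident simp: power2_eq_square\<close>)
qed

lemma Ck_on_inverse:
  fixes f :: "'a::euclidean_space \<Rightarrow> real"
  shows "open S \<Longrightarrow> Ck_on k S f \<Longrightarrow> (\<And>x. x \<in> S \<Longrightarrow> f x \<noteq> 0) \<Longrightarrow> Ck_on k S (\<lambda>x. inverse (f x))"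
  by (rule Ck_on_compose[OF _ open_real_nonzero _ Ck_on_real_inverse]) auto

lemma Ck_on_divide:
  fixes f :: "'a::euclidean_space \<Rightarrow> real"
  assumes "open S" "Ck_on k S f" "Ck_on k S g" "\<And>x. x \<in> S \<Longrightarrow> g x \<noteq> 0"
  shows "Ck_on k S (\<lambda>x. f x / g x)"
  using Ck_on_mult[OF assms(1,2) Ck_on_inverse[OF assms(1,3,4)]] by (simp add: divide_inverse)

lemma Ck_on_ln:
  "open S \<Longrightarrow> Ck_on k S f \<Longrightarrow> (\<And>x. x \<in> S \<Longrightarrow> f x > (0::real)) \<Longrightarrow> Ck_on k S (\<lambda>x. ln (f x))"
  by (rule Ck_on_compose[OF _ _ _ Ck_on_real_ln]) auto

lemma Ck_on_sqrt:
  "open S \<Longrightarrow> Ck_on k S f \<Longrightarrow> (\<And>x. x \<in> S \<Longrightarrow> f x > 0) \<Longrightarrow> Ck_on k S (\<lambda>x. sqrt (f x))"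
  by (rule Ck_on_compose[OF _ _ _ Ck_on_real_sqrt]) auto

lemma Ck_on_sin: "open S \<Longrightarrow> Ck_on k S f \<Longrightarrow> Ck_on k S (\<lambda>x. sin (f x :: real))"
  by (rule Ck_on_compose[OF _ open_UNIV _ conjunct1[OF Ck_on_real_sin_cos]]) auto

lemma Ck_on_cos: "open S \<Longrightarrow> Ck_on k S f \<Longrightarrow> Ck_on k S (\<lambda>x. cos (f x :: real))"
  by (rule Ck_on_compose[OF _ open_UNIV _ conjunct2[OF Ck_on_real_sin_cos]]) auto

lemma Ck_on_arctan: "open S \<Longrightarrow> Ck_on k S f \<Longrightarrow> Ck_on k S (\<lambda>x. arctan (f x))"
  by (rule Ck_on_compose[OF _ open_UNIV _ Ck_on_real_arctan]) auto

text \<open>Cramer's rule: for complex numbers read as plane vectors, \<open>Im (cnj p * q)\<close>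
  is the determinant of \<open>p\<close> and \<open>q\<close>. Jacobians are written in this way
  throughout.\<close>

lemma complex_plane_linear_solve:
  assumes "Im (cnj p * q) \<noteq> 0"
  shows "of_real (- Im (cnj q * v) / Im (cnj p * q)) * p + of_real (Im (cnj p * v) / Im (cnj p * q)) * q = v"
proof -
  obtain p1 p2 where p: "p = Complex p1 p2" by (cases p)
  obtain q1 q2 where q: "q = Complex q1 q2" by (cases q)
  obtain v1 v2 where v: "v = Complex v1 v2" by (cases v)
  have n: "p1 * q2 - p2 * q1 \<noteq> 0" using assms by (simp add: p q)
  show ?thesis
    using n by (simp add: p q v complex_eq_iff divide_simps) algebra
qed

lemma complex_linear_eq:
  fixes L :: "complex \<Rightarrow> 'a::real_vector"
  assumes "linear L" shows "L h = Re h *\<^sub>R L 1 + Im h *\<^sub>R L \<i>"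
proof -
  have "h = Re h *\<^sub>R 1 + Im h *\<^sub>R \<i>" by (simp add: complex_eq_iff)
  then show ?thesis using assms by (metis linear_add linear_cmul)
qed

text \<open>Only continuity of \<open>G\<close> is assumed. By Cramer's rule its derivative is a
  rational expression in the partial derivatives of \<open>F\<close> at \<open>G y\<close>, so each
  order of smoothness of \<open>G\<close> yields the next.\<close>

theorem Ck_on_inverse_map:
  fixes F G :: "complex \<Rightarrow> complex"
  assumes S: "open S" "open T" and F: "Ck_on (Suc k) S F" and G: "continuous_on T G"
    and GF: "G ` T \<subseteq> S" "\<And>y. y \<in> T \<Longrightarrow> F (G y) = y"
    and J: "\<And>x. x \<in> S \<Longrightarrow> Im (cnj (frechet_derivative F (at x) 1) * frechet_derivative F (at x) \<i>) \<noteq> 0"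
  shows "Ck_on (Suc k) T G"
proof -
  define p q where "p = (\<lambda>x. frechet_derivative F (at x) 1)" and "q = (\<lambda>x. frechet_derivative F (at x) \<i>)"
  define D where "D = (\<lambda>y v. Complex (- Im (cnj (q (G y)) * v) / Im (cnj (p (G y)) * q (G y)))
        (Im (cnj (p (G y)) * v) / Im (cnj (p (G y)) * q (G y))))"
  have D: "(G has_derivative D y) (at y)" if y: "y \<in> T" for y
  proof (rule has_derivative_inverse_basic)
    have x: "G y \<in> S" using GF y by auto
    let ?L = "frechet_derivative F (at (G y))"
    show L: "(F has_derivative ?L) (at (G y))" by (rule Ck_on_SucD[OF F x])
    have lin: "linear ?L" using L by (rule has_derivative_linear)
    have J': "Im (cnj (p (G y)) * q (G y)) \<noteq> 0" using J[OF x] by (simp add: p_def q_def)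
    have bl: "linear (D y)"
      by (rule linearI) (simp_all add: D_def complex_eq_iff add_divide_distrib diff_divide_distrib algebra_simps)
    then show "bounded_linear (D y)" by (simp add: linear_conv_bounded_linear)
    show "D y \<circ> ?L = id"
    proof
      fix h
      have "?L h = of_real (Re h) * p (G y) + of_real (Im h) * q (G y)"
        using complex_linear_eq[OF lin, of h] by (simp add: p_def q_def scaleR_conv_of_real)
      then show "(D y \<circ> ?L) h = id h"
        using J' by (auto simp: D_def complex_eq_iff divide_simps) (simp_all add: algebra_simps)
    qed
    show "continuous (at y) G" using G S(2) y continuous_on_eq_continuous_at by blast
    show "open T" "y \<in> T" "\<And>y. y \<in> T \<Longrightarrow> F (G y) = y" using S y GF by auto
  qed
  have "j \<le> Suc k \<Longrightarrow> Ck_on j T G" for j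
  proof (induction j)
    case 0 then show ?case using G by simp
  next
    case (Suc j)
    have Fj: "Ck_on (Suc j) S F"
      using Suc.prems F
    proof (induction "k - j" arbitrary: k)
      case 0 then show ?case by (metis diff_is_0_eq le_antisym Suc_le_mono)
    next
      case (Suc m)
      then obtain k' where "k = Suc k'" by (cases k) auto
      then show ?case using Suc.hyps(1)[of k'] Suc Ck_on_Suc_imp[OF S(1)] by (metis Suc_diff_le Suc_le_mono diff_Suc_Suc diff_is_0_eq nat.inject nat_le_linear not_less_eq_eq zero_less_Suc Zero_not_Suc)
    qed
    have c: "Ck_on j T (\<lambda>y. p (G y))" "Ck_on j T (\<lambda>y. q (G y))"
      unfolding p_def q_def
      by (rule Ck_on_compose[OF S(2,1) _ Ck_on_SucD2[OF Fj] GF(1)], use Suc in simp)+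
    have cnj: "Ck_on j T (\<lambda>y. cnj (f y))" if "Ck_on j T f" for f
      using Ck_on_bounded_linear_compose[OF S(2) bounded_linear_cnj that] .
    show ?case
    proof (rule Ck_on_SucI[OF S(2) D])
      show "Ck_on j T (\<lambda>y. D y v)" for v
        unfolding D_def using J GF(1)
        by (intro Ck_on_Complex Ck_on_divide Ck_on_minus Ck_on_Im Ck_on_mult cnj c S Ck_on_const)
          (auto simp: p_def q_def)
    qed
  qed
  then show ?thesis by blast
qed

text \<open>A proper local homeomorphism is a covering with finite fibres. The target is simply
  connected, so the identity lifts to a section, and uniqueness of lifts makes this section a
  two-sided inverse.\<close>

theorem proper_local_homeomorphism_imp_homeomorphism:
  fixes F :: "'a::euclidean_space \<Rightarrow> 'a"
  assumes S: "open S" "connected S" "S \<noteq> {}" and cont: "continuous_on S F"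
    and loc: "\<And>x. x \<in> S \<Longrightarrow> \<exists>U. open U \<and> x \<in> U \<and> U \<subseteq> S \<and> inj_on F U"
    and proper: "\<And>K. compact K \<Longrightarrow> compact (S \<inter> F -` K)"
  shows "\<exists>G. homeomorphism S UNIV F G"
proof -
  obtain U where U: "\<And>x. x \<in> S \<Longrightarrow> open (U x) \<and> x \<in> U x \<and> U x \<subseteq> S \<and> inj_on F (U x)"
    using loc by metis
  have opn: "open (F ` V)" if V: "open V" "V \<subseteq> S" for V
    unfolding open_subopen[of "F ` V"]
  proof (clarify)
    fix x assume x: "x \<in> V"
    note Ux = U[OF subsetD[OF V(2) x]]
    have "open (F ` (U x \<inter> V))"
    proof (rule invariance_of_domain)
      show "continuous_on (U x \<inter> V) F" by (rule continuous_on_subset[OF cont]) (use V in auto)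
      show "inj_on F (U x \<inter> V)" by (rule inj_on_subset[of _ "U x"]) (use Ux in auto)
    qed (use Ux V in auto)
    then show "\<exists>T. open T \<and> F x \<in> T \<and> T \<subseteq> F ` V"
      using x Ux by (intro exI[of _ "F ` (U x \<inter> V)"]) auto
  qed
  have cl: "closed (F ` K)" if "closedin (top_of_set S) K" for K
    using proper_map[OF that, of UNIV F] proper by simp
  \<comment> \<open>The image is open by invariance of domain, closed by properness, and not
    empty.\<close>
  have surj: "F ` S = UNIV"
    using opn[OF S(1)] cl[of S] S clopen[of "F ` S"] by auto
  have fib: "finite (S \<inter> F -` {y})" for y
  proof -
    have "compact (S \<inter> F -` {y})" by (rule proper) simp
    moreover have "S \<inter> F -` {y} \<subseteq> (\<Union>x\<in>S \<inter> F -` {y}. U x)" using U by auto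
    ultimately obtain C where C: "C \<subseteq> S \<inter> F -` {y}" "finite C" "S \<inter> F -` {y} \<subseteq> (\<Union>x\<in>C. U x)"
      using compactE_image[of "S \<inter> F -` {y}" "S \<inter> F -` {y}" U] U by (metis IntD1)
    have "S \<inter> F -` {y} \<subseteq> C"
    proof
      fix x assume x: "x \<in> S \<inter> F -` {y}"
      then obtain c where c: "c \<in> C" "x \<in> U c" using C by auto
      have cS: "c \<in> S" "F c = F x" using C(1) c(1) x by auto
      have "x = c" using U[OF cS(1)] c(2) cS(2) inj_onD[of F "U c" c x] by auto
      then show "x \<in> C" using c by simp
    qed
    then show ?thesis using C(2) finite_subset by blast
  qed
  have cov: "covering_space S F UNIV"
  proof
    fix y :: 'a
    define P where "P = S \<inter> F -` {y}"
    have fP: "finite P" unfolding P_def by (rule fib)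
    have "\<exists>d>0. \<forall>z\<in>P. z \<noteq> x \<longrightarrow> d \<le> dist x z" for x
      by (rule finite_set_avoid[OF fP])
    then obtain d where d: "\<And>x. d x > 0" "\<And>x z. z \<in> P \<Longrightarrow> z \<noteq> x \<Longrightarrow> d x \<le> dist x z" by metis
    define W where "W = (\<lambda>x. U x \<inter> ball x (d x / 2))"
    have W: "open (W x)" "x \<in> W x" "W x \<subseteq> S" "inj_on F (W x)" if "x \<in> P" for x
      using U[of x] that d(1)[of x] by (auto simp: P_def W_def intro: inj_on_subset)
    have disj: "W x \<inter> W z = {}" if "x \<in> P" "z \<in> P" "x \<noteq> z" for x z
    proof (rule ccontr)
      assume "W x \<inter> W z \<noteq> {}"
      then obtain w where "dist x w < d x / 2" "dist z w < d z / 2" by (auto simp: W_def)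
      then show False using d(2)[of z x] d(2)[of x z] that dist_triangle2[of x z w]
        by (auto simp: dist_commute)
    qed
    \<comment> \<open>The second set removes the image of everything outside the sheets
      \<open>W x\<close>. That image is closed by properness, and over \<open>V\<close> no further
      preimages occur.\<close>
    define V where "V = (\<Inter>x\<in>P. F ` W x) \<inter> - F ` (S - (\<Union>x\<in>P. W x))"
    have oV: "open V" unfolding V_def
    proof (intro open_Int open_INT open_Compl fP ballI)
      show "open (F ` W x)" if "x \<in> P" for x
        by (rule opn[OF W(1)[OF that] W(3)[OF that]])
      have "open (\<Union>x\<in>P. W x)" using W by blast
      then show "closed (F ` (S - (\<Union>x\<in>P. W x)))"
        using W(3) openin_open_eq[OF S(1)] by (intro cl closedin_diff) auto
    qed
    have yV: "y \<in> V"
    proof -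
      have "y \<in> F ` W x" if "x \<in> P" for x using W(2)[OF that] that by (auto simp: P_def)
      moreover have "y \<notin> F ` (S - (\<Union>x\<in>P. W x))" using W(2) by (auto simp: P_def)
      ultimately show ?thesis by (auto simp: V_def)
    qed
    define v where "v = (\<lambda>x. W x \<inter> F -` V) ` P"
    show "\<exists>T. y \<in> T \<and> openin (top_of_set UNIV) T \<and>
             (\<exists>v. \<Union> v = S \<inter> F -` T \<and> (\<forall>u\<in>v. openin (top_of_set S) u) \<and>
                  pairwise disjnt v \<and> (\<forall>u\<in>v. \<exists>q. homeomorphism u T F q))"
    proof (rule exI[of _ V], rule conjI[OF yV], rule conjI, simp add: oV, rule exI[of _ v], intro conjI ballI)
      show "\<Union> v = S \<inter> F -` V" using W(3) by (auto simp: v_def V_def)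
      show "pairwise disjnt v"
        using disj by (force simp: v_def pairwise_def disjnt_def)
      fix u assume "u \<in> v"
      then obtain x where x: "x \<in> P" "u = W x \<inter> F -` V" by (auto simp: v_def)
      have cW: "continuous_on (W x) F" using cont W(3)[OF x(1)] continuous_on_subset by blast
      have ou: "open u" unfolding x(2)
        by (rule continuous_open_preimage[OF cW W(1)[OF x(1)] oV])
      then show "openin (top_of_set S) u" using W(3)[OF x(1)] x(2)
        by (auto simp: openin_open)
      have "V \<subseteq> F ` W x" using x(1) by (auto simp: V_def)
      then have "F ` u = V" unfolding x(2) by auto
      moreover have "continuous_on u F" "inj_on F u"
        using x W(4)[OF x(1)] cW by (auto intro: continuous_on_subset inj_on_subset)
      ultimately have "\<exists>q. homeomorphism u (F ` u) F q"
        using invariance_of_domain_homeomorphism[of u F] ou by auto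
      then show "\<exists>q. homeomorphism u V F q" using \<open>F ` u = V\<close> by simp
    qed
  qed (use cont surj in auto)
  have sc: "simply_connected (UNIV :: 'a set)" "locally path_connected (UNIV :: 'a set)"
    by (simp_all add: convex_imp_simply_connected open_imp_locally_path_connected)
  obtain g where g: "continuous_on UNIV g" "g \<in> UNIV \<rightarrow> S" "\<And>y. F (g y) = y"
    by (rule covering_space_lift[OF cov sc continuous_on_id]) auto
  \<comment> \<open>\<open>g\<close> after \<open>F\<close> and the identity are both lifts of
    \<open>F\<close>, and they agree at \<open>g 0\<close>.\<close>
  have gF: "g (F x) = x" if "x \<in> S" for x
  proof (rule covering_space_lift_unique[OF cov _ cont _ _ _ _ continuous_on_id, of "\<lambda>x. g (F x)" "g 0"])
    show "continuous_on S (\<lambda>x. g (F x))"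
      using continuous_on_compose2[OF g(1) cont] by auto
  qed (use g S that in auto)
  then have "homeomorphism S UNIV F g"
    unfolding homeomorphism_def using g cont surj by (auto simp: image_iff) (metis)
  then show ?thesis by blast
qed

section \<open>Real analytic functions\<close>

text \<open>Cauchy's estimates turn the bounds on the coefficient functions into a geometric
  majorant in both indices, so that a power series in x with coefficients holomorphic in y can be
  rearranged into a double series.\<close>

lemma double_series_of_slices:
  fixes A :: "nat \<Rightarrow> complex \<Rightarrow> complex"
  assumes hol: "\<And>k. A k holomorphic_on ball 0 \<rho>" and bnd: "\<And>k y. cmod y < \<rho> \<Longrightarrow> cmod (A k y) \<le> M * C ^ k"
    and pos: "\<rho> > 0" "C > 0" "M \<ge> 0"
  obtains r a where "r > 0" "r \<le> \<rho>" "r < 1 / C" "\<And>x y S. \<bar>x\<bar> < r \<Longrightarrow> \<bar>y\<bar> < r \<Longrightarrow>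
     (\<lambda>k. A k (of_real y) * of_real x ^ k) sums S \<Longrightarrow>
     ((\<lambda>(i, j). x ^ i * y ^ j * a (i, j)) has_sum Re S) UNIV"
proof -
  define a where "a = (\<lambda>(k, j). (deriv ^^ j) (A k) 0 / fact j)"
  have abound: "cmod (a (k, j)) \<le> M * C ^ k / (\<rho>/2) ^ j" for k j
  proof -
    have "norm ((deriv ^^ j) (A k) 0) \<le> fact j * (M * C ^ k) / (\<rho>/2) ^ j"
    proof (rule Cauchy_inequality)
      show "A k holomorphic_on ball 0 (\<rho> / 2)" using pos by (intro holomorphic_on_subset[OF hol]) auto
      have "continuous_on (ball 0 \<rho>) (A k)" by (rule holomorphic_on_imp_continuous_on[OF hol])
      then show "continuous_on (cball 0 (\<rho> / 2)) (A k)" using pos by (auto intro: continuous_on_subset)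
    qed (use pos bnd in auto)
    then show ?thesis by (simp add: a_def norm_divide field_simps)
  qed
  \<comment> \<open>These radii make both ratios \<open>\<bar>x\<bar> * C\<close> and
    \<open>\<bar>y\<bar> / (\<rho>/2)\<close> at most 1/2.\<close>
  define r where "r = min (1 / (2 * C)) (\<rho> / 4)"
  have r: "r > 0" "r \<le> 1 / (2 * C)" "r \<le> \<rho> / 4" using pos by (auto simp: r_def)
  show thesis
  proof
    show "r > 0" by fact
    show "r \<le> \<rho>" using r pos by auto
    have "1 / (2 * C) < 1 / C" using pos by (simp add: field_simps)
    then show "r < 1 / C" using r by linarith
    fix x y :: real and S
    assume x: "\<bar>x\<bar> < r" and y: "\<bar>y\<bar> < r" and S: "(\<lambda>k. A k (of_real y) * of_real x ^ k) sums S"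
    define t where "t = (\<lambda>(k, j). a (k, j) * of_real x ^ k * of_real y ^ j)"
    have "\<bar>x\<bar> * C \<le> 1 / (2 * C) * C" using x r(2) pos by (intro mult_right_mono) auto
    then have xC: "\<bar>x\<bar> * C \<le> 1/2" using pos by simp
    have yr: "\<bar>y\<bar> / (\<rho>/2) \<le> 1/2" using y r(3) pos by (simp add: field_simps)
    have tb: "norm (t (k, j)) \<le> M * (1/2) ^ k * (1/2) ^ j" for k j
    proof -
      have "norm (t (k, j)) = cmod (a (k, j)) * (\<bar>x\<bar> ^ k * \<bar>y\<bar> ^ j)" by (simp add: t_def norm_mult norm_power)
      also have "\<dots> \<le> (M * C ^ k / (\<rho>/2) ^ j) * (\<bar>x\<bar> ^ k * \<bar>y\<bar> ^ j)"
        by (rule mult_right_mono[OF abound]) simp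
      also have "\<dots> = M * ((\<bar>x\<bar> * C) ^ k * (\<bar>y\<bar> / (\<rho>/2)) ^ j)"
        by (simp add: power_mult_distrib power_divide)
      also have "\<dots> \<le> M * ((1/2) ^ k * (1/2) ^ j)"
        using xC yr pos by (intro mult_left_mono mult_mono power_mono) auto
      finally show ?thesis by (simp add: mult.assoc)
    qed
    have geo: "((\<lambda>j::nat. (1/2::real) ^ j) has_sum 2) UNIV"
      by (rule norm_summable_imp_has_sum) (use geometric_sums[of "1/2::real"] in \<open>auto intro: summable_geometric\<close>)
    have "(\<lambda>p. case p of (k, j) \<Rightarrow> M * (1/2) ^ k * (1/2) ^ j) summable_on (Sigma UNIV (\<lambda>_. UNIV) :: (nat \<times> nat) set)"
    proof (rule summable_on_SigmaI)
      show "((\<lambda>j. case (k, j) of (k, j) \<Rightarrow> M * (1/2) ^ k * (1/2) ^ j) has_sum M * (1/2) ^ k * 2) UNIV" for k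
        using has_sum_cmult_right[OF geo, of "M * (1/2) ^ k"] by simp
      have "((\<lambda>k. M * 2 * (1/2) ^ k) has_sum M * 2 * 2) UNIV" by (rule has_sum_cmult_right[OF geo])
      moreover have "(\<lambda>k::nat. M * (1/2) ^ k * 2) = (\<lambda>k. M * 2 * (1/2) ^ k)" by auto
      ultimately show "(\<lambda>k. M * (1/2) ^ k * 2) summable_on UNIV"
        by (metis has_sum_imp_summable)
    qed (use pos in auto)
    then have "(\<lambda>p. norm (t p)) summable_on UNIV"
      by (intro Infinite_Sum.abs_summable_on_comparison_test'[where g="\<lambda>p. case p of (k, j) \<Rightarrow> M * (1/2) ^ k * (1/2) ^ j"])
        (use tb in auto)
    then have ts: "t summable_on (Sigma UNIV (\<lambda>_. UNIV))" using abs_summable_summable by auto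
    have inner: "((\<lambda>j. t (k, j)) has_sum A k (of_real y) * of_real x ^ k) UNIV" for k
    proof (rule norm_summable_imp_has_sum)
      have "summable (\<lambda>j. M * (1/2) ^ k * (1/2::real) ^ j)"
        by (intro summable_mult summable_geometric) auto
      then show "summable (\<lambda>j. norm (t (k, j)))"
        by (rule summable_comparison_test'[where N=0]) (use tb in auto)
      have "of_real y \<in> ball (0::complex) \<rho>" using y r pos by auto
      from holomorphic_power_series[OF hol this, of k]
      have "(\<lambda>j. a (k, j) * of_real y ^ j) sums A k (of_real y)" by (simp add: a_def)
      from sums_mult2[OF this, of "of_real x ^ k"]
      show "(\<lambda>j. t (k, j)) sums (A k (of_real y) * of_real x ^ k)" by (simp add: t_def mult_ac)
    qed
    obtain S' where S': "(t has_sum S') (Sigma UNIV (\<lambda>_. UNIV))" using ts by (auto simp: summable_on_def)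
    have "((\<lambda>k. A k (of_real y) * of_real x ^ k) has_sum S') UNIV"
      by (rule has_sum_SigmaD[OF S' inner])
    then have "S' = S" using has_sum_imp_sums S sums_unique2 by blast
    then have "((\<lambda>p. Re (t p)) has_sum Re S) UNIV" using has_sum_Re[OF S'] by simp
    moreover have "Re (t p) = (case p of (i, j) \<Rightarrow> x ^ i * y ^ j * Re (a (i, j)))" for p
    proof (cases p)
      case (Pair i j)
      have "t p = of_real (x ^ i * y ^ j) * a (i, j)" by (simp add: t_def Pair mult_ac)
      then show ?thesis by (simp add: Pair flip: of_real_power of_real_mult)
    qed
    ultimately show "((\<lambda>(i, j). x ^ i * y ^ j * (\<lambda>p. Re (a p)) (i, j)) has_sum Re S) UNIV"
      by (simp add: case_prod_unfold)
  qed
qed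

text \<open>Analyticity in both charts reduces to this: ln |d + c x| is the real part of Ln d + Ln
  (1 + c x / d), and the logarithmic series in x has coefficients holomorphic in y.\<close>

lemma ln_cmod_double_series:
  fixes d :: "complex \<Rightarrow> complex" and c :: complex
  assumes hol: "d holomorphic_on UNIV" and d0: "Re (d 0) > 0" and c: "cmod c \<le> 1"
  obtains r a where "r > 0" "\<And>x y. \<bar>x\<bar> < r \<Longrightarrow> \<bar>y\<bar> < r \<Longrightarrow>
     ((\<lambda>(i, j). x ^ i * y ^ j * a (i, j)) has_sum ln (cmod (d (of_real y) + c * of_real x))) UNIV"
proof -
  \<comment> \<open>Near 0 the values of \<open>d\<close> have real part above \<open>e\<close>,
    inside the domain where the principal logarithm is holomorphic.\<close>
  define e where "e = Re (d 0) / 2"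
  have e: "e > 0" using d0 by (simp add: e_def)
  have "isCont d 0"
    using holomorphic_on_imp_continuous_on[OF hol] by (simp add: continuous_on_eq_continuous_at)
  then obtain \<rho> where \<rho>: "\<rho> > 0" "\<And>y. cmod y < \<rho> \<Longrightarrow> cmod (d y - d 0) < e"
    using e unfolding continuous_at_eps_delta by (auto simp: dist_norm)
  have Red: "Re (d y) > e" if "cmod y < \<rho>" for y
    using \<rho>(2)[OF that] abs_Re_le_cmod[of "d y - d 0"] by (simp add: e_def)
  have cd: "cmod (d y) > e" if "cmod y < \<rho>" for y using Red[OF that] complex_Re_le_cmod[of "d y"] by linarith
  have cdu: "cmod (d y) < e + cmod (d 0)" if "cmod y < \<rho>" for y
    using \<rho>(2)[OF that] norm_triangle_sub[of "d y" "d 0"] by linarith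
  define A where "A = (\<lambda>k y. if k = 0 then Ln (d y) else (- 1) ^ Suc k / of_nat k * (c / d y) ^ k)"
  \<comment> \<open>Bounds the constant term: the real part of Ln lies between two fixed logarithms
    and the imaginary part is at most pi in modulus.\<close>
  define L where "L = \<bar>ln e\<bar> + \<bar>ln (e + cmod (d 0))\<bar> + pi"
  have L: "cmod (Ln (d y)) \<le> L" if y: "cmod y < \<rho>" for y
  proof -
    have nz: "d y \<noteq> 0" using cd[OF y] e by auto
    have "ln e \<le> ln (cmod (d y))" "ln (cmod (d y)) \<le> ln (e + cmod (d 0))"
      using cd[OF y] cdu[OF y] e by (auto intro!: ln_mono simp: less_imp_le)
    then have "\<bar>Re (Ln (d y))\<bar> \<le> \<bar>ln e\<bar> + \<bar>ln (e + cmod (d 0))\<bar>" using nz by simp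
    moreover have "\<bar>Im (Ln (d y))\<bar> \<le> pi" using nz Im_Ln_le_pi[of "d y"] mpi_less_Im_Ln[of "d y"] by auto
    ultimately show ?thesis using cmod_le[of "Ln (d y)"] by (simp add: L_def)
  qed
  have bnd: "cmod (A k y) \<le> (1 + L) * (1 / e) ^ k" if y: "cmod y < \<rho>" for k y
  proof (cases "k = 0")
    case True then show ?thesis using L[OF y] by (simp add: A_def)
  next
    case False
    have "cmod (A k y) = 1 / real k * (cmod c / cmod (d y)) ^ k"
      using False by (simp add: A_def norm_mult norm_divide norm_power)
    also have "\<dots> \<le> 1 * (1 / e) ^ k"
      using False c cd[OF y] e by (intro mult_mono power_mono frac_le) auto
    also have "\<dots> \<le> (1 + L) * (1 / e) ^ k"
      using e by (intro mult_right_mono) (auto simp: L_def)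
    finally show ?thesis .
  qed
  have hol': "A k holomorphic_on ball 0 \<rho>" for k
  proof -
    have dh: "d holomorphic_on ball 0 \<rho>" using hol by (rule holomorphic_on_subset) simp
    have nn: "d y \<notin> \<real>\<^sub>\<le>\<^sub>0" "d y \<noteq> 0" if "y \<in> ball 0 \<rho>" for y
      using Red[of y] that e by (auto simp: complex_nonpos_Reals_iff)
    show ?thesis
    proof (cases "k = 0")
      case True
      then show ?thesis using nn dh by (auto simp: A_def intro!: holomorphic_intros)
    next
      case False
      then show ?thesis using nn dh by (auto simp: A_def intro!: holomorphic_intros)
    qed
  qed
  have L0: "1 + L \<ge> 0" by (simp add: L_def)
  have e1: "1 / e > 0" using e by simp
  obtain r a where r: "r > 0" "r \<le> \<rho>" "r < 1 / (1 / e)" and H: "\<And>x y S. \<bar>x\<bar> < r \<Longrightarrow> \<bar>y\<bar> < r \<Longrightarrow>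
     (\<lambda>k. A k (of_real y) * of_real x ^ k) sums S \<Longrightarrow>
     ((\<lambda>(i, j). x ^ i * y ^ j * a (i, j)) has_sum Re S) UNIV"
    by (rule double_series_of_slices[of A \<rho> "1 + L" "1 / e", OF hol' _ \<rho>(1) e1 L0], erule bnd, rule that)
  show thesis
  proof (rule that[OF r(1)])
    fix x y :: real assume x: "\<bar>x\<bar> < r" and y: "\<bar>y\<bar> < r"
    have y': "cmod (of_real y) < \<rho>" using y r by auto
    define D where "D = d (of_real y)"
    define q where "q = c * of_real x / D"
    have D: "cmod D > e" "D \<noteq> 0" using cd[OF y'] e by (auto simp: D_def)
    have "cmod (c * of_real x) < e"
      using c x r(3) mult_left_le_one_le[of "\<bar>x\<bar>" "cmod c"] by (simp add: norm_mult)
    then have q: "cmod q < 1" using D e by (simp add: q_def norm_divide field_simps)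
    have "(\<lambda>k. (- 1) ^ Suc k / of_nat k * q ^ k) sums ln (1 + q)" using Ln_series[OF q] .
    then have "(\<lambda>k. (if k = 0 then Ln D else 0) + (- 1) ^ Suc k / of_nat k * q ^ k) sums (Ln D + ln (1 + q))"
      by (rule sums_add[OF sums_single])
    then have "(\<lambda>k. A k (of_real y) * of_real x ^ k) sums (Ln D + ln (1 + q))"
      by (rule sums_cong[THEN iffD1, rotated])
        (auto simp: A_def D_def q_def power_divide power_mult_distrib)
    from H[OF x y this]
    have "((\<lambda>(i, j). x ^ i * y ^ j * a (i, j)) has_sum Re (Ln D + ln (1 + q))) UNIV" .
    moreover have "Re (Ln D + ln (1 + q)) = ln (cmod (D + c * of_real x))"
    proof -
      have "1 + q \<noteq> 0" using q by (metis add_eq_0_iff less_irrefl norm_minus_cancel norm_one)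
      moreover have "D + c * of_real x = D * (1 + q)" using D by (simp add: q_def field_simps)
      ultimately show ?thesis using D by (simp add: norm_mult ln_mult)
    qed
    ultimately show "((\<lambda>(i, j). x ^ i * y ^ j * a (i, j)) has_sum ln (cmod (d (of_real y) + c * of_real x))) UNIV"
      by (simp add: D_def)
  qed
qed

lemma real_analytic_on_add:
  assumes "real_analytic_on S F" "real_analytic_on S G"
  shows "real_analytic_on S (\<lambda>p. F p + G p)"
  unfolding real_analytic_on_def
proof (clarify)
  fix x0 y0 assume p: "(x0, y0) \<in> S"
  obtain r a where r: "r > 0" "\<And>x y. \<bar>x - x0\<bar> < r \<and> \<bar>y - y0\<bar> < r \<Longrightarrow>
       ((\<lambda>(i, j). ((x - x0) ^ i * (y - y0) ^ j) *\<^sub>R a (i, j)) has_sum F (x, y)) UNIV"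
    using assms(1) p unfolding real_analytic_on_def by blast
  obtain s b where s: "s > 0" "\<And>x y. \<bar>x - x0\<bar> < s \<and> \<bar>y - y0\<bar> < s \<Longrightarrow>
       ((\<lambda>(i, j). ((x - x0) ^ i * (y - y0) ^ j) *\<^sub>R b (i, j)) has_sum G (x, y)) UNIV"
    using assms(2) p unfolding real_analytic_on_def by blast
  show "\<exists>r>0. \<exists>a. \<forall>x y. \<bar>x - x0\<bar> < r \<and> \<bar>y - y0\<bar> < r \<longrightarrow>
       ((\<lambda>(i, j). ((x - x0) ^ i * (y - y0) ^ j) *\<^sub>R a (i, j)) has_sum F (x, y) + G (x, y)) UNIV"
  proof (intro exI[of _ "min r s"] exI[of _ "\<lambda>p. a p + b p"] conjI allI impI)
    fix x y assume "\<bar>x - x0\<bar> < min r s \<and> \<bar>y - y0\<bar> < min r s"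
    then show "((\<lambda>(i, j). ((x - x0) ^ i * (y - y0) ^ j) *\<^sub>R (a (i, j) + b (i, j))) has_sum F (x, y) + G (x, y)) UNIV"
      using has_sum_add[OF r(2)[of x y] s(2)[of x y]] by (simp add: scaleR_add_right case_prod_unfold)
  qed (use r s in auto)
qed

lemma real_analytic_on_const: "real_analytic_on S (\<lambda>p. c)"
  unfolding real_analytic_on_def
proof (clarify)
  fix x0 y0 :: real
  have *: "((\<lambda>(i, j). ((x - x0) ^ i * (y - y0) ^ j) *\<^sub>R (if (i, j) = (0, 0) then c else 0)) has_sum c) UNIV" for x y
    by (rule has_sum_finite_neutralI[where B="{(0,0)}"]) (auto split: if_splits)
  show "\<exists>r>0. \<exists>a. \<forall>x y. \<bar>x - x0\<bar> < r \<and> \<bar>y - y0\<bar> < r \<longrightarrow>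
       ((\<lambda>(i, j). ((x - x0) ^ i * (y - y0) ^ j) *\<^sub>R a (i, j)) has_sum c) UNIV"
    by (rule exI[of _ 1], rule conjI[OF zero_less_one], rule exI[of _ "\<lambda>p. if p = (0, 0) then c else 0"])
      (intro allI impI *)
qed

lemma real_analytic_on_bounded_linear:
  assumes "bounded_linear L" "real_analytic_on S F"
  shows "real_analytic_on S (\<lambda>p. L (F p))"
  unfolding real_analytic_on_def
proof (clarify)
  fix x0 y0 assume p: "(x0, y0) \<in> S"
  obtain r a where r: "r > 0" "\<And>x y. \<bar>x - x0\<bar> < r \<and> \<bar>y - y0\<bar> < r \<Longrightarrow>
       ((\<lambda>(i, j). ((x - x0) ^ i * (y - y0) ^ j) *\<^sub>R a (i, j)) has_sum F (x, y)) UNIV"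
    using assms(2) p unfolding real_analytic_on_def by blast
  show "\<exists>r>0. \<exists>a. \<forall>x y. \<bar>x - x0\<bar> < r \<and> \<bar>y - y0\<bar> < r \<longrightarrow>
       ((\<lambda>(i, j). ((x - x0) ^ i * (y - y0) ^ j) *\<^sub>R a (i, j)) has_sum L (F (x, y))) UNIV"
  proof (intro exI[of _ r] exI[of _ "\<lambda>p. L (a p)"] conjI allI impI)
    fix x y assume "\<bar>x - x0\<bar> < r \<and> \<bar>y - y0\<bar> < r"
    from has_sum_bounded_linear[OF assms(1) r(2)[OF this]]
    show "((\<lambda>(i, j). ((x - x0) ^ i * (y - y0) ^ j) *\<^sub>R L (a (i, j))) has_sum L (F (x, y))) UNIV"
      by (simp add: o_def case_prod_unfold linear_cmul[OF bounded_linear.linear[OF assms(1)]])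
  qed (use r in auto)
qed

lemma real_analytic_on_sum:
  "(\<And>i. i \<in> I \<Longrightarrow> real_analytic_on S (F i)) \<Longrightarrow> real_analytic_on S (\<lambda>p. \<Sum>i\<in>I. F i p)"
  by (induction I rule: infinite_finite_induct) (auto intro: real_analytic_on_add real_analytic_on_const)

lemma real_analytic_on_cong:
  assumes "open S" "\<And>p. p \<in> S \<Longrightarrow> F p = G p" "real_analytic_on S F"
  shows "real_analytic_on S G"
  unfolding real_analytic_on_def
proof (clarify)
  fix x0 y0 assume p: "(x0, y0) \<in> S"
  obtain r a where r: "r > 0" "\<And>x y. \<bar>x - x0\<bar> < r \<and> \<bar>y - y0\<bar> < r \<Longrightarrow>
       ((\<lambda>(i, j). ((x - x0) ^ i * (y - y0) ^ j) *\<^sub>R a (i, j)) has_sum F (x, y)) UNIV"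
    using assms(3) p unfolding real_analytic_on_def by blast
  obtain A B where AB: "open A" "open B" "(x0, y0) \<in> A \<times> B" "A \<times> B \<subseteq> S"
    by (rule open_prod_elim[OF assms(1) p])
  obtain s where s: "s > 0" "ball x0 s \<subseteq> A" using AB openE[of A x0] by auto
  obtain t where t: "t > 0" "ball y0 t \<subseteq> B" using AB openE[of B y0] by auto
  have st: "(x, y) \<in> S" if "\<bar>x - x0\<bar> < s" "\<bar>y - y0\<bar> < t" for x y
  proof -
    have "x \<in> ball x0 s" "y \<in> ball y0 t" using that by (simp_all add: dist_real_def abs_minus_commute)
    then show ?thesis using s t AB(4) by blast
  qed
  show "\<exists>r>0. \<exists>a. \<forall>x y. \<bar>x - x0\<bar> < r \<and> \<bar>y - y0\<bar> < r \<longrightarrow>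
       ((\<lambda>(i, j). ((x - x0) ^ i * (y - y0) ^ j) *\<^sub>R a (i, j)) has_sum G (x, y)) UNIV"
  proof (intro exI[of _ "min r (min s t)"] exI[of _ a] conjI allI impI)
    fix x y assume "\<bar>x - x0\<bar> < min r (min s t) \<and> \<bar>y - y0\<bar> < min r (min s t)"
    then show "((\<lambda>(i, j). ((x - x0) ^ i * (y - y0) ^ j) *\<^sub>R a (i, j)) has_sum G (x, y)) UNIV"
      using r(2)[of x y] assms(2)[OF st[of x y]] by simp
  qed (use r s t in auto)
qed

lemma real_analytic_on_horizontal_slice:
  assumes "real_analytic_on S F" "(x0, y0) \<in> S"
  obtains r a where "r > 0" "\<And>x. \<bar>x - x0\<bar> < r \<Longrightarrow> (\<lambda>i. (x - x0) ^ i *\<^sub>R a i) sums F (x, y0)"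
proof -
  obtain r a where r: "r > 0" "\<And>x y. \<bar>x - x0\<bar> < r \<and> \<bar>y - y0\<bar> < r \<Longrightarrow>
       ((\<lambda>(i, j). ((x - x0) ^ i * (y - y0) ^ j) *\<^sub>R a (i, j)) has_sum F (x, y)) UNIV"
    using assms unfolding real_analytic_on_def by blast
  show thesis
  proof (rule that[of r "\<lambda>i. a (i, 0)"])
    fix x assume "\<bar>x - x0\<bar> < r"
    then have "((\<lambda>(i, j). ((x - x0) ^ i * 0 ^ j) *\<^sub>R a (i, j)) has_sum F (x, y0)) UNIV"
      using r(2)[of x y0] r(1) by simp
    also have "((\<lambda>(i, j). ((x - x0) ^ i * 0 ^ j) *\<^sub>R a (i, j)) has_sum F (x, y0)) UNIV \<longleftrightarrow>
       ((\<lambda>(i, j). ((x - x0) ^ i * 0 ^ j) *\<^sub>R a (i, j)) has_sum F (x, y0)) (range (\<lambda>i. (i, 0::nat)))"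
      by (rule has_sum_cong_neutral) (auto simp: image_iff)
    also have "\<dots> \<longleftrightarrow> ((\<lambda>i. (x - x0) ^ i *\<^sub>R a (i, 0)) has_sum F (x, y0)) UNIV"
      by (subst has_sum_reindex) (auto simp: inj_on_def o_def)
    finally show "(\<lambda>i. (x - x0) ^ i *\<^sub>R a (i, 0)) sums F (x, y0)" by (rule has_sum_imp_sums)
  qed (fact r(1))
qed

text \<open>An identity theorem along one ray: the points near which \<open>F\<close> vanishes form
  a set that is open and closed in the ray. It gives the uniqueness of the analytic
  extension.\<close>

lemma real_analytic_on_ray_zero:
  fixes F :: "real \<times> real \<Rightarrow> real"
  assumes F: "real_analytic_on S F" and S: "\<And>u. u > m \<Longrightarrow> (u, y) \<in> S"
    and z: "\<And>u. u > m \<Longrightarrow> u \<ge> c \<Longrightarrow> F (u, y) = 0" and u: "u > m"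
  shows "F (u, y) = 0"
proof -
  define h where "h = (\<lambda>u. F (u, y))"
  define Z where "Z = {u. u > m \<and> (\<exists>d>0. \<forall>x. \<bar>x - u\<bar> < d \<longrightarrow> h x = 0)}"
  \<comment> \<open>If zeros accumulate at \<open>u0\<close>, the isolation of zeros kills every
    coefficient of the expansion there. Closedness below rests on this.\<close>
  have all0: "u0 \<in> Z" if u0: "u0 > m" and lim: "\<And>d. d > 0 \<Longrightarrow> \<exists>x. x \<noteq> u0 \<and> \<bar>x - u0\<bar> < d \<and> h x = 0" for u0
  proof -
    obtain r a where r: "r > 0" "\<And>x. \<bar>x - u0\<bar> < r \<Longrightarrow> (\<lambda>i. (x - u0) ^ i *\<^sub>R a i) sums F (x, y)"
      by (rule real_analytic_on_horizontal_slice[OF F S[OF u0]], rule that)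
    have sm: "(\<lambda>i. a i * (x - u0) ^ i) sums h x" if "\<bar>x - u0\<bar> < r" for x
      using r(2)[OF that] by (simp add: mult.commute h_def)
    have cont: "isCont h u0"
    proof -
      have "isCont (\<lambda>x. \<Sum>i. a i * x ^ i) 0"
        using sums_summable[OF sm[of "u0 + r/2"]] r(1) by (intro isCont_powser[of a "r/2"]) auto
      then have 1: "isCont (\<lambda>x. \<Sum>i. a i * (x - u0) ^ i) u0"
        by (intro isCont_o2[where f="\<lambda>x. x - u0" and g="\<lambda>x. \<Sum>i. a i * x ^ i"]) (auto intro!: continuous_intros)
      have "\<forall>\<^sub>F x in nhds u0. (\<Sum>i. a i * (x - u0) ^ i) = h x"
        unfolding eventually_nhds_metric
        by (intro exI[of _ r]) (use r sm in \<open>auto simp: dist_real_def sums_iff\<close>)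
      from isCont_cong[OF this] 1 show ?thesis by simp
    qed
    have h0: "h u0 = 0"
    proof (rule ccontr)
      assume "h u0 \<noteq> 0"
      then obtain d where d: "d > 0" "\<And>x. \<bar>x - u0\<bar> < d \<Longrightarrow> \<bar>h x - h u0\<bar> < \<bar>h u0\<bar>"
        using cont unfolding continuous_at_eps_delta dist_real_def by (metis zero_less_abs_iff)
      then show False using lim[OF d(1)] by fastforce
    qed
    have "a i = 0" if "i > 0" for i
    proof (rule ccontr)
      assume ai: "a i \<noteq> 0"
      show False
      proof (rule powser_0_nonzero[of r u0 a h i])
        show "(\<lambda>n. a n * (x - u0) ^ n) sums h x" if "norm (x - u0) < r" for x
          using sm[of x] that by simp
        fix s assume s: "0 < s" "\<And>z. z \<in> cball u0 s - {u0} \<Longrightarrow> h z \<noteq> 0"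
        obtain x where "x \<noteq> u0" "\<bar>x - u0\<bar> < s" "h x = 0" using lim[OF s(1)] by blast
        then show False using s(2)[of x] by (auto simp: dist_real_def abs_minus_commute)
      qed (use r h0 ai that in auto)
    qed
    moreover have "a 0 = 0" using sm[of u0] r h0 by (simp add: sums_iff powser_zero)
    ultimately have "a = (\<lambda>i. 0)" by (metis gr0I)
    then have "h x = 0" if "\<bar>x - u0\<bar> < r" for x
      using sm[OF that] by (simp add: sums_iff)
    then show ?thesis using r u0 by (auto simp: Z_def)
  qed
  have oZ: "open Z"
    unfolding open_subopen[of Z]
  proof (intro ballI)
    fix x assume "x \<in> Z"
    then obtain d where d: "x > m" "d > 0" "\<And>t. \<bar>t - x\<bar> < d \<Longrightarrow> h t = 0" by (auto simp: Z_def)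
    show "\<exists>T. open T \<and> x \<in> T \<and> T \<subseteq> Z"
    proof (intro exI[of _ "ball x (min d (x - m))"] conjI subsetI)
      fix t assume t: "t \<in> ball x (min d (x - m))"
      have "\<forall>v. \<bar>v - t\<bar> < d - \<bar>t - x\<bar> \<longrightarrow> h v = 0"
        using d(3) by (auto intro!: d(3))
      moreover have "d - \<bar>t - x\<bar> > 0" "t > m" using t by (auto simp: dist_real_def)
      ultimately show "t \<in> Z" unfolding Z_def by blast
    qed (use d in auto)
  qed
  have "closedin (top_of_set {m<..}) Z"
    unfolding closedin_limpt
  proof (intro conjI allI impI)
    show "Z \<subseteq> {m<..}" by (auto simp: Z_def)
    fix x assume x: "x islimpt Z \<and> x \<in> {m<..}"
    show "x \<in> Z"
    proof (rule all0)
      show "x > m" using x by simp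
      fix d :: real assume "d > 0"
      then obtain t where "t \<in> Z" "t \<noteq> x" "dist t x < d"
        using x by (auto simp: islimpt_approachable)
      then show "\<exists>t. t \<noteq> x \<and> \<bar>t - x\<bar> < d \<and> h t = 0"
        by (intro exI[of _ t]) (auto simp: Z_def dist_real_def)
    qed
  qed
  moreover have "openin (top_of_set {m<..}) Z" using oZ by (auto simp: openin_open Z_def)
  \<comment> \<open>All points within distance 1 of this one exceed both \<open>c\<close> and
    \<open>m\<close>.\<close>
  moreover have "\<bar>c\<bar> + \<bar>m\<bar> + 1 \<in> Z" unfolding Z_def
    using z by (auto intro!: exI[of _ "1::real"] simp: h_def)
  ultimately have "Z = {m<..}"
    using connected_clopen[of "{m<..}"] by (auto simp: connected_Ioi)
  then have "u \<in> Z" using u by simp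
  then show ?thesis by (force simp: Z_def h_def)
qed

section \<open>Partial fractions of the Weierstrass data\<close>

text \<open>Lagrange interpolation: \<open>p\<close> equals its interpolation polynomial
  \<open>L\<close> at the nodes, and the sum of the \<open>c j\<close> is the coefficient of degree
  \<open>m - 1\<close> in \<open>L\<close>.\<close>

lemma partial_fraction_simple_poles:
  fixes \<zeta> :: "nat \<Rightarrow> complex" and p :: "complex poly"
  assumes inj: "inj_on \<zeta> {..<m}" and deg: "degree p < m"
  defines "c \<equiv> \<lambda>j. poly p (\<zeta> j) / (\<Prod>k\<in>{..<m} - {j}. \<zeta> j - \<zeta> k)"
  shows "z \<notin> \<zeta> ` {..<m} \<Longrightarrow> poly p z / (\<Prod>j<m. z - \<zeta> j) = (\<Sum>j<m. c j / (z - \<zeta> j))"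
    and "Suc (degree p) < m \<Longrightarrow> (\<Sum>j<m. c j) = 0"
proof -
  define P where "P = (\<lambda>j. \<Prod>k\<in>{..<m} - {j}. [:- \<zeta> k, 1:])"
  define L where "L = (\<Sum>j<m. smult (c j) (P j))"
  have polyP: "poly (P j) z = (\<Prod>k\<in>{..<m} - {j}. z - \<zeta> k)" for j z
    by (simp add: P_def poly_prod)
  have degP: "degree (P j) = m - 1" if "j < m" for j
    using that unfolding P_def by (subst degree_prod_eq_sum_degree) auto
  have lcP: "coeff (P j) (m - 1) = 1" if "j < m" for j
    using lead_coeff_prod[of "\<lambda>k. [:- \<zeta> k, 1:]" "{..<m} - {j}"] degP[OF that] by (simp add: P_def)
  have degL: "degree L < m"
    unfolding L_def using deg degP by (intro degree_sum_less) (auto intro: le_less_trans[OF degree_smult_le])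
  have nz: "(\<Prod>k\<in>{..<m} - {j}. \<zeta> j - \<zeta> k) \<noteq> 0" if "j < m" for j
    using inj that by (auto simp: inj_on_def)
  have "p = L"
  proof (rule poly_eqI_degree)
    show "degree p < card (\<zeta> ` {..<m})" "degree L < card (\<zeta> ` {..<m})"
      using deg degL by (simp_all add: card_image inj)
    fix x assume "x \<in> \<zeta> ` {..<m}"
    then obtain i where i: "i < m" "x = \<zeta> i" by auto
    have "poly L x = (\<Sum>j<m. c j * poly (P j) x)" by (simp add: L_def poly_sum)
    also have "\<dots> = (\<Sum>j<m. if j = i then poly p x else 0)"
    proof (rule sum.cong[OF refl])
      fix j assume "j \<in> {..<m}"
      show "c j * poly (P j) x = (if j = i then poly p x else 0)"
      proof (cases "j = i")
        case True then show ?thesis using nz[OF i(1)] by (simp add: c_def polyP i)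
      next
        case False
        then have "poly (P j) x = 0" using i unfolding polyP by (intro prod_zero) auto
        then show ?thesis using False by simp
      qed
    qed
    also have "\<dots> = poly p x" using i by simp
    finally show "poly p x = poly L x" by simp
  qed
  show "poly p z / (\<Prod>j<m. z - \<zeta> j) = (\<Sum>j<m. c j / (z - \<zeta> j))" if z: "z \<notin> \<zeta> ` {..<m}"
  proof -
    have zn: "z - \<zeta> j \<noteq> 0" if "j < m" for j using z that by auto
    have nzp: "(\<Prod>j<m. z - \<zeta> j) \<noteq> 0" using zn by simp
    have "c j / (z - \<zeta> j) = c j * poly (P j) z / (\<Prod>j<m. z - \<zeta> j)" if "j < m" for j
    proof -
      have "(\<Prod>j<m. z - \<zeta> j) = (z - \<zeta> j) * poly (P j) z"
        unfolding polyP using that by (subst prod.remove[of _ j]) auto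
      then show ?thesis using nzp by auto
    qed
    then have "(\<Sum>j<m. c j / (z - \<zeta> j)) = (\<Sum>j<m. c j * poly (P j) z) / (\<Prod>j<m. z - \<zeta> j)"
      by (simp add: sum_divide_distrib)
    also have "(\<Sum>j<m. c j * poly (P j) z) = poly p z" by (subst \<open>p = L\<close>) (simp add: L_def poly_sum)
    finally show ?thesis by simp
  qed
  show "(\<Sum>j<m. c j) = 0" if "Suc (degree p) < m"
  proof -
    have "coeff p (m - 1) = 0" using that by (intro coeff_eq_0) auto
    then have "coeff L (m - 1) = 0" using \<open>p = L\<close> by simp
    then show ?thesis using lcP by (simp add: L_def coeff_sum)
  qed
qed

text \<open>\<open>\<gamma>\<close> bounds all gaps, the last one closing up at 2 pi. The final
  assumption makes the argument of g gain less than pi along an arc of length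
  \<open>\<gamma>\<close>; its sum is the bound of \<open>tau'_bounds\<close>.\<close>

locale kobayashi =
  fixes n :: nat and \<alpha> :: "nat \<Rightarrow> real" and b :: "nat \<Rightarrow> complex" and \<gamma> :: real
  assumes n2: "n \<ge> 2" and alpha0: "\<alpha> 0 = 0"
    and alpha_less: "\<And>j. Suc j < 2 * n \<Longrightarrow> \<alpha> j < \<alpha> (Suc j)" and alpha_last: "\<alpha> (2 * n - 1) < 2 * pi"
    and gap: "\<And>j. Suc j < 2 * n \<Longrightarrow> \<alpha> (Suc j) - \<alpha> j \<le> \<gamma>" and gap_last: "2 * pi - \<alpha> (2 * n - 1) \<le> \<gamma>"
    and b_less: "\<And>i. i \<in> {1..n-1} \<Longrightarrow> cmod (b i) < 1"
    and gamma: "(\<Sum>i\<in>{1..n-1}. (1 + cmod (b i)) / (1 - cmod (b i))) * \<gamma> < pi"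
begin

definition \<zeta> where "\<zeta> j = cis (\<alpha> j)"
definition B where "B z = (\<Prod>i\<in>{1..n-1}. z - b i)"
definition Bs where "Bs z = (\<Prod>i\<in>{1..n-1}. 1 - cnj (b i) * z)"
definition Q where "Q z = (\<Prod>j<2*n. cis (- \<alpha> j / 2) * z - cis (\<alpha> j / 2))"
text \<open>The coefficients of g^2 omega, omega and g omega, written without the removable
  singularities at the poles of g.\<close>

definition bb where "bb z = \<i> * (B z)\<^sup>2 / Q z"
definition aa where "aa z = \<i> * (Bs z)\<^sup>2 / Q z"
definition cc where "cc z = \<i> * (B z * Bs z) / Q z"
text \<open>The derivative of \<open>Q\<close> at \<open>\<zeta> j\<close>. Thus
  \<open>\<beta> j\<close> and \<open>\<kappa> j\<close> are the residues of \<open>bb\<close> and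
  \<open>cc\<close>, and \<open>\<mu> j\<close> is the real number that remains of
  \<open>\<i> / q' j\<close> after its phase is split off.\<close>

definition q' where "q' j = (\<Prod>k<2*n. cis (- \<alpha> k / 2)) * (\<Prod>k\<in>{..<2*n} - {j}. \<zeta> j - \<zeta> k)"
definition \<mu> where "\<mu> j = 1 / (2 * (-4) ^ (n - 1) * (\<Prod>k\<in>{..<2*n} - {j}. sin ((\<alpha> j - \<alpha> k) / 2)))"
definition \<beta> where "\<beta> j = \<i> * (B (\<zeta> j))\<^sup>2 / q' j"
definition \<kappa> where "\<kappa> j = \<mu> j * (cmod (B (\<zeta> j)))\<^sup>2"

lemma index_eq: "{0..2*n-1} = {..<2*n}" using n2 by auto

lemma alpha_strict: "i < j \<Longrightarrow> j < 2 * n \<Longrightarrow> \<alpha> i < \<alpha> j"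
proof (induction j)
  case (Suc j)
  then show ?case using alpha_less[of j] by (cases "i = j") auto
qed simp

lemma alpha_range: assumes "j < 2 * n" shows "0 \<le> \<alpha> j" "\<alpha> j < 2 * pi"
proof -
  show "0 \<le> \<alpha> j" using alpha_strict[of 0 j] assms alpha0 by (cases "j = 0") auto
  show "\<alpha> j < 2 * pi"
  proof (cases "j = 2*n-1")
    case False
    then have "j < 2*n-1" using assms by linarith
    from alpha_strict[OF this] show ?thesis using alpha_last n2 by auto
  qed (use alpha_last in simp)
qed

lemma sin_half_nz: assumes "j < 2*n" "k < 2*n" "j \<noteq> k" shows "sin ((\<alpha> j - \<alpha> k) / 2) \<noteq> 0"
proof -
  have "\<alpha> j \<noteq> \<alpha> k" using assms alpha_strict by (metis linorder_neq_iff order_less_irrefl)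
  then show ?thesis using alpha_range[OF assms(1)] alpha_range[OF assms(2)]
    sin_eq_0_pi[of "(\<alpha> j - \<alpha> k) / 2"] by auto
qed

lemma zeta_diff: "\<zeta> j - \<zeta> k = cis ((\<alpha> j + \<alpha> k) / 2) * (2 * \<i> * sin ((\<alpha> j - \<alpha> k) / 2))"
proof -
  have "\<zeta> j = cis ((\<alpha> j + \<alpha> k) / 2) * cis ((\<alpha> j - \<alpha> k) / 2)"
    "\<zeta> k = cis ((\<alpha> j + \<alpha> k) / 2) * cis (- ((\<alpha> j - \<alpha> k) / 2))"
    unfolding cis_mult \<zeta>_def by (rule arg_cong[of _ _ cis], simp add: field_simps)+
  moreover have "cis t - cis (- t) = 2 * \<i> * sin t" for t by (simp add: complex_eq_iff)
  ultimately show ?thesis by (metis right_diff_distrib)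
qed

lemma inj_zeta: "inj_on \<zeta> {..<2*n}"
proof (rule inj_onI)
  fix j k assume jk: "j \<in> {..<2*n}" "k \<in> {..<2*n}" "\<zeta> j = \<zeta> k"
  then have "\<zeta> j - \<zeta> k = 0" by simp
  then have "sin ((\<alpha> j - \<alpha> k) / 2) = 0" unfolding zeta_diff by (simp add: cis_neq_zero)
  then show "j = k" using sin_half_nz jk by auto
qed

lemma norm_zeta[simp]: "cmod (\<zeta> j) = 1" by (simp add: \<zeta>_def)
lemma zeta_nz[simp]: "\<zeta> j \<noteq> 0" by (simp add: \<zeta>_def cis_neq_zero)
lemma zeta_cnj: "\<zeta> j * cnj (\<zeta> j) = 1" by (simp add: complex_norm_square[symmetric])

lemma mu_nz: assumes "j < 2 * n" shows "\<mu> j \<noteq> 0"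
  using sin_half_nz[OF assms] by (auto simp: \<mu>_def)

text \<open>Each difference \<open>\<zeta> j - \<zeta> k\<close> is 2 i sin times a half-angle
  phase, and the half angles in \<open>Q\<close> cancel all of these except a power of
  \<open>\<zeta> j\<close>. There are 2n - 1 factors 2 i, an odd number, so the numerator i makes
  the remaining factor real.\<close>

lemma i_over_q': assumes j: "j < 2 * n" shows "\<i> / q' j = of_real (\<mu> j) / \<zeta> j ^ (n - 1)"
proof -
  define s where "s = (\<Prod>k\<in>{..<2*n} - {j}. sin ((\<alpha> j - \<alpha> k) / 2))"
  define N where "N = n - 1"
  have card: "card ({..<2*n} - {j}) = Suc (2 * N)" using j n2 by (simp add: N_def)
  have s: "s \<noteq> 0" using sin_half_nz[OF j] by (auto simp: s_def)
  have "q' j = cis (- \<alpha> j / 2) * (\<Prod>k\<in>{..<2*n} - {j}. cis (- \<alpha> k / 2) * (\<zeta> j - \<zeta> k))"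
    using j by (simp add: q'_def prod.remove[of _ j] prod.distrib)
  also have "(\<Prod>k\<in>{..<2*n} - {j}. cis (- \<alpha> k / 2) * (\<zeta> j - \<zeta> k))
      = (\<Prod>k\<in>{..<2*n} - {j}. (cis (\<alpha> j / 2) * (2 * \<i>)) * of_real (sin ((\<alpha> j - \<alpha> k) / 2)))"
  proof (rule prod.cong[OF refl])
    fix k
    have "cis (- \<alpha> k / 2) * cis ((\<alpha> j + \<alpha> k) / 2) = cis (\<alpha> j / 2)"
      unfolding cis_mult by (rule arg_cong[of _ _ cis]) (simp add: field_simps)
    then show "cis (- \<alpha> k / 2) * (\<zeta> j - \<zeta> k) = (cis (\<alpha> j / 2) * (2 * \<i>)) * of_real (sin ((\<alpha> j - \<alpha> k) / 2))"
      unfolding zeta_diff by (simp add: mult.assoc[symmetric])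
  qed
  also have "\<dots> = (cis (\<alpha> j / 2) * (2 * \<i>)) ^ Suc (2 * N) * of_real s"
  proof -
    have "(\<Prod>k\<in>A. c * of_real (f k)) = c ^ card A * of_real (\<Prod>k\<in>A. f k)"
      for c :: complex and f :: "nat \<Rightarrow> real" and A by (simp add: prod.distrib)
    then show ?thesis unfolding s_def card[symmetric] .
  qed
  also have "(cis (\<alpha> j / 2) * (2 * \<i>)) ^ Suc (2 * N) = cis (\<alpha> j / 2) * (2 * \<i>) * (\<zeta> j * (-4)) ^ N"
  proof -
    have sq: "(cis (\<alpha> j / 2) * (2 * \<i>))\<^sup>2 = \<zeta> j * (-4)"
      by (simp add: power_mult_distrib \<zeta>_def Complex.DeMoivre)
    have odd: "x ^ Suc (2 * N) = x * (x\<^sup>2) ^ N" for x :: complex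
      by (simp only: power_Suc power_mult)
    show ?thesis unfolding odd sq ..
  qed
  finally have "q' j = cis (- \<alpha> j / 2) * (cis (\<alpha> j / 2) * (2 * \<i>) * (\<zeta> j * (-4)) ^ N * of_real s)" .
  also have "\<dots> = (cis (- \<alpha> j / 2) * cis (\<alpha> j / 2)) * (2 * \<i> * \<zeta> j ^ N * (-4) ^ N * of_real s)"
    by (simp only: power_mult_distrib mult_ac)
  also have "cis (- \<alpha> j / 2) * cis (\<alpha> j / 2) = 1" by (simp add: cis_mult)
  finally have "q' j = 2 * \<i> * \<zeta> j ^ N * (-4) ^ N * of_real s" by simp
  moreover have mu: "\<mu> j = 1 / (2 * (-4) ^ N * s)" by (simp only: \<mu>_def s_def N_def)
  ultimately show ?thesis unfolding N_def[symmetric] mu using s by (simp add: field_simps)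
qed

text \<open>On the unit circle \<open>z * cnj z = 1\<close> turns each factor of \<open>Bs\<close>
  into a reflected factor of \<open>B\<close>.\<close>

lemma Bs_circle: assumes "cmod z = 1" shows "Bs z = z ^ (n - 1) * cnj (B z)"
proof -
  have zz: "z * cnj z = 1" using assms by (simp add: complex_norm_square[symmetric])
  have "1 - cnj c * z = z * cnj (z - c)" for c using zz by (simp add: algebra_simps)
  then show ?thesis by (simp add: Bs_def B_def prod.distrib)
qed

lemma beta_eq: assumes "j < 2 * n" shows "\<beta> j = of_real (\<mu> j) * (B (\<zeta> j))\<^sup>2 / \<zeta> j ^ (n - 1)"
proof -
  have "\<beta> j = (\<i> / q' j) * (B (\<zeta> j))\<^sup>2" by (simp add: \<beta>_def)
  then show ?thesis unfolding i_over_q'[OF assms] by simp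
qed

text \<open>With conjugate residues of \<open>aa\<close> and \<open>bb\<close>, and real ones of
  \<open>cc\<close>, the three forms have real residues; the real parts of their integrals therefore
  have no periods.\<close>

lemma cnj_beta_eq: assumes "j < 2 * n" shows "\<i> * (Bs (\<zeta> j))\<^sup>2 / q' j = cnj (\<beta> j)"
proof -
  have "\<i> * (Bs (\<zeta> j))\<^sup>2 / q' j = (\<i> / q' j) * (Bs (\<zeta> j))\<^sup>2" by simp
  also have "\<dots> = of_real (\<mu> j) * \<zeta> j ^ (n - 1) * (cnj (B (\<zeta> j)))\<^sup>2"
    unfolding i_over_q'[OF assms] by (simp add: Bs_circle power2_eq_square)
  also have "\<zeta> j ^ (n - 1) = 1 / cnj (\<zeta> j) ^ (n - 1)"
    using zeta_cnj[of j] by (simp add: field_simps flip: power_mult_distrib)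
  finally show ?thesis by (simp add: beta_eq[OF assms])
qed

lemma kappa_eq: assumes "j < 2 * n" shows "\<i> * (B (\<zeta> j) * Bs (\<zeta> j)) / q' j = of_real (\<kappa> j)"
proof -
  have "\<i> * (B (\<zeta> j) * Bs (\<zeta> j)) / q' j = (\<i> / q' j) * (B (\<zeta> j) * Bs (\<zeta> j))" by simp
  also have "\<dots> = of_real (\<mu> j) * (B (\<zeta> j) * cnj (B (\<zeta> j)))"
    unfolding i_over_q'[OF assms] by (simp add: Bs_circle)
  finally show ?thesis by (simp only: \<kappa>_def of_real_mult complex_norm_square)
qed

definition Bp where "Bp = (\<Prod>i\<in>{1..n-1}. [:- b i, 1:])"
definition Bsp where "Bsp = (\<Prod>i\<in>{1..n-1}. [:1, - cnj (b i):])"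

lemma degree_linear_le: "degree [:c, d:] \<le> 1"
  by (cases "d = 0") auto

lemma Bp: "poly Bp z = B z" "degree Bp \<le> n - 1" and Bsp: "poly Bsp z = Bs z" "degree Bsp \<le> n - 1"
proof -
  show "poly Bp z = B z" "poly Bsp z = Bs z"
    by (simp_all add: Bp_def Bsp_def B_def Bs_def poly_prod mult.commute)
  have "degree Bp \<le> (\<Sum>i\<in>{1..n-1}. 1)" unfolding Bp_def
    by (rule order_trans[OF degree_prod_sum_le]) (simp, rule sum_mono, unfold o_def, rule degree_linear_le)
  then show "degree Bp \<le> n - 1" by simp
  have "degree Bsp \<le> (\<Sum>i\<in>{1..n-1}. 1)" unfolding Bsp_def
    by (rule order_trans[OF degree_prod_sum_le]) (simp, rule sum_mono, unfold o_def, rule degree_linear_le)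
  then show "degree Bsp \<le> n - 1" by simp
qed

lemma Q_eq: "Q z = (\<Prod>j<2*n. cis (- \<alpha> j / 2)) * (\<Prod>j<2*n. z - \<zeta> j)"
proof -
  have "cis (- \<alpha> j / 2) * z - cis (\<alpha> j / 2) = cis (- \<alpha> j / 2) * (z - \<zeta> j)" for j
  proof -
    have "cis (- \<alpha> j / 2) * \<zeta> j = cis (\<alpha> j / 2)" by (simp add: \<zeta>_def cis_mult)
    then show ?thesis by (simp add: algebra_simps)
  qed
  then show ?thesis by (simp add: Q_def prod.distrib)
qed

lemma partial_fraction_Q:
  assumes deg: "degree p \<le> 2 * (n - 1)"
  shows "z \<notin> \<zeta> ` {..<2*n} \<Longrightarrow> poly p z / Q z = (\<Sum>j<2*n. (poly p (\<zeta> j) / q' j) / (z - \<zeta> j))"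
    and "(\<Sum>j<2*n. poly p (\<zeta> j) / q' j) = 0"
proof -
  let ?c = "\<Prod>j<2*n. cis (- \<alpha> j / 2)"
  have d: "degree p < 2 * n" "Suc (degree p) < 2 * n" using deg n2 by auto
  show "poly p z / Q z = (\<Sum>j<2*n. (poly p (\<zeta> j) / q' j) / (z - \<zeta> j))" if "z \<notin> \<zeta> ` {..<2*n}"
  proof -
    have "poly p z / Q z = poly p z / (\<Prod>j<2*n. z - \<zeta> j) / ?c" by (simp add: Q_eq)
    then show ?thesis unfolding partial_fraction_simple_poles(1)[OF inj_zeta d(1) that] q'_def
      by (simp add: sum_divide_distrib field_simps)
  qed
  have "(\<Sum>j<2*n. poly p (\<zeta> j) / q' j) = (\<Sum>j<2*n. poly p (\<zeta> j) / (\<Prod>k\<in>{..<2*n} - {j}. \<zeta> j - \<zeta> k)) / ?c"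
    by (simp add: q'_def sum_divide_distrib field_simps)
  then show "(\<Sum>j<2*n. poly p (\<zeta> j) / q' j) = 0"
    unfolding partial_fraction_simple_poles(2)[OF inj_zeta d] by simp
qed

text \<open>The numerators have degree at most 2n - 2 and \<open>Q\<close> has degree 2n, so there
  is no residue at infinity and the finite ones sum to zero.\<close>

lemma residue_expansions:
  shows bb_eq: "z \<notin> \<zeta> ` {..<2*n} \<Longrightarrow> bb z = (\<Sum>j<2*n. \<beta> j / (z - \<zeta> j))"
    and aa_eq: "z \<notin> \<zeta> ` {..<2*n} \<Longrightarrow> aa z = (\<Sum>j<2*n. cnj (\<beta> j) / (z - \<zeta> j))"
    and cc_eq: "z \<notin> \<zeta> ` {..<2*n} \<Longrightarrow> cc z = (\<Sum>j<2*n. of_real (\<kappa> j) / (z - \<zeta> j))"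
    and sum_beta: "(\<Sum>j<2*n. \<beta> j) = 0"
    and sum_kappa: "(\<Sum>j<2*n. \<kappa> j) = 0"
proof -
  have d: "degree (smult \<i> (Bp * Bp)) \<le> 2 * (n - 1)" "degree (smult \<i> (Bsp * Bsp)) \<le> 2 * (n - 1)"
    "degree (smult \<i> (Bp * Bsp)) \<le> 2 * (n - 1)"
    using Bp(2) Bsp(2) degree_mult_le[of Bp Bp] degree_mult_le[of Bsp Bsp] degree_mult_le[of Bp Bsp]
    by (auto intro!: order_trans[OF degree_smult_le])
  show "bb z = (\<Sum>j<2*n. \<beta> j / (z - \<zeta> j))" if "z \<notin> \<zeta> ` {..<2*n}"
    using partial_fraction_Q(1)[OF d(1) that] by (simp add: Bp \<beta>_def bb_def power2_eq_square)
  show "aa z = (\<Sum>j<2*n. cnj (\<beta> j) / (z - \<zeta> j))" if "z \<notin> \<zeta> ` {..<2*n}"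
    using partial_fraction_Q(1)[OF d(2) that] by (simp add: Bsp cnj_beta_eq[symmetric] aa_def power2_eq_square)
  show "cc z = (\<Sum>j<2*n. of_real (\<kappa> j) / (z - \<zeta> j))" if "z \<notin> \<zeta> ` {..<2*n}"
    using partial_fraction_Q(1)[OF d(3) that] by (simp add: Bp Bsp kappa_eq[symmetric] cc_def)
  show "(\<Sum>j<2*n. \<beta> j) = 0"
    using partial_fraction_Q(2)[OF d(1)] by (simp add: Bp \<beta>_def power2_eq_square)
  have "of_real (\<Sum>j<2*n. \<kappa> j) = (0::complex)"
    using partial_fraction_Q(2)[OF d(3)] by (simp add: Bp Bsp kappa_eq[symmetric])
  then show "(\<Sum>j<2*n. \<kappa> j) = 0" by (simp only: of_real_eq_0_iff)
qed

lemma cc_square: "(cc z)\<^sup>2 = aa z * bb z"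
  by (simp add: cc_def aa_def bb_def power2_eq_square)

lemma Bs_nz: assumes "cmod z \<le> 1" shows "Bs z \<noteq> 0"
proof -
  have "1 - cnj (b i) * z \<noteq> 0" if "i \<in> {1..n-1}" for i
  proof
    assume "1 - cnj (b i) * z = 0"
    then have "cmod (b i) * cmod z = 1" by (metis complex_mod_cnj eq_iff_diff_eq_0 norm_mult norm_one)
    then show False using b_less[OF that] assms mult_left_le[of "cmod z" "cmod (b i)"] by auto
  qed
  then show ?thesis by (auto simp: Bs_def)
qed

lemma B_circle_nz: assumes "cmod z = 1" shows "B z \<noteq> 0"
  using b_less assms by (force simp: B_def)

lemma beta_nz: "j < 2 * n \<Longrightarrow> \<beta> j \<noteq> 0"
  using mu_nz B_circle_nz[of "\<zeta> j"] by (simp add: beta_eq)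

lemma Q_nz: "z \<notin> \<zeta> ` {..<2*n} \<Longrightarrow> Q z \<noteq> 0"
  by (auto simp: Q_eq cis_neq_zero)

text \<open>This is |g| < 1 in the disc, cleared of denominators. For each factor the difference of
  the squares is \<open>(1 - (cmod z)\<^sup>2) * (1 - (cmod (b i))\<^sup>2)\<close>.\<close>

lemma B_less_Bs: assumes "cmod z < 1" shows "cmod (B z) < cmod (Bs z)"
proof -
  have *: "cmod (z - b i) < cmod (1 - cnj (b i) * z)" if "i \<in> {1..n-1}" for i
  proof -
    have "(1 - (cmod z)\<^sup>2) * (1 - (cmod (b i))\<^sup>2) > 0"
      using assms b_less[OF that] by (auto intro!: mult_pos_pos simp: power_less_one_iff abs_square_less_1)
    moreover have "(cmod (1 - cnj (b i) * z))\<^sup>2 - (cmod (z - b i))\<^sup>2 = (1 - (cmod z)\<^sup>2) * (1 - (cmod (b i))\<^sup>2)"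
      unfolding cmod_power2 by (simp add: power2_eq_square algebra_simps)
    ultimately show ?thesis by (smt (verit) power2_less_imp_less norm_ge_zero)
  qed
  show ?thesis unfolding B_def Bs_def prod_norm[symmetric]
  proof (rule prod_mono_strict[of 1])
    show "0 \<le> cmod (z - b i) \<and> cmod (z - b i) \<le> cmod (1 - cnj (b i) * z)" if "i \<in> {1..n-1}" for i
      using *[OF that] by simp
    show "0 < cmod (1 - cnj (b i) * z)" if "i \<in> {1..n-1}" for i
      using *[OF that] by (rule le_less_trans[OF norm_ge_zero])
    show "cmod (z - b 1) < cmod (1 - cnj (b 1) * z)" using n2 by (intro *) auto
  qed (use n2 in auto)
qed

end

section \<open>The argument of g along the unit circle\<close>

context kobayashi begin

lemma gamma_pos: "\<gamma> > 0" using gap[of 0] alpha_less[of 0] n2 by auto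

lemma sum_ge: "(\<Sum>i\<in>{1..n-1}. (1 + cmod (b i)) / (1 - cmod (b i))) \<ge> 1"
proof -
  have "(\<Sum>i\<in>{1..n-1}. 1) \<le> (\<Sum>i\<in>{1..n-1}. (1 + cmod (b i)) / (1 - cmod (b i)))"
    using b_less by (intro sum_mono) (auto simp: field_simps)
  then show ?thesis using n2 by auto
qed

text \<open>Lets neighbouring tangents meet: a gap of pi or more would leave the polygon
  unbounded.\<close>

lemma gamma_pi: "\<gamma> < pi"
  using mult_right_mono[OF sum_ge, of \<gamma>] gamma_pos gamma by linarith

text \<open>A continuous argument of \<open>g = B / Bs\<close> along the unit circle, read off from
  \<open>(z - b) / (1 - cnj b z) = z v / cnj v\<close> with \<open>v = 1 - b / z\<close>.\<close>

definition \<tau> where "\<tau> x = (\<Sum>i\<in>{1..n-1}. x + 2 * Im (Ln (1 - b i * cis (- x))))"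

lemma Re_pos_circle: assumes "cmod y < 1" shows "Re (1 - y) > 0"
  using assms abs_Re_le_cmod[of y] by simp

lemma cis_tau: "B (cis x) = cis (\<tau> x) * Bs (cis x)"
proof -
  have *: "cis x - b i = cis (x + 2 * Im (Ln (1 - b i * cis (- x)))) * (1 - cnj (b i) * cis x)"
    if i: "i \<in> {1..n-1}" for i
  proof -
    define v where "v = 1 - b i * cis (- x)"
    have "cmod (b i * cis (- x)) < 1" using b_less[OF i] by (simp add: norm_mult)
    then have "Re v > 0" unfolding v_def by (rule Re_pos_circle)
    then have "v \<noteq> 0" by auto
    then have v: "v = of_real (cmod v) * cis (Im (Ln v))"
      using exp_Ln[of v] by (simp add: exp_eq_polar[of "Ln v"])
    then have "cnj v = of_real (cmod v) * cis (- Im (Ln v))"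
      by (metis complex_cnj_complex_of_real complex_cnj_mult cis_cnj)
    then have "cis (2 * Im (Ln v)) * cnj v = of_real (cmod v) * (cis (2 * Im (Ln v)) * cis (- Im (Ln v)))" by simp
    also have "cis (2 * Im (Ln v)) * cis (- Im (Ln v)) = cis (Im (Ln v))" by (simp add: cis_mult)
    finally have 1: "cis (2 * Im (Ln v)) * cnj v = v" using v by simp
    have cv: "cnj v = 1 - cnj (b i) * cis x" by (simp add: v_def cis_cnj)
    have "cis x * v = cis x - b i" by (simp add: v_def algebra_simps cis_mult)
    then show ?thesis unfolding v_def[symmetric] cv[symmetric] using 1 by (simp add: mult.assoc flip: cis_mult)
  qed
  have cp: "cis (\<Sum>i\<in>A. f i) = (\<Prod>i\<in>A. cis (f i))" for A :: "nat set" and f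
    by (induction A rule: infinite_finite_induct) (auto simp: cis_mult[symmetric])
  show ?thesis unfolding B_def Bs_def \<tau>_def cp prod.distrib[symmetric] by (rule prod.cong[OF refl *])
qed

text \<open>A sum of Poisson kernels of the disc at the points \<open>b i\<close>.\<close>

definition \<tau>' where "\<tau>' x = (\<Sum>i\<in>{1..n-1}. (1 - (cmod (b i))\<^sup>2) / (cmod (1 - b i * cis (- x)))\<^sup>2)"

lemma tau_deriv: "(\<tau> has_real_derivative \<tau>' x) (at x)"
  unfolding \<tau>_def[abs_def] \<tau>'_def
proof (rule DERIV_sum)
  fix i assume i: "i \<in> {1..n-1}"
  define y where "y = b i * cis (- x)"
  have y: "cmod y < 1" using b_less[OF i] by (simp add: y_def norm_mult)
  have nn: "1 - y \<notin> \<real>\<^sub>\<le>\<^sub>0" "1 - y \<noteq> 0"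
    using Re_pos_circle[OF y] by (auto simp: complex_nonpos_Reals_iff)
  have "((\<lambda>x. 1 - b i * cis (- x)) has_vector_derivative \<i> * y) (at x)"
    unfolding has_vector_derivative_def y_def
    by (auto intro!: derivative_eq_intros has_derivative_cis simp: scaleR_conv_of_real algebra_simps)
  moreover have "(Ln has_field_derivative inverse (1 - y)) (at (1 - b i * cis (- x)))"
    using has_field_derivative_Ln[OF nn(1)] by (simp add: y_def)
  ultimately have "((\<lambda>x. Ln (1 - b i * cis (- x))) has_vector_derivative (\<i> * y * inverse (1 - y))) (at x)"
    using field_vector_diff_chain_at[of "\<lambda>x. 1 - b i * cis (- x)" "\<i> * y" x Ln] by (simp add: o_def)
  then have "((\<lambda>x. Im (Ln (1 - b i * cis (- x)))) has_vector_derivative Im (\<i> * y * inverse (1 - y))) (at x)"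
    by (rule bounded_linear.has_vector_derivative[OF bounded_linear_Im])
  then have "((\<lambda>x. Im (Ln (1 - b i * cis (- x)))) has_real_derivative Im (\<i> * y * inverse (1 - y))) (at x)"
    by (simp add: has_real_derivative_iff_has_vector_derivative)
  then have "((\<lambda>x. x + 2 * Im (Ln (1 - b i * cis (- x)))) has_real_derivative 1 + 2 * Im (\<i> * y * inverse (1 - y))) (at x)"
    by (rule DERIV_add[OF DERIV_ident DERIV_cmult])
  moreover have "1 + 2 * Im (\<i> * y * inverse (1 - y)) = (1 - (cmod (b i))\<^sup>2) / (cmod (1 - y))\<^sup>2"
  proof -
    have "inverse v = cnj v / of_real ((cmod v)\<^sup>2)" if "v \<noteq> 0" for v
      using that by (subst complex_norm_square) (simp add: field_simps)
    from this[OF nn(2)] have "\<i> * y * inverse (1 - y) = \<i> * y * cnj (1 - y) / of_real ((cmod (1 - y))\<^sup>2)"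
      by (simp only: times_divide_eq_right)
    then have "Im (\<i> * y * inverse (1 - y)) = Im (\<i> * y * cnj (1 - y)) / (cmod (1 - y))\<^sup>2"
      by (simp only: Im_divide_of_real)
    moreover have "(cmod (1 - y))\<^sup>2 \<noteq> 0" using nn by simp
    moreover have "(cmod (1 - y))\<^sup>2 + 2 * Im (\<i> * y * cnj (1 - y)) = 1 - (cmod y)\<^sup>2"
      unfolding cmod_power2 by (simp add: power2_eq_square algebra_simps)
    moreover have "cmod y = cmod (b i)" by (simp add: y_def norm_mult)
    ultimately show ?thesis by (simp add: field_simps)
  qed
  ultimately show "((\<lambda>x. x + 2 * Im (Ln (1 - b i * cis (- x)))) has_real_derivative
        (1 - (cmod (b i))\<^sup>2) / (cmod (1 - b i * cis (- x)))\<^sup>2) (at x)" by (simp add: y_def)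
qed

text \<open>Each Poisson kernel is positive and bounded by its Harnack constant. The sum in the last
  assumption of the locale comes from this bound.\<close>

lemma tau'_bounds: "0 < \<tau>' x" "\<tau>' x \<le> (\<Sum>i\<in>{1..n-1}. (1 + cmod (b i)) / (1 - cmod (b i)))"
proof -
  have *: "0 < (1 - (cmod (b i))\<^sup>2) / (cmod (1 - b i * cis (- x)))\<^sup>2 \<and>
    (1 - (cmod (b i))\<^sup>2) / (cmod (1 - b i * cis (- x)))\<^sup>2 \<le> (1 + cmod (b i)) / (1 - cmod (b i))"
    if i: "i \<in> {1..n-1}" for i
  proof -
    define r where "r = cmod (b i)"
    have r: "0 \<le> r" "r < 1" using b_less[OF i] by (auto simp: r_def)
    have "cmod (b i * cis (- x)) = r" by (simp add: norm_mult r_def)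
    then have ge: "cmod (1 - b i * cis (- x)) \<ge> 1 - r" using norm_triangle_ineq2[of 1 "b i * cis (- x)"] by simp
    have p: "1 - r\<^sup>2 > 0" using r by (simp add: abs_square_less_1)
    have "(1 - r\<^sup>2) / (cmod (1 - b i * cis (- x)))\<^sup>2 \<le> (1 - r\<^sup>2) / (1 - r)\<^sup>2"
      using ge r p by (intro divide_left_mono power_mono mult_pos_pos zero_less_power) auto
    also have "\<dots> = (1 + r) / (1 - r)"
    proof -
      have "1 - r\<^sup>2 = (1 + r) * (1 - r)" by (simp add: power2_eq_square algebra_simps)
      then show ?thesis using r by (simp add: power2_eq_square)
    qed
    finally show ?thesis unfolding r_def[symmetric] using p ge r by (auto intro!: divide_pos_pos)
  qed
  show "0 < \<tau>' x" unfolding \<tau>'_def using * n2 by (intro sum_pos) auto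
  show "\<tau>' x \<le> (\<Sum>i\<in>{1..n-1}. (1 + cmod (b i)) / (1 - cmod (b i)))"
    unfolding \<tau>'_def using * by (intro sum_mono) auto
qed

lemma tau_diff: assumes "x < y" "y - x \<le> \<gamma>" shows "0 < \<tau> y - \<tau> x" "\<tau> y - \<tau> x < pi"
proof -
  obtain z where z: "\<tau> y - \<tau> x = (y - x) * \<tau>' z" using MVT2[OF assms(1), of \<tau> \<tau>'] tau_deriv by blast
  show "0 < \<tau> y - \<tau> x" unfolding z using assms tau'_bounds(1) by simp
  have "(y - x) * \<tau>' z \<le> \<gamma> * (\<Sum>i\<in>{1..n-1}. (1 + cmod (b i)) / (1 - cmod (b i)))"
    using assms tau'_bounds[of z] by (intro mult_mono) auto
  then show "\<tau> y - \<tau> x < pi" unfolding z using gamma by (simp add: mult.commute)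
qed

lemma sin_tau: assumes "x < y" "y - x \<le> \<gamma>" shows "sin (\<tau> y - \<tau> x) > 0"
  using tau_diff[OF assms] by (rule sin_gt_zero)

text \<open>The values of g at the ends of a short arc are independent over the reals, as their
  arguments differ by a number strictly between 0 and pi. Squares appear because the Jacobian
  contains g only through g^2.\<close>

lemma B_Bs_independent:
  assumes "x < y" "y - x \<le> \<gamma>"
  shows "(B (cis x) * Bs (cis y))\<^sup>2 \<noteq> (B (cis y) * Bs (cis x))\<^sup>2"
proof
  assume a: "(B (cis x) * Bs (cis y))\<^sup>2 = (B (cis y) * Bs (cis x))\<^sup>2"
  have nz: "Bs (cis x) \<noteq> 0" "Bs (cis y) \<noteq> 0" using Bs_nz by auto
  have "(cis (\<tau> x))\<^sup>2 * (Bs (cis x) * Bs (cis y))\<^sup>2 = (cis (\<tau> y))\<^sup>2 * (Bs (cis x) * Bs (cis y))\<^sup>2"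
    using a by (simp add: cis_tau power_mult_distrib mult_ac)
  then have "(cis (\<tau> x))\<^sup>2 = (cis (\<tau> y))\<^sup>2" using nz by simp
  then have e: "cis (2 * \<tau> x) = cis (2 * \<tau> y)" by (simp add: Complex.DeMoivre)
  have "cis (2 * (\<tau> y - \<tau> x)) = cis (2 * \<tau> y) / cis (2 * \<tau> x)"
    by (simp add: cis_divide right_diff_distrib)
  also have "\<dots> = 1" by (simp add: e cis_neq_zero)
  finally have "cos (2 * (\<tau> y - \<tau> x)) = 1" by (simp only: complex_eq_iff cis.simps one_complex.simps)
  then have "1 - 2 * (sin (\<tau> y - \<tau> x))\<^sup>2 = 1" by (simp only: cos_double_sin)
  then show False using sin_tau[OF assms] by simp
qed

text \<open>The interval from \<open>l\<close> to \<open>h\<close> is the gap arc that contains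
  \<open>\<theta>\<close>. Its ends are compared with the \<open>\<alpha> j\<close> by cosines only,
  because on the last arc \<open>h\<close> is 2 pi and stands for
  \<open>\<alpha> 0 = 0\<close>.\<close>

lemma arc_containing:
  assumes "0 \<le> \<theta>" "\<theta> < 2 * pi"
  obtains j k l h where "j < 2 * n" "k < 2 * n" "l \<le> \<theta>" "\<theta> \<le> h" "h - l \<le> \<gamma>"
    "cos (\<theta> - \<alpha> j) = cos (\<theta> - l)" "cos (\<theta> - \<alpha> k) = cos (h - \<theta>)"
proof -
  define S where "S = {j. j < 2 * n \<and> \<alpha> j \<le> \<theta>}"
  have fin: "finite S" by (simp add: S_def)
  have "0 \<in> S" using n2 alpha0 assms by (simp add: S_def)
  define j where "j = Max S"
  have jS: "j \<in> S" using Max_in[OF fin] \<open>0 \<in> S\<close> by (auto simp: j_def)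
  show thesis
  proof (cases "Suc j < 2 * n")
    case True
    have "Suc j \<notin> S" using Max_ge[OF fin, of "Suc j"] by (auto simp: j_def)
    then have "\<theta> < \<alpha> (Suc j)" using True by (simp add: S_def)
    then show ?thesis using jS True gap[OF True] cos_minus[of "\<theta> - \<alpha> (Suc j)"]
      by (intro that[of j "Suc j" "\<alpha> j" "\<alpha> (Suc j)"]) (auto simp: S_def)
  next
    case False
    moreover have "j < 2 * n" using jS by (simp add: S_def)
    ultimately have j: "j = 2 * n - 1" by linarith
    show ?thesis using jS j gap_last assms n2 cos_minus[of \<theta>] alpha0
      by (intro that[of j 0 "\<alpha> j" "2 * pi"]) (auto simp: S_def cos_diff)
  qed
qed

lemma near_alpha: obtains j where "j < 2 * n" "cos (\<theta> - \<alpha> j) \<ge> cos (\<gamma> / 2)"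
proof -
  define t where "t = Arg2pi (cis \<theta>)"
  have t: "0 \<le> t" "t < 2 * pi" using Arg2pi[of "cis \<theta>"] by (auto simp: t_def)
  have "cis \<theta> = of_real (cmod (cis \<theta>)) * exp (\<i> * of_real t)" unfolding t_def by (rule Arg2pi_eq)
  then have ct: "cis t = cis \<theta>" by (simp only: norm_cis of_real_1 mult_1 cis_conv_exp[of t])
  have cs: "cos (t - a) = cos (\<theta> - a)" for a
    using ct by (simp add: cos_diff complex_eq_iff)
  obtain j k l h where *: "j < 2 * n" "k < 2 * n" "l \<le> t" "t \<le> h" "h - l \<le> \<gamma>"
    "cos (t - \<alpha> j) = cos (t - l)" "cos (t - \<alpha> k) = cos (h - t)"
    by (rule arc_containing[OF t(1,2)])
  show thesis
  proof (cases "t - l \<le> \<gamma> / 2")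
    case True
    then have "cos (\<gamma> / 2) \<le> cos (t - l)"
      using * gamma_pi gamma_pos by (intro cos_monotone_0_pi_le) auto
    then show ?thesis using *(1,6) cs[of "\<alpha> j"] by (intro that[of j]) auto
  next
    case False
    then have "cos (\<gamma> / 2) \<le> cos (h - t)"
      using * gamma_pi gamma_pos by (intro cos_monotone_0_pi_le) auto
    then show ?thesis using *(2,7) cs[of "\<alpha> k"] by (intro that[of k]) auto
  qed
qed

lemma cos_gamma_pos: "cos (\<gamma> / 2) > 0"
  using gamma_pi gamma_pos by (intro cos_gt_zero_pi) auto

text \<open>Outside the unit circle, a point of the closed polygon is the intersection of the tangents
  at \<open>cis (\<theta> - s)\<close> and \<open>cis (\<theta> + s)\<close>, and these two points lie on a single arc.\<close>

lemma tangent_points: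
  assumes w: "cmod w > 1" and le: "\<And>j. j < 2 * n \<Longrightarrow> Re (w * cnj (\<zeta> j)) \<le> 1"
  obtains \<theta> s where "0 < s" "s < pi / 2" "2 * s \<le> \<gamma>" "w = of_real (1 / cos s) * cis \<theta>"
proof -
  define s where "s = arccos (1 / cmod w)"
  define \<theta> where "\<theta> = Arg2pi w"
  have wpos: "0 < cmod w" using w by linarith
  have b: "0 < 1 / cmod w" "1 / cmod w < 1" using w wpos by (simp_all add: field_simps)
  have s: "cos s = 1 / cmod w" "0 < s" "s < pi / 2"
  proof -
    have m: "-1 < 1 / cmod w" using b by linarith
    show "cos s = 1 / cmod w" unfolding s_def using m b by (intro cos_arccos; linarith)
    show "0 < s" using arccos_lt_bounded[OF m b(2)] by (simp add: s_def)
    show "s < pi / 2" using arccos_less_arccos[of 0 "1 / cmod w"] b by (simp add: s_def)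
  qed
  have w': "w = of_real (cmod w) * cis \<theta>" using Arg2pi_eq[of w] by (simp add: \<theta>_def cis_conv_exp)
  have th: "0 \<le> \<theta>" "\<theta> < 2 * pi" using Arg2pi[of w] by (auto simp: \<theta>_def)
  have c: "cos (\<theta> - \<alpha> j) \<le> cos s" if "j < 2 * n" for j
  proof -
    have "Re (w * cnj (\<zeta> j)) = cmod w * cos (\<theta> - \<alpha> j)"
      by (subst w') (simp add: \<zeta>_def cis_cnj cis_mult mult.assoc del: of_real_mult)
    then have "cmod w * cos (\<theta> - \<alpha> j) \<le> 1" using le[OF that] by simp
    then show ?thesis using wpos by (simp add: s(1) pos_le_divide_eq mult.commute)
  qed
  obtain j k l h where *: "j < 2 * n" "k < 2 * n" "l \<le> \<theta>" "\<theta> \<le> h" "h - l \<le> \<gamma>"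
    "cos (\<theta> - \<alpha> j) = cos (\<theta> - l)" "cos (\<theta> - \<alpha> k) = cos (h - \<theta>)"
    by (rule arc_containing[OF th])
  have mono: "s \<le> x" if "0 \<le> x" "cos x \<le> cos s" for x
    using cos_monotone_0_pi[of x s] that s by (cases "x < s") auto
  \<comment> \<open>Neither end of the gap arc lies strictly between the two points of tangency, so
    these fit into a single gap.\<close>
  have "s \<le> \<theta> - l" "s \<le> h - \<theta>"
    using c[OF *(1)] c[OF *(2)] * by (auto intro!: mono)
  then show thesis using * s w' by (intro that[of s \<theta>]) auto
qed

end

section \<open>The Klein model\<close>

lemma has_derivative_ln_cmod:
  assumes "z \<noteq> c"
  shows "((\<lambda>z. ln (cmod (z - c))) has_derivative (\<lambda>h. Re (h / (z - c)))) (at z)"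
proof -
  have nz: "z - c \<noteq> 0" "cmod (z - c) > 0" using assms by auto
  have eq: "Re (h / x) = (h \<bullet> sgn x) / cmod x" if "x \<noteq> 0" for h x :: complex
  proof -
    have "h / x = h * cnj x / of_real ((cmod x)\<^sup>2)"
      using that by (subst complex_norm_square) simp
    then have "Re (h / x) = Re (h * cnj x) / (cmod x)\<^sup>2" by (simp only: Re_divide_of_real)
    moreover have "h \<bullet> sgn x = Re (h * cnj x) / cmod x"
      by (simp add: sgn_div_norm inner_complex_def divide_inverse algebra_simps)
    ultimately show ?thesis by (simp add: power2_eq_square)
  qed
  have "((\<lambda>z. cmod (z - c)) has_derivative (\<lambda>h. h \<bullet> sgn (z - c))) (at z)"
  proof -
    have "((\<lambda>z. z - c) has_derivative (\<lambda>h. h)) (at z)" by (auto intro!: derivative_eq_intros)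
    from has_derivative_compose[of "\<lambda>z. z - c" "\<lambda>h. h" z UNIV cmod "\<lambda>h. h \<bullet> sgn (z - c)", OF this has_derivative_norm[OF nz(1)]]
    show ?thesis .
  qed
  from has_derivative_ln[OF nz(2) this]
  have "((\<lambda>z. ln (cmod (z - c))) has_derivative (\<lambda>h. (h \<bullet> sgn (z - c)) * (1 / cmod (z - c)))) (at z)"
    by (simp add: inverse_eq_divide)
  then show ?thesis using eq[OF nz(1)] by simp
qed

text \<open>The passage from the Poincare model to the Klein model of the disc.\<close>

definition klein :: "complex \<Rightarrow> complex" where "klein z = (2 / (1 + (cmod z)\<^sup>2)) *\<^sub>R z"
definition klein_inv :: "complex \<Rightarrow> complex" where "klein_inv w = (1 / (1 + sqrt (1 - (cmod w)\<^sup>2))) *\<^sub>R w"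

lemma norm_klein: "cmod (klein z) = 2 * cmod z / (1 + (cmod z)\<^sup>2)"
proof -
  have "1 + (cmod z)\<^sup>2 > 0" by (simp add: add_pos_nonneg)
  then show ?thesis by (simp add: klein_def)
qed

lemma klein_less: assumes "cmod z < 1" shows "cmod (klein z) < 1"
proof -
  have "0 < (1 - cmod z)\<^sup>2" using assms by simp
  then have "2 * cmod z < 1 + (cmod z)\<^sup>2" by (simp add: power2_eq_square algebra_simps)
  moreover have "1 + (cmod z)\<^sup>2 > 0" by (simp add: add_pos_nonneg)
  ultimately show ?thesis unfolding norm_klein by (simp add: divide_less_eq)
qed

lemma klein_inv_klein: assumes "cmod z \<le> 1" shows "klein_inv (klein z) = z"
proof -
  define R where "R = (cmod z)\<^sup>2"
  have R: "0 \<le> R" "R \<le> 1" using assms by (auto simp: R_def abs_square_le_1)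
  have c: "(cmod (klein z))\<^sup>2 = 4 * R / (1 + R)\<^sup>2"
    unfolding norm_klein R_def[symmetric] by (simp add: power_divide power_mult_distrib R_def)
  have "1 - (cmod (klein z))\<^sup>2 = ((1 - R) / (1 + R))\<^sup>2"
  proof -
    have "1 - 4 * R / (1 + R)\<^sup>2 = ((1 + R)\<^sup>2 - 4 * R) / (1 + R)\<^sup>2" using R by (simp add: diff_divide_distrib)
    also have "(1 + R)\<^sup>2 - 4 * R = (1 - R)\<^sup>2" by (simp add: power2_eq_square algebra_simps)
    finally show ?thesis unfolding c by (simp add: power_divide)
  qed
  then have "sqrt (1 - (cmod (klein z))\<^sup>2) = (1 - R) / (1 + R)" using R by simp
  then have eq: "1 + sqrt (1 - (cmod (klein z))\<^sup>2) = 2 / (1 + R)" using R by (simp add: field_simps)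
  have "1 / (2 / (1 + R)) * (2 / (1 + R)) = 1" using R by simp
  then show ?thesis unfolding klein_inv_def eq by (simp only: klein_def R_def[symmetric] scaleR_scaleR scaleR_one)
qed

lemma klein_klein_inv: assumes "cmod w \<le> 1" shows "klein (klein_inv w) = w" "cmod (klein_inv w) \<le> 1"
    "cmod w < 1 \<Longrightarrow> cmod (klein_inv w) < 1"
proof -
  define s where "s = sqrt (1 - (cmod w)\<^sup>2)"
  have s: "s \<ge> 0" "s\<^sup>2 = 1 - (cmod w)\<^sup>2" using assms by (auto simp: s_def abs_square_le_1)
  have n: "cmod (klein_inv w) = cmod w / (1 + s)" using s by (simp add: klein_inv_def s_def[symmetric])
  then show "cmod (klein_inv w) \<le> 1" using assms s(1) by (simp add: divide_le_eq)
  show "cmod (klein_inv w) < 1" if "cmod w < 1" using that s(1) n by (simp add: divide_less_eq)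
  have "1 + (cmod (klein_inv w))\<^sup>2 = (1 + 2 * s + s\<^sup>2 + (cmod w)\<^sup>2) / (1 + s)\<^sup>2"
    unfolding n using s(1) by (simp add: power_divide field_simps) (simp add: power2_eq_square algebra_simps)
  also have "1 + 2 * s + s\<^sup>2 + (cmod w)\<^sup>2 = 2 * (1 + s)" using s by simp
  also have "2 * u / u\<^sup>2 = 2 / u" for u :: real by (simp add: power2_eq_square)
  finally show "klein (klein_inv w) = w"
    using s(1) unfolding klein_def klein_inv_def s_def[symmetric] by simp
qed

lemma klein_circle: "cmod z = 1 \<Longrightarrow> klein z = z"
  by (simp add: klein_def)

text \<open>A linear function in the Klein model becomes a squared distance in the Poincare model,
  up to a factor that is the same for all points \<open>c\<close> of the circle. Zero-sum
  combinations of logarithms do not see that factor.\<close>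

lemma klein_Re: "1 - Re (klein z * cnj c) = (cmod (z - c))\<^sup>2 / (1 + (cmod z)\<^sup>2)" if "cmod c = 1"
proof -
  have p: "1 + (cmod z)\<^sup>2 \<noteq> 0" by (metis add_pos_nonneg less_irrefl zero_le_power2 zero_less_one)
  have "(cmod (z - c))\<^sup>2 = (cmod z)\<^sup>2 + (cmod c)\<^sup>2 - 2 * Re (z * cnj c)"
    unfolding cmod_power2 by (simp add: power2_eq_square algebra_simps)
  then show ?thesis using p that by (simp add: klein_def field_simps)
qed

lemma Ck_on_norm_sq: "open S \<Longrightarrow> Ck_on k S (\<lambda>z::complex. (cmod z)\<^sup>2)"
  unfolding cmod_power2 unfolding power2_eq_square
  by (intro Ck_on_add Ck_on_mult Ck_on_Re Ck_on_Im Ck_on_ident)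

lemma Ck_on_klein: "Ck_on k UNIV klein"
proof -
  have "1 + (cmod z)\<^sup>2 \<noteq> 0" for z by (metis add_pos_nonneg less_irrefl zero_le_power2 zero_less_one)
  then show ?thesis unfolding klein_def[abs_def]
    by (intro Ck_on_scaleR Ck_on_divide Ck_on_const Ck_on_add Ck_on_norm_sq Ck_on_ident) auto
qed

lemma Ck_on_klein_inv: "Ck_on k (ball 0 1) klein_inv"
proof -
  have 1: "1 - (cmod w)\<^sup>2 > 0" if "w \<in> ball 0 1" for w :: complex using that by (simp add: abs_square_less_1)
  have "1 + sqrt (1 - (cmod w)\<^sup>2) \<noteq> 0" if "w \<in> ball 0 1" for w :: complex
    using real_sqrt_gt_zero[OF 1[OF that]] by linarith
  with 1 show ?thesis unfolding klein_inv_def[abs_def]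
    by (intro Ck_on_scaleR Ck_on_divide Ck_on_const Ck_on_add Ck_on_norm_sq Ck_on_ident Ck_on_sqrt Ck_on_diff) auto
qed

text \<open>The metric of the Klein model multiplied by
  \<open>(1 - (cmod w)\<^sup>2)\<^sup>2\<close>, which makes it polynomial and meaningful outside
  the disc, where it is indefinite.\<close>

definition N where "N w h = (1 - (cmod w)\<^sup>2) * (cmod h)\<^sup>2 + (Re (cnj w * h))\<^sup>2" for w h :: complex

section \<open>The extension on the polygon and its differential\<close>

context kobayashi begin

definition ell where "ell j w = 1 - Re (w * cnj (\<zeta> j))"
definition Pol where "Pol = {w. \<forall>j<2*n. ell j w > 0}"
text \<open>Up to a translation, \<open>F\<close> is the planar projection of the extension as a
  complex number and \<open>H\<close> its time coordinate.\<close>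

definition F where "F w = (\<Sum>j<2*n. ln (ell j w) *\<^sub>R \<beta> j)"
definition H where "H w = - (\<Sum>j<2*n. \<kappa> j * ln (ell j w))"
definition DF where "DF w h = (\<Sum>j<2*n. (- Re (h * cnj (\<zeta> j)) / ell j w) *\<^sub>R \<beta> j)"
definition DH where "DH w h = (\<Sum>j<2*n. \<kappa> j * (Re (h * cnj (\<zeta> j)) / ell j w))"

lemma continuous_ell: "continuous_on S (ell j)"
  unfolding ell_def[abs_def] by (intro continuous_intros)

lemma open_Pol: "open Pol"
proof -
  have "Pol = (\<Inter>j\<in>{..<2*n}. {w. 0 < ell j w})" by (auto simp: Pol_def)
  then show ?thesis by (auto intro!: open_INT open_Collect_less continuous_ell)
qed

lemma ball_subset_Pol: "ball 0 1 \<subseteq> Pol"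
proof
  fix w :: complex assume "w \<in> ball 0 1"
  then have "Re (w * cnj (\<zeta> j)) < 1" for j
    using complex_Re_le_cmod[of "w * cnj (\<zeta> j)"] by (simp add: norm_mult)
  then show "w \<in> Pol" by (simp add: Pol_def ell_def)
qed

lemma convex_Pol: "convex Pol"
proof (rule convexI)
  fix x y :: complex and u v :: real assume *: "x \<in> Pol" "y \<in> Pol" "0 \<le> u" "0 \<le> v" "u + v = 1"
  have "ell j (u *\<^sub>R x + v *\<^sub>R y) = u * ell j x + v * ell j y" for j
    using *(5) by (simp add: ell_def algebra_simps)
  then show "u *\<^sub>R x + v *\<^sub>R y \<in> Pol" using *
    by (auto simp: Pol_def) (metis add_pos_nonneg add_nonneg_pos mult_nonneg_nonneg mult_pos_pos less_eq_real_def add.right_neutral zero_neq_one)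
qed

lemma ell_pos: "w \<in> Pol \<Longrightarrow> j < 2*n \<Longrightarrow> ell j w > 0" by (simp add: Pol_def)

lemma Ck_on_ell: "open S \<Longrightarrow> Ck_on k S (ell j)"
  unfolding ell_def[abs_def]
  by (intro Ck_on_diff Ck_on_const Ck_on_Re Ck_on_mult Ck_on_ident)

lemma Ck_on_F: "Ck_on k Pol F" and Ck_on_H: "Ck_on k Pol H"
proof -
  show "Ck_on k Pol F" unfolding F_def[abs_def] using ell_pos
    by (intro Ck_on_sum Ck_on_scaleR Ck_on_ln Ck_on_ell Ck_on_const open_Pol) auto
  show "Ck_on k Pol H" unfolding H_def[abs_def] using ell_pos
    by (intro Ck_on_minus Ck_on_sum Ck_on_mult Ck_on_ln Ck_on_ell Ck_on_const open_Pol) auto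
qed

lemma has_derivative_ln_ell:
  assumes "ell j w > 0"
  shows "((\<lambda>w. ln (ell j w)) has_derivative (\<lambda>h. - Re (h * cnj (\<zeta> j)) / ell j w)) (at w)"
proof -
  have "(ell j has_derivative (\<lambda>h. - Re (h * cnj (\<zeta> j)))) (at w)"
    unfolding ell_def[abs_def] by (auto intro!: derivative_eq_intros has_derivative_Re has_derivative_mult_left)
  from has_derivative_ln[OF assms this] show ?thesis by (simp add: divide_inverse)
qed

lemma has_derivative_F: "w \<in> Pol \<Longrightarrow> (F has_derivative DF w) (at w)"
  unfolding F_def[abs_def] DF_def[abs_def]
  by (intro has_derivative_sum has_derivative_scaleR_left has_derivative_ln_ell ell_pos) auto

lemma has_derivative_H: "w \<in> Pol \<Longrightarrow> (H has_derivative DH w) (at w)"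
proof -
  assume w: "w \<in> Pol"
  have "((\<lambda>w. \<Sum>j<2*n. \<kappa> j * ln (ell j w)) has_derivative (\<lambda>h. \<Sum>j<2*n. \<kappa> j * (- Re (h * cnj (\<zeta> j)) / ell j w))) (at w)"
    using w by (intro has_derivative_sum has_derivative_mult_right has_derivative_ln_ell ell_pos) auto
  from has_derivative_minus[OF this]
  have "(H has_derivative (\<lambda>h. - (\<Sum>j<2*n. \<kappa> j * (- Re (h * cnj (\<zeta> j)) / ell j w)))) (at w)"
    by (simp only: H_def[abs_def])
  moreover have "(\<lambda>h. - (\<Sum>j<2*n. \<kappa> j * (- Re (h * cnj (\<zeta> j)) / ell j w))) = DH w"
    by (rule ext) (simp only: DH_def mult_minus_right minus_divide_left[symmetric] sum_negf minus_minus)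
  ultimately show ?thesis by simp
qed

text \<open>The first fundamental form in Lorentz-Minkowski space, as a quadratic form.\<close>

definition gm where "gm w h = (cmod (DF w h))\<^sup>2 - (DH w h)\<^sup>2"

text \<open>On the unit circle the quadratic polynomial with roots \<open>z1\<close>,
  \<open>z2\<close> is, up to a nonvanishing factor, the affine function
  \<open>Re (w * cnj z) - 1\<close>. This links the sides of the polygon to partial fractions in
  z.\<close>

lemma quadratic_at_zeta:
  assumes "w \<noteq> 0" "z1 + z2 = 2 / cnj w" "z1 * z2 = w / cnj w"
  shows "(\<zeta> j - z1) * (\<zeta> j - z2) = - (2 * \<zeta> j / cnj w) * of_real (ell j w)"
proof -
  have e: "of_real (ell j w) = 1 - (w * cnj (\<zeta> j) + cnj w * \<zeta> j) / 2"
    by (simp add: ell_def complex_eq_iff field_simps)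
  have "(\<zeta> j - z1) * (\<zeta> j - z2) = (\<zeta> j)\<^sup>2 - \<zeta> j * (z1 + z2) + z1 * z2"
    by (simp add: power2_eq_square algebra_simps)
  also have "\<dots> = (\<zeta> j)\<^sup>2 - \<zeta> j * (2 / cnj w) + w / cnj w * (\<zeta> j * cnj (\<zeta> j))" by (simp add: assms zeta_cnj)
  also have "\<dots> = - (2 * \<zeta> j / cnj w) * of_real (ell j w)"
    unfolding e using assms(1) by (simp add: field_simps power2_eq_square)
  finally show ?thesis .
qed

text \<open>Each summand has the denominator \<open>(\<zeta> j - z1) * (\<zeta> j - z2)\<close> and
  splits into simple fractions in \<open>z1\<close> and \<open>z2\<close> plus a multiple of
  \<open>c j\<close> that is lost in the sum. One computation serves the residues of
  \<open>aa\<close>, \<open>bb\<close> and \<open>cc\<close>.\<close>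

lemma derivative_coefficients:
  fixes c :: "nat \<Rightarrow> complex"
  assumes w: "w \<in> Pol" "w \<noteq> 0" and z: "z1 + z2 = 2 / cnj w" "z1 * z2 = w / cnj w" "z1 \<noteq> z2"
    and c: "(\<Sum>j<2*n. c j) = 0" and S: "\<And>z. z \<notin> \<zeta> ` {..<2*n} \<Longrightarrow> S z = (\<Sum>j<2*n. c j / (z - \<zeta> j))"
  shows "z1 \<notin> \<zeta> ` {..<2*n}" "z2 \<notin> \<zeta> ` {..<2*n}"
    "(\<Sum>j<2*n. of_real (- Re (h * cnj (\<zeta> j)) / ell j w) * c j)
      = ((h + z2\<^sup>2 * cnj h) * S z2 - (h + z1\<^sup>2 * cnj h) * S z1) / (cnj w * (z1 - z2))"
proof -
  have nz: "\<zeta> j - z1 \<noteq> 0 \<and> \<zeta> j - z2 \<noteq> 0" if "j < 2*n" for j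
    using quadratic_at_zeta[OF w(2) z(1,2), of j] ell_pos[OF w(1) that] w(2) by auto
  then show z12: "z1 \<notin> \<zeta> ` {..<2*n}" "z2 \<notin> \<zeta> ` {..<2*n}" by auto
  have trm: "of_real (- Re (h * cnj (\<zeta> j)) / ell j w) * c j
     = cnj h / cnj w * c j + ((h + z2\<^sup>2 * cnj h) * (c j / (z2 - \<zeta> j)) - (h + z1\<^sup>2 * cnj h) * (c j / (z1 - \<zeta> j))) / (cnj w * (z1 - z2))"
    if j: "j < 2*n" for j
  proof -
    define x y where "x = \<zeta> j - z1" and "y = \<zeta> j - z2"
    have xy: "x \<noteq> 0" "y \<noteq> 0" "z1 - z2 = y - x" "y - x \<noteq> 0" "z1 = \<zeta> j - x" "z2 = \<zeta> j - y"
      using nz[OF j] z(3) by (auto simp: x_def y_def)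
    have "of_real (ell j w) * (2 * \<zeta> j) = - (cnj w * (- (2 * \<zeta> j / cnj w) * of_real (ell j w)))"
      using w(2) by simp
    then have f1: "of_real (ell j w) * (2 * \<zeta> j) = - (cnj w * (x * y))"
      unfolding quadratic_at_zeta[OF w(2) z(1,2), of j, symmetric] x_def y_def .
    have R: "of_real (Re (h * cnj (\<zeta> j))) = (h * cnj (\<zeta> j) + cnj h * \<zeta> j) / 2"
      by (simp add: complex_eq_iff field_simps)
    have "of_real (Re (h * cnj (\<zeta> j))) * (2 * \<zeta> j) = h * (\<zeta> j * cnj (\<zeta> j)) + cnj h * (\<zeta> j)\<^sup>2"
      unfolding R by (simp add: power2_eq_square algebra_simps)
    then have f2: "of_real (Re (h * cnj (\<zeta> j))) * (2 * \<zeta> j) = h + cnj h * (\<zeta> j)\<^sup>2" by (simp add: zeta_cnj)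
    have "complex_of_real (- r / l) = - (of_real r * t / (of_real l * t))" if "t \<noteq> 0" for r l t
      using that by simp
    then have "of_real (- Re (h * cnj (\<zeta> j)) / ell j w)
        = - (of_real (Re (h * cnj (\<zeta> j))) * (2 * \<zeta> j) / (of_real (ell j w) * (2 * \<zeta> j)))"
      by (metis zeta_nz mult_eq_0_iff zero_neq_numeral)
    then have r: "of_real (- Re (h * cnj (\<zeta> j)) / ell j w) = (h + cnj h * (\<zeta> j)\<^sup>2) / (cnj w * (x * y))"
      unfolding f1 f2 by simp
    have cy: "c j / (z2 - \<zeta> j) = - (c j / y)" "c j / (z1 - \<zeta> j) = - (c j / x)"
      using minus_divide_right[of "c j" y] minus_divide_right[of "c j" x] by (simp_all add: x_def y_def)
    have "(h + (\<zeta> j - y)\<^sup>2 * cnj h) * (c j / (z2 - \<zeta> j)) - (h + (\<zeta> j - x)\<^sup>2 * cnj h) * (c j / (z1 - \<zeta> j))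
       = c j * ((h + (\<zeta> j - x)\<^sup>2 * cnj h) * y - (h + (\<zeta> j - y)\<^sup>2 * cnj h) * x) / (x * y)"
      unfolding cy using xy(1,2) by (simp add: field_simps)
    also have "(h + (\<zeta> j - x)\<^sup>2 * cnj h) * y - (h + (\<zeta> j - y)\<^sup>2 * cnj h) * x = (y - x) * (h + cnj h * (\<zeta> j)\<^sup>2 - cnj h * (x * y))"
      by (simp add: power2_eq_square algebra_simps)
    finally have EQ: "((h + z2\<^sup>2 * cnj h) * (c j / (z2 - \<zeta> j)) - (h + z1\<^sup>2 * cnj h) * (c j / (z1 - \<zeta> j))) / (cnj w * (z1 - z2))
       = c j * (h + cnj h * (\<zeta> j)\<^sup>2 - cnj h * (x * y)) / (cnj w * (x * y))"
      unfolding xy(3) xy(5,6)[symmetric] using xy(4) by simp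
    show ?thesis unfolding r EQ using xy(1,2) w(2) by (simp add: field_simps)
  qed
  have "(\<Sum>j<2*n. of_real (- Re (h * cnj (\<zeta> j)) / ell j w) * c j)
    = (\<Sum>j<2*n. cnj h / cnj w * c j + ((h + z2\<^sup>2 * cnj h) * (c j / (z2 - \<zeta> j)) - (h + z1\<^sup>2 * cnj h) * (c j / (z1 - \<zeta> j))) / (cnj w * (z1 - z2)))"
    using trm by (intro sum.cong) auto
  also have "\<dots> = ((h + z2\<^sup>2 * cnj h) * S z2 - (h + z1\<^sup>2 * cnj h) * S z1) / (cnj w * (z1 - z2))"
    unfolding sum.distrib sum_divide_distrib[symmetric] sum_subtractf sum_distrib_left[symmetric] c S[OF z12(1)] S[OF z12(2)]
    by simp
  finally show "(\<Sum>j<2*n. of_real (- Re (h * cnj (\<zeta> j)) / ell j w) * c j)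
      = ((h + z2\<^sup>2 * cnj h) * S z2 - (h + z1\<^sup>2 * cnj h) * S z1) / (cnj w * (z1 - z2))" .
qed

lemma DF_generic:
  assumes w: "w \<in> Pol" "w \<noteq> 0" and z: "z1 + z2 = 2 / cnj w" "z1 * z2 = w / cnj w" "z1 \<noteq> z2"
  shows "DF w h = ((h + z2\<^sup>2 * cnj h) * bb z2 - (h + z1\<^sup>2 * cnj h) * bb z1) / (cnj w * (z1 - z2))"
    and "cnj (DF w h) = ((h + z2\<^sup>2 * cnj h) * aa z2 - (h + z1\<^sup>2 * cnj h) * aa z1) / (cnj w * (z1 - z2))"
    and "of_real (DH w h) = - ((h + z2\<^sup>2 * cnj h) * cc z2 - (h + z1\<^sup>2 * cnj h) * cc z1) / (cnj w * (z1 - z2))"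
    and "z1 \<notin> \<zeta> ` {..<2*n}" "z2 \<notin> \<zeta> ` {..<2*n}"
proof -
  note * = derivative_coefficients[OF w z]
  show "DF w h = ((h + z2\<^sup>2 * cnj h) * bb z2 - (h + z1\<^sup>2 * cnj h) * bb z1) / (cnj w * (z1 - z2))"
    using *(3)[OF sum_beta bb_eq, of h] by (simp add: DF_def scaleR_conv_of_real)
  have sa: "(\<Sum>j<2*n. cnj (\<beta> j)) = 0" using arg_cong[OF sum_beta, of cnj] by simp
  show "cnj (DF w h) = ((h + z2\<^sup>2 * cnj h) * aa z2 - (h + z1\<^sup>2 * cnj h) * aa z1) / (cnj w * (z1 - z2))"
    using *(3)[OF sa aa_eq, of h] by (simp add: DF_def scaleR_conv_of_real)
  have sk: "(\<Sum>j<2*n. complex_of_real (\<kappa> j)) = 0"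
    using arg_cong[OF sum_kappa, of complex_of_real] by simp
  have "DH w h = - (\<Sum>j<2*n. (- Re (h * cnj (\<zeta> j)) / ell j w) * \<kappa> j)"
    by (simp only: DH_def minus_divide_left[symmetric] mult_minus_left mult_minus_right sum_negf minus_minus mult.commute)
  then have e: "of_real (DH w h) = - (\<Sum>j<2*n. of_real (- Re (h * cnj (\<zeta> j)) / ell j w) * complex_of_real (\<kappa> j))"
    by (simp only: of_real_minus of_real_sum of_real_mult)
  have t: "(\<Sum>j<2*n. of_real (- Re (h * cnj (\<zeta> j)) / ell j w) * complex_of_real (\<kappa> j))
    = ((h + z2\<^sup>2 * cnj h) * cc z2 - (h + z1\<^sup>2 * cnj h) * cc z1) / (cnj w * (z1 - z2))"
    by (rule *(3)[OF sk cc_eq])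
  show "of_real (DH w h) = - ((h + z2\<^sup>2 * cnj h) * cc z2 - (h + z1\<^sup>2 * cnj h) * cc z1) / (cnj w * (z1 - z2))"
    unfolding e t by (simp only: minus_divide_left)
  show "z1 \<notin> \<zeta> ` {..<2*n}" "z2 \<notin> \<zeta> ` {..<2*n}" using *(1,2)[OF sum_beta bb_eq] by auto
qed

text \<open>The relation \<open>cc_square\<close> removes the squares of \<open>u1\<close> and
  \<open>u2\<close>, and the remaining product \<open>u1 * u2\<close> is \<open>N w h\<close> up to
  a factor free of \<open>h\<close>. Hence the induced form is conformal to the metric of the Klein
  model.\<close>

lemma gm_generic:
  assumes w: "w \<in> Pol" "w \<noteq> 0" and z: "z1 + z2 = 2 / cnj w" "z1 * z2 = w / cnj w" "z1 \<noteq> z2"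
  defines "E \<equiv> (aa z1 * bb z2 + aa z2 * bb z1 - 2 * cc z1 * cc z2) / (cnj w * (z1 - z2))\<^sup>2"
  shows "of_real (gm w h) = - (4 * E / (cnj w)\<^sup>2) * of_real (N w h)"
proof -
  define D u1 u2 where "D = cnj w * (z1 - z2)" and "u1 = h + z1\<^sup>2 * cnj h" and "u2 = h + z2\<^sup>2 * cnj h"
  have "of_real (gm w h) = DF w h * cnj (DF w h) - (of_real (DH w h))\<^sup>2"
    by (simp only: gm_def of_real_diff of_real_power complex_norm_square[symmetric])
  also have "\<dots> = (u2 * bb z2 - u1 * bb z1) / D * ((u2 * aa z2 - u1 * aa z1) / D) - (- (u2 * cc z2 - u1 * cc z1) / D)\<^sup>2"
  proof -
    have "DF w h * cnj (DF w h) = (u2 * bb z2 - u1 * bb z1) / D * ((u2 * aa z2 - u1 * aa z1) / D)"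
      unfolding D_def u1_def u2_def by (rule arg_cong2[OF DF_generic(1,2)[OF w z]])
    moreover have "of_real (DH w h) = - (u2 * cc z2 - u1 * cc z1) / D"
      unfolding D_def u1_def u2_def by (rule DF_generic(3)[OF w z])
    ultimately show ?thesis by simp
  qed
  also have "\<dots> = ((u2 * bb z2 - u1 * bb z1) * (u2 * aa z2 - u1 * aa z1) - (u2 * cc z2 - u1 * cc z1)\<^sup>2) / D\<^sup>2"
  proof -
    have "p / D * (q / D) - (- r / D)\<^sup>2 = (p * q - r\<^sup>2) / D\<^sup>2" for p q r
      by (simp add: power2_eq_square diff_divide_distrib)
    then show ?thesis .
  qed
  also have "(u2 * bb z2 - u1 * bb z1) * (u2 * aa z2 - u1 * aa z1) - (u2 * cc z2 - u1 * cc z1)\<^sup>2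
    = u2\<^sup>2 * (aa z2 * bb z2 - (cc z2)\<^sup>2) + u1\<^sup>2 * (aa z1 * bb z1 - (cc z1)\<^sup>2)
       - u1 * u2 * (aa z1 * bb z2 + aa z2 * bb z1 - 2 * cc z1 * cc z2)"
    by (simp add: power2_eq_square algebra_simps)
  also have "\<dots> / D\<^sup>2 = - (u1 * u2 * E)" unfolding cc_square E_def D_def by simp
  \<comment> \<open>The product is symmetric in the roots, hence expressible by their sum and
    product.\<close>
  also have "u1 * u2 = 4 / (cnj w)\<^sup>2 * of_real (N w h)"
  proof -
    have "z1\<^sup>2 + z2\<^sup>2 = (z1 + z2)\<^sup>2 - 2 * (z1 * z2)" by (simp add: power2_eq_square algebra_simps)
    then have s: "z1\<^sup>2 + z2\<^sup>2 = 4 / (cnj w)\<^sup>2 - 2 * w / cnj w" unfolding z by (simp add: power_divide)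
    have p: "z1\<^sup>2 * z2\<^sup>2 = w\<^sup>2 / (cnj w)\<^sup>2" unfolding power_mult_distrib[symmetric] z by (simp add: power_divide)
    have "u1 * u2 = h\<^sup>2 + (z1\<^sup>2 + z2\<^sup>2) * (h * cnj h) + (z1\<^sup>2 * z2\<^sup>2) * (cnj h)\<^sup>2"
      unfolding u1_def u2_def by (simp add: power2_eq_square algebra_simps)
    also have "\<dots> = 4 / (cnj w)\<^sup>2 * ((1 - w * cnj w) * (h * cnj h) + ((cnj w * h + w * cnj h) / 2)\<^sup>2)"
      unfolding s p using w(2) by (simp add: field_simps power2_eq_square)
    also have "(1 - w * cnj w) * (h * cnj h) + ((cnj w * h + w * cnj h) / 2)\<^sup>2 = of_real (N w h)"
    proof -
      have "of_real (Re (cnj w * h)) = (cnj w * h + w * cnj h) / 2" by (simp add: complex_eq_iff)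
      then show ?thesis by (simp only: N_def of_real_add of_real_mult of_real_diff of_real_1 of_real_power complex_norm_square[symmetric])
    qed
    finally show ?thesis .
  qed
  finally show ?thesis by simp
qed

lemma DF_linear: "linear (DF w)" and DH_linear: "linear (DH w)"
  by (rule linearI; simp add: DF_def DH_def algebra_simps add_divide_distrib diff_divide_distrib sum.distrib
      sum_negf sum_subtractf scaleR_sum_right sum_distrib_left)+

text \<open>Terms with both factors at the same root cancel, so only the difference of g^2 at the
  two roots matters.\<close>

lemma Jacobian_generic:
  assumes w: "w \<in> Pol" "w \<noteq> 0" and z: "z1 + z2 = 2 / cnj w" "z1 * z2 = w / cnj w" "z1 \<noteq> z2"
  shows "of_real (Im (cnj (DF w 1) * DF w \<i>)) = (z2\<^sup>2 - z1\<^sup>2) * (aa z1 * bb z2 - aa z2 * bb z1) / (cnj w * (z1 - z2))\<^sup>2"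
proof -
  define D where "D = cnj w * (z1 - z2)"
  have i: "of_real (Im (cnj x * y)) = (cnj x * y - x * cnj y) / (2 * \<i>)" for x y by (simp add: complex_eq_iff diff_divide_distrib)
  have d: "DF w 1 = ((1 + z2\<^sup>2) * bb z2 - (1 + z1\<^sup>2) * bb z1) / D"
     "DF w \<i> = \<i> * ((1 - z2\<^sup>2) * bb z2 - (1 - z1\<^sup>2) * bb z1) / D"
     "cnj (DF w 1) = ((1 + z2\<^sup>2) * aa z2 - (1 + z1\<^sup>2) * aa z1) / D"
     "cnj (DF w \<i>) = \<i> * ((1 - z2\<^sup>2) * aa z2 - (1 - z1\<^sup>2) * aa z1) / D"
    using DF_generic(1)[OF w z, of 1] DF_generic(1)[OF w z, of \<i>] DF_generic(2)[OF w z, of 1] DF_generic(2)[OF w z, of \<i>]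
    unfolding D_def[symmetric] by (simp_all add: algebra_simps)
  define p1 p2 q1 q2 where "p1 = (1 + z2\<^sup>2) * bb z2 - (1 + z1\<^sup>2) * bb z1"
    and "p2 = (1 - z2\<^sup>2) * bb z2 - (1 - z1\<^sup>2) * bb z1"
    and "q1 = (1 + z2\<^sup>2) * aa z2 - (1 + z1\<^sup>2) * aa z1"
    and "q2 = (1 - z2\<^sup>2) * aa z2 - (1 - z1\<^sup>2) * aa z1"
  have 1: "cnj (DF w 1) * DF w \<i> = q1 / D * (\<i> * p2 / D)"
    unfolding p1_def p2_def q1_def q2_def by (rule arg_cong2[OF d(3,2)])
  have 2: "DF w 1 * cnj (DF w \<i>) = p1 / D * (\<i> * q2 / D)"
    unfolding p1_def p2_def q1_def q2_def by (rule arg_cong2[OF d(1,4)])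
  have "of_real (Im (cnj (DF w 1) * DF w \<i>)) = (cnj (DF w 1) * DF w \<i> - DF w 1 * cnj (DF w \<i>)) / (2 * \<i>)"
    by (rule i)
  also have "\<dots> = (q1 / D * (\<i> * p2 / D) - p1 / D * (\<i> * q2 / D)) / (2 * \<i>)" by (simp only: 1 2)
  also have "q1 / D * (\<i> * p2 / D) - p1 / D * (\<i> * q2 / D) = \<i> * ((q1 * p2 - p1 * q2) / D\<^sup>2)"
    by (simp add: power2_eq_square diff_divide_distrib algebra_simps)
  also have "\<i> * x / (2 * \<i>) = x / 2" for x by (simp add: field_simps)
  also have "(q1 * p2 - p1 * q2) / D\<^sup>2 / 2 = (q1 * p2 - p1 * q2) / (2 * D\<^sup>2)" by simp
  also have "q1 * p2 - p1 * q2 = 2 * ((z2\<^sup>2 - z1\<^sup>2) * (aa z1 * bb z2 - aa z2 * bb z1))"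
    unfolding p1_def p2_def q1_def q2_def by (simp add: power2_eq_square algebra_simps)
  also have "\<dots> / (2 * D\<^sup>2) = (z2\<^sup>2 - z1\<^sup>2) * (aa z1 * bb z2 - aa z2 * bb z1) / D\<^sup>2" by simp
  finally show ?thesis unfolding D_def .
qed

end

section \<open>Conformality and the space-like disc\<close>

context kobayashi begin

lemma quadratic_roots:
  assumes "w \<noteq> 0" "cmod w \<noteq> 1"
  obtains z1 z2 where "z1 + z2 = 2 / cnj w" "z1 * z2 = w / cnj w" "z1 \<noteq> z2"
proof -
  define d where "d = csqrt (1 - w * cnj w)"
  have d2: "d\<^sup>2 = 1 - w * cnj w" by (simp add: d_def)
  have "w * cnj w \<noteq> 1"
  proof
    assume "w * cnj w = 1"
    then have "(cmod w)\<^sup>2 = 1" unfolding complex_norm_square[symmetric] by (simp only: of_real_eq_1_iff)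
    then show False using assms(2) power2_eq_iff_nonneg[of "cmod w" 1] by simp
  qed
  then have "d \<noteq> 0" using d2 by auto
  show thesis
  proof (rule that[of "(1 + d) / cnj w" "(1 - d) / cnj w"])
    show "(1 + d) / cnj w + (1 - d) / cnj w = 2 / cnj w" by (simp add: add_divide_distrib[symmetric])
    have "(1 + d) * (1 - d) = w * cnj w" using d2 by (simp add: algebra_simps power2_eq_square)
    then show "(1 + d) / cnj w * ((1 - d) / cnj w) = w / cnj w" using assms(1) by simp
    show "(1 + d) / cnj w \<noteq> (1 - d) / cnj w" using \<open>d \<noteq> 0\<close> assms(1) by (auto simp: eq_neg_iff_add_eq_0)
  qed
qed

lemma N_self: "N w w = (cmod w)\<^sup>2"
proof -
  have "Re (cnj w * w) = (cmod w)\<^sup>2" unfolding cmod_power2 by (simp add: power2_eq_square)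
  then show ?thesis by (simp add: N_def power2_eq_square algebra_simps)
qed

lemma N_0: "N 0 h = (cmod h)\<^sup>2" by (simp add: N_def)

lemma conformal_generic:
  assumes "w \<in> Pol" "w \<noteq> 0" "cmod w \<noteq> 1"
  shows "N w k * gm w h = N w h * gm w k"
proof -
  obtain z1 z2 where z: "z1 + z2 = 2 / cnj w" "z1 * z2 = w / cnj w" "z1 \<noteq> z2"
    using quadratic_roots[OF assms(2,3)] by blast
  have "complex_of_real (N w k * gm w h) = of_real (N w h * gm w k)"
    by (simp add: gm_generic[OF assms(1,2) z])
  then show ?thesis by (simp only: of_real_eq_iff)
qed

lemma conformal:
  assumes w: "w \<in> Pol" shows "N w k * gm w h = N w h * gm w k"
proof -
  \<comment> \<open>Moving radially from \<open>w\<close> leaves the circle at once; at the centre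
    any direction serves.\<close>
  define v where "v = (if w = 0 then 1 else w)"
  define \<phi> where "\<phi> = (\<lambda>t::real. N (w + t *\<^sub>R v) k * gm (w + t *\<^sub>R v) h - N (w + t *\<^sub>R v) h * gm (w + t *\<^sub>R v) k)"
  define T where "T = (\<lambda>t::real. w + t *\<^sub>R v) -` Pol"
  have oT: "open T" unfolding T_def by (intro open_vimage open_Pol continuous_intros)
  have T0: "0 \<in> T" using w by (simp add: T_def)
  have nz: "1 - Re ((w + t *\<^sub>R v) * cnj (\<zeta> j)) \<noteq> 0" if "t \<in> T" "j \<in> {..<2*n}" for t j
  proof -
    have "0 < ell j (w + t *\<^sub>R v)" using that by (intro ell_pos) (auto simp: T_def)
    then show ?thesis unfolding ell_def by linarith
  qed
  have "continuous_on T \<phi>"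
    unfolding \<phi>_def N_def gm_def DF_def DH_def ell_def
    by (intro continuous_intros ballI nz)
  then have c: "\<phi> \<midarrow>0\<rightarrow> \<phi> 0" using oT T0 continuous_on_eq_continuous_at isCont_def by blast
  have "\<forall>\<^sub>F t in at 0. t \<in> T" using oT T0 by (simp add: eventually_at_in_open')
  moreover have "\<forall>\<^sub>F t in at (0::real). t \<noteq> 0 \<and> \<bar>t\<bar> < 1/2 \<and> (cmod w \<noteq> 1 \<and> w \<noteq> 0 \<longrightarrow> cmod (w + t *\<^sub>R v) \<noteq> 1)"
  proof -
    have "\<forall>\<^sub>F t in at (0::real). cmod w \<noteq> 1 \<longrightarrow> cmod (w + t *\<^sub>R v) \<noteq> 1"
    proof (cases "cmod w = 1")
      case False
      have "((\<lambda>t. cmod (w + t *\<^sub>R v)) \<longlongrightarrow> cmod (w + 0 *\<^sub>R v)) (at 0)" by (intro tendsto_intros)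
      then have "\<forall>\<^sub>F t in at 0. cmod (w + t *\<^sub>R v) \<noteq> 1" using False by (intro tendsto_imp_eventually_ne) auto
      then show ?thesis by (rule eventually_mono) simp
    qed simp
    moreover have "\<forall>\<^sub>F t in at (0::real). t \<noteq> 0 \<and> \<bar>t\<bar> < 1/2"
      unfolding eventually_at by (intro exI[of _ "1/2"]) auto
    ultimately show ?thesis by eventually_elim auto
  qed
  ultimately have "\<forall>\<^sub>F t in at 0. \<phi> t = 0"
  proof eventually_elim
    case (elim t)
    let ?w = "w + t *\<^sub>R v"
    have P: "?w \<in> Pol" using elim by (simp add: T_def)
    have "?w \<noteq> 0 \<and> cmod ?w \<noteq> 1"
    proof (cases "w = 0")
      case True then show ?thesis using elim by (simp add: v_def)
    next
      case False
      have e: "?w = (1 + t) *\<^sub>R w" using False by (simp add: v_def algebra_simps)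
      have "1 + t \<noteq> 0" "\<bar>1 + t\<bar> \<noteq> 1" using elim by auto
      then show ?thesis using False elim unfolding e by (cases "cmod w = 1") (auto simp: e)
    qed
    then show "\<phi> t = 0" using conformal_generic[OF P, of k h] by (simp add: \<phi>_def)
  qed
  then have "\<phi> \<midarrow>0\<rightarrow> 0" by (simp add: tendsto_eventually)
  then have "\<phi> 0 = 0" using c LIM_unique by blast
  then show ?thesis by (simp add: \<phi>_def)
qed

lemma conformal_factor: assumes "w \<in> Pol" obtains m where "\<And>h. gm w h = m * N w h"
proof -
  have "N w (if w = 0 then 1 else w) \<noteq> 0" using N_self[of w] N_0[of 1] by simp
  then obtain k where k: "N w k \<noteq> 0" by blast
  show thesis by (rule that[of "gm w k / N w k"]) (use k conformal[OF assms, of k] in \<open>simp add: field_simps\<close>)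
qed

lemma disc_not_zeta: "cmod z < 1 \<Longrightarrow> z \<notin> \<zeta> ` {..<2*n}" by auto

definition Fd where "Fd z h = bb z * h + cnj (aa z * h)"
definition Hd where "Hd z h = - 2 * Re (cc z * h)"

lemma ell_klein: "ell j (klein z) = (cmod (z - \<zeta> j))\<^sup>2 / (1 + (cmod z)\<^sup>2)"
  unfolding ell_def by (rule klein_Re) simp

text \<open>The factor \<open>1 + (cmod z)\<^sup>2\<close> is common to all sides, so the zero sum
  removes it and leaves logarithms of distances, which are harmonic in z.\<close>

lemma sum_ln_ell_klein:
  fixes c :: "nat \<Rightarrow> 'x::real_vector"
  assumes "(\<Sum>j<2*n. c j) = 0" "z \<notin> \<zeta> ` {..<2*n}"
  shows "(\<Sum>j<2*n. ln (ell j (klein z)) *\<^sub>R c j) = (\<Sum>j<2*n. (2 * ln (cmod (z - \<zeta> j))) *\<^sub>R c j)"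
proof -
  have p: "1 + (cmod z)\<^sup>2 > 0" by (simp add: add_pos_nonneg)
  have "ln (ell j (klein z)) = 2 * ln (cmod (z - \<zeta> j)) - ln (1 + (cmod z)\<^sup>2)" if "j < 2*n" for j
  proof -
    have "cmod (z - \<zeta> j) > 0" using assms(2) that by auto
    then show ?thesis unfolding ell_klein using p by (simp add: ln_div ln_realpow)
  qed
  then have "(\<Sum>j<2*n. ln (ell j (klein z)) *\<^sub>R c j)
     = (\<Sum>j<2*n. (2 * ln (cmod (z - \<zeta> j))) *\<^sub>R c j - ln (1 + (cmod z)\<^sup>2) *\<^sub>R c j)"
    by (intro sum.cong) (auto simp: scaleR_diff_left)
  also have "\<dots> = (\<Sum>j<2*n. (2 * ln (cmod (z - \<zeta> j))) *\<^sub>R c j)"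
    by (simp add: sum_subtractf scaleR_sum_right[symmetric] assms)
  finally show ?thesis .
qed

lemma F_klein: "z \<notin> \<zeta> ` {..<2*n} \<Longrightarrow> F (klein z) = (\<Sum>j<2*n. (2 * ln (cmod (z - \<zeta> j))) *\<^sub>R \<beta> j)"
  and H_klein: "z \<notin> \<zeta> ` {..<2*n} \<Longrightarrow> H (klein z) = - (\<Sum>j<2*n. 2 * \<kappa> j * ln (cmod (z - \<zeta> j)))"
  unfolding F_def H_def using sum_ln_ell_klein[OF sum_beta] sum_ln_ell_klein[OF sum_kappa]
  by (simp_all add: mult_ac)

lemma klein_in_Pol: assumes "cmod z \<le> 1" "z \<notin> \<zeta> ` {..<2*n}" shows "klein z \<in> Pol"
proof -
  have "1 + (cmod z)\<^sup>2 > 0" by (simp add: add_pos_nonneg)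
  then show ?thesis using assms by (auto simp: Pol_def ell_klein intro!: divide_pos_pos)
qed

lemma has_derivative_F_klein: assumes "cmod z < 1" shows "((\<lambda>z. F (klein z)) has_derivative Fd z) (at z)"
proof (rule has_derivative_transform_within_open[where s="ball 0 1"])
  have nz: "z \<noteq> \<zeta> j" for j using assms by auto
  have "((\<lambda>z. \<Sum>j<2*n. (2 * ln (cmod (z - \<zeta> j))) *\<^sub>R \<beta> j) has_derivative
     (\<lambda>h. \<Sum>j<2*n. (2 * Re (h / (z - \<zeta> j))) *\<^sub>R \<beta> j)) (at z)"
    by (intro has_derivative_sum has_derivative_scaleR_left has_derivative_mult_right has_derivative_ln_cmod nz)
  moreover have "(\<lambda>h. \<Sum>j<2*n. (2 * Re (h / (z - \<zeta> j))) *\<^sub>R \<beta> j) = Fd z"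
  proof
    fix h
    have "(2 * Re (h / (z - \<zeta> j))) *\<^sub>R \<beta> j = \<beta> j / (z - \<zeta> j) * h + cnj (cnj (\<beta> j) / (z - \<zeta> j) * h)" for j
    proof -
      have "of_real (2 * Re x) = x + cnj x" for x by (simp add: complex_eq_iff)
      from this[of "h / (z - \<zeta> j)"] show ?thesis by (simp add: scaleR_conv_of_real algebra_simps)
    qed
    then show "(\<Sum>j<2*n. (2 * Re (h / (z - \<zeta> j))) *\<^sub>R \<beta> j) = Fd z h"
      unfolding Fd_def bb_eq[OF disc_not_zeta[OF assms]] aa_eq[OF disc_not_zeta[OF assms]]
      by (simp only: sum.distrib sum_distrib_right[symmetric] cnj_sum[symmetric])
  qed
  ultimately show "((\<lambda>z. \<Sum>j<2*n. (2 * ln (cmod (z - \<zeta> j))) *\<^sub>R \<beta> j) has_derivative Fd z) (at z)" by simp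
  show "(\<Sum>j<2*n. (2 * ln (cmod (x - \<zeta> j))) *\<^sub>R \<beta> j) = F (klein x)" if "x \<in> ball 0 1" for x
    using F_klein[OF disc_not_zeta] that by simp
qed (use assms in auto)

lemma has_derivative_H_klein: assumes "cmod z < 1" shows "((\<lambda>z. H (klein z)) has_derivative Hd z) (at z)"
proof (rule has_derivative_transform_within_open[where s="ball 0 1"])
  have nz: "z \<noteq> \<zeta> j" for j using assms by auto
  have "((\<lambda>z. - (\<Sum>j<2*n. 2 * \<kappa> j * ln (cmod (z - \<zeta> j)))) has_derivative
     (\<lambda>h. - (\<Sum>j<2*n. 2 * \<kappa> j * Re (h / (z - \<zeta> j))))) (at z)"
    by (intro has_derivative_minus has_derivative_sum has_derivative_mult_right has_derivative_ln_cmod nz)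
  moreover have "(\<lambda>h. - (\<Sum>j<2*n. 2 * \<kappa> j * Re (h / (z - \<zeta> j)))) = Hd z"
  proof
    fix h
    have "2 * \<kappa> j * Re (h / (z - \<zeta> j)) = 2 * Re (of_real (\<kappa> j) / (z - \<zeta> j) * h)" for j
    proof -
      have "of_real (\<kappa> j) / (z - \<zeta> j) * h = of_real (\<kappa> j) * (h / (z - \<zeta> j))" by simp
      moreover have "Re (of_real r * x) = r * Re x" for r x by simp
      ultimately show ?thesis by (simp only: mult.assoc)
    qed
    then show "- (\<Sum>j<2*n. 2 * \<kappa> j * Re (h / (z - \<zeta> j))) = Hd z h"
      unfolding Hd_def cc_eq[OF disc_not_zeta[OF assms]]
      by (simp only: sum_distrib_left[symmetric] Re_sum[symmetric] sum_distrib_right[symmetric] mult_minus_left)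
  qed
  ultimately show "((\<lambda>z. - (\<Sum>j<2*n. 2 * \<kappa> j * ln (cmod (z - \<zeta> j)))) has_derivative Hd z) (at z)" by simp
  show "- (\<Sum>j<2*n. 2 * \<kappa> j * ln (cmod (x - \<zeta> j))) = H (klein x)" if "x \<in> ball 0 1" for x
    using H_klein[OF disc_not_zeta] that by simp
qed (use assms in auto)

text \<open>The metric (1 - |g|^2)^2 |omega|^2 of a maxface. The terms in \<open>h\<^sup>2\<close>
  and its conjugate vanish by \<open>cc_square\<close>.\<close>

lemma metric_disc: "(cmod (Fd z h))\<^sup>2 - (Hd z h)\<^sup>2 = (cmod (aa z) - cmod (bb z))\<^sup>2 * (cmod h)\<^sup>2"
proof -
  have c: "cc z * cc z = aa z * bb z" using cc_square by (simp add: power2_eq_square)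
  have n: "cmod (cc z) * cmod (cc z) = cmod (aa z) * cmod (bb z)"
    using arg_cong[OF c, of cmod] by (simp add: norm_mult)
  have "complex_of_real ((cmod (Fd z h))\<^sup>2 - (Hd z h)\<^sup>2) = Fd z h * cnj (Fd z h) - (of_real (Hd z h))\<^sup>2"
    by (simp only: of_real_diff of_real_power complex_norm_square[symmetric])
  also have "of_real (Hd z h) = - (cc z * h + cnj (cc z * h))" by (simp add: Hd_def complex_eq_iff)
  also have "Fd z h * cnj (Fd z h) - (- (cc z * h + cnj (cc z * h)))\<^sup>2
    = (aa z * cnj (aa z) + bb z * cnj (bb z) - 2 * (cc z * cnj (cc z))) * (h * cnj h)
      + (aa z * bb z - cc z * cc z) * h\<^sup>2 + cnj ((aa z * bb z - cc z * cc z) * h\<^sup>2)"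
    by (simp add: Fd_def power2_eq_square algebra_simps)
  also have "\<dots> = of_real (((cmod (aa z))\<^sup>2 + (cmod (bb z))\<^sup>2 - 2 * (cmod (cc z))\<^sup>2) * (cmod h)\<^sup>2)"
    unfolding c by (simp add: complex_norm_square[symmetric])
  finally have "(cmod (Fd z h))\<^sup>2 - (Hd z h)\<^sup>2 = ((cmod (aa z))\<^sup>2 + (cmod (bb z))\<^sup>2 - 2 * (cmod (cc z))\<^sup>2) * (cmod h)\<^sup>2"
    by (simp only: of_real_eq_iff)
  moreover have "(cmod (aa z) - cmod (bb z))\<^sup>2 = (cmod (aa z))\<^sup>2 + (cmod (bb z))\<^sup>2 - 2 * (cmod (cc z))\<^sup>2"
    using n by (simp add: power2_eq_square algebra_simps)
  ultimately show ?thesis by simp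
qed

lemma aa_bb_less: assumes "cmod z < 1" shows "cmod (bb z) < cmod (aa z)"
proof -
  have "(cmod (B z))\<^sup>2 < (cmod (Bs z))\<^sup>2" using B_less_Bs[OF assms] by (intro power_strict_mono) auto
  then show ?thesis using Q_nz[OF disc_not_zeta[OF assms]]
    by (simp add: aa_def bb_def norm_mult norm_divide norm_power divide_strict_right_mono)
qed

lemma chain_klein:
  assumes "cmod z < 1" "(klein has_derivative K') (at z)"
  shows "DF (klein z) (K' h) = Fd z h" "DH (klein z) (K' h) = Hd z h"
proof -
  have P: "klein z \<in> Pol" using klein_in_Pol[of z] disc_not_zeta[of z] assms by auto
  show "DF (klein z) (K' h) = Fd z h"
    using has_derivative_unique[OF has_derivative_compose[OF assms(2) has_derivative_F[OF P]] has_derivative_F_klein[OF assms(1)]]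
    by (rule fun_cong)
  show "DH (klein z) (K' h) = Hd z h"
    using has_derivative_unique[OF has_derivative_compose[OF assms(2) has_derivative_H[OF P]] has_derivative_H_klein[OF assms(1)]]
    by (rule fun_cong)
qed

lemma klein_derivative_surj:
  assumes "cmod z < 1" "(klein has_derivative K') (at z)"
  obtains h where "K' h = k"
proof -
  have "klein z \<in> ball 0 1" using klein_less[OF assms(1)] by simp
  then obtain L where L: "(klein_inv has_derivative L) (at (klein z))"
    using Ck_on_SucD[OF Ck_on_klein_inv[of "Suc 0"]] by blast
  have "((\<lambda>z. klein_inv (klein z)) has_derivative (\<lambda>h. L (K' h))) (at z)"
    by (rule has_derivative_compose[OF assms(2) L])
  moreover have "((\<lambda>z. klein_inv (klein z)) has_derivative (\<lambda>h. h)) (at z)"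
    by (rule has_derivative_transform_within_open[where s="ball 0 1" and f="\<lambda>z. z"])
      (use assms klein_inv_klein in auto)
  ultimately have "L (K' h) = h" for h using has_derivative_unique by metis
  then have "inj K'" by (metis injI)
  moreover have "linear K'" using assms(2) by (rule has_derivative_linear)
  ultimately have "surj K'" by (simp add: linear_injective_imp_surjective)
  then show thesis using that by (metis surjD)
qed

lemma spacelike_disc:
  assumes "cmod w < 1" "k \<noteq> 0" shows "gm w k > 0"
proof -
  define z where "z = klein_inv w"
  have z: "cmod z < 1" "klein z = w" using klein_klein_inv[of w] assms by (auto simp: z_def)
  obtain K' where K: "(klein has_derivative K') (at z)"
    using Ck_on_SucD[OF Ck_on_klein[of "Suc 0"]] by blast
  obtain h where h: "K' h = k" by (rule klein_derivative_surj[OF z(1) K])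
  have "h \<noteq> 0" using h assms(2) linear_0[OF has_derivative_linear[OF K]] by auto
  then have "(cmod (aa z) - cmod (bb z))\<^sup>2 * (cmod h)\<^sup>2 > 0" using aa_bb_less[OF z(1)] by simp
  then show ?thesis using chain_klein[OF z(1) K, of h] metric_disc[of z h] by (simp add: gm_def z h)
qed

lemma not_spacelike_outside:
  assumes "w \<in> Pol" "cmod w \<ge> 1" obtains h where "h \<noteq> 0" "gm w h = 0"
proof -
  define R where "R = (cmod w)\<^sup>2"
  have R: "R \<ge> 1" using assms by (simp add: R_def)
  have w0: "w \<noteq> 0" using assms by auto
  \<comment> \<open>This vector is parallel to a tangent from \<open>w\<close> to the unit circle, a
    null direction of \<open>N w\<close>.\<close>
  define h where "h = w * Complex (sqrt (R - 1)) 1"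
  have "(cmod (Complex (sqrt (R - 1)) 1))\<^sup>2 = R" using R by (simp add: cmod_power2)
  then have "(cmod h)\<^sup>2 = R * R" by (simp only: h_def norm_mult power_mult_distrib R_def)
  moreover have "Re (cnj w * h) = R * sqrt (R - 1)"
  proof -
    have "w * cnj w = of_real R" by (simp only: R_def complex_norm_square)
    then have "cnj w * h = of_real R * Complex (sqrt (R - 1)) 1"
      unfolding h_def by (metis mult.assoc mult.commute)
    then show ?thesis by simp
  qed
  ultimately have "N w h = 0" using R by (simp add: N_def R_def[symmetric] power_mult_distrib) (simp add: power2_eq_square algebra_simps)
  then have "gm w h = 0" using conformal[OF assms(1), of w h] w0 by (simp add: N_self)
  moreover have "Complex (sqrt (R - 1)) 1 \<noteq> 0" by (simp add: complex_eq_iff)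
  then have "h \<noteq> 0" using w0 by (simp add: h_def)
  ultimately show thesis using that by blast
qed

end

section \<open>The Jacobian does not vanish\<close>

context kobayashi begin

definition Jac where "Jac w = Im (cnj (DF w 1) * DF w \<i>)"

lemma kernel_of_Jac_0: assumes "Jac w = 0" obtains h where "h \<noteq> 0" "DF w h = 0"
proof (cases "DF w 1 = 0")
  case True then show thesis using that[of 1] by simp
next
  case False
  define p q where "p = DF w 1" and "q = DF w \<i>"
  define r where "r = Re (cnj p * q) / (cmod p)\<^sup>2"
  have p: "p \<noteq> 0" using False by (simp add: p_def)
  have "cnj p * q = of_real (Re (cnj p * q))" using assms by (simp add: Jac_def p_def q_def complex_eq_iff)
  then have "cnj p * q = of_real r * (p * cnj p)"
    using p by (simp add: r_def complex_norm_square[symmetric] del: times_complex.simps)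
  then have "cnj p * (q - of_real r * p) = 0" by (simp add: algebra_simps)
  then have "q - of_real r * p = 0" using p by simp
  moreover have "DF w (\<i> - of_real r) = q - of_real r * p"
    using complex_linear_eq[OF DF_linear, of w "\<i> - of_real r"]
    by (simp add: p_def q_def scaleR_conv_of_real)
  ultimately show thesis using that[of "\<i> - of_real r"] by (auto simp: complex_eq_iff)
qed

lemma tangent_roots:
  assumes "w \<in> Pol" "cmod w > 1"
  obtains x y where "x < y" "y - x \<le> \<gamma>" "cis x + cis y = 2 / cnj w" "cis x * cis y = w / cnj w" "cis x \<noteq> cis y"
proof -
  have "Re (w * cnj (\<zeta> j)) \<le> 1" if "j < 2*n" for j
    using ell_pos[OF assms(1) that] unfolding ell_def by linarith
  then obtain \<theta> s where s: "0 < s" "s < pi / 2" "2 * s \<le> \<gamma>" "w = of_real (1 / cos s) * cis \<theta>"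
    by (rule tangent_points[OF assms(2)])
  have c: "cos s > 0" using s by (intro cos_gt_zero_pi) auto
  have cw: "cnj w = of_real (1 / cos s) * cis (- \<theta>)" by (simp add: s(4) cis_cnj)
  show thesis
  proof (rule that[of "\<theta> - s" "\<theta> + s"])
    have "cis (\<theta> - s) + cis (\<theta> + s) = 2 * of_real (cos s) * cis \<theta>"
      by (simp add: complex_eq_iff cos_add cos_diff sin_add sin_diff)
    also have "\<dots> = 2 / cnj w" unfolding cw using c by (simp add: field_simps cis_mult)
    finally show "cis (\<theta> - s) + cis (\<theta> + s) = 2 / cnj w" .
    have "w / cnj w = cis \<theta> / cis (- \<theta>)" unfolding s(4) cw[unfolded s(4)] using c by simp
    then show "cis (\<theta> - s) * cis (\<theta> + s) = w / cnj w" by (simp add: cis_mult cis_divide)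
    show "cis (\<theta> - s) \<noteq> cis (\<theta> + s)"
    proof
      assume "cis (\<theta> - s) = cis (\<theta> + s)"
      then have "sin \<theta> * sin s = 0" "cos \<theta> * sin s = 0"
        by (simp_all add: complex_eq_iff cos_add cos_diff sin_add sin_diff)
      moreover have "sin s > 0" using s by (intro sin_gt_zero) auto
      ultimately have "sin \<theta> = 0" "cos \<theta> = 0" by auto
      then show False using sin_cos_squared_add[of \<theta>] by simp
    qed
  qed (use s in auto)
qed

lemma aa_bb_products:
  assumes "z1 \<notin> \<zeta> ` {..<2*n}" "z2 \<notin> \<zeta> ` {..<2*n}"
  shows "aa z1 * bb z2 - aa z2 * bb z1 = ((B z1 * Bs z2)\<^sup>2 - (B z2 * Bs z1)\<^sup>2) / (Q z1 * Q z2)"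
    "aa z1 * bb z2 + aa z2 * bb z1 - 2 * cc z1 * cc z2 = - (B z1 * Bs z2 - B z2 * Bs z1)\<^sup>2 / (Q z1 * Q z2)"
  using Q_nz[OF assms(1)] Q_nz[OF assms(2)]
  by (simp_all add: aa_def bb_def cc_def divide_simps) (simp_all add: power2_eq_square algebra_simps)

lemma Jac_outside: assumes "w \<in> Pol" "cmod w > 1" shows "Jac w \<noteq> 0"
proof -
  obtain x y where xy: "x < y" "y - x \<le> \<gamma>" and z: "cis x + cis y = 2 / cnj w" "cis x * cis y = w / cnj w" "cis x \<noteq> cis y"
    by (rule tangent_roots[OF assms])
  have w0: "w \<noteq> 0" using assms by auto
  note nz = DF_generic(4,5)[OF assms(1) w0 z]
  have "(cis y)\<^sup>2 - (cis x)\<^sup>2 = - ((cis x + cis y) * (cis x - cis y))" by (simp add: power2_eq_square algebra_simps)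
  then have "(cis y)\<^sup>2 - (cis x)\<^sup>2 \<noteq> 0" using z w0 by simp
  moreover have "aa (cis x) * bb (cis y) - aa (cis y) * bb (cis x) \<noteq> 0"
    unfolding aa_bb_products(1)[OF nz] using Q_nz[OF nz(1)] Q_nz[OF nz(2)] B_Bs_independent[OF xy] by simp
  ultimately have "complex_of_real (Jac w) \<noteq> 0"
    unfolding Jac_def Jacobian_generic[OF assms(1) w0 z] using z w0 by simp
  then show ?thesis by simp
qed

lemma gm_nonzero_outside: assumes "w \<in> Pol" "cmod w > 1" "N w h \<noteq> 0" shows "gm w h \<noteq> 0"
proof -
  obtain x y where xy: "x < y" "y - x \<le> \<gamma>" and z: "cis x + cis y = 2 / cnj w" "cis x * cis y = w / cnj w" "cis x \<noteq> cis y"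
    by (rule tangent_roots[OF assms(1,2)])
  have w0: "w \<noteq> 0" using assms by auto
  note nz = DF_generic(4,5)[OF assms(1) w0 z]
  have "B (cis x) * Bs (cis y) - B (cis y) * Bs (cis x) \<noteq> 0" using B_Bs_independent[OF xy] by auto
  then have "complex_of_real (gm w h) \<noteq> 0"
    unfolding gm_generic[OF assms(1) w0 z] aa_bb_products(2)[OF nz]
    using z w0 Q_nz[OF nz(1)] Q_nz[OF nz(2)] assms(3) by simp
  then show ?thesis by simp
qed

text \<open>In a kernel direction of \<open>DF\<close> only the time coordinate moves, so that
  direction would not be space-like.\<close>

lemma Jac_inside: assumes "cmod w < 1" shows "Jac w \<noteq> 0"
proof
  assume "Jac w = 0"
  then obtain h where h: "h \<noteq> 0" "DF w h = 0" by (rule kernel_of_Jac_0)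
  have "gm w h \<le> 0" unfolding gm_def h(2) by simp
  then show False using spacelike_disc[OF assms h(1)] by simp
qed

text \<open>The confluent case of \<open>derivative_coefficients\<close>: on the circle both roots
  equal \<open>w\<close>, so the difference quotient turns into a derivative and squared
  denominators appear.\<close>

lemma circle_coefficients:
  fixes c :: "nat \<Rightarrow> complex"
  assumes w: "w \<in> Pol" "cmod w = 1" and c: "(\<Sum>j<2*n. c j) = 0"
  shows "(\<Sum>j<2*n. of_real (- Re (h * cnj (\<zeta> j)) / ell j w) * c j)
      = w * ((h + w\<^sup>2 * cnj h) * (\<Sum>j<2*n. c j / (w - \<zeta> j)\<^sup>2) - 2 * w * cnj h * (\<Sum>j<2*n. c j / (w - \<zeta> j)))"
proof -
  have w0: "w \<noteq> 0" and ww: "w * cnj w = 1" using w(2) complex_norm_square[of w] by auto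
  have trm: "of_real (- Re (h * cnj (\<zeta> j)) / ell j w) * c j
     = w * cnj h * c j + w * ((h + w\<^sup>2 * cnj h) * (c j / (w - \<zeta> j)\<^sup>2) - 2 * w * cnj h * (c j / (w - \<zeta> j)))"
    if j: "j < 2*n" for j
  proof -
    define x where "x = w - \<zeta> j"
    have L: "ell j w \<noteq> 0" using ell_pos[OF w(1) j] by simp
    have e: "of_real (ell j w) = 1 - (w * cnj (\<zeta> j) + cnj w * \<zeta> j) / 2"
      by (simp add: ell_def complex_eq_iff field_simps)
    have f1: "of_real (ell j w) * (2 * w * \<zeta> j) = - x\<^sup>2"
    proof -
      have "of_real (ell j w) * (2 * w * \<zeta> j) = 2 * w * \<zeta> j - w\<^sup>2 * (\<zeta> j * cnj (\<zeta> j)) - (w * cnj w) * (\<zeta> j)\<^sup>2"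
        unfolding e by (simp add: power2_eq_square algebra_simps)
      then show ?thesis unfolding zeta_cnj ww x_def by (simp add: power2_eq_square algebra_simps)
    qed
    have xn: "x \<noteq> 0" using f1 L w0 by auto
    have R: "of_real (Re (h * cnj (\<zeta> j))) = (h * cnj (\<zeta> j) + cnj h * \<zeta> j) / 2"
      by (simp add: complex_eq_iff field_simps)
    have "of_real (Re (h * cnj (\<zeta> j))) * (2 * w * \<zeta> j) = w * (h * (\<zeta> j * cnj (\<zeta> j)) + cnj h * (\<zeta> j)\<^sup>2)"
      unfolding R by (simp add: power2_eq_square algebra_simps)
    then have f2: "of_real (Re (h * cnj (\<zeta> j))) * (2 * w * \<zeta> j) = w * (h + cnj h * (\<zeta> j)\<^sup>2)" by (simp add: zeta_cnj)
    have gen: "complex_of_real (- r / l) = - (of_real r * t / (of_real l * t))" if "t \<noteq> 0" for r l t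
      using that by simp
    have "2 * w * \<zeta> j \<noteq> 0" using w0 by simp
    from gen[OF this, of "Re (h * cnj (\<zeta> j))" "ell j w", unfolded f1 f2]
    have r: "of_real (- Re (h * cnj (\<zeta> j)) / ell j w) = w * (h + cnj h * (\<zeta> j)\<^sup>2) / x\<^sup>2"
      by (simp only: minus_divide_right minus_minus)
    have zx: "w - x = \<zeta> j" by (simp add: x_def)
    have "w * (h + cnj h * (w - x)\<^sup>2) * k * c j = w * cnj h * c j * (x\<^sup>2 * k)
        + w * ((h + w\<^sup>2 * cnj h) * (c j * k) - 2 * w * cnj h * (c j * (x * k)))" for k
      by (simp add: power2_eq_square algebra_simps)
    note alg = this[of "1 / x\<^sup>2"]
    have k: "x\<^sup>2 * (1 / x\<^sup>2) = 1" "x * (1 / x\<^sup>2) = 1 / x" using xn by (simp_all add: power2_eq_square)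
    show ?thesis using alg unfolding r x_def[symmetric] k zx
      by (simp only: times_divide_eq_right times_divide_eq_left mult_1_right)
  qed
  have "(\<Sum>j<2*n. of_real (- Re (h * cnj (\<zeta> j)) / ell j w) * c j)
    = (\<Sum>j<2*n. w * cnj h * c j + w * ((h + w\<^sup>2 * cnj h) * (c j / (w - \<zeta> j)\<^sup>2) - 2 * w * cnj h * (c j / (w - \<zeta> j))))"
    using trm by (intro sum.cong) auto
  also have "\<dots> = w * ((h + w\<^sup>2 * cnj h) * (\<Sum>j<2*n. c j / (w - \<zeta> j)\<^sup>2) - 2 * w * cnj h * (\<Sum>j<2*n. c j / (w - \<zeta> j)))"
    unfolding sum.distrib sum_subtractf sum_distrib_left[symmetric] c by simp
  finally show ?thesis .
qed

lemma vector_derivative_on_circle: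
  fixes c :: "nat \<Rightarrow> complex"
  assumes x: "cis x \<notin> \<zeta> ` {..<2*n}" and S: "\<And>z. z \<notin> \<zeta> ` {..<2*n} \<Longrightarrow> S z = (\<Sum>j<2*n. c j / (z - \<zeta> j))"
  shows "((\<lambda>x. S (cis x)) has_vector_derivative (- \<i> * cis x * (\<Sum>j<2*n. c j / (cis x - \<zeta> j)\<^sup>2))) (at x)"
proof (rule has_vector_derivative_transform_within_open)
  have nz: "cis x - \<zeta> j \<noteq> 0" if "j < 2*n" for j using x that by auto
  have 1: "((\<lambda>z. \<Sum>j<2*n. c j / (z - \<zeta> j)) has_field_derivative (\<Sum>j<2*n. - (c j / (cis x - \<zeta> j)\<^sup>2))) (at (cis x))"
  proof (rule DERIV_sum)
    fix j assume "j \<in> {..<2*n}"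
    then show "((\<lambda>z. c j / (z - \<zeta> j)) has_field_derivative - (c j / (cis x - \<zeta> j)\<^sup>2)) (at (cis x))"
      using nz[of j] by (auto intro!: derivative_eq_intros simp: power2_eq_square)
  qed
  have 2: "(cis has_vector_derivative \<i> * cis x) (at x)"
    unfolding has_vector_derivative_def
    by (auto intro!: derivative_eq_intros has_derivative_cis simp: scaleR_conv_of_real algebra_simps)
  from field_vector_diff_chain_at[OF 2 1]
  show "((\<lambda>x. \<Sum>j<2*n. c j / (cis x - \<zeta> j)) has_vector_derivative (- \<i> * cis x * (\<Sum>j<2*n. c j / (cis x - \<zeta> j)\<^sup>2))) (at x)"
    by (simp add: o_def sum_negf mult_ac)
  show "open {x. cis x \<notin> \<zeta> ` {..<2*n}}"
  proof -
    have "open (cis -` (- (\<zeta> ` {..<2*n})))"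
      by (intro open_vimage open_Compl finite_imp_closed finite_imageI finite_lessThan continuous_on_cis continuous_on_id)
    then show ?thesis by (simp add: vimage_def)
  qed
  show "x \<in> {x. cis x \<notin> \<zeta> ` {..<2*n}}" using x by simp
  show "(\<Sum>j<2*n. c j / (cis y - \<zeta> j)) = S (cis y)" if "y \<in> {x. cis x \<notin> \<zeta> ` {..<2*n}}" for y
    using S that by simp
qed

lemma bb_circle: "bb (cis x) = cis (2 * \<tau> x) * aa (cis x)"
  by (simp add: bb_def aa_def cis_tau power_mult_distrib Complex.DeMoivre)

text \<open>When \<open>bb = cis (2 * \<tau>) * aa\<close> is differentiated along the circle, the
  terms with the derivative of \<open>aa\<close> cancel in the determinant and leave
  \<open>\<tau>'\<close> times nonzero factors. The growth of the argument of g thus decides this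
  limit case as well.\<close>

lemma Jac_circle: assumes w: "w \<in> Pol" "cmod w = 1" shows "Jac w \<noteq> 0"
proof -
  define x where "x = Arg w"
  have wx: "cis x = w" using w(2) by (metis cis_Arg norm_zero sgn_eq x_def zero_neq_one div_by_1 of_real_1)
  have nz: "w \<notin> \<zeta> ` {..<2*n}"
  proof
    assume "w \<in> \<zeta> ` {..<2*n}"
    then obtain j where j: "j < 2*n" "w = \<zeta> j" by auto
    have "ell j w = 0" using j zeta_cnj[of j] by (simp add: ell_def)
    then show False using ell_pos[OF w(1) j(1)] by simp
  qed
  define a2 b2 where "a2 = (\<Sum>j<2*n. cnj (\<beta> j) / (w - \<zeta> j)\<^sup>2)" and "b2 = (\<Sum>j<2*n. \<beta> j / (w - \<zeta> j)\<^sup>2)"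
  have w0: "w \<noteq> 0" using w by auto
  have a0: "aa w \<noteq> 0" using Q_nz[OF nz] Bs_nz[of w] w by (simp add: aa_def)
  have sa: "(\<Sum>j<2*n. cnj (\<beta> j)) = 0" using arg_cong[OF sum_beta, of cnj] by simp
  have F: "DF w h = w * ((h + w\<^sup>2 * cnj h) * b2 - 2 * w * cnj h * bb w)" for h
    using circle_coefficients[OF w sum_beta, of h] by (simp add: DF_def scaleR_conv_of_real b2_def bb_eq[OF nz])
  have Fc: "cnj (DF w h) = w * ((h + w\<^sup>2 * cnj h) * a2 - 2 * w * cnj h * aa w)" for h
    using circle_coefficients[OF w sa, of h] by (simp add: DF_def scaleR_conv_of_real a2_def aa_eq[OF nz])
  have da: "((\<lambda>x. aa (cis x)) has_vector_derivative (- \<i> * w * a2)) (at x)"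
    using vector_derivative_on_circle[of x aa, OF _ aa_eq] nz by (simp add: wx a2_def)
  have db: "((\<lambda>x. bb (cis x)) has_vector_derivative (- \<i> * w * b2)) (at x)"
    using vector_derivative_on_circle[of x bb, OF _ bb_eq] nz by (simp add: wx b2_def)
  have dt: "((\<lambda>x. cis (2 * \<tau> x)) has_vector_derivative (of_real (2 * \<tau>' x) * (\<i> * cis (2 * \<tau> x)))) (at x)"
  proof -
    have "((\<lambda>x. 2 * \<tau> x) has_derivative (\<lambda>h. 2 * \<tau>' x * h)) (at x)"
      using DERIV_cmult[OF tau_deriv[of x], of 2] by (simp add: has_field_derivative_def)
    from has_derivative_cis[OF this] show ?thesis
      by (simp add: has_vector_derivative_def scaleR_conv_of_real mult_ac)
  qed
  have "((\<lambda>x. bb (cis x)) has_vector_derivative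
     (cis (2 * \<tau> x) * (- \<i> * w * a2) + of_real (2 * \<tau>' x) * (\<i> * cis (2 * \<tau> x)) * aa (cis x))) (at x)"
    unfolding bb_circle by (rule has_vector_derivative_mult[OF dt da])
  from vector_derivative_unique_at[OF db this]
  have "\<i> * (w * b2) = \<i> * (w * cis (2 * \<tau> x) * a2 - of_real (2 * \<tau>' x) * cis (2 * \<tau> x) * aa w)"
    by (simp add: wx algebra_simps)
  then have wb2: "w * b2 = w * cis (2 * \<tau> x) * a2 - of_real (2 * \<tau>' x) * cis (2 * \<tau> x) * aa w"
    by (simp only: mult_cancel_left) simp
  have bw: "bb w = cis (2 * \<tau> x) * aa w" using bb_circle[of x] by (simp add: wx)
  have i: "of_real (Im (cnj x * y)) = (cnj x * y - x * cnj y) / (2 * \<i>)" for x y by (simp add: complex_eq_iff diff_divide_distrib)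
  have "of_real (Jac w) = (cnj (DF w 1) * DF w \<i> - DF w 1 * cnj (DF w \<i>)) / (2 * \<i>)"
    unfolding Jac_def by (rule i)
  also have "cnj (DF w 1) * DF w \<i> - DF w 1 * cnj (DF w \<i>) = 4 * \<i> * w\<^sup>2 * (a2 * bb w * w - aa w * (w * b2))"
    unfolding Fc unfolding F by (simp add: power2_eq_square algebra_simps)
  also have "a2 * bb w * w - aa w * (w * b2) = of_real (2 * \<tau>' x) * cis (2 * \<tau> x) * (aa w)\<^sup>2"
    unfolding wb2 bw by (simp add: power2_eq_square algebra_simps)
  finally have "complex_of_real (Jac w) \<noteq> 0"
    using w0 a0 tau'_bounds(1)[of x] by (simp add: cis_neq_zero)
  then show ?thesis by simp
qed

lemma Jac_nz: "w \<in> Pol \<Longrightarrow> Jac w \<noteq> 0"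
  using Jac_circle Jac_inside Jac_outside by (metis linorder_neqE)

end

section \<open>The projection to the plane\<close>

lemma complex_derivative_locally_injective:
  fixes F :: "complex \<Rightarrow> complex"
  assumes S: "open S" "a \<in> S" and F: "\<And>x. x \<in> S \<Longrightarrow> (F has_derivative D x) (at x)"
    and c: "continuous_on S (\<lambda>x. D x 1)" "continuous_on S (\<lambda>x. D x \<i>)"
    and J: "Im (cnj (D a 1) * D a \<i>) \<noteq> 0"
  obtains r where "r > 0" "ball a r \<subseteq> S" "inj_on F (ball a r)"
proof -
  define g where "g = (\<lambda>v. Complex (- Im (cnj (D a \<i>) * v) / Im (cnj (D a 1) * D a \<i>))
        (Im (cnj (D a 1) * v) / Im (cnj (D a 1) * D a \<i>)))"
  have lin: "linear (D x)" if "x \<in> S" for x using F[OF that] by (rule has_derivative_linear)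
  have Drep: "D x h = of_real (Re h) * D x 1 + of_real (Im h) * D x \<i>" if "x \<in> S" for x h
    using complex_linear_eq[OF lin[OF that], of h] by (simp add: scaleR_conv_of_real)
  show thesis
  proof (rule has_derivative_locally_injective[OF S(2,1) _ _ F])
    have "linear g"
      by (rule linearI) (simp_all add: g_def complex_eq_iff add_divide_distrib diff_divide_distrib algebra_simps)
    then show "bounded_linear g" by (simp add: linear_conv_bounded_linear)
    show "g \<circ> D a = id"
    proof
      fix h show "(g \<circ> D a) h = id h"
        using J Drep[OF S(2), of h]
        by (auto simp: g_def complex_eq_iff divide_simps) (simp_all add: algebra_simps)
    qed
    fix e :: real assume e: "e > 0"
    have "isCont (\<lambda>x. D x 1) a" "isCont (\<lambda>x. D x \<i>) a" using c S continuous_on_eq_continuous_at by blast+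
    then obtain d1 d2 where d: "d1 > 0" "\<And>x. dist x a < d1 \<Longrightarrow> dist (D x 1) (D a 1) < e / 4"
       "d2 > 0" "\<And>x. dist x a < d2 \<Longrightarrow> dist (D x \<i>) (D a \<i>) < e / 4"
      using e unfolding continuous_at_eps_delta by (metis zero_less_divide_iff zero_less_numeral)
    obtain d3 where d3: "d3 > 0" "ball a d3 \<subseteq> S" using S openE by blast
    show "\<exists>d>0. \<forall>x. dist a x < d \<longrightarrow> onorm (\<lambda>v. D x v - D a v) < e"
    proof (intro exI[of _ "min d1 (min d2 d3)"] conjI allI impI)
      fix x assume x: "dist a x < min d1 (min d2 d3)"
      have xS: "x \<in> S" using x d3 by auto
      have "onorm (\<lambda>v. D x v - D a v) \<le> e / 2"
      proof (rule onorm_le)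
        fix v
        have "D x v - D a v = of_real (Re v) * (D x 1 - D a 1) + of_real (Im v) * (D x \<i> - D a \<i>)"
          unfolding Drep[OF xS, of v] Drep[OF S(2), of v] by (simp add: algebra_simps)
        then have "cmod (D x v - D a v) \<le> \<bar>Re v\<bar> * cmod (D x 1 - D a 1) + \<bar>Im v\<bar> * cmod (D x \<i> - D a \<i>)"
          using norm_triangle_ineq[of "of_real (Re v) * (D x 1 - D a 1)" "of_real (Im v) * (D x \<i> - D a \<i>)"]
          by (simp add: norm_mult)
        also have "\<dots> \<le> cmod v * (e / 4) + cmod v * (e / 4)"
        proof -
          have "dist x a < d1" "dist x a < d2" using x by (simp_all add: dist_commute)
          from d(2)[OF this(1)] d(4)[OF this(2)]
          have "cmod (D x 1 - D a 1) \<le> e / 4" "cmod (D x \<i> - D a \<i>) \<le> e / 4" unfolding dist_norm by linarith+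
          then show ?thesis by (intro add_mono mult_mono abs_Re_le_cmod abs_Im_le_cmod) simp_all
        qed
        finally show "cmod (D x v - D a v) \<le> e / 2 * cmod v" by (simp add: mult.commute)
      qed
      then show "onorm (\<lambda>v. D x v - D a v) < e" using e by linarith
    qed (use d d3 in auto)
  qed (use that in blast)+
qed

lemma Dx_Dy_has_derivative:
  assumes "(l has_derivative l') (at p)"
  shows "Dx l p = l' (1, 0)" "Dy l p = l' (0, 1)"
proof -
  obtain x y where p: "p = (x, y)" by (cases p)
  have lin: "linear l'" using assms by (rule has_derivative_linear)
  have sc: "l' (h, 0) = h * l' (1, 0)" "l' (0, h) = h * l' (0, 1)" for h
    using linear_cmul[OF lin, of h "(1, 0)"] linear_cmul[OF lin, of h "(0, 1)"] by simp_all
  have "((\<lambda>t. l (t, y)) has_derivative (\<lambda>h. l' (h, 0))) (at x)"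
    by (rule has_derivative_compose[of "\<lambda>t. (t, y)" "\<lambda>h. (h, 0)" x UNIV l l', OF has_derivative_Pair[OF has_derivative_ident has_derivative_const]])
      (use assms p in simp)
  then have "((\<lambda>t. l (t, y)) has_real_derivative l' (1, 0)) (at x)"
    unfolding has_field_derivative_def by (rule has_derivative_eq_rhs) (rule ext, subst sc(1), rule mult.commute)
  then show "Dx l p = l' (1, 0)" by (simp add: Dx_def p DERIV_imp_deriv)
  have "((\<lambda>t. l (x, t)) has_derivative (\<lambda>h. l' (0, h))) (at y)"
    by (rule has_derivative_compose[of "\<lambda>t. (x, t)" "\<lambda>h. (0, h)" y UNIV l l', OF has_derivative_Pair[OF has_derivative_const has_derivative_ident]])
      (use assms p in simp)
  then have "((\<lambda>t. l (x, t)) has_real_derivative l' (0, 1)) (at y)"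
    unfolding has_field_derivative_def by (rule has_derivative_eq_rhs) (rule ext, subst sc(2), rule mult.commute)
  then show "Dy l p = l' (0, 1)" by (simp add: Dy_def p DERIV_imp_deriv)
qed

lemma has_derivative_Dx_Dy:
  assumes "(l has_derivative l') (at p)"
  shows "l' (a, b) = Dx l p * a + Dy l p * b"
proof -
  have lin: "linear l'" using assms by (rule has_derivative_linear)
  have "l' (a, b) = l' (a *\<^sub>R (1, 0) + b *\<^sub>R (0, 1))" by simp
  also have "\<dots> = a *\<^sub>R l' (1, 0) + b *\<^sub>R l' (0, 1)"
    using lin by (simp only: linear_add linear_cmul)
  finally show ?thesis using Dx_Dy_has_derivative[OF assms] by (simp add: mult.commute)
qed

text \<open>The contraction of the second fundamental form with the adjugate of the first one. The
  numbers \<open>x\<^sub>i, y\<^sub>i, h\<^sub>i\<close> are the components of the partial derivatives of an immersion whose first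
  fundamental form is \<open>m\<close> times the adjugate of \<open>1 - w w\<^sup>T\<close>.\<close>

lemma zmc_algebra:
  fixes P R x1 y1 x2 y2 h1 h2 m w1 w2 px py rx ry :: real
  assumes h1: "P * x1 + R * y1 = h1" and h2: "P * x2 + R * y2 = h2"
    and g: "x1\<^sup>2 + y1\<^sup>2 - h1\<^sup>2 = m * (1 - w2\<^sup>2)" "x1 * x2 + y1 * y2 - h1 * h2 = m * (w1 * w2)" "x2\<^sup>2 + y2\<^sup>2 - h2\<^sup>2 = m * (1 - w1\<^sup>2)"
    and J: "x1 * y2 - y1 * x2 \<noteq> 0"
    and q: "q11 = (px * x1 + py * y1) * x1 + (rx * x1 + ry * y1) * y1"
      "q12 = (px * x2 + py * y2) * x1 + (rx * x2 + ry * y2) * y1"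
      "q21 = (px * x1 + py * y1) * x2 + (rx * x1 + ry * y1) * y2"
      "q22 = (px * x2 + py * y2) * x2 + (rx * x2 + ry * y2) * y2"
    and s: "q12 = q21" and K: "(1 - w1\<^sup>2) * q11 - 2 * (w1 * w2) * q12 + (1 - w2\<^sup>2) * q22 = 0"
  shows "(1 - R\<^sup>2) * px + 2 * P * R * py + (1 - P\<^sup>2) * ry = 0"
proof -
  \<comment> \<open>Symmetry of the pulled back Hessian passes to the Hessian itself, since its
    antisymmetric part is multiplied by the Jacobian.\<close>
  have "(rx - py) * (x1 * y2 - y1 * x2) = 0" using s unfolding q by (simp add: algebra_simps)
  then have rx: "rx = py" using J by simp
  \<comment> \<open>After multiplication by \<open>m\<close> the coefficients are entries of the
    first fundamental form; only the Jacobian is divided out at the end.\<close>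
  have "0 = m * ((1 - w1\<^sup>2) * q11 - 2 * (w1 * w2) * q12 + (1 - w2\<^sup>2) * q22)" using K by simp
  also have "\<dots> = (m * (1 - w1\<^sup>2)) * q11 - 2 * (m * (w1 * w2)) * q12 + (m * (1 - w2\<^sup>2)) * q22"
    by (simp add: algebra_simps)
  also have "\<dots> = (x1 * y2 - y1 * x2)\<^sup>2 * ((1 - R\<^sup>2) * px + 2 * P * R * py + (1 - P\<^sup>2) * ry)"
    unfolding g[symmetric] q rx h1[symmetric] h2[symmetric] by (simp add: power2_eq_square algebra_simps)
  finally show ?thesis using J by simp
qed

context kobayashi begin

text \<open>Every direction is within \<open>\<gamma> / 2\<close> of a point of contact, which
  bounds the distance of a vertex from the centre.\<close>

lemma bounded_Pol: "Pol \<subseteq> cball 0 (1 / cos (\<gamma> / 2))"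
proof
  fix w assume w: "w \<in> Pol"
  define \<theta> where "\<theta> = Arg w"
  have w': "w = of_real (cmod w) * cis \<theta>" using rcis_cmod_Arg[of w] by (simp add: rcis_def \<theta>_def)
  obtain j where j: "j < 2 * n" "cos (\<theta> - \<alpha> j) \<ge> cos (\<gamma> / 2)" by (rule near_alpha)
  have "Re (w * cnj (\<zeta> j)) = cmod w * cos (\<theta> - \<alpha> j)"
    by (subst w') (simp add: \<zeta>_def cis_cnj cis_mult mult.assoc del: of_real_mult)
  then have "cmod w * cos (\<theta> - \<alpha> j) < 1" using ell_pos[OF w j(1)] unfolding ell_def by linarith
  moreover have "cmod w * cos (\<gamma> / 2) \<le> cmod w * cos (\<theta> - \<alpha> j)" using j by (intro mult_left_mono) auto
  ultimately have "cmod w * cos (\<gamma> / 2) \<le> 1" by linarith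
  then show "w \<in> cball 0 (1 / cos (\<gamma> / 2))" using cos_gamma_pos by (simp add: pos_le_divide_eq)
qed

text \<open>The residue is a real multiple of the value \<open>cis (\<tau> x)\<close> of g at
  \<open>\<zeta> j\<close>. Independence of two residues is thus again a question about the argument
  of g.\<close>

lemma beta_cis: assumes "j < 2 * n" "\<zeta> j = cis x" obtains r where "r \<noteq> 0" "\<beta> j = of_real r * cis (\<tau> x)"
proof (rule that)
  have "B (\<zeta> j) = cis (\<tau> x) * (\<zeta> j ^ (n - 1) * cnj (B (\<zeta> j)))"
    using cis_tau[of x] Bs_circle[OF norm_zeta] by (simp add: assms(2)[symmetric])
  then have "(B (\<zeta> j))\<^sup>2 = (B (\<zeta> j) * cnj (B (\<zeta> j))) * cis (\<tau> x) * \<zeta> j ^ (n - 1)"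
    unfolding power2_eq_square by (metis mult.assoc mult.commute)
  then have "(B (\<zeta> j))\<^sup>2 / \<zeta> j ^ (n - 1) = of_real ((cmod (B (\<zeta> j)))\<^sup>2) * cis (\<tau> x)"
    by (simp only: complex_norm_square) simp
  then show "\<beta> j = of_real (\<mu> j * (cmod (B (\<zeta> j)))\<^sup>2) * cis (\<tau> x)"
    unfolding beta_eq[OF assms(1)] times_divide_eq_right[symmetric] by (simp only: of_real_mult mult.assoc)
  show "\<mu> j * (cmod (B (\<zeta> j)))\<^sup>2 \<noteq> 0" using mu_nz[OF assms(1)] B_circle_nz[of "\<zeta> j"] by simp
qed

text \<open>At a vertex of the polygon two logarithms blow up, but their coefficients are linearly
  independent, so one of them can be isolated by a linear functional.\<close>

lemma active_functional:
  assumes ge: "\<And>j. j < 2 * n \<Longrightarrow> ell j x \<ge> 0" and j: "j < 2 * n" "ell j x = 0"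
  obtains d where "Re (cnj d * \<beta> j) \<noteq> 0" "\<And>i. i < 2 * n \<Longrightarrow> ell i x = 0 \<Longrightarrow> i \<noteq> j \<Longrightarrow> Re (cnj d * \<beta> i) = 0"
proof -
  have sq: "Re (cnj v * v) = (cmod v)\<^sup>2" for v unfolding cmod_power2 by (simp add: power2_eq_square)
  show thesis
  proof (cases "\<exists>i<2*n. ell i x = 0 \<and> i \<noteq> j")
    case False
    moreover have "Re (cnj (\<beta> j) * \<beta> j) \<noteq> 0" unfolding sq using beta_nz[OF j(1)] by simp
    ultimately show ?thesis by (intro that[of "\<beta> j"]) auto
  next
    case True
    then obtain i where i: "i < 2*n" "ell i x = 0" "i \<noteq> j" by auto
    have re1: "Re (x * cnj (\<zeta> k)) = 1" if "ell k x = 0" for k using that unfolding ell_def by linarith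
    have "1 \<le> cmod x" using complex_Re_le_cmod[of "x * cnj (\<zeta> j)"] re1[OF j(2)] by (simp add: norm_mult)
    \<comment> \<open>On the circle a vanishing side forces \<open>x = \<zeta> k\<close>, so two
      distinct sides cannot both vanish there.\<close>
    moreover have "cmod x \<noteq> 1"
    proof
      assume x1: "cmod x = 1"
      have "x = \<zeta> k" if "ell k x = 0" for k
      proof -
        have "(cmod (x - \<zeta> k))\<^sup>2 = (cmod x)\<^sup>2 + (cmod (\<zeta> k))\<^sup>2 - 2 * Re (x * cnj (\<zeta> k))"
          unfolding cmod_power2 by (simp add: power2_eq_square algebra_simps)
        then show ?thesis unfolding re1[OF that] using x1 by simp
      qed
      then have "\<zeta> i = \<zeta> j" using i j by metis
      then show False using inj_zeta i j by (auto simp: inj_on_def)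
    qed
    ultimately have gt: "cmod x > 1" by simp
    have "Re (x * cnj (\<zeta> k)) \<le> 1" if "k < 2*n" for k using ge[OF that] unfolding ell_def by linarith
    then obtain \<theta> s where s: "0 < s" "s < pi / 2" "2 * s \<le> \<gamma>" "x = of_real (1 / cos s) * cis \<theta>"
      by (rule tangent_points[OF gt])
    have c: "cos s > 0" using s by (intro cos_gt_zero_pi) auto
    have pts: "\<zeta> k = cis (\<theta> + s) \<or> \<zeta> k = cis (\<theta> - s)" if "ell k x = 0" for k
    proof -
      have r: "Re (x * cnj (\<zeta> k)) = 1 / cos s * cos (\<theta> - \<alpha> k)"
        by (subst s(4)) (simp add: \<zeta>_def cis_cnj cis_mult mult.assoc del: of_real_mult of_real_divide)
      have "1 / cos s * cos (\<theta> - \<alpha> k) = 1" using re1[OF that] unfolding r .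
      then have e: "cos (\<alpha> k - \<theta>) = cos s" using c cos_minus[of "\<theta> - \<alpha> k"] by (simp add: field_simps)
      have "(sin (\<alpha> k - \<theta>))\<^sup>2 = (sin s)\<^sup>2" using e by (simp add: sin_squared_eq)
      then have "sin (\<alpha> k - \<theta>) = sin s \<or> sin (\<alpha> k - \<theta>) = - sin s" by (simp add: power2_eq_iff)
      then have "cis (\<alpha> k - \<theta>) = cis s \<or> cis (\<alpha> k - \<theta>) = cis (- s)" using e by (auto simp: complex_eq_iff)
      moreover have "\<zeta> k = cis \<theta> * cis (\<alpha> k - \<theta>)" by (simp add: \<zeta>_def cis_mult)
      moreover have "cis \<theta> * cis s = cis (\<theta> + s)" "cis \<theta> * cis (- s) = cis (\<theta> - s)" by (simp_all add: cis_mult)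
      ultimately show ?thesis by metis
    qed
    have neq: "\<zeta> i \<noteq> \<zeta> j" using inj_zeta i j by (auto simp: inj_on_def)
    have only: "k = i \<or> k = j" if "k < 2*n" "ell k x = 0" for k
    proof -
      have "\<zeta> k = \<zeta> i \<or> \<zeta> k = \<zeta> j" using pts[OF that(2)] pts[OF i(2)] pts[OF j(2)] neq by metis
      then show ?thesis using inj_zeta i j that by (auto simp: inj_on_def)
    qed
    have sn: "sin (\<tau> (\<theta> + s) - \<tau> (\<theta> - s)) > 0" using s by (intro sin_tau) auto
    have "\<exists>t u. \<zeta> i = cis t \<and> \<zeta> j = cis u \<and> sin (\<tau> u - \<tau> t) \<noteq> 0"
    proof (cases "\<zeta> i = cis (\<theta> - s)")
      case True
      then have "\<zeta> j = cis (\<theta> + s)" using pts[OF j(2)] neq by auto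
      then show ?thesis using True sn by (metis less_irrefl)
    next
      case False
      then have "\<zeta> i = cis (\<theta> + s)" "\<zeta> j = cis (\<theta> - s)" using pts[OF j(2)] pts[OF i(2)] neq by auto
      moreover have "sin (\<tau> (\<theta> - s) - \<tau> (\<theta> + s)) = - sin (\<tau> (\<theta> + s) - \<tau> (\<theta> - s))"
        by (metis minus_diff_eq sin_minus)
      ultimately show ?thesis using sn by (metis less_irrefl neg_equal_0_iff_equal)
    qed
    then obtain t u where tu: "\<zeta> i = cis t" "\<zeta> j = cis u" "sin (\<tau> u - \<tau> t) \<noteq> 0" by blast
    obtain r where r: "r \<noteq> 0" "\<beta> i = of_real r * cis (\<tau> t)" using beta_cis[OF i(1) tu(1)] by blast
    obtain q where q: "q \<noteq> 0" "\<beta> j = of_real q * cis (\<tau> u)" using beta_cis[OF j(1) tu(2)] by blast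
    \<comment> \<open>The functional is taken along \<open>\<i> * \<beta> i\<close>, which is
      orthogonal to \<open>\<beta> i\<close>.\<close>
    have "cnj (\<i> * \<beta> i) * \<beta> j = - \<i> * of_real (r * q) * cis (\<tau> u - \<tau> t)"
      by (simp add: r q cis_cnj cis_mult mult_ac)
    then have "Re (cnj (\<i> * \<beta> i) * \<beta> j) = Re (- \<i> * of_real (r * q) * cis (\<tau> u - \<tau> t))"
      by (rule arg_cong)
    also have "\<dots> = r * q * sin (\<tau> u - \<tau> t)" by simp
    finally have ij: "Re (cnj (\<i> * \<beta> i) * \<beta> j) \<noteq> 0" using r(1) q(1) tu(3) by (simp only: mult_eq_0_iff de_Morgan_disj) simp
    have ii: "Re (cnj (\<i> * \<beta> i) * \<beta> i) = 0" by simp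
    show ?thesis by (rule that[OF ij]) (use only ii in blast)
  qed
qed

text \<open>A sequence with values in \<open>K\<close> that tends to a side would send one logarithm
  to minus infinity; a functional that isolates this logarithm shows that it stays bounded
  instead.\<close>

lemma proper_F: assumes K: "compact K" shows "compact (Pol \<inter> F -` K)"
  unfolding compact_eq_bounded_closed
proof
  show "bounded (Pol \<inter> F -` K)" using bounded_Pol bounded_cball bounded_subset by (metis inf.coboundedI1)
  show "closed (Pol \<inter> F -` K)"
    unfolding closed_sequential_limits
  proof (intro allI impI, elim conjE)
    fix X l assume X: "\<forall>m. X m \<in> Pol \<inter> F -` K" and lim: "X \<longlonglongrightarrow> l"
    have XP: "X m \<in> Pol" and XK: "F (X m) \<in> K" for m using X by auto
    have el: "(\<lambda>m. ell j (X m)) \<longlonglongrightarrow> ell j l" for j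
      unfolding ell_def by (intro tendsto_intros lim)
    have ge: "ell j l \<ge> 0" if "j < 2*n" for j
      by (rule LIMSEQ_le_const[OF el]) (use ell_pos[OF XP that] in \<open>auto intro!: exI[of _ 0] less_imp_le\<close>)
    show "l \<in> Pol \<inter> F -` K"
    proof (cases "l \<in> Pol")
      case True
      have "isCont F l" using has_derivative_continuous[OF has_derivative_F[OF True]] .
      then have "(\<lambda>m. F (X m)) \<longlonglongrightarrow> F l" using lim by (rule isCont_tendsto_compose)
      then have "F l \<in> K" by (rule closed_sequentially[OF compact_imp_closed[OF K] XK])
      then show ?thesis using True by simp
    next
      case False
      then obtain j where j: "j < 2*n" "ell j l = 0" using ge unfolding Pol_def by force
      obtain d where d: "Re (cnj d * \<beta> j) \<noteq> 0" "\<And>i. i < 2 * n \<Longrightarrow> ell i l = 0 \<Longrightarrow> i \<noteq> j \<Longrightarrow> Re (cnj d * \<beta> i) = 0"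
        using active_functional[OF ge j] by blast
      define r where "r = (\<lambda>i. Re (cnj d * \<beta> i))"
      \<comment> \<open>All other terms: a logarithm that also tends to minus infinity has
        coefficient zero, and the rest converge.\<close>
      define S where "S = (\<lambda>m. \<Sum>i\<in>{..<2*n} - {j}. ln (ell i (X m)) * r i)"
      have S: "convergent S" unfolding S_def
      proof (rule convergent_sum)
        fix i assume i: "i \<in> {..<2*n} - {j}"
        show "convergent (\<lambda>m. ln (ell i (X m)) * r i)"
        proof (cases "ell i l = 0")
          case True
          then have "r i = 0" using d(2)[of i] i by (simp add: r_def)
          then show ?thesis by (simp add: convergent_const)
        next
          case False
          then have "(\<lambda>m. ln (ell i (X m)) * r i) \<longlonglongrightarrow> ln (ell i l) * r i"
            by (intro tendsto_mult tendsto_ln tendsto_const el)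
          then show ?thesis by (rule convergentI)
        qed
      qed
      then obtain C1 where C1: "\<And>m. \<bar>S m\<bar> \<le> C1"
        using convergent_imp_Bseq BseqE by (metis real_norm_def)
      obtain C2 where C2: "\<And>v. v \<in> K \<Longrightarrow> cmod v \<le> C2" using compact_imp_bounded[OF K] bounded_iff by metis
      have FX: "Re (cnj d * F (X m)) = ln (ell j (X m)) * r j + S m" for m
      proof -
        have "Re (cnj d * F (X m)) = (\<Sum>i<2*n. ln (ell i (X m)) * r i)"
          unfolding F_def sum_distrib_left Re_sum r_def by (intro sum.cong) (simp_all add: algebra_simps)
        then show ?thesis unfolding S_def using j(1) by (simp add: sum.remove[of _ j])
      qed
      define C where "C = (cmod d * C2 + C1) / \<bar>r j\<bar>"
      have rj: "\<bar>r j\<bar> > 0" using d(1) by (simp add: r_def)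
      have "ell j (X m) \<ge> exp (- C)" for m
      proof -
        have "\<bar>Re (cnj d * F (X m))\<bar> \<le> cmod d * C2"
          using abs_Re_le_cmod[of "cnj d * F (X m)"] mult_left_mono[OF C2[OF XK[of m]], of "cmod d"] by (simp add: norm_mult)
        then have "\<bar>ln (ell j (X m)) * r j\<bar> \<le> cmod d * C2 + C1" using FX[of m] C1[of m] by linarith
        then have "\<bar>ln (ell j (X m))\<bar> \<le> C" using rj by (simp add: C_def pos_le_divide_eq abs_mult)
        then have "- C \<le> ln (ell j (X m))" by linarith
        then show ?thesis using ell_pos[OF XP j(1), of m] by (simp add: ln_ge_iff)
      qed
      then have "ell j l \<ge> exp (- C)" by (intro LIMSEQ_le_const[OF el]) auto
      then show ?thesis using j(2) by (simp add: not_le[symmetric])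
    qed
  qed
qed

section \<open>The global inverse of the projection\<close>

definition G where "G = inv_into Pol F"

lemma continuous_DF: "continuous_on Pol (\<lambda>x. DF x h)" and continuous_DH: "continuous_on Pol (\<lambda>x. DH x h)"
  unfolding DF_def DH_def using ell_pos
  by (intro continuous_intros continuous_ell ballI; force)+

lemma connected_Pol: "connected Pol" and zero_in_Pol: "0 \<in> Pol"
  using convex_Pol ball_subset_Pol by (auto intro: convex_connected)

lemma homeomorphism_F: "homeomorphism Pol UNIV F G"
proof -
  have "\<exists>G. homeomorphism Pol UNIV F G"
  proof (rule proper_local_homeomorphism_imp_homeomorphism)
    show "continuous_on Pol F" by (rule Ck_on_continuous[OF open_Pol Ck_on_F])
    fix x assume x: "x \<in> Pol"
    obtain r where "r > 0" "ball x r \<subseteq> Pol" "inj_on F (ball x r)"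
      by (rule complex_derivative_locally_injective[OF open_Pol x has_derivative_F continuous_DF continuous_DF])
        (use Jac_nz[OF x] in \<open>auto simp: Jac_def\<close>)
    then show "\<exists>U. open U \<and> x \<in> U \<and> U \<subseteq> Pol \<and> inj_on F U" by (intro exI[of _ "ball x r"]) auto
  qed (use open_Pol connected_Pol zero_in_Pol proper_F in auto)
  then obtain G' where G': "homeomorphism Pol UNIV F G'" by blast
  have inj: "inj_on F Pol" using G' by (metis homeomorphism_def inj_on_inverseI)
  have "G' y = G y" for y
  proof -
    have "G' y \<in> Pol" "F (G' y) = y" using G' by (auto simp: homeomorphism_def)
    then show ?thesis unfolding G_def using inj by (metis inv_into_f_f)
  qed
  then have "G' = G" by blast
  then show ?thesis using G' by simp
qed

lemma G_in_Pol: "G q \<in> Pol" and F_G: "F (G q) = q" and G_F: "w \<in> Pol \<Longrightarrow> G (F w) = w"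
  using homeomorphism_F by (auto simp: homeomorphism_def)

lemma Ck_on_G: "Ck_on k UNIV G"
proof -
  have fd: "frechet_derivative F (at x) = DF x" if "x \<in> Pol" for x
    using frechet_derivative_at[OF has_derivative_F[OF that]] by simp
  have "Ck_on (Suc k) UNIV G"
    by (rule Ck_on_inverse_map[OF open_Pol open_UNIV Ck_on_F])
      (use homeomorphism_F fd Jac_nz in \<open>auto simp: homeomorphism_def Jac_def\<close>)
  then show ?thesis by (rule Ck_on_Suc_imp[OF open_UNIV])
qed

lemma DF_surj: assumes "w \<in> Pol" obtains h where "DF w h = v"
proof -
  define h where "h = Complex (- Im (cnj (DF w \<i>) * v) / Jac w) (Im (cnj (DF w 1) * v) / Jac w)"
  have "DF w h = of_real (Re h) * DF w 1 + of_real (Im h) * DF w \<i>"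
    using complex_linear_eq[OF DF_linear, of w h] by (simp only: scaleR_conv_of_real)
  also have "\<dots> = v" unfolding h_def complex.sel Jac_def
    using Jac_nz[OF assms] by (intro complex_plane_linear_solve) (simp only: Jac_def not_False_eq_True)
  finally show thesis by (rule that)
qed

end

section \<open>The mean curvature equation\<close>

context kobayashi begin

definition D2F where "D2F w h k = (\<Sum>j<2*n. (- (Re (h * cnj (\<zeta> j)) * Re (k * cnj (\<zeta> j))) / (ell j w)\<^sup>2) *\<^sub>R \<beta> j)"
definition D2H where "D2H w h k = (\<Sum>j<2*n. \<kappa> j * (Re (h * cnj (\<zeta> j)) * Re (k * cnj (\<zeta> j)) / (ell j w)\<^sup>2))"

lemma has_derivative_inverse_ell:
  assumes "ell j w > 0"
  shows "((\<lambda>w. c / ell j w) has_derivative (\<lambda>k. c * Re (k * cnj (\<zeta> j)) / (ell j w)\<^sup>2)) (at w)"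
proof -
  define R where "R = (\<lambda>h. Re (h * cnj (\<zeta> j)))"
  have "(ell j has_derivative (\<lambda>h. - R h)) (at w)"
    unfolding ell_def[abs_def] R_def by (auto intro!: derivative_eq_intros has_derivative_Re has_derivative_mult_left)
  from has_derivative_divide[OF has_derivative_const[of c] this] assms
  have "((\<lambda>w. c / ell j w) has_derivative (\<lambda>k. c * R k / (ell j w)\<^sup>2)) (at w)"
    by (simp add: power2_eq_square divide_inverse mult_ac)
  then show ?thesis by (simp only: R_def)
qed

lemma has_derivative_DF: assumes "w \<in> Pol" shows "((\<lambda>w. DF w h) has_derivative D2F w h) (at w)"
proof -
  have "((\<lambda>w. - Re (h * cnj (\<zeta> j)) / ell j w) has_derivative
      (\<lambda>k. - (Re (h * cnj (\<zeta> j)) * Re (k * cnj (\<zeta> j))) / (ell j w)\<^sup>2)) (at w)" if "j < 2*n" for j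
    using has_derivative_inverse_ell[OF ell_pos[OF assms that], of "- Re (h * cnj (\<zeta> j))"]
    by (simp only: mult_minus_left)
  then show ?thesis unfolding DF_def D2F_def[abs_def]
    by (intro has_derivative_sum has_derivative_scaleR_left) auto
qed

lemma has_derivative_DH: assumes "w \<in> Pol" shows "((\<lambda>w. DH w h) has_derivative D2H w h) (at w)"
  unfolding DH_def D2H_def[abs_def]
  by (intro has_derivative_sum has_derivative_mult_right has_derivative_inverse_ell ell_pos assms) auto

text \<open>The second derivatives are contracted with the matrix 1 - w w^T, whose adjugate is the
  form \<open>N w\<close>. On the unit vector \<open>\<zeta> j\<close> this gives 1 - s^2 with s =
  \<open>Re (w * cnj (\<zeta> j))\<close>, which cancels one power of \<open>ell j w\<close>, that
  is, of 1 - s.\<close>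

lemma contraction_coefficient:
  assumes "j < 2*n" "w \<in> Pol"
  shows "((1 - (Re w)\<^sup>2) * (Re (1 * cnj (\<zeta> j)) * Re (1 * cnj (\<zeta> j))) - 2 * (Re w * Im w) * (Re (1 * cnj (\<zeta> j)) * Re (\<i> * cnj (\<zeta> j)))
     + (1 - (Im w)\<^sup>2) * (Re (\<i> * cnj (\<zeta> j)) * Re (\<i> * cnj (\<zeta> j)))) / (ell j w)\<^sup>2 = 2 * (Re (w * cnj (\<zeta> j)) / ell j w) + 1"
proof -
  define a c where "a = Re (\<zeta> j)" and "c = Im (\<zeta> j)"
  define s where "s = Re (w * cnj (\<zeta> j))"
  have ac: "a\<^sup>2 + c\<^sup>2 = 1" using norm_zeta[of j] cmod_power2[of "\<zeta> j"] by (simp add: a_def c_def)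
  have s: "s = Re w * a + Im w * c" by (simp add: s_def a_def c_def)
  have e: "ell j w = 1 - s" by (simp add: ell_def s_def)
  have e0: "1 - s \<noteq> 0" using ell_pos[OF assms(2,1)] e by simp
  have "(1 - (Re w)\<^sup>2) * (a * a) - 2 * (Re w * Im w) * (a * c) + (1 - (Im w)\<^sup>2) * (c * c) = (a\<^sup>2 + c\<^sup>2) - s\<^sup>2"
    unfolding s by (simp add: power2_eq_square algebra_simps)
  also have "\<dots> = (1 - s) * (1 + s)" unfolding ac by (simp add: power2_eq_square algebra_simps)
  finally have "((1 - (Re w)\<^sup>2) * (a * a) - 2 * (Re w * Im w) * (a * c) + (1 - (Im w)\<^sup>2) * (c * c)) / (1 - s)\<^sup>2 = (1 + s) / (1 - s)"
    using e0 by (simp add: power2_eq_square)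
  also have "\<dots> = 2 * (s / (1 - s)) + 1" using e0 by (simp add: field_simps)
  finally show ?thesis unfolding e s_def[symmetric] by (simp add: a_def c_def)
qed

text \<open>Laplace's equation for the metric of the Klein model, in a form that stays valid outside
  the disc. The constant 1 in \<open>contraction_coefficient\<close> contributes the sum of the
  residues, which is zero.\<close>

lemma contraction_D2F:
  assumes "w \<in> Pol"
  shows "(1 - (Re w)\<^sup>2) *\<^sub>R D2F w 1 1 - (2 * (Re w * Im w)) *\<^sub>R D2F w 1 \<i> + (1 - (Im w)\<^sup>2) *\<^sub>R D2F w \<i> \<i> = 2 *\<^sub>R DF w w"
proof -
  have "(1 - (Re w)\<^sup>2) *\<^sub>R D2F w 1 1 - (2 * (Re w * Im w)) *\<^sub>R D2F w 1 \<i> + (1 - (Im w)\<^sup>2) *\<^sub>R D2F w \<i> \<i>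
    = (\<Sum>j<2*n. (- (2 * (Re (w * cnj (\<zeta> j)) / ell j w) + 1)) *\<^sub>R \<beta> j)"
    unfolding D2F_def scaleR_sum_right sum_subtractf[symmetric] sum.distrib[symmetric]
  proof (rule sum.cong[OF refl])
    fix j assume "j \<in> {..<2*n}"
    then have j: "j < 2*n" by simp
    show "(1 - (Re w)\<^sup>2) *\<^sub>R (- (Re (1 * cnj (\<zeta> j)) * Re (1 * cnj (\<zeta> j))) / (ell j w)\<^sup>2) *\<^sub>R \<beta> j
       - (2 * (Re w * Im w)) *\<^sub>R (- (Re (1 * cnj (\<zeta> j)) * Re (\<i> * cnj (\<zeta> j))) / (ell j w)\<^sup>2) *\<^sub>R \<beta> j
       + (1 - (Im w)\<^sup>2) *\<^sub>R (- (Re (\<i> * cnj (\<zeta> j)) * Re (\<i> * cnj (\<zeta> j))) / (ell j w)\<^sup>2) *\<^sub>R \<beta> j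
       = (- (2 * (Re (w * cnj (\<zeta> j)) / ell j w) + 1)) *\<^sub>R \<beta> j"
      unfolding contraction_coefficient[OF j assms, symmetric] scaleR_scaleR scaleR_diff_left[symmetric] scaleR_add_left[symmetric]
    proof (rule arg_cong[of _ _ "\<lambda>x. x *\<^sub>R \<beta> j"])
      have "A * (- a / e) - B * (- b / e) + C * (- c / e) = - ((A * a - B * b + C * c) / e)" for A B C a b c e :: real
        by (simp add: add_divide_distrib diff_divide_distrib algebra_simps)
      then show "(1 - (Re w)\<^sup>2) * (- (Re (1 * cnj (\<zeta> j)) * Re (1 * cnj (\<zeta> j))) / (ell j w)\<^sup>2)
         - 2 * (Re w * Im w) * (- (Re (1 * cnj (\<zeta> j)) * Re (\<i> * cnj (\<zeta> j))) / (ell j w)\<^sup>2)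
         + (1 - (Im w)\<^sup>2) * (- (Re (\<i> * cnj (\<zeta> j)) * Re (\<i> * cnj (\<zeta> j))) / (ell j w)\<^sup>2)
         = - (((1 - (Re w)\<^sup>2) * (Re (1 * cnj (\<zeta> j)) * Re (1 * cnj (\<zeta> j)))
           - 2 * (Re w * Im w) * (Re (1 * cnj (\<zeta> j)) * Re (\<i> * cnj (\<zeta> j)))
           + (1 - (Im w)\<^sup>2) * (Re (\<i> * cnj (\<zeta> j)) * Re (\<i> * cnj (\<zeta> j)))) / (ell j w)\<^sup>2)" .
    qed
  qed
  also have "\<dots> = 2 *\<^sub>R DF w w - (\<Sum>j<2*n. \<beta> j)"
  proof -
    have "(- (2 * x + 1)) *\<^sub>R v = 2 *\<^sub>R (- x) *\<^sub>R v - v" for x and v :: complex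
      by (simp add: scaleR_conv_of_real algebra_simps)
    then show ?thesis unfolding DF_def scaleR_sum_right sum_subtractf[symmetric] minus_divide_left[symmetric]
      by (intro sum.cong refl)
  qed
  finally show ?thesis by (simp add: sum_beta)
qed

lemma contraction_D2H:
  assumes "w \<in> Pol"
  shows "(1 - (Re w)\<^sup>2) * D2H w 1 1 - (2 * (Re w * Im w)) * D2H w 1 \<i> + (1 - (Im w)\<^sup>2) * D2H w \<i> \<i> = 2 * DH w w"
proof -
  have "(1 - (Re w)\<^sup>2) * D2H w 1 1 - (2 * (Re w * Im w)) * D2H w 1 \<i> + (1 - (Im w)\<^sup>2) * D2H w \<i> \<i>
    = (\<Sum>j<2*n. \<kappa> j * (2 * (Re (w * cnj (\<zeta> j)) / ell j w) + 1))"
    unfolding D2H_def sum_distrib_left sum_subtractf[symmetric] sum.distrib[symmetric]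
  proof (rule sum.cong[OF refl])
    fix j assume "j \<in> {..<2*n}"
    then have j: "j < 2*n" by simp
    show "(1 - (Re w)\<^sup>2) * (\<kappa> j * (Re (1 * cnj (\<zeta> j)) * Re (1 * cnj (\<zeta> j)) / (ell j w)\<^sup>2))
       - (2 * (Re w * Im w)) * (\<kappa> j * (Re (1 * cnj (\<zeta> j)) * Re (\<i> * cnj (\<zeta> j)) / (ell j w)\<^sup>2))
       + (1 - (Im w)\<^sup>2) * (\<kappa> j * (Re (\<i> * cnj (\<zeta> j)) * Re (\<i> * cnj (\<zeta> j)) / (ell j w)\<^sup>2))
       = \<kappa> j * (2 * (Re (w * cnj (\<zeta> j)) / ell j w) + 1)"
      unfolding contraction_coefficient[OF j assms, symmetric]
      by (simp only: add_divide_distrib diff_divide_distrib times_divide_eq_right distrib_left right_diff_distrib mult.left_commute)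
  qed
  also have "\<dots> = 2 * DH w w + (\<Sum>j<2*n. \<kappa> j)"
    unfolding DH_def sum_distrib_left sum.distrib[symmetric]
    by (rule sum.cong[OF refl]) (simp only: distrib_left mult.left_commute mult_1_right)
  finally show ?thesis by (simp add: sum_kappa)
qed

lemma D2_sym: "D2F w h k = D2F w k h" "D2H w h k = D2H w k h"
  by (simp_all only: D2F_def D2H_def mult.commute)

section \<open>The graph function and its equation\<close>

definition graph_fun where
  "graph_fun c0 c1 p = c0 + H (G (Complex (fst p) (snd p) - c1))"

lemma Ck_on_graph_fun: "Ck_on k UNIV (graph_fun c0 c1)"
proof -
  have q: "Ck_on k UNIV (\<lambda>p::real \<times> real. Complex (fst p) (snd p) - c1)"
    by (intro Ck_on_diff Ck_on_Complex Ck_on_fst Ck_on_snd Ck_on_const open_UNIV)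
  have "Ck_on k UNIV (\<lambda>p::real \<times> real. G (Complex (fst p) (snd p) - c1))"
    by (rule Ck_on_compose[OF open_UNIV open_UNIV q Ck_on_G]) simp
  then have "Ck_on k UNIV (\<lambda>p::real \<times> real. H (G (Complex (fst p) (snd p) - c1)))"
    by (rule Ck_on_compose[OF open_UNIV open_Pol _ Ck_on_H]) (use G_in_Pol in auto)
  then show ?thesis unfolding graph_fun_def[abs_def] by (intro Ck_on_add Ck_on_const open_UNIV)
qed

definition proj where "proj c1 w = (Re (c1 + F w), Im (c1 + F w))" for c1 w

lemma graph_fun_proj: "w \<in> Pol \<Longrightarrow> graph_fun c0 c1 (proj c1 w) = c0 + H w"
proof -
  assume "w \<in> Pol"
  moreover have "Complex (fst (proj c1 w)) (snd (proj c1 w)) - c1 = F w" by (simp add: proj_def complex_eq_iff)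
  ultimately show ?thesis by (simp only: graph_fun_def G_F)
qed

lemma has_derivative_proj: "w \<in> Pol \<Longrightarrow> (proj c1 has_derivative (\<lambda>h. (Re (DF w h), Im (DF w h)))) (at w)"
  unfolding proj_def[abs_def]
  using has_derivative_add[OF has_derivative_const has_derivative_F]
  by (intro has_derivative_Pair has_derivative_Re has_derivative_Im) auto

lemma graph_fun_deriv1:
  assumes "w \<in> Pol"
  shows "Dx (graph_fun c0 c1) (proj c1 w) * Re (DF w h) + Dy (graph_fun c0 c1) (proj c1 w) * Im (DF w h) = DH w h"
proof -
  let ?l = "graph_fun c0 c1"
  have l: "(?l has_derivative frechet_derivative ?l (at (proj c1 w))) (at (proj c1 w))"
    using Ck_on_SucD[OF Ck_on_graph_fun[of "Suc 0"]] by simp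
  have 1: "((\<lambda>w. ?l (proj c1 w)) has_derivative (\<lambda>h. frechet_derivative ?l (at (proj c1 w)) (Re (DF w h), Im (DF w h)))) (at w)"
    by (rule has_derivative_compose[OF has_derivative_proj[OF assms] l])
  have 2: "((\<lambda>w. ?l (proj c1 w)) has_derivative DH w) (at w)"
  proof (rule has_derivative_transform_within_open[OF _ open_Pol assms])
    show "((\<lambda>w. c0 + H w) has_derivative DH w) (at w)"
      using has_derivative_add[OF has_derivative_const has_derivative_H[OF assms], of c0] by simp
  qed (simp add: graph_fun_proj)
  from has_derivative_unique[OF 1 2] have "frechet_derivative ?l (at (proj c1 w)) (Re (DF w h), Im (DF w h)) = DH w h"
    by (rule fun_cong)
  then show ?thesis unfolding has_derivative_Dx_Dy[OF l] .
qed

lemma Ck_on_Dx_Dy: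
  assumes "\<And>k. Ck_on k UNIV l" shows "Ck_on k UNIV (Dx l)" "Ck_on k UNIV (Dy l)"
proof -
  have l: "(l has_derivative frechet_derivative l (at p)) (at p)" for p
    using Ck_on_SucD[OF assms[of "Suc 0"]] by simp
  have "Dx l = (\<lambda>p. frechet_derivative l (at p) (1, 0))" "Dy l = (\<lambda>p. frechet_derivative l (at p) (0, 1))"
    using Dx_Dy_has_derivative[OF l] by auto
  then show "Ck_on k UNIV (Dx l)" "Ck_on k UNIV (Dy l)"
    using Ck_on_SucD2[OF assms[of "Suc k"]] by simp_all
qed

lemma deriv_along_proj:
  assumes "w \<in> Pol" "\<And>k. Ck_on k UNIV l"
  shows "((\<lambda>w. l (proj c1 w)) has_derivative
     (\<lambda>k. Dx l (proj c1 w) * Re (DF w k) + Dy l (proj c1 w) * Im (DF w k))) (at w)"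
proof -
  have l: "(l has_derivative frechet_derivative l (at (proj c1 w))) (at (proj c1 w))"
    using Ck_on_SucD[OF assms(2)[of "Suc 0"]] by simp
  show ?thesis using has_derivative_compose[OF has_derivative_proj[OF assms(1)] l]
    unfolding has_derivative_Dx_Dy[OF l] .
qed

text \<open>Differentiating \<open>graph_fun_deriv1\<close> once more expresses the pulled back
  Hessian by the second derivatives of \<open>F\<close> and \<open>H\<close>, which are
  explicit.\<close>

lemma graph_fun_deriv2:
  fixes c0 c1 w
  assumes w: "w \<in> Pol"
  defines "l \<equiv> graph_fun c0 c1" and "p \<equiv> proj c1 w"
  shows "(Dx (Dx l) p * Re (DF w k) + Dy (Dx l) p * Im (DF w k)) * Re (DF w h)
     + (Dx (Dy l) p * Re (DF w k) + Dy (Dy l) p * Im (DF w k)) * Im (DF w h)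
     = D2H w h k - Dx l p * Re (D2F w h k) - Dy l p * Im (D2F w h k)"
proof -
  have C: "Ck_on k UNIV l" for k unfolding l_def by (rule Ck_on_graph_fun)
  let ?d = "\<lambda>l k. Dx l p * Re (DF w k) + Dy l p * Im (DF w k)"
  have d1: "((\<lambda>w. Dx l (proj c1 w)) has_derivative ?d (Dx l)) (at w)"
    unfolding p_def by (rule deriv_along_proj[OF w Ck_on_Dx_Dy(1)[OF C]])
  have d2: "((\<lambda>w. Dy l (proj c1 w)) has_derivative ?d (Dy l)) (at w)"
    unfolding p_def by (rule deriv_along_proj[OF w Ck_on_Dx_Dy(2)[OF C]])
  have r: "((\<lambda>w. Re (DF w h)) has_derivative (\<lambda>k. Re (D2F w h k))) (at w)"
    "((\<lambda>w. Im (DF w h)) has_derivative (\<lambda>k. Im (D2F w h k))) (at w)"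
    using has_derivative_DF[OF w] by (auto intro: has_derivative_Re has_derivative_Im)
  have "((\<lambda>w. Dx l (proj c1 w) * Re (DF w h) + Dy l (proj c1 w) * Im (DF w h)) has_derivative
     (\<lambda>k. (Dx l (proj c1 w) * Re (D2F w h k) + ?d (Dx l) k * Re (DF w h))
        + (Dy l (proj c1 w) * Im (D2F w h k) + ?d (Dy l) k * Im (DF w h)))) (at w)"
    by (intro has_derivative_add has_derivative_mult d1 d2 r)
  moreover have "((\<lambda>w. Dx l (proj c1 w) * Re (DF w h) + Dy l (proj c1 w) * Im (DF w h)) has_derivative D2H w h) (at w)"
    by (rule has_derivative_transform_within_open[OF has_derivative_DH[OF w] open_Pol w])
      (simp add: l_def graph_fun_deriv1)
  ultimately have "(\<lambda>k. (Dx l (proj c1 w) * Re (D2F w h k) + ?d (Dx l) k * Re (DF w h))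
        + (Dy l (proj c1 w) * Im (D2F w h k) + ?d (Dy l) k * Im (DF w h))) = D2H w h"
    by (rule has_derivative_unique)
  from fun_cong[OF this, of k] show ?thesis by (simp add: p_def)
qed

text \<open>Polarization, to read off the mixed coefficient from the conformality of the quadratic
  form.\<close>

lemma gm_polar: "gm w (1 + \<i>) = gm w 1 + 2 * (Re (DF w 1) * Re (DF w \<i>) + Im (DF w 1) * Im (DF w \<i>) - DH w 1 * DH w \<i>) + gm w \<i>"
proof -
  have 1: "DF w (1 + \<i>) = DF w 1 + DF w \<i>" by (rule linear_add[OF DF_linear])
  have 2: "DH w (1 + \<i>) = DH w 1 + DH w \<i>" by (rule linear_add[OF DH_linear])
  show ?thesis unfolding gm_def 1 2 cmod_power2 by (simp add: power2_eq_square algebra_simps)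
qed

lemma zmc_at:
  fixes c0 c1 w
  assumes w: "w \<in> Pol"
  defines "l \<equiv> graph_fun c0 c1" and "p \<equiv> proj c1 w"
  shows "(1 - (Dy l p)\<^sup>2) * Dx (Dx l) p + 2 * Dx l p * Dy l p * Dy (Dx l) p + (1 - (Dx l p)\<^sup>2) * Dy (Dy l) p = 0"
proof -
  obtain m where m: "\<And>h. gm w h = m * N w h" using conformal_factor[OF w] by blast
  have R: "(cmod w)\<^sup>2 = (Re w)\<^sup>2 + (Im w)\<^sup>2" by (rule cmod_power2)
  have n1: "N w 1 = 1 - (Im w)\<^sup>2" and n2: "N w \<i> = 1 - (Re w)\<^sup>2" and n3: "N w (1 + \<i>) = 2 - ((Re w)\<^sup>2 + (Im w)\<^sup>2) + 2 * (Re w * Im w)"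
    unfolding N_def R by (simp_all add: cmod_power2) (simp add: power2_eq_square algebra_simps)
  have g11: "(Re (DF w 1))\<^sup>2 + (Im (DF w 1))\<^sup>2 - (DH w 1)\<^sup>2 = m * (1 - (Im w)\<^sup>2)"
    using m[of 1] unfolding gm_def n1 cmod_power2 .
  have g22: "(Re (DF w \<i>))\<^sup>2 + (Im (DF w \<i>))\<^sup>2 - (DH w \<i>)\<^sup>2 = m * (1 - (Re w)\<^sup>2)"
    using m[of \<i>] unfolding gm_def n2 cmod_power2 .
  have "2 * (Re (DF w 1) * Re (DF w \<i>) + Im (DF w 1) * Im (DF w \<i>) - DH w 1 * DH w \<i>) = m * (2 * (Re w * Im w))"
    using gm_polar[of w] m[of 1] m[of \<i>] m[of "1 + \<i>"] unfolding n1 n2 n3 by (simp add: algebra_simps)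
  then have g12: "Re (DF w 1) * Re (DF w \<i>) + Im (DF w 1) * Im (DF w \<i>) - DH w 1 * DH w \<i> = m * (Re w * Im w)"
    by simp
  have J: "Re (DF w 1) * Im (DF w \<i>) - Im (DF w 1) * Re (DF w \<i>) \<noteq> 0"
    using Jac_nz[OF w] by (simp add: Jac_def)
  define q where "q = (\<lambda>h k. D2H w h k - Dx l p * Re (D2F w h k) - Dy l p * Im (D2F w h k))"
  note d2 = graph_fun_deriv2[OF w, of c0 c1, folded l_def p_def, symmetric]
  have e1: "Dx l p * Re (DF w h) + Dy l p * Im (DF w h) = DH w h" for h
    unfolding l_def p_def by (rule graph_fun_deriv1[OF w])
  \<comment> \<open>Both contractions reduce to twice a first derivative in direction
    \<open>w\<close>, and these are related by \<open>e1\<close>.\<close>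
  have K: "(1 - (Re w)\<^sup>2) * q 1 1 - 2 * (Re w * Im w) * q 1 \<i> + (1 - (Im w)\<^sup>2) * q \<i> \<i> = 0"
  proof -
    have "(1 - (Re w)\<^sup>2) * q 1 1 - 2 * (Re w * Im w) * q 1 \<i> + (1 - (Im w)\<^sup>2) * q \<i> \<i>
      = ((1 - (Re w)\<^sup>2) * D2H w 1 1 - (2 * (Re w * Im w)) * D2H w 1 \<i> + (1 - (Im w)\<^sup>2) * D2H w \<i> \<i>)
       - Dx l p * Re ((1 - (Re w)\<^sup>2) *\<^sub>R D2F w 1 1 - (2 * (Re w * Im w)) *\<^sub>R D2F w 1 \<i> + (1 - (Im w)\<^sup>2) *\<^sub>R D2F w \<i> \<i>)
       - Dy l p * Im ((1 - (Re w)\<^sup>2) *\<^sub>R D2F w 1 1 - (2 * (Re w * Im w)) *\<^sub>R D2F w 1 \<i> + (1 - (Im w)\<^sup>2) *\<^sub>R D2F w \<i> \<i>)"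
      by (simp add: q_def algebra_simps)
    also have "\<dots> = 2 * (DH w w - (Dx l p * Re (DF w w) + Dy l p * Im (DF w w)))"
      unfolding contraction_D2F[OF w] contraction_D2H[OF w] by simp
    finally show ?thesis unfolding e1 by simp
  qed
  show ?thesis
    by (rule zmc_algebra[where rx = "Dx (Dy l) p", OF e1 e1 g11 g12 g22 J _ _ _ _ _ K])
      (unfold q_def, (rule d2)+, simp only: D2_sym[of w \<i> 1])
qed

lemma proj_surj: obtains w where "w \<in> Pol" "proj c1 w = p"
proof (rule that[of "G (Complex (fst p) (snd p) - c1)"])
  show "proj c1 (G (Complex (fst p) (snd p) - c1)) = p" by (simp add: proj_def F_G)
qed (rule G_in_Pol)

lemma zero_mean_curvature_graph_fun: "zero_mean_curvature (graph_fun c0 c1)"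
  unfolding zero_mean_curvature_def
proof
  fix p :: "real \<times> real"
  obtain w where "w \<in> Pol" "proj c1 w = p" by (rule proj_surj)
  then show "(1 - (Dy (graph_fun c0 c1) p)\<^sup>2) * Dx (Dx (graph_fun c0 c1)) p
     + 2 * Dx (graph_fun c0 c1) p * Dy (graph_fun c0 c1) p * Dy (Dx (graph_fun c0 c1)) p
     + (1 - (Dx (graph_fun c0 c1) p)\<^sup>2) * Dy (Dy (graph_fun c0 c1)) p = 0"
    using zmc_at by metis
qed

text \<open>A point of the circle other than the finitely many points of contact lies in the open
  polygon and can be pushed outwards.\<close>

lemma exists_outside: obtains w where "w \<in> Pol" "cmod w > 1"
proof -
  have "inj_on cis {0..1}"
  proof (rule inj_onI)
    fix x y :: real assume *: "x \<in> {0..1}" "y \<in> {0..1}" "cis x = cis y"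
    then have "cos x = cos y" by (simp add: complex_eq_iff)
    then show "x = y" using * pi_gt3 cos_inj_pi[of x y] by auto
  qed
  then have "infinite (cis ` {0..1::real})" using infinite_Icc[of 0 "1::real"] finite_image_iff[of cis "{0..1}"] by simp
  then obtain e where e: "e \<in> cis ` {0..1::real}" "e \<notin> \<zeta> ` {..<2*n}"
    by (metis finite_imageI finite_lessThan finite_subset subsetI)
  have ne: "cmod e = 1" using e by auto
  then have "e \<in> Pol" using klein_in_Pol[of e] e klein_circle by simp
  then obtain r where r: "r > 0" "ball e r \<subseteq> Pol" using open_Pol openE by blast
  define w where "w = (1 + r / 2) *\<^sub>R e"
  have "w - e = (r / 2) *\<^sub>R e" by (simp add: w_def algebra_simps)
  then have "dist w e < r" using r ne by (simp add: dist_norm)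
  then have "w \<in> Pol" using r by (auto simp: dist_commute)
  moreover have "cmod w > 1" using r ne by (simp add: w_def)
  ultimately show thesis by (rule that)
qed

lemma mixed_type_graph_fun: "mixed_type (graph_fun c0 c1)"
proof -
  let ?l = "graph_fun c0 c1"
  have 1: "(Dx ?l (proj c1 0))\<^sup>2 + (Dy ?l (proj c1 0))\<^sup>2 < 1"
  proof -
    define P R where "P = Dx ?l (proj c1 0)" and "R = Dy ?l (proj c1 0)"
    \<comment> \<open>Testing the positive form on the direction that maps to the gradient gives
      |grad|^2 (1 - |grad|^2) > 0.\<close>
    obtain h where h: "DF 0 h = Complex P R" using DF_surj[OF zero_in_Pol] by blast
    have H: "DH 0 h = P\<^sup>2 + R\<^sup>2"
      using graph_fun_deriv1[OF zero_in_Pol, of c0 c1 h] unfolding h P_def[symmetric] R_def[symmetric]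
      by (simp add: power2_eq_square)
    show ?thesis
    proof (cases "h = 0")
      case True
      then have "Complex P R = 0" using h linear_0[OF DF_linear] by simp
      then show ?thesis by (simp add: P_def R_def complex_eq_iff)
    next
      case False
      have "gm 0 h > 0" by (rule spacelike_disc) (use False in auto)
      then have "(P\<^sup>2 + R\<^sup>2) * (1 - (P\<^sup>2 + R\<^sup>2)) > 0" unfolding gm_def H h cmod_power2
        by (simp add: power2_eq_square algebra_simps)
      moreover have "P\<^sup>2 + R\<^sup>2 \<ge> 0" by simp
      ultimately show ?thesis unfolding P_def[symmetric] R_def[symmetric]
        by (simp add: zero_less_mult_iff)
    qed
  qed
  obtain w where w: "w \<in> Pol" "cmod w > 1" by (rule exists_outside)
  have 2: "(Dx ?l (proj c1 w))\<^sup>2 + (Dy ?l (proj c1 w))\<^sup>2 > 1"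
  proof -
    define P R where "P = Dx ?l (proj c1 w)" and "R = Dy ?l (proj c1 w)"
    have w0: "w \<noteq> 0" using w by auto
    obtain m where m: "\<And>h. gm w h = m * N w h" using conformal_factor[OF w(1)] by blast
    have ni: "N w (\<i> * w) < 0"
    proof -
      have "Re (cnj w * (\<i> * w)) = 0" by simp
      then have "N w (\<i> * w) = (1 - (cmod w)\<^sup>2) * (cmod w)\<^sup>2" unfolding N_def by (simp add: norm_mult)
      moreover have "1 - (cmod w)\<^sup>2 < 0" using w(2) by (simp add: power_gt1_lemma one_less_power)
      ultimately show ?thesis using w0 by (simp add: mult_neg_pos)
    qed
    have nw: "N w w > 0" using w0 by (simp add: N_self)
    have "gm w w \<noteq> 0" by (rule gm_nonzero_outside[OF w]) (use nw in simp)
    then have "m \<noteq> 0" using m by auto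
    \<comment> \<open>Outside the disc \<open>N w\<close> takes both signs, so whatever the sign of
      \<open>m\<close> some direction is time-like; by the Cauchy-Schwarz inequality the gradient is
      then longer than 1.\<close>
    then have "\<exists>h. gm w h < 0" using m ni nw by (metis linorder_neqE_linordered_idom mult_neg_pos mult_pos_neg)
    then obtain h where h: "gm w h < 0" by blast
    define x y where "x = Re (DF w h)" and "y = Im (DF w h)"
    have e: "DH w h = P * x + R * y"
      using graph_fun_deriv1[OF w(1), of c0 c1 h] by (simp add: P_def R_def x_def y_def)
    have "x\<^sup>2 + y\<^sup>2 < (P * x + R * y)\<^sup>2" using h unfolding gm_def e cmod_power2 x_def y_def by simp
    also have "(P * x + R * y)\<^sup>2 \<le> (P\<^sup>2 + R\<^sup>2) * (x\<^sup>2 + y\<^sup>2)"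
    proof -
      have "(P\<^sup>2 + R\<^sup>2) * (x\<^sup>2 + y\<^sup>2) - (P * x + R * y)\<^sup>2 = (P * y - R * x)\<^sup>2"
        by (simp add: power2_eq_square algebra_simps)
      then show ?thesis by (metis diff_ge_0_iff_ge zero_le_power2)
    qed
    finally have "0 < (P\<^sup>2 + R\<^sup>2 - 1) * (x\<^sup>2 + y\<^sup>2)" by (simp add: algebra_simps)
    moreover have "x\<^sup>2 + y\<^sup>2 \<ge> 0" by simp
    ultimately show ?thesis unfolding P_def[symmetric] R_def[symmetric] by (simp add: zero_less_mult_iff)
  qed
  show ?thesis unfolding mixed_type_def using 1 2 by blast
qed

definition X :: "real^3 \<Rightarrow> complex \<Rightarrow> real^3" where "X v w = vector [v $ 1 + H w, v $ 2 + Re (F w), v $ 3 + Im (F w)]"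

lemma zmc_image: "zmc_entire_graph_of_mixed_type (X v ` Pol)"
  unfolding zmc_entire_graph_of_mixed_type_def
proof (intro exI conjI)
  define c1 where "c1 = Complex (v $ 2) (v $ 3)"
  let ?l = "graph_fun (v $ 1) c1"
  show "smooth_on UNIV ?l" using Ck_on_graph_fun by (simp add: smooth_on_def)
  show "zero_mean_curvature ?l" "mixed_type ?l" by (rule zero_mean_curvature_graph_fun mixed_type_graph_fun)+
  have Xw: "X v w = vector [?l (proj c1 w), fst (proj c1 w), snd (proj c1 w)]" if "w \<in> Pol" for w
    using that unfolding X_def by (simp add: graph_fun_proj) (simp add: proj_def c1_def)
  show "X v ` Pol = entire_graph_of ?l"
  proof (intro equalityI subsetI)
    fix q assume "q \<in> X v ` Pol"
    then obtain w where "w \<in> Pol" "q = X v w" by auto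
    then have "q = vector [?l (fst (proj c1 w), snd (proj c1 w)), fst (proj c1 w), snd (proj c1 w)]" using Xw by simp
    then show "q \<in> entire_graph_of ?l" unfolding entire_graph_of_def by blast
  next
    fix q assume "q \<in> entire_graph_of ?l"
    then obtain x y where q: "q = vector [?l (x, y), x, y]" unfolding entire_graph_of_def by blast
    obtain w where w: "w \<in> Pol" "proj c1 w = (x, y)" by (rule proj_surj)
    have "q = X v w" using Xw[OF w(1)] q w by simp
    then show "q \<in> X v ` Pol" using w by blast
  qed
qed

end

section \<open>The surface and its analytic extension\<close>

text \<open>Along the path the integral is a continuous branch of the logarithm, and the real part
  does not depend on the branch.\<close>

lemma Re_contour_integral_inverse:
  assumes "valid_path p" "c \<notin> path_image p"
  shows "Re (contour_integral p (\<lambda>z. 1 / (z - c))) = ln (cmod (pathfinish p - c)) - ln (cmod (pathstart p - c))"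
proof -
  define I where "I = contour_integral p (\<lambda>z. 1 / (z - c))"
  have I: "I = integral {0..1} (\<lambda>x. vector_derivative p (at x) / (p x - c))"
    unfolding I_def contour_integral_integral by simp
  have "exp (- I) * (p 1 - c) = p 0 - c"
    unfolding I using winding_number_exp_integral(2)[of p 0 1 c] assms
    by (simp add: valid_path_def path_image_def)
  then have "cmod (exp (- I) * (p 1 - c)) = cmod (p 0 - c)" by simp
  then have e: "exp (- Re I) * cmod (p 1 - c) = cmod (p 0 - c)" by (simp add: norm_mult)
  have "p 1 \<noteq> c" using assms(2) by (auto simp: path_image_def)
  then have "ln (cmod (p 0 - c)) = - Re I + ln (cmod (p 1 - c))"
    unfolding e[symmetric] by (simp add: ln_mult)
  then show ?thesis by (simp add: I_def pathfinish_def pathstart_def)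
qed

section \<open>Passage between the two models of the domain\<close>

definition to_pol :: "ext_point \<Rightarrow> complex" where
  "to_pol p = (case p of None \<Rightarrow> 0 | Some (u, c) \<Rightarrow> c / of_real u)"

definition of_pol :: "complex \<Rightarrow> ext_point" where
  "of_pol w = (if w = 0 then None else Some (1 / cmod w, sgn w))"

lemma to_pol_of_pol: "to_pol (of_pol w) = w"
  by (simp add: to_pol_def of_pol_def sgn_eq)

text \<open>The value u = (r + 1/r) / 2 is the reciprocal of the Klein radius 2 r / (1 + r^2); this
  is how the Klein model enters.\<close>

lemma ext_iota_klein: "ext_iota z = of_pol (klein z)"
proof (cases "z = 0")
  case False
  define R where "R = cmod z"
  have R: "R > 0" using False by (simp add: R_def)
  have p: "1 + R\<^sup>2 > 0" by (simp add: add_pos_nonneg)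
  have k: "klein z = (2 / (1 + R\<^sup>2)) *\<^sub>R z" by (simp add: klein_def R_def)
  have "klein z \<noteq> 0" using False p by (simp add: k)
  moreover have "sgn (klein z) = sgn z" unfolding k using p by (simp add: sgn_scaleR)
  moreover have "1 / cmod (klein z) = (R + inverse R) / 2"
    unfolding norm_klein R_def[symmetric] using R p by (simp add: field_simps power2_eq_square)
  ultimately show ?thesis using False by (simp add: ext_iota_def of_pol_def R_def)
qed (simp add: ext_iota_def of_pol_def klein_def)

lemma to_pol_polar_param: "to_pol (polar_param (u, \<theta>)) = cis \<theta> / of_real u"
  by (simp add: to_pol_def polar_param_def)

context kobayashi begin

lemma singular_points_eq: "singular_points n \<alpha> = \<zeta> ` {..<2*n}"
  unfolding singular_points_def index_eq \<zeta>_def ..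

lemma polar_domain_iff: "(u, \<theta>) \<in> polar_domain n \<alpha> \<longleftrightarrow> (\<forall>j<2*n. cos (\<theta> - \<alpha> j) < u)"
proof -
  have "0 \<in> {..<2*n}" using n2 by simp
  then have "{..<2*n} \<noteq> {}" by blast
  then show ?thesis unfolding polar_domain_def index_eq by auto
qed

text \<open>Holds because the gaps are below pi; it permits the division by \<open>u\<close> in the
  passage to \<open>w\<close>.\<close>

lemma polar_domain_pos: assumes "(u, \<theta>) \<in> polar_domain n \<alpha>" shows "u > 0"
proof -
  obtain j where "j < 2 * n" "cos (\<theta> - \<alpha> j) \<ge> cos (\<gamma> / 2)" by (rule near_alpha)
  then show ?thesis using assms cos_gamma_pos unfolding polar_domain_iff by force
qed

lemma ell_polar: "ell j (cis \<theta> / of_real u) = 1 - cos (\<theta> - \<alpha> j) / u"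
proof -
  have "cis \<theta> / of_real u * cnj (\<zeta> j) = cis (\<theta> - \<alpha> j) / of_real u"
    by (simp add: \<zeta>_def cis_cnj cis_mult)
  then show ?thesis unfolding ell_def by (simp only:) simp
qed

lemma polar_in_Pol: assumes "(u, \<theta>) \<in> polar_domain n \<alpha>" shows "cis \<theta> / of_real u \<in> Pol"
  using assms polar_domain_pos[OF assms] by (simp add: Pol_def ell_polar polar_domain_iff)

lemma of_pol_polar: assumes "u > 0" shows "of_pol (cis \<theta> / of_real u) = polar_param (u, \<theta>)"
  using assms by (simp add: of_pol_def polar_param_def cis_neq_zero norm_divide sgn_divide sgn_of_real)

lemma Pol_polar:
  assumes "w \<in> Pol" "w \<noteq> 0" shows "(1 / cmod w, Arg w) \<in> polar_domain n \<alpha>" "w = cis (Arg w) / of_real (1 / cmod w)"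
proof -
  show w: "w = cis (Arg w) / of_real (1 / cmod w)"
    using rcis_cmod_Arg[of w] by (simp add: rcis_def mult.commute)
  have "0 < 1 - cos (Arg w - \<alpha> j) / (1 / cmod w)" if "j < 2*n" for j
    using ell_pos[OF assms(1) that] ell_polar[of j "Arg w" "1 / cmod w"] w by metis
  then show "(1 / cmod w, Arg w) \<in> polar_domain n \<alpha>"
    using assms(2) by (auto simp: polar_domain_iff field_simps)
qed

lemma to_pol_in_Pol: "p \<in> ext_domain n \<alpha> \<Longrightarrow> to_pol p \<in> Pol"
  using polar_in_Pol zero_in_Pol by (auto simp: ext_domain_def to_pol_polar_param) (simp add: to_pol_def)

lemma of_pol_to_pol: "p \<in> ext_domain n \<alpha> \<Longrightarrow> of_pol (to_pol p) = p"
  using of_pol_polar polar_domain_pos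
  by (auto simp: ext_domain_def to_pol_polar_param) (simp add: to_pol_def of_pol_def)

lemma of_pol_in_domain: assumes "w \<in> Pol" shows "of_pol w \<in> ext_domain n \<alpha>"
proof (cases "w = 0")
  case False
  have "of_pol w = polar_param (1 / cmod w, Arg w)"
    using of_pol_polar[of "1 / cmod w" "Arg w"] Pol_polar(2)[OF assms False] False by auto
  then show ?thesis using Pol_polar(1)[OF assms False] by (auto simp: ext_domain_def)
qed (simp add: of_pol_def ext_domain_def)

lemma image_to_pol: "to_pol ` ext_domain n \<alpha> = Pol"
  using to_pol_in_Pol of_pol_in_domain to_pol_of_pol by (metis (no_types, lifting) image_eqI subsetI subset_antisym image_subsetI)

text \<open>The residues of the three forms at \<open>\<zeta> j\<close>, which are real.\<close>

definition R :: "nat \<Rightarrow> real^3" where "R j = vector [- 2 * \<kappa> j, 2 * Re (\<beta> j), 2 * Im (\<beta> j)]"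

lemma R_comp: "R j $ 1 = - 2 * \<kappa> j" "R j $ 2 = 2 * Re (\<beta> j)" "R j $ 3 = 2 * Im (\<beta> j)"
  by (simp_all add: R_def vector_3)

lemma sum_R: "(\<Sum>j<2*n. R j) = 0"
proof -
  have "(\<Sum>j<2*n. Re (\<beta> j)) = 0" "(\<Sum>j<2*n. Im (\<beta> j)) = 0"
    using arg_cong[OF sum_beta, of Re] arg_cong[OF sum_beta, of Im] by simp_all
  then show ?thesis using sum_kappa
    by (simp add: vec_eq_iff forall_3 R_comp sum_negf flip: sum_distrib_left)
qed

lemma X_eq: "X v w = v + (1/2) *\<^sub>R (\<Sum>j<2*n. ln (ell j w) *\<^sub>R R j)"
proof -
  have "Re (F w) = (\<Sum>j<2*n. ln (ell j w) * Re (\<beta> j))" "Im (F w) = (\<Sum>j<2*n. ln (ell j w) * Im (\<beta> j))"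
    by (simp_all add: F_def)
  moreover have "(\<Sum>j<2*n. ln (ell j w) * (2 * r j)) = 2 * (\<Sum>j<2*n. ln (ell j w) * r j)" for r :: "nat \<Rightarrow> real"
    by (simp add: sum_distrib_left mult_ac)
  moreover have "(\<Sum>j<2*n. ln (ell j w) * (- 2 * \<kappa> j)) = 2 * H w"
    unfolding H_def by (simp add: sum_distrib_left sum_negf mult_ac)
  ultimately show ?thesis
    by (simp add: vec_eq_iff forall_3 X_def vector_3 R_comp)
qed

lemma X_klein: assumes "z \<notin> \<zeta> ` {..<2*n}" shows "X v (klein z) = v + (\<Sum>j<2*n. ln (cmod (z - \<zeta> j)) *\<^sub>R R j)"
  unfolding X_eq sum_ln_ell_klein[OF sum_R assms] by (simp add: scaleR_sum_right)

lemma poles_g_outside: assumes "z \<in> poles_g n b" shows "Bs z = 0" "cmod z > 1"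
proof -
  show "Bs z = 0" using assms by (auto simp: poles_g_def Bs_def)
  then show "cmod z > 1" using Bs_nz[of z] by force
qed

lemma integrand_eq:
  assumes "z \<notin> \<zeta> ` {..<2*n}" "z \<notin> poles_g n b"
  shows "kobayashi_integrand n \<alpha> b z $ k = (\<Sum>j<2*n. of_real (R j $ k) * (1 / (z - \<zeta> j)))"
proof -
  have Bs0: "Bs z \<noteq> 0" using assms(2) by (auto simp: poles_g_def Bs_def)
  have g: "kobayashi_g n b z = B z / Bs z" by (simp add: kobayashi_g_def B_def Bs_def prod_dividef)
  have w: "kobayashi_omega n \<alpha> b z = aa z"
    by (simp add: kobayashi_omega_def aa_def Bs_def Q_def prod_power_distrib index_eq[simplified])
  have "- 2 * kobayashi_g n b z * kobayashi_omega n \<alpha> b z = - 2 * cc z"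
    unfolding g w using Bs0 by (simp add: aa_def cc_def power2_eq_square)
  moreover have "(1 + (kobayashi_g n b z)\<^sup>2) * kobayashi_omega n \<alpha> b z = aa z + bb z"
    and "\<i> * (1 - (kobayashi_g n b z)\<^sup>2) * kobayashi_omega n \<alpha> b z = \<i> * (aa z - bb z)"
    unfolding g w using Bs0 by (simp_all add: aa_def bb_def power2_eq_square algebra_simps add_divide_distrib diff_divide_distrib)
  ultimately have I: "kobayashi_integrand n \<alpha> b z $ 1 = - 2 * cc z" "kobayashi_integrand n \<alpha> b z $ 2 = aa z + bb z"
    "kobayashi_integrand n \<alpha> b z $ 3 = \<i> * (aa z - bb z)"
    unfolding kobayashi_integrand_def Let_def by (simp_all add: vector_3)
  have c: "cnj x + x = of_real (2 * Re x)" "\<i> * (cnj x - x) = of_real (2 * Im x)" for x by (simp_all add: complex_eq_iff)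
  consider "k = 1" | "k = 2" | "k = 3" using exhaust_3 by blast
  then show ?thesis
  proof cases
    case 1
    then show ?thesis unfolding 1 I cc_eq[OF assms(1)] R_comp by (simp add: sum_distrib_left)
  next
    case 2
    show ?thesis unfolding 2 I aa_eq[OF assms(1)] bb_eq[OF assms(1)] R_comp sum.distrib[symmetric] c(1)[symmetric]
      by (simp add: add_divide_distrib)
  next
    case 3
    show ?thesis unfolding 3 I aa_eq[OF assms(1)] bb_eq[OF assms(1)] R_comp sum_subtractf[symmetric] sum_distrib_left c(2)[symmetric]
      by (rule sum.cong[OF refl]) (simp add: diff_divide_distrib right_diff_distrib)
  qed
qed

lemma contour_integral_integrand:
  assumes p: "valid_path p" "path_image p \<subseteq> - (singular_points n \<alpha> \<union> poles_g n b)"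
  shows "Re (contour_integral p (\<lambda>z. kobayashi_integrand n \<alpha> b z $ k))
    = (\<Sum>j<2*n. ln (cmod (pathfinish p - \<zeta> j)) *\<^sub>R R j) $ k - (\<Sum>j<2*n. ln (cmod (pathstart p - \<zeta> j)) *\<^sub>R R j) $ k"
proof -
  have nz: "\<zeta> j \<notin> path_image p" if "j < 2*n" for j using p that by (auto simp: singular_points_eq)
  have "contour_integral p (\<lambda>z. kobayashi_integrand n \<alpha> b z $ k)
     = contour_integral p (\<lambda>z. \<Sum>j<2*n. of_real (R j $ k) * (1 / (z - \<zeta> j)))"
    by (rule contour_integral_eq) (use p integrand_eq singular_points_eq in blast)
  also have "\<dots> = (\<Sum>j<2*n. of_real (R j $ k) * contour_integral p (\<lambda>z. 1 / (z - \<zeta> j)))"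
  proof (rule contour_integral_unique, rule has_contour_integral_sum)
    fix j assume "j \<in> {..<2*n}"
    then have "(\<lambda>z. 1 / (z - \<zeta> j)) contour_integrable_on p"
      using nz p(1) by (intro contour_integrable_inversediff) auto
    then show "((\<lambda>z. of_real (R j $ k) * (1 / (z - \<zeta> j))) has_contour_integral
        of_real (R j $ k) * contour_integral p (\<lambda>z. 1 / (z - \<zeta> j))) p"
      by (intro has_contour_integral_lmul has_contour_integral_integral)
  qed simp
  also have "Re \<dots> = (\<Sum>j<2*n. R j $ k * (ln (cmod (pathfinish p - \<zeta> j)) - ln (cmod (pathstart p - \<zeta> j))))"
    using Re_contour_integral_inverse[OF p(1) nz] by simp
  finally show ?thesis by (simp add: algebra_simps sum_subtractf)
qed

text \<open>The radius from 0 to z avoids the poles of g, which lie outside the closed disc, and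
  meets the circle at most in its end point.\<close>

lemma surface_in_disc:
  assumes f: "kobayashi_surface n \<alpha> b f" and z: "cmod z \<le> 1" "z \<notin> \<zeta> ` {..<2*n}"
  shows "f z = X (f 0) (klein z)"
proof -
  have sub: "path_image (linepath 0 z) \<subseteq> - (singular_points n \<alpha> \<union> poles_g n b)"
  proof
    fix y assume "y \<in> path_image (linepath 0 z)"
    then obtain t where t: "0 \<le> t" "t \<le> 1" "y = t *\<^sub>R z" by (auto simp: in_segment)
    have "cmod y \<le> 1" using t z mult_le_one[of t "cmod z"] by simp
    then have "y \<notin> poles_g n b" using poles_g_outside(2) by fastforce
    moreover have "y \<notin> \<zeta> ` {..<2*n}"
    proof
      assume "y \<in> \<zeta> ` {..<2*n}"
      then have y1: "cmod y = 1" by auto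
      then have "t * cmod z = 1" using t by simp
      then have "t = 1" using t z mult_left_le[of "cmod z" t] by auto
      then show False using t z \<open>y \<in> \<zeta> ` {..<2*n}\<close> by simp
    qed
    ultimately show "y \<in> - (singular_points n \<alpha> \<union> poles_g n b)" by (simp add: singular_points_eq)
  qed
  have "f z $ k - f 0 $ k = (\<Sum>j<2*n. ln (cmod (z - \<zeta> j)) *\<^sub>R R j) $ k" for k
  proof -
    have "f (pathfinish (linepath 0 z)) $ k - f (pathstart (linepath 0 z)) $ k =
          Re (contour_integral (linepath 0 z) (\<lambda>z. kobayashi_integrand n \<alpha> b z $ k))"
      using f sub unfolding kobayashi_surface_def by blast
    then show ?thesis unfolding contour_integral_integrand[OF valid_path_linepath sub] by simp
  qed
  then show ?thesis unfolding X_klein[OF z(2)] by (simp add: vec_eq_iff algebra_simps)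
qed

section \<open>Analyticity and uniqueness of the extension\<close>

lemma open_polar_domain: "open (polar_domain n \<alpha>)"
proof -
  have "polar_domain n \<alpha> = (\<Inter>j\<in>{..<2*n}. {p. cos (snd p - \<alpha> j) < fst p})"
    by (auto simp: polar_domain_iff)
  moreover have "open {p :: real \<times> real. cos (snd p - \<alpha> j) < fst p}" for j
    by (intro open_Collect_less continuous_intros)
  ultimately show ?thesis by auto
qed

lemma real_analytic_X_polar: "real_analytic_on (polar_domain n \<alpha>) (\<lambda>p. X v (to_pol (polar_param p)))"
proof (rule real_analytic_on_cong[OF open_polar_domain])
  \<comment> \<open>In polar coordinates the common term \<open>ln u\<close> drops out, because the
    vectors \<open>R j\<close> sum to zero.\<close>
  show "v + (\<Sum>j<2*n. (1/2) *\<^sub>R ln \<bar>fst p - cos (snd p - \<alpha> j)\<bar> *\<^sub>R R j) = X v (to_pol (polar_param p))"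
    if "p \<in> polar_domain n \<alpha>" for p
  proof -
    obtain u \<theta> where p: "p = (u, \<theta>)" by (cases p)
    have u: "u > 0" "(u, \<theta>) \<in> polar_domain n \<alpha>" using that polar_domain_pos p by auto
    have "ln (ell j (cis \<theta> / of_real u)) = ln \<bar>u - cos (\<theta> - \<alpha> j)\<bar> - ln u" if "j < 2*n" for j
    proof -
      have "u - cos (\<theta> - \<alpha> j) > 0" using u(2) that by (simp add: polar_domain_iff)
      moreover have "1 - cos (\<theta> - \<alpha> j) / u = (u - cos (\<theta> - \<alpha> j)) / u" using u by (simp add: field_simps)
      ultimately show ?thesis unfolding ell_polar using u by (simp add: ln_div)
    qed
    then have "(\<Sum>j<2*n. ln (ell j (cis \<theta> / of_real u)) *\<^sub>R R j) = (\<Sum>j<2*n. ln \<bar>u - cos (\<theta> - \<alpha> j)\<bar> *\<^sub>R R j - ln u *\<^sub>R R j)"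
      by (intro sum.cong) (auto simp: scaleR_diff_left)
    also have "\<dots> = (\<Sum>j<2*n. ln \<bar>u - cos (\<theta> - \<alpha> j)\<bar> *\<^sub>R R j)"
      by (simp add: sum_subtractf sum_R flip: scaleR_sum_right)
    finally show ?thesis unfolding X_eq p to_pol_polar_param by (simp add: scaleR_sum_right)
  qed
  show "real_analytic_on (polar_domain n \<alpha>) (\<lambda>p. v + (\<Sum>j<2*n. (1/2) *\<^sub>R ln \<bar>fst p - cos (snd p - \<alpha> j)\<bar> *\<^sub>R R j))"
  proof (intro real_analytic_on_add real_analytic_on_const real_analytic_on_sum
      real_analytic_on_bounded_linear[OF bounded_linear_scaleR_right] real_analytic_on_bounded_linear[OF bounded_linear_scaleR_left])
    fix j assume "j \<in> {..<2*n}"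
    then have j: "j < 2*n" by simp
    show "real_analytic_on (polar_domain n \<alpha>) (\<lambda>p. ln \<bar>fst p - cos (snd p - \<alpha> j)\<bar>)"
      unfolding real_analytic_on_def
    proof clarify
      fix u \<theta> assume p: "(u, \<theta>) \<in> polar_domain n \<alpha>"
      \<comment> \<open>The angle is complexified, and the increment of u becomes the variable x
        with coefficient 1.\<close>
      define d where "d = (\<lambda>y. of_real u - cos (of_real (\<theta> - \<alpha> j) + y) :: complex)"
      have dr: "d (of_real y) + 1 * of_real x = of_real (u + x - cos (\<theta> + y - \<alpha> j))" for x y
      proof -
        have "cos (of_real (\<theta> - \<alpha> j) + of_real y) = complex_of_real (cos (\<theta> + y - \<alpha> j))"
          unfolding cos_of_real[symmetric] by (rule arg_cong[of _ _ cos]) simp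
        then show ?thesis by (simp add: d_def)
      qed
      have "Re (d 0) > 0" using dr[of 0 0] p j by (simp add: polar_domain_iff)
      moreover have "d holomorphic_on UNIV" unfolding d_def by (intro holomorphic_intros)
      ultimately have c: "d holomorphic_on UNIV" "0 < Re (d 0)" by auto
      obtain r a where ra: "r > 0" "\<And>x y. \<bar>x\<bar> < r \<Longrightarrow> \<bar>y\<bar> < r \<Longrightarrow>
         ((\<lambda>(i, j). x ^ i * y ^ j * a (i, j)) has_sum ln (cmod (d (of_real y) + 1 * of_real x))) UNIV"
        by (rule ln_cmod_double_series[of d 1, OF c]) (simp, rule that)
      show "\<exists>r>0. \<exists>a. \<forall>x y. \<bar>x - u\<bar> < r \<and> \<bar>y - \<theta>\<bar> < r \<longrightarrow>
         ((\<lambda>(i, j). ((x - u) ^ i * (y - \<theta>) ^ j) *\<^sub>R a (i, j)) has_sum ln \<bar>fst (x, y) - cos (snd (x, y) - \<alpha> j)\<bar>) UNIV"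
      proof (intro exI[of _ r] exI[of _ a] conjI allI impI ra(1))
        fix x y assume "\<bar>x - u\<bar> < r \<and> \<bar>y - \<theta>\<bar> < r"
        with ra(2)[of "x - u" "y - \<theta>"] show "((\<lambda>(i, j). ((x - u) ^ i * (y - \<theta>) ^ j) *\<^sub>R a (i, j)) has_sum ln \<bar>fst (x, y) - cos (snd (x, y) - \<alpha> j)\<bar>) UNIV"
          unfolding dr norm_of_real by simp
      qed
    qed
  qed
qed

lemma real_analytic_X_disc: "real_analytic_on (ball 0 1) (\<lambda>(x, y). X v (klein (Complex x y)))"
proof (rule real_analytic_on_cong[OF open_ball])
  have nb: "cmod (Complex (fst p) (snd p)) < 1" if "p \<in> ball 0 1" for p :: "real \<times> real"
    using that by (cases p) (simp add: norm_Pair complex_norm)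
  show "v + (\<Sum>j<2*n. ln (cmod (Complex (fst p) (snd p) - \<zeta> j)) *\<^sub>R R j) = (case p of (x, y) \<Rightarrow> X v (klein (Complex x y)))"
    if "p \<in> ball 0 1" for p
    using X_klein[OF disc_not_zeta[OF nb[OF that]]] by (cases p) simp
  show "real_analytic_on (ball 0 1) (\<lambda>p. v + (\<Sum>j<2*n. ln (cmod (Complex (fst p) (snd p) - \<zeta> j)) *\<^sub>R R j))"
  proof (intro real_analytic_on_add real_analytic_on_const real_analytic_on_sum
      real_analytic_on_bounded_linear[OF bounded_linear_scaleR_left])
    fix j
    show "real_analytic_on (ball 0 1) (\<lambda>p. ln (cmod (Complex (fst p) (snd p) - \<zeta> j)))"
      unfolding real_analytic_on_def
    proof clarify
      fix x0 y0 :: real assume p: "(x0, y0) \<in> ball 0 1"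
      \<comment> \<open>The difference is multiplied by \<open>- cnj (\<zeta> j)\<close>: of modulus
        1, it preserves the distance and rotates \<open>d 0\<close> into the right half
        plane.\<close>
      define d where "d = (\<lambda>y. 1 - (Complex x0 y0 + \<i> * y) * cnj (\<zeta> j))"
      have dr: "cmod (d (of_real y) + - cnj (\<zeta> j) * of_real x) = cmod (Complex (x0 + x) (y0 + y) - \<zeta> j)" for x y
      proof -
        have "d (of_real y) + - cnj (\<zeta> j) * of_real x = cnj (\<zeta> j) * (\<zeta> j - (Complex x0 y0 + \<i> * of_real y + of_real x))"
          using zeta_cnj[of j] by (simp add: d_def algebra_simps)
        also have "Complex x0 y0 + \<i> * of_real y + of_real x = Complex (x0 + x) (y0 + y)" by (simp add: complex_eq_iff)
        finally show ?thesis by (simp add: norm_mult norm_minus_commute)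
      qed
      have "Re (Complex x0 y0 * cnj (\<zeta> j)) < 1"
        using complex_Re_le_cmod[of "Complex x0 y0 * cnj (\<zeta> j)"] nb[OF p] by (simp add: norm_mult del: times_complex.simps)
      then have "Re (d 0) > 0" by (simp add: d_def)
      moreover have "d holomorphic_on UNIV" unfolding d_def by (intro holomorphic_intros)
      ultimately have c: "d holomorphic_on UNIV" "0 < Re (d 0)" by auto
      obtain r a where ra: "r > 0" "\<And>x y. \<bar>x\<bar> < r \<Longrightarrow> \<bar>y\<bar> < r \<Longrightarrow>
         ((\<lambda>(i, j). x ^ i * y ^ j * a (i, j)) has_sum ln (cmod (d (of_real y) + - cnj (\<zeta> j) * of_real x))) UNIV"
        by (rule ln_cmod_double_series[of d "- cnj (\<zeta> j)", OF c]) (simp, rule that)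
      show "\<exists>r>0. \<exists>a. \<forall>x y. \<bar>x - x0\<bar> < r \<and> \<bar>y - y0\<bar> < r \<longrightarrow>
         ((\<lambda>(i, j). ((x - x0) ^ i * (y - y0) ^ j) *\<^sub>R a (i, j)) has_sum ln (cmod (Complex (fst (x, y)) (snd (x, y)) - \<zeta> j))) UNIV"
      proof (intro exI[of _ r] exI[of _ a] conjI allI impI ra(1))
        fix x y assume "\<bar>x - x0\<bar> < r \<and> \<bar>y - y0\<bar> < r"
        with ra(2)[of "x - x0" "y - y0"] show "((\<lambda>(i, j). ((x - x0) ^ i * (y - y0) ^ j) *\<^sub>R a (i, j)) has_sum ln (cmod (Complex (fst (x, y)) (snd (x, y)) - \<zeta> j))) UNIV"
          unfolding dr by simp
      qed
    qed
  qed
qed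

text \<open>The extension and the formula agree for \<open>u \<ge> 1\<close>, the image of the
  closed disc; on each ray of constant angle the identity theorem carries the equality down to the
  rest of the domain.\<close>

lemma extension_formula:
  assumes f: "kobayashi_surface n \<alpha> b f" and ft: "analytic_extension n \<alpha> f ft" and p: "p \<in> ext_domain n \<alpha>"
  shows "ft p = X (f 0) (to_pol p)"
proof -
  have inner: "ft (of_pol w) = X (f 0) w" if w: "w \<in> Pol" "cmod w \<le> 1" for w
  proof -
    define z where "z = klein_inv w"
    have z: "cmod z \<le> 1" "klein z = w" using klein_klein_inv[OF w(2)] by (auto simp: z_def)
    have nz: "z \<notin> \<zeta> ` {..<2*n}"
    proof
      assume "z \<in> \<zeta> ` {..<2*n}"
      then obtain j where j: "j < 2*n" "z = \<zeta> j" by auto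
      then have "ell j w = 0" using ell_klein[of j z] z by simp
      then show False using ell_pos[OF w(1) j(1)] by simp
    qed
    have "ft (ext_iota z) = f z" using ft z(1) nz by (auto simp: analytic_extension_def singular_points_eq)
    then show ?thesis using surface_in_disc[OF f z(1) nz] by (simp add: ext_iota_klein z)
  qed
  show ?thesis
  proof (cases p)
    case None
    then show ?thesis using inner[of 0] zero_in_Pol by (simp add: of_pol_def to_pol_def)
  next
    case (Some a)
    then obtain u \<theta> where u: "(u, \<theta>) \<in> polar_domain n \<alpha>" "p = polar_param (u, \<theta>)"
      using p by (auto simp: ext_domain_def)
    have fa: "real_analytic_on (polar_domain n \<alpha>) (ft \<circ> polar_param)"
      using ft by (auto simp: analytic_extension_def ext_real_analytic_def ext_params_def)
    define m where "m = Max ((\<lambda>j. cos (\<theta> - \<alpha> j)) ` {0..2*n-1})"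
    have dom: "(u, \<theta>) \<in> polar_domain n \<alpha> \<longleftrightarrow> u > m" for u by (simp add: polar_domain_def m_def)
    have "ft p $ k - X (f 0) (to_pol p) $ k = 0" for k
    proof -
      define D where "D = (\<lambda>q. (ft (polar_param q) + (- 1) *\<^sub>R X (f 0) (to_pol (polar_param q))) $ k)"
      have "real_analytic_on (polar_domain n \<alpha>) D" unfolding D_def
        using fa by (intro real_analytic_on_bounded_linear[OF bounded_linear_vec_nth] real_analytic_on_add
            real_analytic_on_bounded_linear[OF bounded_linear_scaleR_right] real_analytic_X_polar) (simp add: o_def)
      then have "D (u, \<theta>) = 0"
      proof (rule real_analytic_on_ray_zero[where m = m and c = 1])
        show "u > m" using u dom by simp
        show "(u, \<theta>) \<in> polar_domain n \<alpha>" if "u > m" for u using dom that by simp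
        fix u assume um: "u > m" "u \<ge> 1"
        then have P: "(u, \<theta>) \<in> polar_domain n \<alpha>" using dom by simp
        have "cmod (cis \<theta> / of_real u) \<le> 1" using um by (simp add: norm_divide)
        from inner[OF polar_in_Pol[OF P] this] show "D (u, \<theta>) = 0"
          using um by (simp add: D_def of_pol_polar to_pol_polar_param)
      qed
      then show ?thesis by (simp add: D_def u)
    qed
    then show ?thesis by (simp add: vec_eq_iff)
  qed
qed

lemma surface_exists:
  defines "f \<equiv> \<lambda>z. \<Sum>j<2*n. ln (cmod (z - \<zeta> j)) *\<^sub>R R j" and "ft \<equiv> \<lambda>p. X 0 (to_pol p)"
  shows "kobayashi_surface n \<alpha> b f" "analytic_extension n \<alpha> f ft"
proof -
  have "continuous_on (- singular_points n \<alpha>) f"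
    unfolding f_def singular_points_eq by (intro continuous_intros) auto
  then show "kobayashi_surface n \<alpha> b f"
    unfolding kobayashi_surface_def using contour_integral_integrand by (auto simp: f_def)
  have "ft (ext_iota z) = f z" if "z \<notin> singular_points n \<alpha>" for z
    using that X_klein[of z 0] by (simp add: ext_iota_klein ft_def f_def to_pol_of_pol singular_points_eq)
  moreover have "real_analytic_on (ball 0 1) (ft \<circ> (\<lambda>(x, y). ext_iota (Complex x y)))"
  proof -
    have "ft \<circ> (\<lambda>(x, y). ext_iota (Complex x y)) = (\<lambda>(x, y). X 0 (klein (Complex x y)))"
      by (auto simp: ft_def ext_iota_klein to_pol_of_pol)
    then show ?thesis using real_analytic_X_disc[of 0] by simp
  qed
  moreover have "real_analytic_on (polar_domain n \<alpha>) (ft \<circ> polar_param)"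
    using real_analytic_X_polar[of 0] by (simp add: ft_def o_def)
  ultimately show "analytic_extension n \<alpha> f ft"
    by (simp add: analytic_extension_def ext_real_analytic_def ext_params_def)
qed

end

text \<open>Provides a smooth local choice of the angle, once a rotation has moved the point into
  the right half plane.\<close>

lemma cis_arctan_quotient:
  assumes "Re w > 0" shows "cis (arctan (Im w / Re w)) = sgn w"
proof -
  define x y where "x = Re w" and "y = Im w"
  have x: "x > 0" using assms by (simp add: x_def)
  have s: "sqrt (1 + (y / x)\<^sup>2) = cmod w / x"
  proof -
    have "1 + (y / x)\<^sup>2 = (cmod w / x)\<^sup>2"
      using x by (simp add: power_divide cmod_power2 x_def[symmetric] y_def[symmetric] field_simps)
    then show ?thesis using x by simp
  qed
  have "cos (arctan (y / x)) = x / cmod w" "sin (arctan (y / x)) = y / cmod w"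
    using x by (simp_all only: cos_arctan sin_arctan s) auto
  then show ?thesis
    by (simp add: complex_eq_iff sgn_div_norm x_def y_def divide_inverse mult.commute)
qed

section \<open>The projection as a diffeomorphism\<close>

context kobayashi begin

lemma Ck_on_proj: "Ck_on k Pol (proj c1)"
  unfolding proj_def[abs_def]
  by (intro Ck_on_Pair Ck_on_Re Ck_on_Im Ck_on_add Ck_on_const Ck_on_F open_Pol)

lemma X_proj: "(X v w $ 2, X v w $ 3) = proj (Complex (v $ 2) (v $ 3)) w"
  by (simp add: X_def proj_def vector_3)

lemma proj_eq_iff: "w \<in> Pol \<Longrightarrow> proj c1 w = q \<longleftrightarrow> w = G (Complex (fst q) (snd q) - c1) "
proof
  assume w: "w \<in> Pol" "proj c1 w = q"
  then have "Complex (fst q) (snd q) - c1 = F w" by (auto simp: proj_def complex_eq_iff)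
  then show "w = G (Complex (fst q) (snd q) - c1)" using G_F w by simp
next
  assume "w = G (Complex (fst q) (snd q) - c1)"
  then show "proj c1 w = q" by (cases q) (simp add: proj_def F_G)
qed

theorem ext_diffeomorphism_X:
  fixes ft :: "ext_point \<Rightarrow> real^3"
  assumes ft: "\<And>p. p \<in> ext_domain n \<alpha> \<Longrightarrow> ft p = X v (to_pol p)"
  shows "ext_diffeomorphism n \<alpha> (\<lambda>p. (ft p $ 2, ft p $ 3))"
proof -
  define c1 where "c1 = Complex (v $ 2) (v $ 3)"
  define Phi where "Phi = (\<lambda>p. (ft p $ 2, ft p $ 3))"
  have Phi: "Phi p = proj c1 (to_pol p)" if "p \<in> ext_domain n \<alpha>" for p
    using ft[OF that] X_proj by (simp add: Phi_def c1_def)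
  define W where "W = (\<lambda>q. G (Complex (fst q) (snd q) - c1))"
  have W: "W q \<in> Pol" "proj c1 (W q) = q" for q
    using proj_eq_iff[of "W q"] G_in_Pol by (auto simp: W_def)
  have CW: "Ck_on k UNIV W" for k unfolding W_def
    by (rule Ck_on_compose[OF open_UNIV open_UNIV _ Ck_on_G])
      (auto intro!: Ck_on_diff Ck_on_Complex Ck_on_fst Ck_on_snd Ck_on_const)
  have cW: "continuous_on UNIV W" using CW[of 0] by simp
  have bij: "bij_betw Phi (ext_domain n \<alpha>) UNIV"
  proof (rule bij_betwI[where g="\<lambda>q. of_pol (W q)"])
    show "Phi (of_pol (W q)) = q" for q
      using of_pol_in_domain[OF W(1)] Phi W(2) by (simp add: to_pol_of_pol)
    show "(\<lambda>q. of_pol (W q)) \<in> UNIV \<rightarrow> ext_domain n \<alpha>" using of_pol_in_domain[OF W(1)] by blast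
    show "of_pol (W (Phi p)) = p" if "p \<in> ext_domain n \<alpha>" for p
    proof -
      have "to_pol p = W (Phi p)" unfolding W_def Phi[OF that]
        by (rule iffD1[OF proj_eq_iff[OF to_pol_in_Pol[OF that]] refl])
      then show ?thesis using of_pol_to_pol[OF that] by metis
    qed
  qed auto
  have inv: "inv_into (ext_domain n \<alpha>) Phi q = of_pol (W q)" for q
    using of_pol_in_domain[OF W(1)] Phi W(2) bij
    by (intro inv_into_f_eq) (auto simp: bij_betw_def to_pol_of_pol)
  have from1: "smooth_on (polar_domain n \<alpha>) (Phi \<circ> polar_param)"
    unfolding smooth_on_def
  proof
    fix k
    let ?c = "\<lambda>p::real \<times> real. Complex (cos (snd p) / fst p) (sin (snd p) / fst p)"
    have c: "?c p = to_pol (polar_param p)" for p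
      by (cases p) (simp add: to_pol_polar_param complex_eq_iff)
    have "Ck_on k (polar_domain n \<alpha>) (\<lambda>p. proj c1 (?c p))"
    proof (rule Ck_on_compose[OF open_polar_domain open_Pol _ Ck_on_proj])
      show "Ck_on k (polar_domain n \<alpha>) ?c"
        using polar_domain_pos
        by (intro Ck_on_Complex Ck_on_divide Ck_on_cos Ck_on_sin Ck_on_fst Ck_on_snd open_polar_domain) force+
      show "?c ` polar_domain n \<alpha> \<subseteq> Pol" unfolding c using polar_in_Pol by (auto simp: to_pol_polar_param)
    qed
    then show "Ck_on k (polar_domain n \<alpha>) (Phi \<circ> polar_param)"
      by (rule Ck_on_cong[OF open_polar_domain, rotated]) (simp add: c Phi ext_domain_def)
  qed
  have from2: "smooth_on (ball 0 1) (Phi \<circ> (\<lambda>(x, y). ext_iota (Complex x y)))"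
    unfolding smooth_on_def
  proof
    fix k
    let ?c = "\<lambda>p::real \<times> real. klein (Complex (fst p) (snd p))"
    have nb: "cmod (Complex (fst p) (snd p)) < 1" if "p \<in> ball 0 1" for p :: "real \<times> real"
      using that by (cases p) (simp add: norm_Pair complex_norm)
    have cP: "?c p \<in> Pol" if "p \<in> ball 0 1" for p
      using klein_less[OF nb[OF that]] ball_subset_Pol by auto
    have "Ck_on k (ball 0 1) (\<lambda>p. proj c1 (?c p))"
    proof (rule Ck_on_compose[OF open_ball open_Pol _ Ck_on_proj])
      show "Ck_on k (ball 0 1) ?c"
        by (rule Ck_on_compose[OF open_ball open_UNIV _ Ck_on_klein])
          (auto intro!: Ck_on_Complex Ck_on_fst Ck_on_snd)
      show "?c ` ball 0 1 \<subseteq> Pol" using cP by auto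
    qed
    then show "Ck_on k (ball 0 1) (Phi \<circ> (\<lambda>(x, y). ext_iota (Complex x y)))"
    proof (rule Ck_on_cong[OF open_ball, rotated])
      fix p :: "real \<times> real" assume p: "p \<in> ball 0 1"
      show "proj c1 (?c p) = (Phi \<circ> (\<lambda>(x, y). ext_iota (Complex x y))) p"
        using Phi[OF of_pol_in_domain[OF cP[OF p]]]
        by (simp add: ext_iota_klein to_pol_of_pol case_prod_unfold)
    qed
  qed
  have into: "\<exists>(E, \<psi>)\<in>ext_params n \<alpha>. \<exists>V h. open V \<and> q \<in> V \<and> smooth_on V h \<and> h ` V \<subseteq> E \<and>
      (\<forall>p\<in>V. of_pol (W p) = \<psi> (h p))" for q
  \<comment> \<open>Inside the circle the chart around \<open>None\<close> applies; elsewhere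
    \<open>W q\<close> is not zero and the polar chart applies, which also covers the circle, where
    the other chart folds.\<close>
  proof (cases "cmod (W q) < 1")
    case True
    define V where "V = W -` ball 0 1"
    define h where "h = (\<lambda>p. (Re (klein_inv (W p)), Im (klein_inv (W p))))"
    have oV: "open V" unfolding V_def using open_vimage[OF open_ball cW] .
    have z: "cmod (klein_inv (W p)) < 1" "klein (klein_inv (W p)) = W p" if "p \<in> V" for p
      using klein_klein_inv[of "W p"] that by (auto simp: V_def)
    have "smooth_on V h" unfolding smooth_on_def
    proof
      fix k
      have "Ck_on k V (\<lambda>p. klein_inv (W p))"
        by (rule Ck_on_compose[OF oV open_ball Ck_on_subset[OF CW] Ck_on_klein_inv]) (auto simp: V_def)
      then show "Ck_on k V h" unfolding h_def by (intro Ck_on_Pair Ck_on_Re Ck_on_Im oV)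
    qed
    moreover have "h ` V \<subseteq> ball 0 1" using z(1) by (auto simp: h_def norm_Pair cmod_def)
    moreover have "\<forall>p\<in>V. of_pol (W p) = (case h p of (x, y) \<Rightarrow> ext_iota (Complex x y))"
      using z(2) by (simp add: h_def ext_iota_klein)
    moreover have "q \<in> V" using True by (simp add: V_def)
    ultimately show ?thesis using oV unfolding ext_params_def by blast
  next
    case False
    define \<theta>0 where "\<theta>0 = Arg (W q)"
    define U where "U = (\<lambda>p. W p * cis (- \<theta>0))"
    define V where "V = {p. 0 < Re (U p)}"
    \<comment> \<open>The angle is measured from that of \<open>W q\<close>, so that near
      \<open>q\<close> it comes from arctan without a jump; the modulus is written as a root of its
      smooth square.\<close>
    define h where "h = (\<lambda>p. (1 / sqrt ((cmod (W p))\<^sup>2), \<theta>0 + arctan (Im (U p) / Re (U p))))"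
    have cU: "Ck_on k UNIV U" for k unfolding U_def by (intro Ck_on_mult CW Ck_on_const open_UNIV)
    have oV: "open V" unfolding V_def
      using cU[of 0] by (intro open_Collect_less continuous_intros) auto
    have W0: "W p \<noteq> 0" if "p \<in> V" for p using that by (auto simp: V_def U_def)
    have w: "W q = of_real (cmod (W q)) * cis \<theta>0" using rcis_cmod_Arg[of "W q"] by (simp add: rcis_def \<theta>0_def)
    have "U q = of_real (cmod (W q)) * cis \<theta>0 * cis (- \<theta>0)" unfolding U_def w[symmetric] ..
    then have "U q = of_real (cmod (W q))" by (simp add: cis_mult mult.assoc)
    then have qV: "q \<in> V" using False by (auto simp: V_def)
    have pp: "polar_param (h p) = of_pol (W p)" if "p \<in> V" for p
    proof -
      have "cis (\<theta>0 + arctan (Im (U p) / Re (U p))) = cis \<theta>0 * sgn (U p)"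
        using cis_arctan_quotient[of "U p"] that by (simp add: V_def cis_mult[symmetric])
      also have "\<dots> = sgn (W p)"
        by (simp add: U_def sgn_mult cis_mult)
      finally show ?thesis using W0[OF that] by (simp add: polar_param_def h_def of_pol_def)
    qed
    \<comment> \<open>Membership in the domain depends on the angle only modulo 2 pi, hence can be
      read off from the encoded point.\<close>
    have hE: "h p \<in> polar_domain n \<alpha>" if "p \<in> V" for p
    proof -
      have "of_pol (W p) \<in> ext_domain n \<alpha>" by (rule of_pol_in_domain[OF W(1)])
      then have "polar_param (h p) \<in> polar_param ` polar_domain n \<alpha>"
        unfolding pp[OF that, symmetric] by (auto simp: ext_domain_def polar_param_def split: prod.splits)
      then obtain p' where p': "p' \<in> polar_domain n \<alpha>" "polar_param (h p) = polar_param p'" by blast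
      obtain u \<theta> u' \<theta>' where *: "h p = (u, \<theta>)" "p' = (u', \<theta>')" by (cases "h p", cases p')
      have e: "u = u'" "cis \<theta> = cis \<theta>'" using p'(2) * by (simp_all add: polar_param_def)
      then have "cos (\<theta> - a) = cos (\<theta>' - a)" for a by (simp add: cos_diff complex_eq_iff)
      then show ?thesis using p'(1) e * by (simp add: polar_domain_iff)
    qed
    have "smooth_on V h" unfolding smooth_on_def
    proof
      fix k
      have cWV: "Ck_on k V W" "Ck_on k V U" using CW cU Ck_on_subset by blast+
      have nn: "Ck_on k V (\<lambda>p. (cmod (W p))\<^sup>2)"
        by (rule Ck_on_compose[OF oV open_UNIV cWV(1) Ck_on_norm_sq]) auto
      have ps: "(cmod (W p))\<^sup>2 > 0" "sqrt ((cmod (W p))\<^sup>2) \<noteq> 0" if "p \<in> V" for p using W0[OF that] by auto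
      have rr: "Re (U p) \<noteq> 0" if "p \<in> V" for p using that by (simp add: V_def)
      show "Ck_on k V h" unfolding h_def
        by (intro Ck_on_Pair Ck_on_divide Ck_on_const Ck_on_sqrt nn Ck_on_add Ck_on_arctan Ck_on_Re Ck_on_Im cWV oV ps rr)
    qed
    moreover have "h ` V \<subseteq> polar_domain n \<alpha>" using hE by auto
    moreover have "\<forall>p\<in>V. of_pol (W p) = polar_param (h p)" using pp by simp
    ultimately show ?thesis using oV qV unfolding ext_params_def by blast
  qed
  show ?thesis unfolding Phi_def[symmetric] ext_diffeomorphism_def ext_smooth_from_def ext_smooth_into_def
    using bij from1 from2 into by (simp add: inv ext_params_def)
qed

lemma zmc_graph_X:
  assumes "\<And>p. p \<in> ext_domain n \<alpha> \<Longrightarrow> ft p = X v (to_pol p)"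
  shows "ft ` ext_domain n \<alpha> = X v ` Pol" "zmc_entire_graph_of_mixed_type (ft ` ext_domain n \<alpha>)"
proof -
  show e: "ft ` ext_domain n \<alpha> = X v ` Pol" unfolding image_to_pol[symmetric] image_image
    using assms by (intro image_cong) auto
  show "zmc_entire_graph_of_mixed_type (ft ` ext_domain n \<alpha>)" unfolding e by (rule zmc_image)
qed

end

section \<open>How small the zeros must be\<close>

lemma kobayashiI:
  assumes n: "n \<ge> 2" and data: "kobayashi_data n \<alpha> b" and inj: "inj_on \<alpha> {0..2*n-1}"
    and gaps: "\<And>j. j \<in> {0..2*n-1} \<Longrightarrow> \<bar>(\<alpha>(2*n := 2*pi)) j - (\<alpha>(2*n := 2*pi)) (j + 1)\<bar> \<le> \<gamma>"
    and b: "\<And>i. i \<in> {1..n-1} \<Longrightarrow> cmod (b i) \<le> \<epsilon>" and e: "0 \<le> \<epsilon>" "\<epsilon> < 1"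
    and g: "(real n - 1) * (1 + \<epsilon>) / (1 - \<epsilon>) * \<gamma> < pi"
  shows "kobayashi n \<alpha> b \<gamma>"
proof
  show "n \<ge> 2" by fact
  show "\<alpha> 0 = 0" "\<alpha> (2 * n - 1) < 2 * pi" and bl: "\<And>i. i \<in> {1..n-1} \<Longrightarrow> cmod (b i) < 1"
    using data by (auto simp: kobayashi_data_def)
  have mono: "\<alpha> j \<le> \<alpha> (Suc j)" if "j < 2*n - 1" for j using data that by (auto simp: kobayashi_data_def)
  show "\<alpha> j < \<alpha> (Suc j)" if "Suc j < 2 * n" for j
    using mono[of j] inj_onD[OF inj, of j "Suc j"] that by fastforce
  show "\<alpha> (Suc j) - \<alpha> j \<le> \<gamma>" if "Suc j < 2 * n" for j
  proof -
    have "j \<in> {0..2*n-1}" "j \<noteq> 2*n" "j + 1 \<noteq> 2*n" using that by auto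
    with gaps[of j] show ?thesis by simp
  qed
  have "2 * n - 1 \<noteq> 2 * n" "2 * n - 1 + 1 = 2 * n" using n by auto
  then show "2 * pi - \<alpha> (2 * n - 1) \<le> \<gamma>"
    using gaps[of "2*n-1"] by (auto simp del: One_nat_def)
  have g0: "\<gamma> \<ge> 0" using gaps[of 0] abs_ge_zero order_trans by auto
  have "(1 + cmod (b i)) / (1 - cmod (b i)) \<le> (1 + \<epsilon>) / (1 - \<epsilon>)" if "i \<in> {1..n-1}" for i
    using b[OF that] e by (intro frac_le) auto
  then have "(\<Sum>i\<in>{1..n-1}. (1 + cmod (b i)) / (1 - cmod (b i))) \<le> (\<Sum>i\<in>{1..n-1}. (1 + \<epsilon>) / (1 - \<epsilon>))"
    by (rule sum_mono)
  also have "\<dots> = (real n - 1) * (1 + \<epsilon>) / (1 - \<epsilon>)" using n by (simp add: of_nat_diff)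
  finally show "(\<Sum>i\<in>{1..n-1}. (1 + cmod (b i)) / (1 - cmod (b i))) * \<gamma> < pi"
    using g g0 mult_right_mono by fastforce
qed

lemma epsilon_exists:
  assumes "n \<ge> 2" "0 \<le> \<gamma>" "\<gamma> < pi / (real n - 1)"
  obtains \<epsilon> :: real where "0 < \<epsilon>" "\<epsilon> < 1" "(real n - 1) * (1 + \<epsilon>) / (1 - \<epsilon>) * \<gamma> < pi"
proof -
  define c where "c = (real n - 1) * \<gamma>"
  have n1: "real n - 1 > 0" using assms by auto
  have c: "0 \<le> c" "c < pi"
    using assms(2,3) n1 by (simp_all add: c_def pos_less_divide_eq mult.commute mult_nonneg_nonneg)
  \<comment> \<open>Half of the value at which \<open>c * (1 + e) = pi * (1 - e)\<close>.\<close>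
  define e where "e = (pi - c) / (2 * (pi + c))"
  have pc: "pi + c > 0" using c pi_gt_zero by linarith
  have e0: "0 < e" using c pc by (simp add: e_def)
  have "x / (2 * k) * k = x / 2" if "k > 0" for x k :: real using that by simp
  from this[OF pc] have ee: "e * (pi + c) = (pi - c) / 2" unfolding e_def .
  have e1: "e < 1" using c pc pi_gt_zero by (simp add: e_def divide_less_eq)
  have "c * (1 + e) < pi * (1 - e)" using ee c by (simp add: algebra_simps)
  then have "c * (1 + e) / (1 - e) < pi" using e1 by (simp add: divide_less_eq)
  moreover have "(real n - 1) * (1 + e) / (1 - e) * \<gamma> = c * (1 + e) / (1 - e)" by (simp add: c_def)
  ultimately show thesis using that e0 e1 by metis
qed

theorem kobayashi_extension_diffeomorphism:
  assumes n: "n \<ge> 2" and gaps: "small_gaps n \<alpha>" and inj: "inj_on \<alpha> {0..2*n-1}"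
  shows "\<exists>\<epsilon>>0. \<forall>b f ft.
          kobayashi_data n \<alpha> b \<and> (\<forall>i\<in>{1..n-1}. cmod (b i) < \<epsilon>) \<and>
          kobayashi_surface n \<alpha> b f \<and> analytic_extension n \<alpha> f ft \<longrightarrow>
            ext_diffeomorphism n \<alpha> (\<lambda>p. (ft p $ 2, ft p $ 3)) \<and>
            zmc_entire_graph_of_mixed_type (ft ` ext_domain n \<alpha>)"
proof -
  define g where "g = (\<lambda>j. \<bar>(\<alpha>(2*n := 2*pi)) j - (\<alpha>(2*n := 2*pi)) (j + 1)\<bar>)"
  \<comment> \<open>A maximum of finitely many gaps is still strictly below pi / (n - 1), and this
    slack determines \<open>\<epsilon>\<close>.\<close>
  define \<gamma> where "\<gamma> = Max (g ` {0..2*n-1})"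
  have gle: "g j \<le> \<gamma>" if "j \<in> {0..2*n-1}" for j unfolding \<gamma>_def using that by (intro Max_ge) auto
  have "\<gamma> \<in> g ` {0..2*n-1}" unfolding \<gamma>_def by (intro Max_in) auto
  then have gl: "\<gamma> < pi / (real n - 1)" using gaps by (auto simp: small_gaps_def Let_def g_def)
  have g0: "0 \<le> \<gamma>" using gle[of 0] by (simp add: g_def order_trans[OF abs_ge_zero])
  obtain \<epsilon> :: real where e: "0 < \<epsilon>" "\<epsilon> < 1" "(real n - 1) * (1 + \<epsilon>) / (1 - \<epsilon>) * \<gamma> < pi"
    by (rule epsilon_exists[OF n g0 gl])
  show ?thesis
  proof (intro exI[of _ \<epsilon>] conjI allI impI e(1); elim conjE)
    fix b f ft
    assume *: "kobayashi_data n \<alpha> b" "\<forall>i\<in>{1..n-1}. cmod (b i) < \<epsilon>" "kobayashi_surface n \<alpha> b f" "analytic_extension n \<alpha> f ft"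
    interpret kobayashi n \<alpha> b \<gamma>
      by (rule kobayashiI[OF n *(1) inj, of \<gamma> \<epsilon>]) (use gle e *(2) in \<open>auto simp: g_def less_imp_le\<close>)
    have ft: "ft p = X (f 0) (to_pol p)" if "p \<in> ext_domain n \<alpha>" for p
      by (rule extension_formula[OF *(3,4) that])
    show "ext_diffeomorphism n \<alpha> (\<lambda>p. (ft p $ 2, ft p $ 3))" by (rule ext_diffeomorphism_X[OF ft])
    show "zmc_entire_graph_of_mixed_type (ft ` ext_domain n \<alpha>)" by (rule zmc_graph_X(2)[OF ft])
  qed
qed

section \<open>Automorphisms of the disc\<close>

text \<open>\<open>p\<close> and \<open>q\<close> are the Wirtinger derivatives. Comparing the
  lengths of the images of 1, i and 1 + i gives \<open>p * cnj q = 0\<close>.\<close>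

lemma conformal_real_linear:
  fixes D :: "complex \<Rightarrow> complex"
  assumes "linear D" and C: "\<And>h. cmod (D h) = C * cmod h"
  defines "p \<equiv> (D 1 - \<i> * D \<i>) / 2" and "q \<equiv> (D 1 + \<i> * D \<i>) / 2"
  shows "D h = p * h + q * cnj h" "p * cnj q = 0" "C > 0 \<Longrightarrow> p \<noteq> 0 \<or> q \<noteq> 0"
proof -
  have i: "cmod x ^ 2 = Re (x * cnj x)" for x unfolding cmod_power2 by (simp add: power2_eq_square)
  show D: "D h = p * h + q * cnj h" for h
    using complex_linear_eq[OF assms(1), of h]
    by (simp add: p_def q_def complex_eq_iff field_simps)
  have 1: "cmod (p + q) = C" using C[of 1] D[of 1] by simp
  have 2: "cmod (p - q) = C"
  proof -
    have "D \<i> = \<i> * (p - q)" using D[of \<i>] by (simp add: algebra_simps)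
    then show ?thesis using C[of \<i>] by (simp add: norm_mult)
  qed
  have 3: "(cmod (p * (1 + \<i>) + q * (1 - \<i>)))\<^sup>2 = C\<^sup>2 * 2"
  proof -
    have "D (1 + \<i>) = p * (1 + \<i>) + q * (1 - \<i>)" using D[of "1 + \<i>"] by simp
    moreover have "(cmod (1 + \<i>))\<^sup>2 = 2" by (simp add: cmod_power2)
    ultimately show ?thesis using C[of "1 + \<i>"] by (simp add: power_mult_distrib)
  qed
  have "4 * Re (p * cnj q) = (cmod (p + q))\<^sup>2 - (cmod (p - q))\<^sup>2"
    unfolding cmod_power2 by (simp add: power2_eq_square algebra_simps)
  then have re: "Re (p * cnj q) = 0" using 1 2 by simp
  have "(cmod (p * (1 + \<i>) + q * (1 - \<i>)))\<^sup>2 + 4 * Im (p * cnj q) = (cmod (p + q))\<^sup>2 + (cmod (p - q))\<^sup>2"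
    unfolding cmod_power2 by (simp add: power2_eq_square algebra_simps)
  then have "Im (p * cnj q) = 0" unfolding 1 2 3 by simp
  then show "p * cnj q = 0" using re by (simp add: complex_eq_iff)
  show "p \<noteq> 0 \<or> q \<noteq> 0" if "C > 0" using 1 that by auto
qed

text \<open>At each point exactly one Wirtinger derivative vanishes. The two zero sets are closed
  and complementary in the connected disc, so one of them is everything.\<close>

lemma conformal_imp_holomorphic_or_anti:
  assumes f: "Ck_on (Suc 0) (ball 0 1) \<phi>"
    and C: "\<And>z h. z \<in> ball 0 1 \<Longrightarrow> cmod (frechet_derivative \<phi> (at z) h) = C z * cmod h"
    and Cpos: "\<And>z. z \<in> ball 0 1 \<Longrightarrow> C z > 0"
  shows "\<phi> holomorphic_on ball 0 1 \<or> (\<lambda>z. \<phi> (cnj z)) holomorphic_on ball 0 1"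
proof -
  let ?D = "\<lambda>z. frechet_derivative \<phi> (at z)"
  have der: "(\<phi> has_derivative ?D z) (at z)" if "z \<in> ball 0 1" for z using Ck_on_SucD[OF f that] .
  define p q where "p = (\<lambda>z. (?D z 1 - \<i> * ?D z \<i>) / 2)" and "q = (\<lambda>z. (?D z 1 + \<i> * ?D z \<i>) / 2)"
  have lin: "linear (?D z)" if "z \<in> ball 0 1" for z using der[OF that] by (rule has_derivative_linear)
  have rep: "?D z h = p z * h + q z * cnj h" if "z \<in> ball 0 1" for z h
    unfolding p_def q_def by (rule conformal_real_linear(1)[OF lin[OF that] C[OF that]])
  have pq: "p z = 0 \<or> q z = 0" "p z \<noteq> 0 \<or> q z \<noteq> 0" if "z \<in> ball 0 1" for z
  proof -
    have "p z * cnj (q z) = 0" unfolding p_def q_def by (rule conformal_real_linear(2)[OF lin[OF that] C[OF that]])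
    then show "p z = 0 \<or> q z = 0" by simp
    show "p z \<noteq> 0 \<or> q z \<noteq> 0" unfolding p_def q_def
      by (rule conformal_real_linear(3)[OF lin[OF that] C[OF that] Cpos[OF that]])
  qed
  have cont: "continuous_on (ball 0 1) (\<lambda>z. ?D z h)" for h
    using Ck_on_SucD2[OF f, of h] by simp
  have cp: "continuous_on (ball 0 1) p" "continuous_on (ball 0 1) q"
    unfolding p_def q_def by (intro continuous_intros cont; simp)+
  have cl: "closedin (top_of_set (ball 0 1)) {z \<in> ball 0 1. p z = 0}" "closedin (top_of_set (ball 0 1)) {z \<in> ball 0 1. q z = 0}"
    using continuous_closedin_preimage_constant[OF cp(1), of 0] continuous_closedin_preimage_constant[OF cp(2), of 0]
    by (simp_all add: vimage_def Int_def)
  have eq: "{z \<in> ball 0 1. p z = 0} = ball 0 1 - {z \<in> ball 0 1. q z = 0}"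
  proof (rule set_eqI)
    show "z \<in> {z \<in> ball 0 1. p z = 0} \<longleftrightarrow> z \<in> ball 0 1 - {z \<in> ball 0 1. q z = 0}" for z
      using pq[of z] by (cases "z \<in> ball 0 1") auto
  qed
  have op: "openin (top_of_set (ball 0 1)) {z \<in> ball 0 1. p z = 0}"
    unfolding eq by (rule openin_diff[OF openin_subtopology_self cl(2)])
  have "{z \<in> ball 0 1. p z = 0} = {} \<or> {z \<in> ball 0 1. p z = 0} = ball 0 1"
    using connected_clopen[of "ball 0 (1::real) :: complex set"] op cl(1) by (metis connected_ball)
  then show ?thesis
  proof
    assume "{z \<in> ball 0 1. p z = 0} = {}"
    then have "q z = 0" if "z \<in> ball 0 1" for z using pq[OF that] that by blast
    then have "(\<phi> has_field_derivative p z) (at z)" if "z \<in> ball 0 1" for z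
      using der[OF that] rep[OF that] that unfolding has_field_derivative_def
      by (intro has_derivative_eq_rhs[OF der[OF that]]) auto
    then have "\<phi> holomorphic_on ball 0 1" unfolding holomorphic_on_open[OF open_ball] by blast
    then show ?thesis ..
  next
    assume a: "{z \<in> ball 0 1. p z = 0} = ball 0 1"
    have "((\<lambda>z. \<phi> (cnj z)) has_field_derivative q (cnj z)) (at z)" if "z \<in> ball 0 1" for z
    proof -
      have z: "cnj z \<in> ball 0 1" using that by simp
      then have p0: "p (cnj z) = 0" using a by blast
      have "(cnj has_derivative cnj) (at z)" by (rule bounded_linear_imp_has_derivative[OF bounded_linear_cnj])
      from has_derivative_compose[OF this der[OF z]]
      have "((\<lambda>z. \<phi> (cnj z)) has_derivative (\<lambda>h. ?D (cnj z) (cnj h))) (at z)" .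
      then show ?thesis unfolding has_field_derivative_def
        by (rule has_derivative_eq_rhs) (use rep[OF z] p0 in auto)
    qed
    then have "(\<lambda>z. \<phi> (cnj z)) holomorphic_on ball 0 1" unfolding holomorphic_on_open[OF open_ball] by blast
    then show ?thesis ..
  qed
qed

definition moeb :: "complex \<Rightarrow> complex \<Rightarrow> complex \<Rightarrow> complex" where
  "moeb u a z = u * ((z - a) / (1 - cnj a * z))"

lemma moeb_denom: assumes "cmod a < 1" "cmod z \<le> 1" shows "1 - cnj a * z \<noteq> 0"
proof
  assume "1 - cnj a * z = 0"
  then have "cmod a * cmod z = 1" by (metis complex_mod_cnj eq_iff_diff_eq_0 norm_mult norm_one)
  then show False using assms mult_left_le[of "cmod z" "cmod a"] by auto
qed

text \<open>The distortion of a distance splits into one factor for each end point, which is why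
  moduli of cross ratios are invariant.\<close>

lemma moeb_diff:
  assumes "cmod a < 1" "cmod u = 1" "cmod z \<le> 1" "cmod z' \<le> 1"
  shows "cmod (moeb u a z - moeb u a z') = (1 - (cmod a)\<^sup>2) * cmod (z - z') / (cmod (1 - cnj a * z) * cmod (1 - cnj a * z'))"
proof -
  note d = moeb_denom[OF assms(1,3)] moeb_denom[OF assms(1,4)]
  have "moeb u a z - moeb u a z' = u * ((1 - a * cnj a) * (z - z') / ((1 - cnj a * z) * (1 - cnj a * z')))"
    unfolding moeb_def using d by (simp add: divide_simps) (simp add: algebra_simps)
  moreover have "1 - a * cnj a = of_real (1 - (cmod a)\<^sup>2)" by (simp only: of_real_diff of_real_1 complex_norm_square)
  moreover have "\<bar>1 - (cmod a)\<^sup>2\<bar> = 1 - (cmod a)\<^sup>2" using assms(1) by (simp add: abs_square_le_1 less_imp_le)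
  ultimately show ?thesis using assms(2) by (simp only: norm_mult norm_divide norm_of_real mult_1)
qed

lemma continuous_on_moeb: assumes "cmod a < 1" shows "continuous_on (cball 0 1) (moeb u a)"
  unfolding moeb_def[abs_def] using moeb_denom[OF assms] by (intro continuous_intros) auto

text \<open>After a Moebius map has moved the zero of \<open>m\<close> to 0, the Schwarz lemma for
  the map and for its inverse forces equality at one point, hence a rotation.\<close>

lemma disc_automorphism:
  assumes hol: "m holomorphic_on ball 0 1" and bij: "bij_betw m (ball 0 1) (ball 0 1)"
  obtains u a where "cmod u = 1" "cmod a < 1" "\<And>z. cmod z < 1 \<Longrightarrow> m z = moeb u a z"
proof -
  obtain g where g: "g holomorphic_on ball 0 1" "\<And>z. z \<in> ball 0 1 \<Longrightarrow> g (m z) = z"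
    using holomorphic_has_inverse[OF hol open_ball] bij by (metis bij_betw_def)
  have mb: "m z \<in> ball 0 1" if "z \<in> ball 0 1" for z using bij that by (auto simp: bij_betw_def)
  have gb: "g w \<in> ball 0 1 \<and> m (g w) = w" if "w \<in> ball 0 1" for w
  proof -
    have "w \<in> m ` ball 0 1" using bij that by (simp add: bij_betw_def)
    then obtain z where "z \<in> ball 0 1" "m z = w" by blast
    then show ?thesis using g(2) by auto
  qed
  define a where "a = g 0"
  have a: "cmod a < 1" "m a = 0" using gb[of 0] by (auto simp: a_def)
  let ?M = "Moebius_function 0 a" and ?N = "Moebius_function 0 (- a)"
  have Mb: "?M z \<in> ball 0 1" "?N z \<in> ball 0 1" if "z \<in> ball 0 1" for z
    using Moebius_function_norm_lt_1[of a z 0] Moebius_function_norm_lt_1[of "- a" z 0] a that by auto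
  have MN: "?M (?N z) = z" "?N (?M z) = z" if "z \<in> ball 0 1" for z
    using Moebius_function_compose[of a "- a" z] Moebius_function_compose[of "- a" a z] a that by auto
  define h where "h = m \<circ> ?N"
  define k where "k = ?M \<circ> g"
  have hh: "h holomorphic_on ball 0 1" unfolding h_def
    by (rule holomorphic_on_compose_gen[OF _ hol]) (use a Mb in \<open>auto intro: Moebius_function_holomorphic\<close>)
  have kh: "k holomorphic_on ball 0 1" unfolding k_def
    by (rule holomorphic_on_compose_gen[OF g(1) Moebius_function_holomorphic]) (use a gb in auto)
  have h0: "h 0 = 0" by (simp add: h_def Moebius_function_of_zero a)
  have k0: "k 0 = 0" by (simp add: k_def a_def[symmetric] Moebius_function_eq_zero)
  have hb: "cmod (h z) < 1" if "cmod z < 1" for z using mb Mb that by (simp add: h_def)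
  have kb: "cmod (k z) < 1" if "cmod z < 1" for z using gb Mb that by (simp add: k_def)
  have kh_id: "k (h z) = z" if "cmod z < 1" for z
    using that g(2)[of "?N z"] Mb MN by (simp add: h_def k_def)
  have half: "cmod (h (1/2)) = cmod (1/2 :: complex)"
  proof (rule antisym)
    show "cmod (h (1/2)) \<le> cmod (1/2 :: complex)" by (rule Schwarz_Lemma(1)[OF hh h0 hb]) auto
    have "cmod (k (h (1/2))) \<le> cmod (h (1/2))" by (rule Schwarz_Lemma(1)[OF kh k0 kb hb]) auto
    then show "cmod (1/2 :: complex) \<le> cmod (h (1/2))" using kh_id[of "1/2"] by simp
  qed
  have ex: "(\<exists>z. cmod z < 1 \<and> z \<noteq> 0 \<and> cmod (h z) = cmod z) \<or> cmod (deriv h 0) = 1"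
    by (rule disjI1, rule exI[of _ "1/2"]) (use half in auto)
  obtain u where u: "\<And>z. cmod z < 1 \<Longrightarrow> h z = u * z" "cmod u = 1"
    using Schwarz_Lemma(3)[OF hh h0 hb _ ex, of 0] by auto
  show thesis
  proof (rule that[OF u(2) a(1)])
    fix z :: complex assume z: "cmod z < 1"
    have "m z = h (?M z)" using MN z by (simp add: h_def)
    also have "\<dots> = u * ?M z" using Mb[of z] z by (intro u) auto
    finally show "m z = moeb u a z" by (simp add: moeb_def Moebius_function_simple)
  qed
qed

text \<open>Fixed points solve \<open>cnj a * z\<^sup>2 + (u - 1) * z - u * a = 0\<close>, and three
  distinct roots force all coefficients to vanish.\<close>

lemma moeb_three_fixed:
  assumes "z1 \<noteq> z2" "z1 \<noteq> z3" "z2 \<noteq> z3" "cmod a < 1" "\<And>z. z \<in> {z1, z2, z3} \<Longrightarrow> cmod z = 1 \<and> moeb u a z = z"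
  shows "a = 0" "u = 1"
proof -
  have e: "cnj a * z\<^sup>2 + (u - 1) * z - u * a = 0" if "z \<in> {z1, z2, z3}" for z
  proof -
    have "1 - cnj a * z \<noteq> 0" using moeb_denom[OF assms(4)] assms(5)[OF that] by simp
    then have "u * (z - a) = z * (1 - cnj a * z)" using assms(5)[OF that] by (simp add: moeb_def field_simps)
    then show ?thesis by (simp add: algebra_simps power2_eq_square)
  qed
  have d: "cnj a * (x + y) + (u - 1) = 0" if "x \<in> {z1, z2, z3}" "y \<in> {z1, z2, z3}" "x \<noteq> y" for x y
  proof -
    have "(x - y) * (cnj a * (x + y) + (u - 1)) = 0"
      using e[OF that(1)] e[OF that(2)] by (simp add: algebra_simps power2_eq_square)
    then show ?thesis using that(3) by simp
  qed
  have "cnj a * (z2 - z3) = (cnj a * (z1 + z2) + (u - 1)) - (cnj a * (z1 + z3) + (u - 1))"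
    by (simp add: algebra_simps)
  also have "\<dots> = 0" using d[of z1 z2] d[of z1 z3] assms(1,2) by simp
  finally have "cnj a * (z2 - z3) = 0" .
  then show "a = 0" using assms(3) by simp
  then show "u = 1" using d[of z1 z2] assms(1) by simp
qed

text \<open>On the circle \<open>cnj z\<close> is 1 / z, so a fixed point is a root of a quadratic
  polynomial with leading coefficient 1, and there are at most two.\<close>

lemma moeb_cnj_three_fixed:
  assumes "z1 \<noteq> z2" "z1 \<noteq> z3" "z2 \<noteq> z3" "cmod a < 1" "\<And>z. z \<in> {z1, z2, z3} \<Longrightarrow> cmod z = 1 \<and> moeb u a (cnj z) = z"
  shows False
proof -
  have e: "z\<^sup>2 + (u * a - cnj a) * z - u = 0" if "z \<in> {z1, z2, z3}" for z
  proof -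
    have c: "z * cnj z = 1" using assms(5)[OF that] complex_norm_square[of z] by simp
    have "1 - cnj a * cnj z \<noteq> 0" using moeb_denom[OF assms(4), of "cnj z"] assms(5)[OF that] by simp
    then have "u * (cnj z - a) = z * (1 - cnj a * cnj z)" using assms(5)[OF that] by (simp add: moeb_def field_simps)
    then have "z * (u * (cnj z - a)) = z * (z * (1 - cnj a * cnj z))" by simp
    then have "u * (z * cnj z) - u * a * z = z\<^sup>2 - cnj a * z * (z * cnj z)" by (simp add: algebra_simps power2_eq_square)
    then show ?thesis unfolding c by (simp add: algebra_simps)
  qed
  have d: "x + y + (u * a - cnj a) = 0" if "x \<in> {z1, z2, z3}" "y \<in> {z1, z2, z3}" "x \<noteq> y" for x y
  proof -
    have "(x - y) * (x + y + (u * a - cnj a)) = 0"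
      using e[OF that(1)] e[OF that(2)] by (simp add: algebra_simps power2_eq_square)
    then show ?thesis using that(3) by simp
  qed
  have "z2 - z3 = (z1 + z2 + (u * a - cnj a)) - (z1 + z3 + (u * a - cnj a))" by simp
  also have "\<dots> = 0" using d[of z1 z2] d[of z1 z3] assms(1,2) by simp
  finally have "z2 - z3 = 0" .
  then show False using assms(3) by simp
qed

section \<open>Congruent surfaces\<close>

definition axes :: "real \<Rightarrow> complex \<Rightarrow> real^3" where "axes x y = vector [x, Re y, Im y]"

lemma axes_comp: "axes x y $ 1 = x" "axes x y $ 2 = Re y" "axes x y $ 3 = Im y"
  by (simp_all add: axes_def vector_3)

lemma axes_eq_iff: "axes x y = axes x' y' \<longleftrightarrow> x = x' \<and> y = y'"
  by (auto simp: vec_eq_iff forall_3 axes_comp complex_eq_iff)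

lemma axes_0: "axes 0 0 = 0" by (simp add: vec_eq_iff forall_3 axes_comp)

lemma has_derivative_axes:
  assumes "(f has_derivative f') F" "(g has_derivative g') F"
  shows "((\<lambda>x. axes (f x) (g x)) has_derivative (\<lambda>h. axes (f' h) (g' h))) F"
proof -
  have e: "axes x y = x *\<^sub>R axes 1 0 + Re y *\<^sub>R axes 0 1 + Im y *\<^sub>R axes 0 \<i>" for x y
    by (simp add: vec_eq_iff forall_3 axes_comp)
  show ?thesis
    by (subst (1 2) e) (intro has_derivative_add has_derivative_scaleR_left has_derivative_Re has_derivative_Im assms)
qed

lemma lorentz_axes: "lorentz (axes x y) (axes x y) = (cmod y)\<^sup>2 - x\<^sup>2"
  unfolding cmod_power2 by (simp add: lorentz_def axes_comp power2_eq_square)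

text \<open>The Lorentz form is nondegenerate.\<close>

lemma lorentz_isometry_injective:
  assumes "linear A" "\<And>p q. lorentz (A p) (A q) = lorentz p q" "A p = 0" shows "p = 0"
proof -
  have z: "lorentz p q = 0" for q using assms(2)[of p q] assms(3) by (simp add: lorentz_def)
  show ?thesis using z[of "axes 1 0"] z[of "axes 0 1"] z[of "axes 0 \<i>"]
    by (simp add: vec_eq_iff forall_3 lorentz_def axes_comp)
qed

definition radial :: "complex \<Rightarrow> nat \<Rightarrow> complex" where
  "radial z m = of_real (1 - 1 / real (m + 2)) * z"

lemma norm_radial: assumes "cmod z = 1" shows "cmod (radial z m) < 1"
proof -
  have "1 / real (m + 2) \<le> 1" by simp
  then have "\<bar>1 - 1 / real (m + 2)\<bar> < 1" by (simp only: abs_if) auto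
  then show ?thesis unfolding radial_def norm_mult norm_of_real assms by simp
qed

lemma tendsto_radial: "radial z \<longlonglongrightarrow> z"
proof -
  have lim: "(\<lambda>m. 1 - 1 / real (m + 2)) \<longlonglongrightarrow> 1 - 0"
    by (rule tendsto_diff[OF tendsto_const LIMSEQ_ignore_initial_segment[OF lim_1_over_n]])
  have "radial z \<longlonglongrightarrow> of_real (1 - 0) * z" unfolding radial_def[abs_def]
    by (intro tendsto_mult tendsto_of_real lim tendsto_const)
  then show ?thesis by simp
qed

context kobayashi begin

lemma X_axes: "X v w = v + axes (H w) (F w)"
  by (simp add: vec_eq_iff forall_3 axes_comp X_def vector_3)

lemma has_derivative_X: "w \<in> Pol \<Longrightarrow> (X v has_derivative (\<lambda>h. axes (DH w h) (DF w h))) (at w)"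
  unfolding X_axes[abs_def]
  using has_derivative_add[OF has_derivative_const has_derivative_axes[OF has_derivative_H has_derivative_F]] by simp

lemma has_derivative_X_klein: "cmod z < 1 \<Longrightarrow> ((\<lambda>z. X v (klein z)) has_derivative (\<lambda>h. axes (Hd z h) (Fd z h))) (at z)"
  unfolding X_axes
  using has_derivative_add[OF has_derivative_const has_derivative_axes[OF has_derivative_H_klein has_derivative_F_klein]] by simp

lemma lorentz_gm: "lorentz (axes (DH w h) (DF w h)) (axes (DH w h) (DF w h)) = gm w h"
  by (simp add: lorentz_axes gm_def)

lemma DF_injective: assumes "w \<in> Pol" "DF w h = 0" shows "h = 0"
proof -
  have "DF w h = of_real (Re h) * DF w 1 + of_real (Im h) * DF w \<i>"
    by (simp only: complex_linear_eq[OF DF_linear, of w h] scaleR_conv_of_real)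
  then have e: "of_real (Re h) * DF w 1 + of_real (Im h) * DF w \<i> = 0" using assms by simp
  have "Im (cnj (of_real (Re h) * DF w 1 + of_real (Im h) * DF w \<i>) * DF w \<i>) = Re h * Jac w"
    "Im (cnj (DF w 1) * (of_real (Re h) * DF w 1 + of_real (Im h) * DF w \<i>)) = Im h * Jac w"
    by (simp_all add: Jac_def algebra_simps)
  then have "Re h * Jac w = 0" "Im h * Jac w = 0" unfolding e by simp_all
  then show ?thesis using Jac_nz[OF assms(1)] by (simp add: complex_eq_iff)
qed

text \<open>Describes the disc by the induced form alone, so that it is preserved by every
  similarity of the images.\<close>

lemma spacelike_iff:
  assumes "w \<in> Pol" shows "cmod w < 1 \<longleftrightarrow> (\<forall>h. h \<noteq> 0 \<longrightarrow> gm w h > 0)"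
  using spacelike_disc[of w] not_spacelike_outside[OF assms] by (metis less_irrefl not_less)

text \<open>Near \<open>\<zeta> j\<close> one logarithm is unbounded while the others converge, and
  its coefficient \<open>R j\<close> is not zero.\<close>

lemma X_blowup:
  assumes j: "j < 2 * n"
  shows "\<not> Bseq (\<lambda>m. X v (klein (radial (\<zeta> j) m)))"
proof
  define z where "z = radial (\<zeta> j)"
  assume "Bseq (\<lambda>m. X v (klein (radial (\<zeta> j) m)))"
  then obtain C where C: "\<And>m. norm (X v (klein (z m))) \<le> C" by (auto simp: Bseq_def z_def)
  have nz: "cmod (z m) < 1" for m unfolding z_def by (rule norm_radial) simp
  have lim: "z \<longlonglongrightarrow> \<zeta> j" unfolding z_def by (rule tendsto_radial)
  define S where "S = (\<lambda>m. \<Sum>k\<in>{..<2*n} - {j}. ln (cmod (z m - \<zeta> k)) *\<^sub>R R k)"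
  have "convergent S" unfolding S_def
  proof (rule convergent_sum)
    fix k assume k: "k \<in> {..<2*n} - {j}"
    then have "\<zeta> j - \<zeta> k \<noteq> 0" using inj_zeta j by (auto simp: inj_on_def)
    then have "(\<lambda>m. ln (cmod (z m - \<zeta> k)) *\<^sub>R R k) \<longlonglongrightarrow> ln (cmod (\<zeta> j - \<zeta> k)) *\<^sub>R R k"
      by (intro tendsto_intros lim) auto
    then show "convergent (\<lambda>m. ln (cmod (z m - \<zeta> k)) *\<^sub>R R k)" by (rule convergentI)
  qed
  then obtain C1 where C1: "\<And>m. norm (S m) \<le> C1" using convergent_imp_Bseq BseqE by metis
  have R0: "norm (R j) > 0" using beta_nz[OF j] by (auto simp: vec_eq_iff forall_3 R_comp complex_eq_iff)
  have "\<bar>ln (cmod (z m - \<zeta> j))\<bar> * norm (R j) \<le> C + C1 + norm v" for m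
  proof -
    have "X v (klein (z m)) = v + (ln (cmod (z m - \<zeta> j)) *\<^sub>R R j + S m)"
      unfolding X_klein[OF disc_not_zeta[OF nz]] S_def using j by (simp add: sum.remove[of _ j])
    then have "ln (cmod (z m - \<zeta> j)) *\<^sub>R R j = X v (klein (z m)) - v - S m" by simp
    then have "\<bar>ln (cmod (z m - \<zeta> j))\<bar> * norm (R j) = norm (X v (klein (z m)) - v - S m)"
      by (metis norm_scaleR)
    also have "\<dots> \<le> norm (X v (klein (z m))) + norm v + norm (S m)"
      by (meson add_mono norm_triangle_ineq4 order_trans order_refl)
    finally show ?thesis using C[of m] C1[of m] by linarith
  qed
  then have "\<bar>ln (cmod (z m - \<zeta> j))\<bar> \<le> (C + C1 + norm v) / norm (R j)" for m
    using R0 by (simp add: pos_le_divide_eq)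
  then have ge: "- ((C + C1 + norm v) / norm (R j)) \<le> ln (cmod (z m - \<zeta> j))" for m by (metis abs_le_iff minus_le_iff)
  have "exp (- ((C + C1 + norm v) / norm (R j))) \<le> cmod (z m - \<zeta> j)" for m
  proof -
    have "z m \<noteq> \<zeta> j" using nz[of m] by auto
    then show ?thesis using ge[of m] by (simp add: ln_ge_iff)
  qed
  moreover have "(\<lambda>m. cmod (z m - \<zeta> j)) \<longlonglongrightarrow> cmod (\<zeta> j - \<zeta> j)" by (intro tendsto_intros lim)
  ultimately have "exp (- ((C + C1 + norm v) / norm (R j))) \<le> cmod (\<zeta> j - \<zeta> j)"
    by (intro LIMSEQ_le_const) auto
  then show False by (simp add: not_le[symmetric])
qed

end

section \<open>The map of the disc induced by a congruence\<close>

locale congruent_pair = s: kobayashi n \<alpha> b \<gamma> + t: kobayashi n \<alpha>' b' \<gamma>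
  for n \<alpha> b \<gamma> \<alpha>' b' +
  fixes v v' u0 :: "real^3" and A :: "real^3 \<Rightarrow> real^3" and c :: real
  assumes A: "linear A" "\<And>p q. lorentz (A p) (A q) = lorentz p q" and c: "c > 0"
    and image: "t.X v' ` t.Pol = (\<lambda>p. c *\<^sub>R (A p + u0)) ` s.X v ` s.Pol"
begin

definition P where "P p = c *\<^sub>R (A p + u0)"
text \<open>Inverts the parametrization of the second surface through the planar projection. It is
  defined on all of space, so \<open>Th\<close> is smooth as a composition.\<close>

definition g where "g q = t.G (Complex (q $ 2) (q $ 3) - Complex (v' $ 2) (v' $ 3))" for q :: "real^3"
definition Th where "Th w = g (P (s.X v w))"

lemma A_inj: "A p = A q \<Longrightarrow> p = q"
  using lorentz_isometry_injective[OF A, of "p - q"] linear_diff[OF A(1), of p q] by simp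

lemma P_inj: "P p = P q \<Longrightarrow> p = q"
  using c A_inj by (auto simp: P_def)

lemma g_X: "w \<in> t.Pol \<Longrightarrow> g (t.X v' w) = w"
proof -
  assume w: "w \<in> t.Pol"
  have "Complex (t.X v' w $ 2) (t.X v' w $ 3) - Complex (v' $ 2) (v' $ 3) = t.F w"
    by (simp add: t.X_axes axes_comp complex_eq_iff)
  then show ?thesis using w by (simp add: g_def t.G_F)
qed

lemma X_Th: assumes "w \<in> s.Pol" shows "Th w \<in> t.Pol" "t.X v' (Th w) = P (s.X v w)"
proof -
  have "P (s.X v w) \<in> t.X v' ` t.Pol" unfolding image P_def[symmetric] using assms by blast
  then obtain w' where "w' \<in> t.Pol" "t.X v' w' = P (s.X v w)" by auto
  then show "Th w \<in> t.Pol" "t.X v' (Th w) = P (s.X v w)" using g_X[of w'] by (auto simp: Th_def)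
qed

lemma Th_surj: assumes "w' \<in> t.Pol" obtains w where "w \<in> s.Pol" "Th w = w'"
proof -
  have "t.X v' w' \<in> (\<lambda>p. c *\<^sub>R (A p + u0)) ` s.X v ` s.Pol" using image assms by blast
  then obtain w where "w \<in> s.Pol" "t.X v' w' = P (s.X v w)" by (auto simp: P_def)
  then show thesis using that g_X[OF assms] by (simp add: Th_def)
qed

lemma X_s_inj: assumes "w \<in> s.Pol" "w' \<in> s.Pol" "s.X v w = s.X v w'" shows "w = w'"
  using assms s.G_F by (metis s.X_axes add_left_cancel axes_eq_iff)

lemma Th_inj: assumes "w \<in> s.Pol" "w' \<in> s.Pol" "Th w = Th w'" shows "w = w'"
  using X_Th(2)[OF assms(1)] X_Th(2)[OF assms(2)] assms P_inj X_s_inj by metis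

lemma Ck_on_Th: "Ck_on k s.Pol Th"
proof -
  have bl: "bounded_linear A" using A(1) by (simp add: linear_conv_bounded_linear)
  have X: "Ck_on k s.Pol (s.X v)"
  proof -
    have e: "s.X v w = v + (s.H w *\<^sub>R axes 1 0 + Re (s.F w) *\<^sub>R axes 0 1 + Im (s.F w) *\<^sub>R axes 0 \<i>)" for w
      by (simp add: s.X_axes vec_eq_iff forall_3 axes_comp)
    show ?thesis unfolding e[abs_def]
      by (intro Ck_on_add Ck_on_const Ck_on_scaleR Ck_on_Re Ck_on_Im s.Ck_on_H s.Ck_on_F s.open_Pol)
  qed
  have PX: "Ck_on k s.Pol (\<lambda>w. P (s.X v w))" unfolding P_def
    by (intro Ck_on_scaleR Ck_on_const Ck_on_add Ck_on_bounded_linear_compose[OF _ bl X] s.open_Pol)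
  have nth: "bounded_linear (\<lambda>q::real^3. q $ i)" for i by (rule bounded_linear_vec_nth)
  have "Ck_on k s.Pol (\<lambda>w. Complex (P (s.X v w) $ 2) (P (s.X v w) $ 3) - Complex (v' $ 2) (v' $ 3))"
    by (intro Ck_on_diff Ck_on_Complex Ck_on_bounded_linear_compose[OF _ nth PX] Ck_on_const s.open_Pol)
  then show ?thesis unfolding Th_def g_def
    by (rule Ck_on_compose[OF s.open_Pol open_UNIV _ t.Ck_on_G]) simp
qed

lemma derivative_Th:
  assumes w: "w \<in> s.Pol" and D: "(Th has_derivative D) (at w)"
  shows "axes (t.DH (Th w) (D h)) (t.DF (Th w) (D h)) = c *\<^sub>R A (axes (s.DH w h) (s.DF w h))"
proof -
  have bl: "bounded_linear A" using A(1) by (simp add: linear_conv_bounded_linear)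
  have "((\<lambda>w. t.X v' (Th w)) has_derivative (\<lambda>h. axes (t.DH (Th w) (D h)) (t.DF (Th w) (D h)))) (at w)"
    by (rule has_derivative_compose[OF D t.has_derivative_X[OF X_Th(1)[OF w]]])
  moreover have "((\<lambda>w. t.X v' (Th w)) has_derivative (\<lambda>h. c *\<^sub>R A (axes (s.DH w h) (s.DF w h)))) (at w)"
  proof (rule has_derivative_transform_within_open[OF _ s.open_Pol w])
    have "((\<lambda>w. A (s.X v w) + u0) has_derivative (\<lambda>h. A (axes (s.DH w h) (s.DF w h)) + 0)) (at w)"
      by (intro has_derivative_add bounded_linear.has_derivative[OF bl] s.has_derivative_X w has_derivative_const)
    then show "((\<lambda>w. P (s.X v w)) has_derivative (\<lambda>h. c *\<^sub>R A (axes (s.DH w h) (s.DF w h)))) (at w)"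
      unfolding P_def using has_derivative_scaleR_right by fastforce
  qed (simp add: X_Th)
  ultimately have "(\<lambda>h. axes (t.DH (Th w) (D h)) (t.DF (Th w) (D h))) = (\<lambda>h. c *\<^sub>R A (axes (s.DH w h) (s.DF w h)))"
    by (rule has_derivative_unique)
  then show ?thesis by (rule fun_cong)
qed

lemma metric_Th:
  assumes w: "w \<in> s.Pol" and D: "(Th has_derivative D) (at w)"
  shows "t.gm (Th w) (D h) = c\<^sup>2 * s.gm w h"
proof -
  have sc: "lorentz (c *\<^sub>R p) (c *\<^sub>R p) = c\<^sup>2 * lorentz p p" for p
    by (simp add: lorentz_def power2_eq_square algebra_simps)
  show ?thesis unfolding t.lorentz_gm[symmetric] derivative_Th[OF w D] sc A(2) s.lorentz_gm ..
qed

lemma Th_derivative_bij: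
  assumes w: "w \<in> s.Pol" and D: "(Th has_derivative D) (at w)"
  shows "D h = 0 \<Longrightarrow> h = 0" "surj D"
proof -
  have lin: "linear D" using D by (rule has_derivative_linear)
  show z: "h = 0" if "D h = 0" for h
  proof -
    have "c *\<^sub>R A (axes (s.DH w h) (s.DF w h)) = axes 0 0"
      using derivative_Th[OF w D, of h] that linear_0[OF t.DH_linear] linear_0[OF t.DF_linear] by simp
    then have "A (axes (s.DH w h) (s.DF w h)) = 0" using c by (simp add: axes_0)
    then have "axes (s.DH w h) (s.DF w h) = axes 0 0" using lorentz_isometry_injective[OF A] by (simp add: axes_0)
    then have "s.DF w h = 0" by (simp add: axes_eq_iff)
    then show ?thesis by (rule s.DF_injective[OF w])
  qed
  have "inj D" using z linear_diff[OF lin] by (metis eq_iff_diff_eq_0 injI)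
  then show "surj D" by (rule linear_injective_imp_surjective[OF lin]) simp
qed

text \<open>The derivative of \<open>Th\<close> is bijective and scales the induced form by
  \<open>c\<^sup>2\<close>, so definiteness is transported in both directions.\<close>

lemma Th_disc_iff: assumes w: "w \<in> s.Pol" shows "cmod (Th w) < 1 \<longleftrightarrow> cmod w < 1"
proof -
  obtain D where D: "(Th has_derivative D) (at w)" using Ck_on_SucD[OF Ck_on_Th[of "Suc 0"] w] by blast
  have c2: "c\<^sup>2 > 0" using c by simp
  have "(\<forall>k. k \<noteq> 0 \<longrightarrow> t.gm (Th w) k > 0) \<longleftrightarrow> (\<forall>h. h \<noteq> 0 \<longrightarrow> t.gm (Th w) (D h) > 0)"
  proof
    assume "\<forall>k. k \<noteq> 0 \<longrightarrow> t.gm (Th w) k > 0"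
    then show "\<forall>h. h \<noteq> 0 \<longrightarrow> t.gm (Th w) (D h) > 0" using Th_derivative_bij(1)[OF w D] by blast
  next
    assume a: "\<forall>h. h \<noteq> 0 \<longrightarrow> t.gm (Th w) (D h) > 0"
    show "\<forall>k. k \<noteq> 0 \<longrightarrow> t.gm (Th w) k > 0"
    proof (intro allI impI)
      fix k :: complex assume "k \<noteq> 0"
      obtain h where h: "k = D h" using Th_derivative_bij(2)[OF w D] by (metis surjD)
      then have "h \<noteq> 0" using \<open>k \<noteq> 0\<close> linear_0[OF has_derivative_linear[OF D]] by auto
      then show "t.gm (Th w) k > 0" using a h by simp
    qed
  qed
  then show ?thesis unfolding s.spacelike_iff[OF w] t.spacelike_iff[OF X_Th(1)[OF w]] metric_Th[OF w D]
    using c2 by (simp add: zero_less_mult_iff)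
qed

definition \<phi> where "\<phi> z = klein_inv (Th (klein z))"

lemma klein_Pol: "cmod z < 1 \<Longrightarrow> klein z \<in> s.Pol"
  using klein_less[of z] s.ball_subset_Pol by auto

lemma phi_disc: assumes "cmod z < 1" shows "cmod (\<phi> z) < 1" "klein (\<phi> z) = Th (klein z)"
proof -
  have "cmod (Th (klein z)) < 1" using Th_disc_iff[OF klein_Pol[OF assms]] klein_less[OF assms] by simp
  then show "cmod (\<phi> z) < 1" "klein (\<phi> z) = Th (klein z)" using klein_klein_inv by (auto simp: \<phi>_def)
qed

lemma phi_bij: "bij_betw \<phi> (ball 0 1) (ball 0 1)"
proof (rule bij_betw_imageI)
  show "inj_on \<phi> (ball 0 1)"
  proof (rule inj_onI)
    fix x y :: complex assume *: "x \<in> ball 0 1" "y \<in> ball 0 1" "\<phi> x = \<phi> y"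
    then have n: "cmod x < 1" "cmod y < 1" by auto
    then have "Th (klein x) = Th (klein y)" using phi_disc(2) * by metis
    then have "klein x = klein y" using Th_inj klein_Pol n by blast
    then show "x = y" using klein_inv_klein n by (metis less_imp_le)
  qed
  show "\<phi> ` ball 0 1 = ball 0 1"
  proof (intro equalityI subsetI)
    fix y assume "y \<in> \<phi> ` ball 0 1" then show "y \<in> ball 0 1" using phi_disc(1) by auto
  next
    fix y :: complex assume "y \<in> ball 0 1"
    then have y: "cmod y < 1" by simp
    have "klein y \<in> t.Pol" using klein_less[OF y] t.ball_subset_Pol by auto
    then obtain w where w: "w \<in> s.Pol" "Th w = klein y" by (rule Th_surj)
    then have w1: "cmod w < 1" using Th_disc_iff[OF w(1)] klein_less[OF y] by simp
    define z where "z = klein_inv w"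
    have z: "cmod z < 1" "klein z = w" using klein_klein_inv[of w] w1 by (auto simp: z_def)
    have "\<phi> z = y" using klein_inv_klein[of y] y by (simp add: \<phi>_def z w)
    then show "y \<in> \<phi> ` ball 0 1" using z by auto
  qed
qed

lemma X_phi: "cmod z < 1 \<Longrightarrow> t.X v' (klein (\<phi> z)) = P (s.X v (klein z))"
  using phi_disc(2) X_Th(2) klein_Pol by simp

lemma Ck_on_phi: "Ck_on k (ball 0 1) \<phi>"
proof -
  have "Ck_on k (ball 0 1) (\<lambda>z. Th (klein z))"
    by (rule Ck_on_compose[OF open_ball s.open_Pol Ck_on_subset[OF Ck_on_klein] Ck_on_Th])
      (use klein_Pol in auto)
  then show ?thesis unfolding \<phi>_def
    by (rule Ck_on_compose[OF open_ball open_ball _ Ck_on_klein_inv])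
      (use Th_disc_iff[OF klein_Pol] klein_less in auto)
qed

lemma derivative_phi:
  assumes z: "cmod z < 1" and D: "(\<phi> has_derivative D) (at z)"
  shows "axes (t.Hd (\<phi> z) (D h)) (t.Fd (\<phi> z) (D h)) = c *\<^sub>R A (axes (s.Hd z h) (s.Fd z h))"
proof -
  have bl: "bounded_linear A" using A(1) by (simp add: linear_conv_bounded_linear)
  have 1: "((\<lambda>z. t.X v' (klein (\<phi> z))) has_derivative (\<lambda>h. axes (t.Hd (\<phi> z) (D h)) (t.Fd (\<phi> z) (D h)))) (at z)"
    by (rule has_derivative_compose[OF D t.has_derivative_X_klein[OF phi_disc(1)[OF z]]])
  have 2: "((\<lambda>z. t.X v' (klein (\<phi> z))) has_derivative (\<lambda>h. c *\<^sub>R A (axes (s.Hd z h) (s.Fd z h)))) (at z)"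
  proof (rule has_derivative_transform_within_open[where s="ball 0 1"])
    have "((\<lambda>z. A (s.X v (klein z)) + u0) has_derivative (\<lambda>h. A (axes (s.Hd z h) (s.Fd z h)) + 0)) (at z)"
      by (intro has_derivative_add bounded_linear.has_derivative[OF bl] s.has_derivative_X_klein z has_derivative_const)
    then show "((\<lambda>z. P (s.X v (klein z))) has_derivative (\<lambda>h. c *\<^sub>R A (axes (s.Hd z h) (s.Fd z h)))) (at z)"
      unfolding P_def using has_derivative_scaleR_right by fastforce
  qed (use z X_phi in auto)
  show ?thesis using has_derivative_unique[OF 1 2] by (rule fun_cong)
qed

text \<open>In the Poincare coordinate both induced metrics are multiples of |h|^2, so
  \<open>\<phi>\<close> scales all tangent vectors at a point by the same factor.\<close>

lemma phi_conformal:
  assumes z: "cmod z < 1" and D: "(\<phi> has_derivative D) (at z)"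
  shows "cmod (D h) = c * (cmod (s.aa z) - cmod (s.bb z)) / (cmod (t.aa (\<phi> z)) - cmod (t.bb (\<phi> z))) * cmod h"
proof -
  note e = derivative_phi[OF z D]
  have sc: "lorentz (c *\<^sub>R p) (c *\<^sub>R p) = c\<^sup>2 * lorentz p p" for p
    by (simp add: lorentz_def power2_eq_square algebra_simps)
  define ks kt where "ks = cmod (s.aa z) - cmod (s.bb z)" and "kt = cmod (t.aa (\<phi> z)) - cmod (t.bb (\<phi> z))"
  have k: "ks > 0" "kt > 0" using s.aa_bb_less[OF z] t.aa_bb_less[OF phi_disc(1)[OF z]] by (auto simp: ks_def kt_def)
  have "kt\<^sup>2 * (cmod (D h))\<^sup>2 = lorentz (axes (t.Hd (\<phi> z) (D h)) (t.Fd (\<phi> z) (D h))) (axes (t.Hd (\<phi> z) (D h)) (t.Fd (\<phi> z) (D h)))"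
    unfolding lorentz_axes t.metric_disc kt_def ..
  also have "\<dots> = c\<^sup>2 * (ks\<^sup>2 * (cmod h)\<^sup>2)" unfolding e sc A(2) lorentz_axes s.metric_disc ks_def ..
  finally have "(kt * cmod (D h))\<^sup>2 = (c * ks * cmod h)\<^sup>2" by (simp add: power_mult_distrib)
  then have "kt * cmod (D h) = c * ks * cmod h"
    by (rule power2_eq_imp_eq) (use k c in \<open>simp_all add: mult_nonneg_nonneg\<close>)
  then show ?thesis using k unfolding ks_def[symmetric] kt_def[symmetric] by (simp add: field_simps)
qed

lemma phi_holomorphic: "\<phi> holomorphic_on ball 0 1 \<or> (\<lambda>z. \<phi> (cnj z)) holomorphic_on ball 0 1"
proof (rule conformal_imp_holomorphic_or_anti[OF Ck_on_phi])
  fix z :: complex assume "z \<in> ball 0 1"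
  then have z: "cmod z < 1" by simp
  show "c * (cmod (s.aa z) - cmod (s.bb z)) / (cmod (t.aa (\<phi> z)) - cmod (t.bb (\<phi> z))) > 0"
    using s.aa_bb_less[OF z] t.aa_bb_less[OF phi_disc(1)[OF z]] c by simp
  show "cmod (frechet_derivative \<phi> (at z) h) = c * (cmod (s.aa z) - cmod (s.bb z)) / (cmod (t.aa (\<phi> z)) - cmod (t.bb (\<phi> z))) * cmod h" for h
    by (rule phi_conformal[OF z]) (use Ck_on_SucD[OF Ck_on_phi[of "Suc 0"]] z in simp)
qed

lemma phi_moebius:
  obtains u a \<sigma> where "cmod u = 1" "cmod a < 1" "\<sigma> = id \<or> \<sigma> = cnj" "\<And>z. cmod z < 1 \<Longrightarrow> \<phi> z = moeb u a (\<sigma> z)"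
  using phi_holomorphic
proof
  assume "\<phi> holomorphic_on ball 0 1"
  then obtain u a where "cmod u = 1" "cmod a < 1" "\<And>z. cmod z < 1 \<Longrightarrow> \<phi> z = moeb u a z"
    using disc_automorphism[OF _ phi_bij] by blast
  then show thesis using that[of u a id] by simp
next
  assume h: "(\<lambda>z. \<phi> (cnj z)) holomorphic_on ball 0 1"
  have "bij_betw cnj (ball 0 1) (ball 0 1)"
    by (rule bij_betwI[where g=cnj]) auto
  from bij_betw_trans[OF this phi_bij] have "bij_betw (\<lambda>z. \<phi> (cnj z)) (ball 0 1) (ball 0 1)" by (simp add: o_def)
  then obtain u a where ua: "cmod u = 1" "cmod a < 1" "\<And>z. cmod z < 1 \<Longrightarrow> \<phi> (cnj z) = moeb u a z"
    using disc_automorphism[OF h] by blast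
  have "\<phi> z = moeb u a (cnj z)" if "cmod z < 1" for z using ua(3)[of "cnj z"] that by simp
  then show thesis using that[of u a cnj] ua by simp
qed

end

text \<open>Half the distance between \<open>cis x\<close> and \<open>cis y\<close>.\<close>

definition chord :: "real \<Rightarrow> real \<Rightarrow> real" where "chord x y = \<bar>sin ((x - y) / 2)\<bar>"

context kobayashi begin

lemma cmod_zeta_diff: "cmod (\<zeta> j - \<zeta> k) = 2 * chord (\<alpha> j) (\<alpha> k)"
  unfolding zeta_diff norm_mult by (simp add: chord_def norm_mult)

lemma X_klein_Bseq:
  assumes z: "z \<notin> \<zeta> ` {..<2*n}" and x: "x \<longlonglongrightarrow> z"
  shows "Bseq (\<lambda>m. X v (klein (x m)))"
proof -
  have fin: "closed (\<zeta> ` {..<2*n})" by (intro finite_imp_closed finite_imageI) simp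
  have "\<forall>\<^sub>F m in sequentially. x m \<in> - \<zeta> ` {..<2*n}"
    by (rule topological_tendstoD[OF x]) (use fin z in auto)
  then have ev: "\<forall>\<^sub>F m in sequentially. X v (klein (x m)) = v + (\<Sum>j<2*n. ln (cmod (x m - \<zeta> j)) *\<^sub>R R j)"
    by eventually_elim (rule X_klein, simp)
  have "(\<lambda>m. v + (\<Sum>j<2*n. ln (cmod (x m - \<zeta> j)) *\<^sub>R R j)) \<longlonglongrightarrow> v + (\<Sum>j<2*n. ln (cmod (z - \<zeta> j)) *\<^sub>R R j)"
  proof (intro tendsto_add tendsto_const tendsto_sum tendsto_scaleR tendsto_ln tendsto_norm tendsto_diff x)
    fix j assume "j \<in> {..<2*n}"
    then show "cmod (z - \<zeta> j) \<noteq> 0" using z by auto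
  qed
  then have "(\<lambda>m. X v (klein (x m))) \<longlonglongrightarrow> v + (\<Sum>j<2*n. ln (cmod (z - \<zeta> j)) *\<^sub>R R j)"
    using tendsto_cong[OF ev] by simp
  then show ?thesis by (rule convergent_imp_Bseq[OF convergentI])
qed

end

lemma Bseq_linear_inj:
  fixes A :: "'a::euclidean_space \<Rightarrow> 'b::euclidean_space"
  assumes lin: "linear A" and inj: "inj A" and c: "c > 0" and B: "Bseq (\<lambda>m. c *\<^sub>R (A (x m) + u))"
  shows "Bseq x"
proof -
  obtain e where e: "e > 0" "\<And>p. e * norm p \<le> norm (A p)"
    using linear_inj_bounded_below_pos[OF lin inj] by metis
  obtain C where C: "\<And>m. norm (c *\<^sub>R (A (x m) + u)) \<le> C" using B by (auto simp: Bseq_def)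
  have "norm (x m) \<le> (C / c + norm u) / e" for m
  proof -
    have "norm (A (x m) + u) \<le> C / c" using C[of m] c unfolding norm_scaleR by (simp add: pos_le_divide_eq mult.commute)
    then have "norm (A (x m)) \<le> C / c + norm u" using norm_triangle_sub[of "A (x m)" "- u"] by simp
    then show ?thesis using e(2)[of "x m"] e(1) by (simp add: pos_le_divide_eq mult.commute)
  qed
  then show ?thesis by (rule BseqI')
qed

context congruent_pair begin

text \<open>The points \<open>\<zeta> j\<close> are the places where the surface is unbounded along a radius.\<close>

lemma moebius_zeta:
  assumes u: "cmod u = 1" "cmod a < 1" and \<sigma>: "\<sigma> = id \<or> \<sigma> = cnj"
    and phi: "\<And>z. cmod z < 1 \<Longrightarrow> \<phi> z = moeb u a (\<sigma> z)" and j: "j < 2 * n"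
  shows "moeb u a (\<sigma> (s.\<zeta> j)) \<in> t.\<zeta> ` {..<2*n}"
proof (rule ccontr)
  assume no: "moeb u a (\<sigma> (s.\<zeta> j)) \<notin> t.\<zeta> ` {..<2*n}"
  let ?r = "radial (s.\<zeta> j)"
  have r: "cmod (?r m) < 1" for m by (rule norm_radial) simp
  have ns: "cmod (\<sigma> z) = cmod z" for z using \<sigma> by auto
  have "(\<lambda>m. \<sigma> (?r m)) \<longlonglongrightarrow> \<sigma> (s.\<zeta> j)"
    using \<sigma> tendsto_radial[of "s.\<zeta> j"] tendsto_cnj[OF tendsto_radial[of "s.\<zeta> j"]] by (auto simp: id_def)
  then have lim: "(\<lambda>m. moeb u a (\<sigma> (?r m))) \<longlonglongrightarrow> moeb u a (\<sigma> (s.\<zeta> j))"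
    using continuous_on_moeb[OF u(2), of u, unfolded continuous_on_sequentially, rule_format, of "\<sigma> (s.\<zeta> j)" "\<lambda>m. \<sigma> (?r m)"]
      r less_imp_le[OF r] by (simp add: ns o_def)
  have "\<phi> (?r m) = moeb u a (\<sigma> (?r m))" for m by (rule phi[OF r])
  then have "Bseq (\<lambda>m. t.X v' (klein (\<phi> (?r m))))" using t.X_klein_Bseq[OF no lim] by simp
  then have "Bseq (\<lambda>m. c *\<^sub>R (A (s.X v (klein (?r m))) + u0))" unfolding X_phi[OF r] P_def .
  moreover have "inj A" using A_inj by (rule injI)
  ultimately have "Bseq (\<lambda>m. s.X v (klein (?r m)))"
    using Bseq_linear_inj[OF A(1) _ c, where x="\<lambda>m. s.X v (klein (?r m))" and u=u0] by blast
  then show False using s.X_blowup[OF j] by blast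
qed

text \<open>The tangent plane is horizontal exactly at the zeros of g. Because the two surfaces
  share the zero \<open>b 1\<close>, the isometry preserves horizontal vectors, and so it keeps the
  tangent plane horizontal at every other zero. Boosts are excluded in this way.\<close>

lemma zeros_B:
  assumes phi: "\<And>z. cmod z < 1 \<Longrightarrow> \<phi> z = z" and b1: "b 1 = b' 1" and i: "i \<in> {1..n-1}"
  shows "\<exists>k\<in>{1..n-1}. b i = b' k"
proof -
  have one: "1 \<in> {1..n-1}" using s.n2 by auto
  have der: "axes (t.Hd z h) (t.Fd z h) = c *\<^sub>R A (axes (s.Hd z h) (s.Fd z h))" if "cmod z < 1" for z h
  proof -
    have "(\<phi> has_derivative (\<lambda>h. h)) (at z)"
      by (rule has_derivative_transform_within_open[where s="ball 0 1", OF has_derivative_ident])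
        (use that phi in auto)
    from derivative_phi[OF that this, of h] show ?thesis by (simp add: phi that)
  qed
  let ?z = "b 1"
  have z1: "cmod ?z < 1" by (rule s.b_less[OF one])
  have B0: "s.B ?z = 0" "t.B ?z = 0" unfolding s.B_def t.B_def
    by (rule prod_zero, simp, rule bexI[OF _ one], simp add: b1[simplified])+
  have z: "s.cc ?z = 0" "t.cc ?z = 0" "s.bb ?z = 0" using B0 by (simp_all add: s.cc_def t.cc_def s.bb_def)
  have a0: "s.aa ?z \<noteq> 0" using s.aa_bb_less[OF z1] by auto
  \<comment> \<open>At the shared zero every horizontal vector is tangent to the first surface, and
    its image is tangent to the second.\<close>
  have horiz: "A (axes 0 w) $ 1 = 0" for w
  proof -
    have "s.Fd ?z (cnj w / s.aa ?z) = w" using a0 z[simplified] by (simp add: s.Fd_def)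
    then have "axes 0 (t.Fd ?z (cnj w / s.aa ?z)) = c *\<^sub>R A (axes 0 w)"
      using der[OF z1, of "cnj w / s.aa ?z"] by (simp only: s.Hd_def t.Hd_def z) simp
    then have "c * A (axes 0 w) $ 1 = 0" by (metis axes_comp(1) vector_scaleR_component real_scaleR_def)
    then show ?thesis using c by simp
  qed
  have bi: "cmod (b i) < 1" by (rule s.b_less[OF i])
  have "s.B (b i) = 0" unfolding s.B_def by (rule prod_zero, simp, rule bexI[OF _ i], simp)
  then have "s.Hd (b i) h = 0" for h by (simp add: s.Hd_def s.cc_def)
  then have H: "t.Hd (b i) h = 0" for h
    using arg_cong[OF der[OF bi, of h], of "\<lambda>p::real^3. p $ 1"] horiz by (simp add: axes_comp)
  have "t.cc (b i) = 0" using H[of 1] H[of \<i>] by (simp add: t.Hd_def complex_eq_iff)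
  then have "t.B (b i) = 0" using t.Bs_nz[of "b i"] t.Q_nz[OF t.disc_not_zeta[OF bi]] bi by (simp add: t.cc_def)
  then show ?thesis by (auto simp: t.B_def prod_zero_iff)
qed

lemma angle_eq: assumes "j < 2 * n" "s.\<zeta> j = t.\<zeta> j" shows "\<alpha> j = \<alpha>' j"
proof -
  have "cis (\<alpha> j) = cis (\<alpha>' j)" using assms(2) by (simp add: s.\<zeta>_def t.\<zeta>_def)
  moreover have "0 \<le> \<alpha> j" "\<alpha> j < 2 * pi" "0 \<le> \<alpha>' j" "\<alpha>' j < 2 * pi"
    using s.alpha_range[OF assms(1)] t.alpha_range[OF assms(1)] by auto
  ultimately show ?thesis by (metis Arg2pi_unique cis_conv_exp mult_1 of_real_1 zero_less_one)
qed

text \<open>The second claim is an equality of moduli of cross ratios, cleared of denominators: the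
  distortion factors of \<open>moeb_diff\<close> occur equally often on both sides.\<close>

lemma congruent_data:
  obtains \<pi> where "\<pi> permutes {..<2*n}"
    "\<And>i j k l. i < 2*n \<Longrightarrow> j < 2*n \<Longrightarrow> k < 2*n \<Longrightarrow> l < 2*n \<Longrightarrow>
      chord (\<alpha> i) (\<alpha> j) * chord (\<alpha> k) (\<alpha> l) * (chord (\<alpha>' (\<pi> i)) (\<alpha>' (\<pi> k)) * chord (\<alpha>' (\<pi> j)) (\<alpha>' (\<pi> l))) =
      chord (\<alpha>' (\<pi> i)) (\<alpha>' (\<pi> j)) * chord (\<alpha>' (\<pi> k)) (\<alpha>' (\<pi> l)) * (chord (\<alpha> i) (\<alpha> k) * chord (\<alpha> j) (\<alpha> l))"
    "\<pi> = id \<Longrightarrow> \<forall>j<3. \<alpha> j = \<alpha>' j \<Longrightarrow> b 1 = b' 1 \<Longrightarrow>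
      (\<forall>j<2*n. \<alpha> j = \<alpha>' j) \<and> (\<forall>i\<in>{1..n-1}. \<exists>k\<in>{1..n-1}. b i = b' k)"
proof -
  obtain u a \<sigma> where u: "cmod u = 1" "cmod a < 1" and \<sigma>: "\<sigma> = id \<or> \<sigma> = cnj"
    and phi: "\<And>z. cmod z < 1 \<Longrightarrow> \<phi> z = moeb u a (\<sigma> z)" by (rule phi_moebius, rule that)
  let ?\<phi> = "\<lambda>j. moeb u a (\<sigma> (s.\<zeta> j))"
  have mz: "?\<phi> j \<in> t.\<zeta> ` {..<2*n}" if "j < 2 * n" for j using moebius_zeta[OF u \<sigma> phi that] .
  \<comment> \<open>Extended by the identity, as \<open>permutes\<close> requires.\<close>
  define \<pi> where "\<pi> j = (if j < 2*n then SOME k. k < 2*n \<and> t.\<zeta> k = ?\<phi> j else j)" for j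
  have p: "\<pi> j < 2*n" "t.\<zeta> (\<pi> j) = ?\<phi> j" if "j < 2*n" for j
  proof -
    have "\<exists>k. k < 2*n \<and> t.\<zeta> k = ?\<phi> j" using mz[OF that] by force
    from someI_ex[OF this] show "\<pi> j < 2*n" "t.\<zeta> (\<pi> j) = ?\<phi> j" using that by (auto simp: \<pi>_def)
  qed
  have s1: "cmod (\<sigma> (s.\<zeta> j)) = 1" for j using \<sigma> by auto
  have sd: "cmod (\<sigma> x - \<sigma> y) = cmod (x - y)" for x y using \<sigma> by (auto simp flip: complex_cnj_diff)
  define D where "D j = cmod (1 - cnj a * \<sigma> (s.\<zeta> j))" for j
  define m where "m = 1 - (cmod a)\<^sup>2"
  have D0: "D j > 0" for j using moeb_denom[OF u(2), of "\<sigma> (s.\<zeta> j)"] s1 by (simp add: D_def)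
  have m0: "m > 0" using u(2) by (simp add: m_def abs_square_less_1)
  have ch: "chord (\<alpha>' (\<pi> i)) (\<alpha>' (\<pi> j)) = m * chord (\<alpha> i) (\<alpha> j) / (D i * D j)" if "i < 2*n" "j < 2*n" for i j
  proof -
    have "cmod (t.\<zeta> (\<pi> i) - t.\<zeta> (\<pi> j)) = m * cmod (s.\<zeta> i - s.\<zeta> j) / (D i * D j)"
      unfolding p(2)[OF that(1)] p(2)[OF that(2)] D_def m_def
      by (subst moeb_diff) (use u s1 sd in auto)
    then show ?thesis unfolding s.cmod_zeta_diff t.cmod_zeta_diff by (simp add: mult.left_commute[of m 2])
  qed
  show thesis
  proof (rule that[of \<pi>])
    have "inj_on \<pi> {..<2*n}"
    proof (rule inj_onI)
      fix i j assume ij: "i \<in> {..<2*n}" "j \<in> {..<2*n}" "\<pi> i = \<pi> j"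
      then have "chord (\<alpha>' (\<pi> i)) (\<alpha>' (\<pi> j)) = 0" by (simp add: chord_def)
      then have "chord (\<alpha> i) (\<alpha> j) = 0" using ch[of i j] ij D0[of i] D0[of j] m0 by auto
      then have "s.\<zeta> i = s.\<zeta> j" using s.cmod_zeta_diff[of i j] by simp
      then show "i = j" using s.inj_zeta ij by (auto simp: inj_on_def)
    qed
    moreover have "\<pi> ` {..<2*n} \<subseteq> {..<2*n}" using p(1) by auto
    ultimately have "bij_betw \<pi> {..<2*n} {..<2*n}" by (simp add: bij_betw_def endo_inj_surj)
    then show "\<pi> permutes {..<2*n}" by (rule bij_imp_permutes) (simp add: \<pi>_def)
  next
    fix i j k l assume *: "i < 2*n" "j < 2*n" "k < 2*n" "l < 2*n"
    show "chord (\<alpha> i) (\<alpha> j) * chord (\<alpha> k) (\<alpha> l) * (chord (\<alpha>' (\<pi> i)) (\<alpha>' (\<pi> k)) * chord (\<alpha>' (\<pi> j)) (\<alpha>' (\<pi> l))) =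
      chord (\<alpha>' (\<pi> i)) (\<alpha>' (\<pi> j)) * chord (\<alpha>' (\<pi> k)) (\<alpha>' (\<pi> l)) * (chord (\<alpha> i) (\<alpha> k) * chord (\<alpha> j) (\<alpha> l))"
      unfolding ch[OF *(1,2)] ch[OF *(3,4)] ch[OF *(1,3)] ch[OF *(2,4)]
      by (simp add: mult_ac)
  next
    assume id: "\<pi> = id" and first: "\<forall>j<3. \<alpha> j = \<alpha>' j" and b1: "b 1 = b' 1"
    have fixed: "moeb u a (\<sigma> (s.\<zeta> j)) = s.\<zeta> j" if "j < 3" for j
      using p(2)[of j] that s.n2 first[rule_format, OF that] by (simp add: id s.\<zeta>_def t.\<zeta>_def)
    have ne: "s.\<zeta> 0 \<noteq> s.\<zeta> 1" "s.\<zeta> 0 \<noteq> s.\<zeta> 2" "s.\<zeta> 1 \<noteq> s.\<zeta> 2"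
      using s.n2 by (auto dest!: inj_onD[OF s.inj_zeta])
    have fx: "cmod z = 1 \<and> moeb u a (\<sigma> z) = z" if "z \<in> {s.\<zeta> 0, s.\<zeta> 1, s.\<zeta> 2}" for z using that fixed by auto
    have "\<sigma> \<noteq> cnj" using moeb_cnj_three_fixed[OF ne u(2), of u] fx by auto
    then have \<sigma>: "\<sigma> = id" using \<sigma> by simp
    have "a = 0" "u = 1" using moeb_three_fixed[OF ne u(2), of u] fx by (auto simp: \<sigma>)
    then have mid: "moeb u a (\<sigma> z) = z" for z by (simp add: moeb_def \<sigma>)
    have "\<alpha> j = \<alpha>' j" if "j < 2*n" for j
      using p(2)[OF that] angle_eq[OF that] by (simp add: mid id)
    then show "(\<forall>j<2*n. \<alpha> j = \<alpha>' j) \<and> (\<forall>i\<in>{1..n-1}. \<exists>k\<in>{1..n-1}. b i = b' k)"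
      using zeros_B[OF _ b1] phi by (simp add: mid)
  qed
qed

end

section \<open>The family of incongruent surfaces\<close>

text \<open>Signed chords satisfy a Ptolemy relation, so the ratio of the chords from \<open>x\<close> to two fixed
  points determines \<open>x\<close> as long as \<open>x\<close> stays on the same arc.\<close>

lemma chord_ratio_injective:
  assumes r: "x \<in> {0..<2*pi}" "y \<in> {0..<2*pi}" "p \<in> {0..<2*pi}" "q \<in> {0..<2*pi}"
    and p: "(x < p \<and> y < p) \<or> (x > p \<and> y > p)" and q: "(x < q \<and> y < q) \<or> (x > q \<and> y > q)"
    and pq: "p \<noteq> q" and eq: "chord x p * chord y q = chord x q * chord y p"
  shows "x = y"
proof -
  have pos: "sin ((z - w) / 2) > 0" if "w < z" "z \<in> {0..<2*pi}" "w \<in> {0..<2*pi}" for z w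
    using that by (intro sin_gt_zero) auto
  have neg: "sin ((z - w) / 2) < 0" if "z < w" "z \<in> {0..<2*pi}" "w \<in> {0..<2*pi}" for z w
    using pos[OF that(1,3,2)] sin_minus[of "(z - w) / 2"] by (simp add: minus_divide_left)
  have zero: "z = w" if "sin ((z - w) / 2) = 0" "z \<in> {0..<2*pi}" "w \<in> {0..<2*pi}" for z w
    using pos[OF _ that(2,3)] neg[OF _ that(2,3)] that(1) by (metis linorder_neqE order_less_irrefl)
  \<comment> \<open>Since \<open>x\<close> and \<open>y\<close> lie on the same side of
    \<open>p\<close> and of \<open>q\<close>, the absolute values in the chords can be removed
    consistently.\<close>
  have "sin ((x - p) / 2) * sin ((y - p) / 2) > 0" "sin ((x - q) / 2) * sin ((y - q) / 2) > 0"
    using p q pos neg r by (auto intro: mult_pos_pos mult_neg_neg)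
  then have "0 < (sin ((x - p) / 2) * sin ((y - p) / 2)) * (sin ((x - q) / 2) * sin ((y - q) / 2))"
    by (rule mult_pos_pos)
  also have "\<dots> = (sin ((x - p) / 2) * sin ((y - q) / 2)) * (sin ((x - q) / 2) * sin ((y - p) / 2))" by simp
  finally have s: "0 < (sin ((x - p) / 2) * sin ((y - q) / 2)) * (sin ((x - q) / 2) * sin ((y - p) / 2))" .
  have eq: "\<bar>sin ((x - p) / 2) * sin ((y - q) / 2)\<bar> = \<bar>sin ((x - q) / 2) * sin ((y - p) / 2)\<bar>"
    using eq by (simp add: chord_def abs_mult)
  have e: "sin ((x - p) / 2) * sin ((y - q) / 2) = sin ((x - q) / 2) * sin ((y - p) / 2)"
  proof -
    have "P = Q" if "\<bar>P\<bar> = \<bar>Q\<bar>" "0 < P * Q" for P Q :: real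
      using that by (auto simp: abs_eq_iff zero_less_mult_iff)
    then show ?thesis using s eq by blast
  qed
  have ptol: "sin (a - c) * sin (b - d) - sin (a - d) * sin (b - c) = sin (a - b) * sin (c - d)" for a b c d :: real
    unfolding sin_times_sin by (simp add: algebra_simps diff_divide_distrib)
  have "sin ((x - y) / 2) * sin ((p - q) / 2) = 0"
    using e ptol[of "x / 2" "p / 2" "y / 2" "q / 2"] by (simp add: diff_divide_distrib)
  then show ?thesis using zero pq r by auto
qed

text \<open>The conditions are imposed one after another; each survives on smaller sets, so it
  suffices that every nonempty open set can be shrunk for each single one.\<close>

lemma shrink_open:
  fixes R :: "'k \<Rightarrow> 'a::topological_space \<Rightarrow> 'a \<Rightarrow> bool"
  assumes "finite K" "open U0" "U0 \<noteq> {}"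
    and "\<And>\<kappa> U. \<kappa> \<in> K \<Longrightarrow> open U \<Longrightarrow> U \<noteq> {} \<Longrightarrow> U \<subseteq> U0 \<Longrightarrow>
      \<exists>V. open V \<and> V \<noteq> {} \<and> V \<subseteq> U \<and> (\<forall>s\<in>V. \<forall>t\<in>V. R \<kappa> s t)"
  shows "\<exists>V. open V \<and> V \<noteq> {} \<and> V \<subseteq> U0 \<and> (\<forall>\<kappa>\<in>K. \<forall>s\<in>V. \<forall>t\<in>V. R \<kappa> s t)"
  using assms(1,4)
proof (induction K)
  case empty then show ?case using assms(2,3) by auto
next
  case (insert \<kappa> K)
  obtain V where V: "open V" "V \<noteq> {}" "V \<subseteq> U0" "\<forall>\<kappa>\<in>K. \<forall>s\<in>V. \<forall>t\<in>V. R \<kappa> s t"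
    using insert.IH insert.prems by auto
  obtain W where "open W" "W \<noteq> {}" "W \<subseteq> V" "\<forall>s\<in>W. \<forall>t\<in>W. R \<kappa> s t"
    using insert.prems[OF insertI1 V(1-3)] by auto
  then show ?case using V by (intro exI[of _ W]) blast
qed

text \<open>The parameters \<open>s\<close> and \<open>t\<close> vary independently, so the
  difference at the single point \<open>s0\<close> is spread by disjoint neighbourhoods of the two
  values.\<close>

lemma separate_values:
  fixes F G :: "'a::topological_space \<Rightarrow> 'b::t2_space"
  assumes U: "open U" "s0 \<in> U" and cont: "continuous_on U F" "continuous_on U G" and ne: "F s0 \<noteq> G s0"
  shows "\<exists>V. open V \<and> V \<noteq> {} \<and> V \<subseteq> U \<and> (\<forall>s\<in>V. \<forall>t\<in>V. F s \<noteq> G t)"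
proof -
  obtain O1 O2 where O: "open O1" "open O2" "F s0 \<in> O1" "G s0 \<in> O2" "O1 \<inter> O2 = {}" using hausdorff[OF ne] by blast
  have "open ((F -` O1 \<inter> U) \<inter> (G -` O2 \<inter> U))"
    using cont[unfolded continuous_on_open_vimage[OF U(1)]] O(1,2) by (intro open_Int[of "F -` O1 \<inter> U"]) blast+
  then show ?thesis using U O by (intro exI[of _ "(F -` O1 \<inter> U) \<inter> (G -` O2 \<inter> U)"]) auto
qed

text \<open>The first three singular points and the zero \<open>b 1\<close> are fixed; this uses up the Moebius group.
  The remaining \<open>2n - 3\<close> angles and \<open>n - 2\<close> complex zeros are the parameters.\<close>

locale kobayashi_family =
  fixes n :: nat and ix :: "nat \<Rightarrow> 'm::finite" and \<gamma> \<epsilon> :: real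
  assumes n2: "n \<ge> 2" and ix: "bij_betw ix {..<4*n-7} UNIV"
    and gam: "pi / real n < \<gamma>" "\<gamma> < pi / (real n - 1)" and eps: "0 < \<epsilon>" "\<epsilon> < 1"
    and bound: "(real n - 1) * (1 + \<epsilon>) / (1 - \<epsilon>) * \<gamma> < pi"
begin

definition ang :: "real^'m \<Rightarrow> nat \<Rightarrow> real" where
  "ang s j = (if j < 3 then pi * real j / real n else s $ ix (j - 3))"

text \<open>Coordinates 0 to 2n - 4 hold the free angles; each free zero occupies the next two, real
  part before imaginary part.\<close>

definition zix where "zix i = 2*n - 3 + 2*(i - 2)" for i :: nat

text \<open>The fixed zero is \<open>\<epsilon> / 2\<close>: nonzero, so that the family is of
  general type, and within the bound \<open>\<epsilon>\<close>.\<close>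

definition zer :: "real^'m \<Rightarrow> nat \<Rightarrow> complex" where
  "zer s i = (if i < 2 then of_real (\<epsilon> / 2) else Complex (s $ ix (zix i)) (s $ ix (Suc (zix i))))"

definition U0 :: "(real^'m) set" where
  "U0 = {s. (\<forall>j\<in>{..<2*n-1}. ang s j < ang s (Suc j)) \<and> (\<forall>j\<in>{..<2*n-1}. ang s (Suc j) - ang s j < \<gamma>) \<and>
     ang s (2*n-1) < 2*pi \<and> 2*pi - ang s (2*n-1) < \<gamma> \<and> (\<forall>i\<in>{..<n}. cmod (zer s i) < \<epsilon>)}"

lemma continuous_ang: "continuous_on S (\<lambda>s. ang s j)"
  by (cases "j < 3") (auto simp: ang_def intro!: continuous_intros)

lemma continuous_zer: "continuous_on S (\<lambda>s. zer s i)"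
  by (cases "i < 2") (auto simp: zer_def Complex_eq intro!: continuous_intros)

lemma open_U0: "open U0"
proof -
  have "U0 = (\<Inter>j\<in>{..<2*n-1}. {s. ang s j < ang s (Suc j)}) \<inter> (\<Inter>j\<in>{..<2*n-1}. {s. ang s (Suc j) - ang s j < \<gamma>}) \<inter>
     ({s. ang s (2*n-1) < 2*pi} \<inter> ({s. 2*pi - ang s (2*n-1) < \<gamma>} \<inter> (\<Inter>i\<in>{..<n}. {s. cmod (zer s i) < \<epsilon>})))"
    by (auto simp: U0_def)
  also have "open \<dots>"
    by (intro open_Int open_INT finite_lessThan ballI open_Collect_less continuous_on_diff continuous_ang continuous_on_const
      continuous_on_norm continuous_zer)
  finally show ?thesis .
qed

lemma ix_inj: "k < 4*n-7 \<Longrightarrow> l < 4*n-7 \<Longrightarrow> ix k = ix l \<longleftrightarrow> k = l"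
  using ix by (auto simp: bij_betw_def inj_on_def)

lemma ix_ang: "3 \<le> j \<Longrightarrow> j < 2*n \<Longrightarrow> j - 3 < 4*n - 7" using n2 by auto

lemma ix_zer: "2 \<le> i \<Longrightarrow> i < n \<Longrightarrow> zix i < 4*n - 7" "2 \<le> i \<Longrightarrow> i < n \<Longrightarrow> Suc (zix i) < 4*n - 7" by (auto simp: zix_def)

lemma parameters_separate:
  assumes "\<And>j. 3 \<le> j \<Longrightarrow> j < 2*n \<Longrightarrow> ang s j = ang t j" "\<And>i. 2 \<le> i \<Longrightarrow> i < n \<Longrightarrow> zer s i = zer t i"
  shows "s = t"
proof (rule vec_eq_iff[THEN iffD2], rule allI)
  fix m :: 'm
  have "m \<in> ix ` {..<4*n-7}" using ix by (auto simp: bij_betw_def)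
  then obtain k where k: "k < 4*n-7" "m = ix k" by auto
  show "s $ m = t $ m"
  proof (cases "k < 2*n-3")
    case True then show ?thesis using assms(1)[of "k + 3"] k by (simp add: ang_def)
  next
    case False
    then obtain p where p: "k = 2*n - 3 + p" using le_Suc_ex not_less by blast
    define i where "i = p div 2 + 2"
    have i: "2 \<le> i" "i < n" using k p n2 by (auto simp: i_def)
    have "p = 2 * (p div 2) \<or> p = Suc (2 * (p div 2))" by presburger
    then have "k = zix i \<or> k = Suc (zix i)" by (auto simp: zix_def i_def p)
    then show ?thesis using assms(2)[OF i] i k by (auto simp: zer_def)
  qed
qed

text \<open>The witness has equally spaced ends with gaps pi / n, which is why
  \<open>\<gamma>\<close> lies above that number, and all free zeros at 0.\<close>

lemma U0_nonempty: "U0 \<noteq> {}"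
proof -
  define s :: "real^'m" where
    "s = (\<chi> m. let k = inv_into {..<4*n-7} ix m in if k < 2*n-3 then pi * real (k + 3) / real n else 0)"
  have s: "s $ ix k = (if k < 2*n-3 then pi * real (k + 3) / real n else 0)" if "k < 4*n-7" for k
    using ix that by (simp add: s_def bij_betw_def inv_into_f_f)
  have a: "ang s j = pi * real j / real n" if "j < 2*n" for j
  proof (cases "j < 3")
    case False then show ?thesis using s[of "j - 3"] ix_ang[of j] that by (simp add: ang_def) 
  qed (simp add: ang_def)
  have z: "cmod (zer s i) < \<epsilon>" if "i < n" for i
  proof (cases "i < 2")
    case False
    moreover have "\<not> zix i < 2*n-3" "\<not> Suc (zix i) < 2*n-3" by (simp_all add: zix_def)
    ultimately have "zer s i = 0" using s[OF ix_zer(1)[of i]] s[OF ix_zer(2)[of i]] that by (simp add: zer_def complex_eq_iff)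
    then show ?thesis using eps by simp
  qed (use eps in \<open>simp add: zer_def\<close>)
  have n0: "real n > 0" using n2 by simp
  have d: "ang s (Suc j) - ang s j = pi / real n" if "Suc j < 2*n" for j
    using a[of j] a[of "Suc j"] that n0 by (simp add: field_simps)
  have l: "2 * pi - ang s (2*n-1) = pi / real n"
    using a[of "2*n-1"] n2 n0 by (simp add: of_nat_diff field_simps)
  have p: "pi / real n > 0" using n0 by simp
  have "s \<in> U0" unfolding U0_def
  proof (intro CollectI conjI ballI)
    fix j assume "j \<in> {..<2*n-1}"
    then have "Suc j < 2*n" by auto
    from d[OF this] show "ang s j < ang s (Suc j)" "ang s (Suc j) - ang s j < \<gamma>" using p gam by linarith+
  qed (use l p gam z in auto)
  then show ?thesis by auto
qed

lemma family:
  assumes s: "s \<in> U0"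
  shows "kobayashi_data n (ang s) (zer s)" "small_gaps n (ang s)" "inj_on (ang s) {0..2*n-1}" "kobayashi n (ang s) (zer s) \<gamma>"
    "\<not> principal_type n (zer s)"
proof -
  have u: "\<And>j. j < 2*n-1 \<Longrightarrow> ang s j < ang s (Suc j)" "\<And>j. j < 2*n-1 \<Longrightarrow> ang s (Suc j) - ang s j < \<gamma>"
    "ang s (2*n-1) < 2*pi" "2*pi - ang s (2*n-1) < \<gamma>" "\<And>i. i < n \<Longrightarrow> cmod (zer s i) < \<epsilon>"
    using s by (auto simp: U0_def)
  have b: "cmod (zer s i) < \<epsilon>" if "i \<in> {1..n-1}" for i using u(5)[of i] that n2 by auto
  show data: "kobayashi_data n (ang s) (zer s)"
    unfolding kobayashi_data_def
  proof (intro conjI ballI allI impI)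
    show "cmod (zer s i) < 1" if "i \<in> {1..n-1}" for i using b[OF that] eps by simp
    show "ang s j \<le> ang s (Suc j)" if "j < 2*n-1" for j using u(1)[OF that] by simp
  qed (use u(3) in \<open>auto simp: ang_def[of s 0]\<close>)
  have g: "\<bar>((ang s)(2*n := 2*pi)) j - ((ang s)(2*n := 2*pi)) (j + 1)\<bar> < \<gamma>" if "j \<in> {0..2*n-1}" for j
  proof (cases "j = 2*n-1")
    case True then show ?thesis using u(3,4) n2 by (simp add: Suc_diff_Suc)
  next
    case False
    then have "j < 2*n-1" using that by auto
    then show ?thesis using u(1,2)[of j] by auto
  qed
  show "small_gaps n (ang s)" unfolding small_gaps_def Let_def
    using g gam(2) by (blast intro: less_trans)
  have strict: "ang s i < ang s j" if "i < j" "j < 2*n" for i j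
    using that
  proof (induction j)
    case (Suc j)
    have "ang s j < ang s (Suc j)" by (rule u(1)) (use Suc.prems in linarith)
    then show ?case using Suc by (cases "i = j") auto
  qed simp
  show inj: "inj_on (ang s) {0..2*n-1}"
  proof (rule linorder_inj_onI)
    fix i j assume ij: "i < j" "i \<in> {0..2*n-1}" "j \<in> {0..2*n-1}"
    then have "j < 2*n" using n2 by auto
    then show "ang s i \<noteq> ang s j" using strict[OF ij(1)] by auto
  qed auto
  show "kobayashi n (ang s) (zer s) \<gamma>"
    by (rule kobayashiI[OF n2 data inj less_imp_le[OF g] less_imp_le[OF b] less_imp_le[OF eps(1)] eps(2) bound])
  show "\<not> principal_type n (zer s)"
    using n2 eps by (auto simp: principal_type_def zer_def intro!: bexI[of _ 1])
qed

lemma perturb: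
  assumes "open (U :: (real^'m) set)" "s \<in> U" obtains d where "d > 0" "s + d *\<^sub>R axis m 1 \<in> U"
proof -
  obtain e where e: "e > 0" "ball s e \<subseteq> U" using assms open_contains_ball by blast
  have "s + (e / 2) *\<^sub>R axis m 1 \<in> ball s e" using e(1) by (simp add: dist_norm norm_axis_1)
  then show thesis using that[of "e / 2"] e by auto
qed

lemma ang_perturb:
  assumes "3 \<le> a" "a < 2*n" "j < 2*n"
  shows "ang (s + d *\<^sub>R axis (ix (a - 3)) 1) j = ang s j + (if j = a then d else 0)"
  using assms ix_inj[OF ix_ang[OF assms(1,2)] ix_ang[OF _ assms(3)]] by (auto simp: ang_def axis_def)

lemma zer_perturb:
  assumes "2 \<le> a" "a < n" "i < n"
  shows "zer (s + d *\<^sub>R axis (ix (zix a)) 1) i = zer s i + (if i = a then of_real d else 0)"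
proof (cases "i < 2")
  case False
  then have i: "2 \<le> i" by simp
  have "zix i = zix a \<longleftrightarrow> i = a" "Suc (zix i) \<noteq> zix a" using i assms unfolding zix_def by presburger+
  then show ?thesis using ix_inj[OF ix_zer(1)[OF i assms(3)] ix_zer(1)[OF assms(1,2)]]
      ix_inj[OF ix_zer(2)[OF i assms(3)] ix_zer(1)[OF assms(1,2)]] False
    by (simp add: zer_def axis_def complex_eq_iff)
qed (use assms in \<open>simp add: zer_def\<close>)

text \<open>A congruence matches the zeros only up to reordering. Because the free zero
  \<open>i\<close> can be moved without the others, distinct indices can be kept apart on a smaller
  open set.\<close>

lemma zeros_separate:
  assumes U: "open U" "U \<noteq> {}" and ik: "i < n" "k < n" "2 \<le> i" "i \<noteq> k"
  shows "\<exists>V. open V \<and> V \<noteq> {} \<and> V \<subseteq> U \<and> (\<forall>s\<in>V. \<forall>t\<in>V. zer s i \<noteq> zer t k)"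
proof -
  obtain s where s: "s \<in> U" using U by auto
  obtain d where d: "d > 0" "s + d *\<^sub>R axis (ix (zix i)) 1 \<in> U" using perturb[OF U(1) s] by blast
  have "\<exists>s0\<in>U. zer s0 i \<noteq> zer s0 k"
  proof (cases "zer s i = zer s k")
    case True
    then show ?thesis
      using d zer_perturb[OF ik(3,1,1), of s d] zer_perturb[OF ik(3,1,2), of s d] ik(4)
      by (intro bexI[OF _ d(2)]) auto
  qed (use s in auto)
  then obtain s0 where "s0 \<in> U" "zer s0 i \<noteq> zer s0 k" by auto
  then show ?thesis using separate_values[OF U(1) _ continuous_zer continuous_zer] by blast
qed

lemma chord_pos: assumes "s \<in> U0" "i < 2*n" "j < 2*n" "i \<noteq> j" shows "chord (ang s i) (ang s j) > 0"
  using kobayashi.sin_half_nz[OF family(4)[OF assms(1)] assms(2-4)] by (simp add: chord_def)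

lemma ang_range: "s \<in> U0 \<Longrightarrow> j < 2*n \<Longrightarrow> ang s j \<in> {0..<2*pi}"
  using kobayashi.alpha_range[OF family(4)] by simp

lemma ang_less_iff: assumes "s \<in> U0" "i < 2*n" "j < 2*n" shows "ang s i < ang s j \<longleftrightarrow> i < j"
  using kobayashi.alpha_strict[OF family(4)[OF assms(1)]] assms(2,3) by (metis linorder_cases order_less_asym order_less_irrefl)

lemma ang_eq_iff: "s \<in> U0 \<Longrightarrow> i < 2*n \<Longrightarrow> j < 2*n \<Longrightarrow> ang s i = ang s j \<longleftrightarrow> i = j"
  using ang_less_iff[of s i j] ang_less_iff[of s j i] by (metis linorder_neq_iff order_less_irrefl)

text \<open>The modulus of a cross ratio of four ends.\<close>

definition ratio where
  "ratio s i j k l = chord (ang s i) (ang s j) * chord (ang s k) (ang s l) /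
     (chord (ang s i) (ang s k) * chord (ang s j) (ang s l))" for s :: "real^'m"

lemma continuous_ratio:
  assumes "U \<subseteq> U0" "i < 2*n" "j < 2*n" "k < 2*n" "l < 2*n" "i \<noteq> k" "j \<noteq> l"
  shows "continuous_on U (\<lambda>s. ratio s i j k l)"
proof -
  have c: "continuous_on U (\<lambda>s. chord (ang s i) (ang s j))" for i j
    unfolding chord_def by (intro continuous_intros continuous_ang) auto
  have "chord (ang s i) (ang s k) \<noteq> 0" "chord (ang s j) (ang s l) \<noteq> 0" if "s \<in> U" for s
    using chord_pos[of s i k] chord_pos[of s j l] that assms by force+
  then show ?thesis unfolding ratio_def by (intro continuous_on_divide continuous_on_mult c) auto
qed

text \<open>Only the end \<open>a\<close> may move, and it cannot pass the others because the angles
  stay ordered; so its chords to two fixed ends locate it.\<close>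

lemma ratio_injective:
  assumes st: "s \<in> U0" "t \<in> U0" and a: "a < 2*n" and jkl: "j < 2*n" "k < 2*n" "l < 2*n" "distinct [a, j, k, l]"
    and same: "ang s j = ang t j" "ang s k = ang t k" "ang s l = ang t l" and eq: "ratio s a j k l = ratio t a j k l"
  shows "ang s a = ang t a"
proof (rule chord_ratio_injective[where p="ang s j" and q="ang s k"])
  note c = chord_pos[OF st(1) a jkl(2)] chord_pos[OF st(2) a jkl(2)] chord_pos[OF st(1) jkl(2,3)] chord_pos[OF st(1) jkl(1,3)]
  show "chord (ang s a) (ang s j) * chord (ang t a) (ang s k) = chord (ang s a) (ang s k) * chord (ang t a) (ang s j)"
    using eq c jkl(4) unfolding ratio_def same by (simp add: frac_eq_eq same)
  show "ang s j \<noteq> ang s k"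
    using ang_eq_iff[OF st(1) jkl(1,2)] jkl(4) by simp
  have o: "(ang s a < ang s x \<and> ang t a < ang s x) \<or> (ang s a > ang s x \<and> ang t a > ang s x)" if "x < 2*n" "x \<noteq> a" "ang s x = ang t x" for x
    using ang_less_iff[OF st(1)] ang_less_iff[OF st(2)] that a by (metis linorder_neq_iff)
  show "(ang s a < ang s j \<and> ang t a < ang s j) \<or> (ang s a > ang s j \<and> ang t a > ang s j)"
    "(ang s a < ang s k \<and> ang t a < ang s k) \<or> (ang s a > ang s k \<and> ang t a > ang s k)"
    using o[of j] o[of k] jkl same by auto
qed (use ang_range st a jkl in blast)+

text \<open>If \<open>\<sigma>\<close> moves a variable point \<open>a\<close>, vary that point alone in a cross ratio that \<open>\<sigma>\<close> does not map
  to one involving \<open>a\<close>; if \<open>\<sigma>\<close> moves only fixed points, use two variable points as reference.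
  The latter needs \<open>n \<ge> 3\<close>; for \<open>n = 2\<close> the cross ratio itself is the parameter.\<close>

lemma permutation_separate:
  assumes U: "open U" "U \<noteq> {}" "U \<subseteq> U0" and \<sigma>: "\<sigma> permutes {..<2*n}" "\<sigma> \<noteq> id"
  shows "\<exists>V. open V \<and> V \<noteq> {} \<and> V \<subseteq> U \<and> (\<forall>s\<in>V. \<forall>t\<in>V.
    (\<forall>i<2*n. \<forall>j<2*n. \<forall>k<2*n. \<forall>l<2*n. distinct [i, j, k, l] \<longrightarrow> ratio s i j k l = ratio t (\<sigma> i) (\<sigma> j) (\<sigma> k) (\<sigma> l)) \<longrightarrow> s = t)"
proof -
  have \<sigma>n: "\<sigma> i < 2*n" if "i < 2*n" for i using permutes_in_image[OF \<sigma>(1), of i] that by simp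
  have inj: "\<sigma> i = \<sigma> j \<longleftrightarrow> i = j" for i j using permutes_inj[OF \<sigma>(1)] by (auto simp: inj_def)
  show ?thesis
  \<comment> \<open>Either some cross ratio distinguishes \<open>\<sigma>\<close> at one parameter,
    and continuity spreads this, or \<open>\<sigma>\<close> preserves all cross ratios identically
    on \<open>U\<close>.\<close>
  proof (cases "\<exists>s0\<in>U. \<exists>i<2*n. \<exists>j<2*n. \<exists>k<2*n. \<exists>l<2*n. distinct [i, j, k, l] \<and> ratio s0 i j k l \<noteq> ratio s0 (\<sigma> i) (\<sigma> j) (\<sigma> k) (\<sigma> l)")
    case True
    then obtain s0 i j k l where s0: "s0 \<in> U" and l: "i < 2*n" "j < 2*n" "k < 2*n" "l < 2*n" "distinct [i, j, k, l]"
      and ne: "ratio s0 i j k l \<noteq> ratio s0 (\<sigma> i) (\<sigma> j) (\<sigma> k) (\<sigma> l)" by blast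
    have "continuous_on U (\<lambda>s. ratio s i j k l)" "continuous_on U (\<lambda>s. ratio s (\<sigma> i) (\<sigma> j) (\<sigma> k) (\<sigma> l))"
      using l by (auto intro!: continuous_ratio U(3) \<sigma>n simp: inj)
    from separate_values[OF U(1) s0 this ne] obtain V where V: "open V" "V \<noteq> {}" "V \<subseteq> U"
      "\<forall>s\<in>V. \<forall>t\<in>V. ratio s i j k l \<noteq> ratio t (\<sigma> i) (\<sigma> j) (\<sigma> k) (\<sigma> l)" by blast
    show ?thesis by (intro exI[of _ V] conjI V(1-3) ballI impI) (use V(4) l in blast)
  next
    case False
    then have eq: "ratio s i j k l = ratio s (\<sigma> i) (\<sigma> j) (\<sigma> k) (\<sigma> l)"
      if "s \<in> U" "i < 2*n" "j < 2*n" "k < 2*n" "l < 2*n" "distinct [i, j, k, l]" for s i j k l using that by blast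
    show ?thesis
    proof (cases "n = 2")
      \<comment> \<open>With four ends there is one parameter, and invariance under
        \<open>\<sigma>\<close> turns the hypothesis into an equality of the cross ratio that
        determines it.\<close>
      case n: True
      have h: "s = t" if st: "s \<in> U" "t \<in> U" and all: "\<forall>i<2*n. \<forall>j<2*n. \<forall>k<2*n. \<forall>l<2*n. distinct [i, j, k, l] \<longrightarrow>
          ratio s i j k l = ratio t (\<sigma> i) (\<sigma> j) (\<sigma> k) (\<sigma> l)" for s t
      proof -
        have q: "(3::nat) < 2*n" "(1::nat) < 2*n" "(2::nat) < 2*n" "(0::nat) < 2*n" "distinct [3::nat, 1, 2, 0]" using n by auto
        have r: "ratio s 3 1 2 0 = ratio t 3 1 2 0"
          using all[rule_format, OF q] eq[OF st(2) q] by simp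
        have "ang s 3 = ang t 3"
          by (rule ratio_injective[OF _ _ q _ _ _ r]) (use st U(3) in \<open>auto simp: ang_def\<close>)
        then show ?thesis
          by (intro parameters_separate) (use n in \<open>auto simp: le_less_Suc_eq eval_nat_numeral\<close>)
      qed
      show ?thesis
        by (intro exI[of _ U] conjI U(1,2) order_refl ballI impI) (rule h)
    next
      case False
      then have n3: "n \<ge> 3" using n2 by simp
      obtain s where s: "s \<in> U" using U by auto
      then have s0: "s \<in> U0" using U by auto
      have "False"
      proof (cases "\<exists>a<2*n. 3 \<le> a \<and> \<sigma> a \<noteq> a")
        case True
        then obtain a where a: "a < 2*n" "3 \<le> a" "\<sigma> a \<noteq> a" by auto
        \<comment> \<open>Leaving out the preimage of \<open>a\<close> keeps \<open>a\<close> itself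
          out of the image cross ratio; for n at least 3 enough indices remain.\<close>
        have "card ({..<2*n} - {a, inv \<sigma> a}) \<ge> 3"
          using n3 card_Diff_subset[of "{a, inv \<sigma> a}" "{..<2*n}"] diff_card_le_card_Diff[of "{a, inv \<sigma> a}" "{..<2*n}"]
            card_insert_le_m1[of 2 "{inv \<sigma> a}" a] by (simp add: card_insert_if split: if_splits)
        then obtain T where T: "T \<subseteq> {..<2*n} - {a, inv \<sigma> a}" "card T = 3" by (meson obtain_subset_with_card_n)
        then obtain j k l where jkl: "T = {j, k, l}" "j \<noteq> k" "j \<noteq> l" "k \<noteq> l" by (auto simp: card_3_iff)
        have ne: "x < 2*n \<and> x \<noteq> a \<and> \<sigma> x \<noteq> a" if "x \<in> {j, k, l}" for x
          using T(1) that permutes_inverses(2)[OF \<sigma>(1), of x] unfolding jkl(1) by auto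
        obtain d where d: "d > 0" "s + d *\<^sub>R axis (ix (a - 3)) 1 \<in> U" using perturb[OF U(1) s] by blast
        define t where "t = s + d *\<^sub>R axis (ix (a - 3)) 1"
        have at: "ang t x = ang s x + (if x = a then d else 0)" if "x < 2*n" for x
          unfolding t_def by (rule ang_perturb[OF a(2,1) that])
        have t: "t \<in> U" "t \<in> U0" using d U(3) by (auto simp: t_def)
        have rt: "ratio s (\<sigma> a) (\<sigma> j) (\<sigma> k) (\<sigma> l) = ratio t (\<sigma> a) (\<sigma> j) (\<sigma> k) (\<sigma> l)"
          using at[OF \<sigma>n] a ne by (simp add: ratio_def)
        have q: "j < 2*n" "k < 2*n" "l < 2*n" "distinct [a, j, k, l]" using ne jkl by auto
        have "ratio s a j k l = ratio t a j k l"
          unfolding eq[OF s a(1) q] eq[OF t(1) a(1) q] by (rule rt)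
        then have "ang s a = ang t a"
          by (intro ratio_injective[OF s0 t(2) a(1) q]) (use ne at in auto)
        then show False using at[OF a(1)] d by simp
      next
        case False
        then have fix3: "\<sigma> x = x" if "3 \<le> x" for x using that permutes_not_in[OF \<sigma>(1), of x] by (cases "x < 2*n") auto
        obtain x where x: "\<sigma> x \<noteq> x" using \<sigma>(2) by (auto simp: fun_eq_iff)
        have x3: "x < 3" using fix3[of x] x by (cases "x < 3") auto
        have y3: "\<sigma> x < 3" using fix3[of "\<sigma> x"] x inj by (cases "\<sigma> x < 3") auto
        have q: "x < 2*n" "\<sigma> x < 2*n" "(3::nat) < 2*n" "(4::nat) < 2*n" "(5::nat) < 2*n" using n3 x3 y3 by auto
        \<comment> \<open>The ends 3, 4, 5 exist as n is at least 3 and are fixed by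
          \<open>\<sigma>\<close>, so they compare \<open>x\<close> with its image.\<close>
        have "ratio s x 3 4 5 = ratio s (\<sigma> x) 3 4 5"
          using eq[OF s q(1,3-5)] x3 fix3 by simp
        then have e: "chord (ang s x) (ang s 3) * chord (ang s (\<sigma> x)) (ang s 4) = chord (ang s x) (ang s 4) * chord (ang s (\<sigma> x)) (ang s 3)"
          using chord_pos[OF s0 q(1,4)] chord_pos[OF s0 q(2,4)] chord_pos[OF s0 q(4,5)] chord_pos[OF s0 q(3,5)] x3 y3
          unfolding ratio_def by (simp add: frac_eq_eq)
        have "ang s x = ang s (\<sigma> x)"
          by (rule chord_ratio_injective[OF _ _ _ _ _ _ _ e])
            (use ang_range[OF s0] ang_less_iff[OF s0] ang_eq_iff[OF s0] q x3 y3 in auto)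
        then show False using ang_eq_iff[OF s0 q(1,2)] x by simp
      qed
      then show ?thesis ..
    qed
  qed
qed

definition ext :: "real^'m \<Rightarrow> ext_point \<Rightarrow> real^3" where
  "ext s p = kobayashi.X n (ang s) (zer s) 0 (to_pol p)"

lemma congruent_ratio:
  assumes st: "s \<in> U0" "t \<in> U0"
    and cong: "congruent_up_to_homothety (ext s ` ext_domain n (ang s)) (ext t ` ext_domain n (ang t))"
  obtains \<sigma> where "\<sigma> permutes {..<2*n}"
    "\<And>i j k l. i < 2*n \<Longrightarrow> j < 2*n \<Longrightarrow> k < 2*n \<Longrightarrow> l < 2*n \<Longrightarrow> distinct [i, j, k, l] \<Longrightarrow>
      ratio s i j k l = ratio t (\<sigma> i) (\<sigma> j) (\<sigma> k) (\<sigma> l)"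
    "\<sigma> = id \<Longrightarrow> (\<forall>j<2*n. ang s j = ang t j) \<and> (\<forall>i\<in>{1..n-1}. \<exists>k\<in>{1..n-1}. zer s i = zer t k)"
proof -
  note K = family(4)[OF st(1)] family(4)[OF st(2)]
  have im: "ext s ` ext_domain n (ang s) = kobayashi.X n (ang s) (zer s) 0 ` kobayashi.Pol n (ang s)"
    "ext t ` ext_domain n (ang t) = kobayashi.X n (ang t) (zer t) 0 ` kobayashi.Pol n (ang t)"
    by (rule kobayashi.zmc_graph_X(1)[OF K(1)], simp add: ext_def) (rule kobayashi.zmc_graph_X(1)[OF K(2)], simp add: ext_def)
  obtain A u0 c where A: "linear A" "\<And>p q. lorentz (A p) (A q) = lorentz p q" "c > 0"
    and e: "ext t ` ext_domain n (ang t) = (\<lambda>p. c *\<^sub>R (A p + u0)) ` ext s ` ext_domain n (ang s)"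
    using cong unfolding congruent_up_to_homothety_def lorentz_isometry_def by auto
  have cp: "congruent_pair n (ang s) (zer s) \<gamma> (ang t) (zer t) 0 0 u0 A c"
    using e A unfolding im by (intro congruent_pair.intro K congruent_pair_axioms.intro) auto
  obtain \<sigma> where \<sigma>: "\<sigma> permutes {..<2*n}"
    and rel: "\<And>i j k l. i < 2*n \<Longrightarrow> j < 2*n \<Longrightarrow> k < 2*n \<Longrightarrow> l < 2*n \<Longrightarrow>
      chord (ang s i) (ang s j) * chord (ang s k) (ang s l) * (chord (ang t (\<sigma> i)) (ang t (\<sigma> k)) * chord (ang t (\<sigma> j)) (ang t (\<sigma> l))) =
      chord (ang t (\<sigma> i)) (ang t (\<sigma> j)) * chord (ang t (\<sigma> k)) (ang t (\<sigma> l)) * (chord (ang s i) (ang s k) * chord (ang s j) (ang s l))"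
    and id: "\<sigma> = id \<Longrightarrow> \<forall>j<3. ang s j = ang t j \<Longrightarrow> zer s 1 = zer t 1 \<Longrightarrow>
      (\<forall>j<2*n. ang s j = ang t j) \<and> (\<forall>i\<in>{1..n-1}. \<exists>k\<in>{1..n-1}. zer s i = zer t k)"
    by (rule congruent_pair.congruent_data[OF cp], rule that)
  have \<sigma>n: "\<sigma> i < 2*n" if "i < 2*n" for i using permutes_in_image[OF \<sigma>, of i] that by simp
  have inj: "\<sigma> i = \<sigma> j \<longleftrightarrow> i = j" for i j using permutes_inj[OF \<sigma>] by (auto simp: inj_def)
  show thesis
  proof (rule that[OF \<sigma>])
    fix i j k l assume l: "i < 2*n" "j < 2*n" "k < 2*n" "l < 2*n" "distinct [i, j, k, l]"
    have nz: "chord (ang s i) (ang s k) * chord (ang s j) (ang s l) \<noteq> 0"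
      "chord (ang t (\<sigma> i)) (ang t (\<sigma> k)) * chord (ang t (\<sigma> j)) (ang t (\<sigma> l)) \<noteq> 0"
      using chord_pos[OF st(1) l(1,3)] chord_pos[OF st(1) l(2,4)] l(5)
        chord_pos[OF st(2) \<sigma>n[OF l(1)] \<sigma>n[OF l(3)]] chord_pos[OF st(2) \<sigma>n[OF l(2)] \<sigma>n[OF l(4)]] by (auto simp: inj)
    show "ratio s i j k l = ratio t (\<sigma> i) (\<sigma> j) (\<sigma> k) (\<sigma> l)"
      unfolding ratio_def by (rule frac_eq_eq[OF nz, THEN iffD2]) (rule rel[OF l(1-4)])
  next
    assume "\<sigma> = id"
    then show "(\<forall>j<2*n. ang s j = ang t j) \<and> (\<forall>i\<in>{1..n-1}. \<exists>k\<in>{1..n-1}. zer s i = zer t k)"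
      by (rule id) (simp_all add: ang_def zer_def)
  qed
qed

text \<open>All permutations other than the identity are ruled out on one open set, and all
  coincidences of zeros with different indices on a smaller one. For the identity, angles and zeros
  agree index by index.\<close>

lemma incongruent_open_set:
  obtains U where "open U" "U \<noteq> {}" "U \<subseteq> U0"
    "\<And>s t. s \<in> U \<Longrightarrow> t \<in> U \<Longrightarrow>
      congruent_up_to_homothety (ext s ` ext_domain n (ang s)) (ext t ` ext_domain n (ang t)) \<Longrightarrow> s = t"
proof -
  let ?S = "{\<sigma>. \<sigma> permutes {..<2*n}} - {id}" and ?Z = "{(i, k). 2 \<le> i \<and> i < n \<and> k < n \<and> i \<noteq> k}"
  let ?R = "\<lambda>\<sigma> s t. (\<forall>i<2*n. \<forall>j<2*n. \<forall>k<2*n. \<forall>l<2*n. distinct [i, j, k, l] \<longrightarrow>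
    ratio s i j k l = ratio t (\<sigma> i) (\<sigma> j) (\<sigma> k) (\<sigma> l)) \<longrightarrow> s = t"
  have "\<exists>V. open V \<and> V \<noteq> {} \<and> V \<subseteq> U0 \<and> (\<forall>\<sigma>\<in>?S. \<forall>s\<in>V. \<forall>t\<in>V. ?R \<sigma> s t)"
  proof (rule shrink_open[OF _ open_U0 U0_nonempty])
    show "finite ?S" using finite_permutations[of "{..<2*n}"] by simp
    fix \<sigma> U assume "\<sigma> \<in> ?S" "open U" "U \<noteq> {}" "U \<subseteq> U0"
    then show "\<exists>V. open V \<and> V \<noteq> {} \<and> V \<subseteq> U \<and> (\<forall>s\<in>V. \<forall>t\<in>V. ?R \<sigma> s t)"
      by (intro permutation_separate) auto
  qed
  then obtain V where V: "open V" "V \<noteq> {}" "V \<subseteq> U0" and VR: "\<forall>\<sigma>\<in>?S. \<forall>s\<in>V. \<forall>t\<in>V. ?R \<sigma> s t"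
    by (elim exE conjE) (rule that)
  have "\<exists>U. open U \<and> U \<noteq> {} \<and> U \<subseteq> V \<and> (\<forall>x\<in>?Z. \<forall>s\<in>U. \<forall>t\<in>U. (\<lambda>(i, k) s t. zer s i \<noteq> zer t k) x s t)"
  proof (rule shrink_open[OF _ V(1,2)])
    show "finite ?Z" by (rule finite_subset[of _ "{..<n} \<times> {..<n}"]) auto
    fix x and U :: "(real^'m) set" assume "x \<in> ?Z" "open U" "U \<noteq> {}" "U \<subseteq> V"
    then show "\<exists>V. open V \<and> V \<noteq> {} \<and> V \<subseteq> U \<and> (\<forall>s\<in>V. \<forall>t\<in>V. (\<lambda>(i, k) s t. zer s i \<noteq> zer t k) x s t)"
      using zeros_separate[of U "fst x" "snd x"] by (auto simp: case_prod_beta)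
  qed
  then obtain U where U: "open U" "U \<noteq> {}" "U \<subseteq> V"
    and UZ: "\<forall>x\<in>?Z. \<forall>s\<in>U. \<forall>t\<in>U. (\<lambda>(i, k) s t. zer s i \<noteq> zer t k) x s t"
    by (elim exE conjE) (rule that)
  have UZ: "zer s i \<noteq> zer t k" if "2 \<le> i" "i < n" "k < n" "i \<noteq> k" "s \<in> U" "t \<in> U" for i k s t
    using bspec[OF UZ, of "(i, k)"] that by simp
  show thesis
  proof (rule that[OF U(1,2)])
    show "U \<subseteq> U0" using U V by blast
    fix s t assume st: "s \<in> U" "t \<in> U"
      and cong: "congruent_up_to_homothety (ext s ` ext_domain n (ang s)) (ext t ` ext_domain n (ang t))"
    have stV: "s \<in> V" "t \<in> V" "s \<in> U0" "t \<in> U0" using st U V by auto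
    obtain \<sigma> where \<sigma>: "\<sigma> permutes {..<2*n}"
      and rt: "\<And>i j k l. i < 2*n \<Longrightarrow> j < 2*n \<Longrightarrow> k < 2*n \<Longrightarrow> l < 2*n \<Longrightarrow> distinct [i, j, k, l] \<Longrightarrow>
        ratio s i j k l = ratio t (\<sigma> i) (\<sigma> j) (\<sigma> k) (\<sigma> l)"
      and id: "\<sigma> = id \<Longrightarrow> (\<forall>j<2*n. ang s j = ang t j) \<and> (\<forall>i\<in>{1..n-1}. \<exists>k\<in>{1..n-1}. zer s i = zer t k)"
      by (rule congruent_ratio[OF stV(3,4) cong], rule that)
    show "s = t"
    proof (cases "\<sigma> = id")
      case True
      show ?thesis
      proof (rule parameters_separate)
        show "ang s j = ang t j" if "j < 2*n" for j using id[OF True] that by blast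
        fix i assume i: "2 \<le> i" "i < n"
        then have "i \<in> {1..n-1}" by auto
        then obtain k where k: "k \<in> {1..n-1}" "zer s i = zer t k" using id[OF True] by blast
        then have "k < n" using i by auto
        then show "zer s i = zer t i" using UZ[OF i \<open>k < n\<close> _ st] k by (cases "i = k") auto
      qed
    next
      case False
      then have "\<sigma> \<in> ?S" using \<sigma> by simp
      from bspec[OF bspec[OF bspec[OF VR this] stV(1)] stV(2)] show ?thesis
        by (rule mp) (intro allI impI rt)
    qed
  qed
qed

lemma smooth_ang: "open U \<Longrightarrow> smooth_on U (\<lambda>s. ang s j)"
  unfolding smooth_on_def ang_def
  by (cases "j < 3") (auto intro!: Ck_on_const Ck_on_bounded_linear bounded_linear_vec_nth)

lemma smooth_zer: "open U \<Longrightarrow> smooth_on U (\<lambda>s. zer s i)"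
  unfolding smooth_on_def zer_def
  by (cases "i < 2", simp_all) (intro allI Ck_on_const Ck_on_Complex Ck_on_bounded_linear bounded_linear_vec_nth; assumption)+

lemma family_properties:
  assumes s: "s \<in> U0"
  shows "\<exists>f. kobayashi_surface n (ang s) (zer s) f \<and> analytic_extension n (ang s) f (ext s)"
    "ext_diffeomorphism n (ang s) (\<lambda>p. (ext s p $ 2, ext s p $ 3))"
    "zmc_entire_graph_of_mixed_type (ext s ` ext_domain n (ang s))"
  using kobayashi.surface_exists[OF family(4)[OF s]] kobayashi.ext_diffeomorphism_X[OF family(4)[OF s], of "ext s" 0]
    kobayashi.zmc_graph_X(2)[OF family(4)[OF s], of "ext s" 0]
  unfolding ext_def[abs_def] by blast+

end

lemma kobayashi_family_exists:
  assumes "n \<ge> 2" and "CARD('m::finite) = 4*n-7"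
  obtains ix :: "nat \<Rightarrow> 'm::finite" and \<gamma> \<epsilon> where "kobayashi_family n ix \<gamma> \<epsilon>"
proof -
  obtain ix :: "nat \<Rightarrow> 'm" where ix: "bij_betw ix {..<4*n-7} UNIV"
    using ex_bij_betw_nat_finite[of "UNIV :: 'm set"] assms(2) by (auto simp: atLeast0LessThan)
  \<comment> \<open>\<open>\<gamma>\<close> must exceed the gap of equally spaced ends and obey the
    gap condition of the theorem.\<close>
  have "pi / real n < pi / (real n - 1)" using assms(1) by (intro divide_strict_left_mono) auto
  then obtain \<gamma> where g: "pi / real n < \<gamma>" "\<gamma> < pi / (real n - 1)" using dense by blast
  have "0 \<le> pi / real n" by simp
  then have "0 \<le> \<gamma>" using g(1) by linarith
  obtain \<epsilon> :: real where "0 < \<epsilon>" "\<epsilon> < 1" "(real n - 1) * (1 + \<epsilon>) / (1 - \<epsilon>) * \<gamma> < pi"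
    by (rule epsilon_exists[OF assms(1) \<open>0 \<le> \<gamma>\<close> g(2)], rule that)
  then have "kobayashi_family n ix \<gamma> \<epsilon>" using assms(1) ix g by unfold_locales auto
  then show thesis by (rule that)
qed

theorem theorem4p6:
  fixes n :: nat
  assumes "n \<ge> 2"
  shows
    "(\<forall>\<alpha> :: nat \<Rightarrow> real. small_gaps n \<alpha> \<and> inj_on \<alpha> {0..2*n-1} \<longrightarrow>
       (\<exists>\<epsilon>>0. \<forall>b f ft.
          kobayashi_data n \<alpha> b \<and> \<not> principal_type n b \<and> (\<forall>i\<in>{1..n-1}. cmod (b i) < \<epsilon>) \<and>
          kobayashi_surface n \<alpha> b f \<and> analytic_extension n \<alpha> f ft \<longrightarrow>
            ext_diffeomorphism n \<alpha> (\<lambda>p. (ft p $ 2, ft p $ 3)) \<and>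
            zmc_entire_graph_of_mixed_type (ft ` ext_domain n \<alpha>)))
     \<and>
     (CARD('m::finite) = 4 * n - 7 \<longrightarrow>
       (\<exists>(U :: (real^'m) set) (\<alpha> :: real^'m \<Rightarrow> nat \<Rightarrow> real) (b :: real^'m \<Rightarrow> nat \<Rightarrow> complex) f ft.
          open U \<and> U \<noteq> {} \<and>
          (\<forall>j\<in>{0..2*n-1}. smooth_on U (\<lambda>s. \<alpha> s j)) \<and>
          (\<forall>i\<in>{1..n-1}. smooth_on U (\<lambda>s. b s i)) \<and>
          (\<forall>s\<in>U. kobayashi_data n (\<alpha> s) (b s) \<and> \<not> principal_type n (b s) \<and>
             small_gaps n (\<alpha> s) \<and> inj_on (\<alpha> s) {0..2*n-1} \<and>
             kobayashi_surface n (\<alpha> s) (b s) (f s) \<and> analytic_extension n (\<alpha> s) (f s) (ft s) \<and>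
             ext_diffeomorphism n (\<alpha> s) (\<lambda>p. (ft s p $ 2, ft s p $ 3)) \<and>
             zmc_entire_graph_of_mixed_type (ft s ` ext_domain n (\<alpha> s))) \<and>
          (\<forall>s\<in>U. \<forall>t\<in>U. s \<noteq> t \<longrightarrow>
             \<not> congruent_up_to_homothety (ft s ` ext_domain n (\<alpha> s)) (ft t ` ext_domain n (\<alpha> t)))))"
proof (rule conjI)
  show "\<forall>\<alpha> :: nat \<Rightarrow> real. small_gaps n \<alpha> \<and> inj_on \<alpha> {0..2*n-1} \<longrightarrow>
       (\<exists>\<epsilon>>0. \<forall>b f ft.
          kobayashi_data n \<alpha> b \<and> \<not> principal_type n b \<and> (\<forall>i\<in>{1..n-1}. cmod (b i) < \<epsilon>) \<and>
          kobayashi_surface n \<alpha> b f \<and> analytic_extension n \<alpha> f ft \<longrightarrow>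
            ext_diffeomorphism n \<alpha> (\<lambda>p. (ft p $ 2, ft p $ 3)) \<and>
            zmc_entire_graph_of_mixed_type (ft ` ext_domain n \<alpha>))"
    using kobayashi_extension_diffeomorphism[OF assms] by meson
next
  show "CARD('m) = 4 * n - 7 \<longrightarrow>
       (\<exists>(U :: (real^'m) set) (\<alpha> :: real^'m \<Rightarrow> nat \<Rightarrow> real) (b :: real^'m \<Rightarrow> nat \<Rightarrow> complex) f ft.
          open U \<and> U \<noteq> {} \<and>
          (\<forall>j\<in>{0..2*n-1}. smooth_on U (\<lambda>s. \<alpha> s j)) \<and>
          (\<forall>i\<in>{1..n-1}. smooth_on U (\<lambda>s. b s i)) \<and>
          (\<forall>s\<in>U. kobayashi_data n (\<alpha> s) (b s) \<and> \<not> principal_type n (b s) \<and>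
             small_gaps n (\<alpha> s) \<and> inj_on (\<alpha> s) {0..2*n-1} \<and>
             kobayashi_surface n (\<alpha> s) (b s) (f s) \<and> analytic_extension n (\<alpha> s) (f s) (ft s) \<and>
             ext_diffeomorphism n (\<alpha> s) (\<lambda>p. (ft s p $ 2, ft s p $ 3)) \<and>
             zmc_entire_graph_of_mixed_type (ft s ` ext_domain n (\<alpha> s))) \<and>
          (\<forall>s\<in>U. \<forall>t\<in>U. s \<noteq> t \<longrightarrow>
             \<not> congruent_up_to_homothety (ft s ` ext_domain n (\<alpha> s)) (ft t ` ext_domain n (\<alpha> t))))"
  proof
    assume m: "CARD('m) = 4 * n - 7"
    obtain ix :: "nat \<Rightarrow> 'm" and \<gamma> \<epsilon> where "kobayashi_family n ix \<gamma> \<epsilon>"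
      by (rule kobayashi_family_exists[OF assms m])
    then interpret kobayashi_family n ix \<gamma> \<epsilon> .
    obtain U where U: "open U" "U \<noteq> {}" "U \<subseteq> U0"
      and inc: "\<And>s t. s \<in> U \<Longrightarrow> t \<in> U \<Longrightarrow>
        congruent_up_to_homothety (ext s ` ext_domain n (ang s)) (ext t ` ext_domain n (ang t)) \<Longrightarrow> s = t"
      by (rule incongruent_open_set, rule that)
    \<comment> \<open>The extension is the explicit map \<open>ext s\<close>; only the surface that
      it extends is chosen.\<close>
    obtain f where f: "\<forall>s\<in>U0. kobayashi_surface n (ang s) (zer s) (f s) \<and> analytic_extension n (ang s) (f s) (ext s)"
      using bchoice[of U0 "\<lambda>s f. kobayashi_surface n (ang s) (zer s) f \<and> analytic_extension n (ang s) f (ext s)"]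
        family_properties(1) by blast
    show "\<exists>(U :: (real^'m) set) (\<alpha> :: real^'m \<Rightarrow> nat \<Rightarrow> real) (b :: real^'m \<Rightarrow> nat \<Rightarrow> complex) f ft.
          open U \<and> U \<noteq> {} \<and>
          (\<forall>j\<in>{0..2*n-1}. smooth_on U (\<lambda>s. \<alpha> s j)) \<and>
          (\<forall>i\<in>{1..n-1}. smooth_on U (\<lambda>s. b s i)) \<and>
          (\<forall>s\<in>U. kobayashi_data n (\<alpha> s) (b s) \<and> \<not> principal_type n (b s) \<and>
             small_gaps n (\<alpha> s) \<and> inj_on (\<alpha> s) {0..2*n-1} \<and>
             kobayashi_surface n (\<alpha> s) (b s) (f s) \<and> analytic_extension n (\<alpha> s) (f s) (ft s) \<and>
             ext_diffeomorphism n (\<alpha> s) (\<lambda>p. (ft s p $ 2, ft s p $ 3)) \<and>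
             zmc_entire_graph_of_mixed_type (ft s ` ext_domain n (\<alpha> s))) \<and>
          (\<forall>s\<in>U. \<forall>t\<in>U. s \<noteq> t \<longrightarrow>
             \<not> congruent_up_to_homothety (ft s ` ext_domain n (\<alpha> s)) (ft t ` ext_domain n (\<alpha> t)))"
    proof (rule exI[of _ U], rule exI[of _ ang], rule exI[of _ zer], rule exI[of _ f], rule exI[of _ ext],
        intro conjI ballI impI notI U(1,2) smooth_ang smooth_zer)
      fix s assume "s \<in> U"
      then have s: "s \<in> U0" using U(3) by blast
      show "kobayashi_data n (ang s) (zer s)" "small_gaps n (ang s)" "inj_on (ang s) {0..2*n-1}" by (rule family[OF s])+
      show "kobayashi_surface n (ang s) (zer s) (f s)" "analytic_extension n (ang s) (f s) (ext s)" using f s by blast+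
      show "ext_diffeomorphism n (ang s) (\<lambda>p. (ext s p $ 2, ext s p $ 3))"
        "zmc_entire_graph_of_mixed_type (ext s ` ext_domain n (ang s))" by (rule family_properties[OF s])+
      show False if "principal_type n (zer s)" using family(5)[OF s] that by blast
    next
      fix s t assume "s \<in> U" "t \<in> U" "s \<noteq> t"
        "congruent_up_to_homothety (ext s ` ext_domain n (ang s)) (ext t ` ext_domain n (ang t))"
      then show False using inc by blast
    next
      show False if "U = {}" using U(2) that by blast
    qed
  qed
qed

end
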